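(* Let $\mathbb{M},\mu,L,\Gamma,\Gamma^Z,P_t$ be as in the context. Assume: (a) there is an increasing sequence $h_k\in C_0^\infty(\mathbb{M})$ with $h_k\nearrow1$ on $\mathbb{M}$ and $\|\Gamma(h_k)\|_\infty+\|\Gamma^Z(h_k)\|_\infty\to0$ as $k\to\infty$; (b) $\Gamma(f,\Gamma^Z(f))=\Gamma^Z(f,\Gamma(f))$ for every $f\in C^\infty(\mathbb{M})$; (c) $P_t1=1$ for every $t\ge0$, and for every $f\in C_0^\infty(\mathbb{M})$ and $T\ge0$, $\sup_{t\in[0,T]}(\|\Gamma(P_tf)\|_\infty+\|\Gamma^Z(P_tf)\|_\infty)<\infty$; (d) for some $\rho_1>0$, $\rho_2>0$, $\kappa\ge0$, $0<d\le\infty$, the inequality $\Gamma_2(f)+\nu\Gamma_2^Z(f)\ge\frac1d(Lf)^2+(\rho_1-\frac\kappa\nu)\Gamma(f)+\rho_2\Gamma^Z(f)$ holds for every $f\in C^\infty(\mathbb{M})$ and every $\nu>0$. Then the metric space $(\mathbb{M},d)$ is compact and, with $D=d\big(1+\frac{3\kappa}{2\rho_2}\big)$, $$\mathrm{diam}\,\mathbb{M}\le\frac{\pi}{\sqrt{\rho_1}}\,2\sqrt3\,\sqrt{\Big(\frac{\kappa}{\rho_2}+1\Big)D}=2\sqrt3\,\pi\sqrt{\frac{\rho_2+\kappa}{\rho_1\rho_2}\Big(1+\frac{3\kappa}{2\rho_2}\Big)d}\,.$$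
   Context: $\mathbb{M}$ is a smooth connected manifold with a smooth measure $\mu$; $L$ is a smooth second-order diffusion operator with real coefficients, $L1=0$, symmetric and non-positive: $\int fLg\,d\mu=\int gLf\,d\mu$, $\int fLf\,d\mu\le0$ for $f,g\in C_0^\infty(\mathbb{M})$ (smooth compactly supported). $L$ is locally subelliptic (Fefferman-Phong): locally, estimates $\|f\|^2_{H^\epsilon}\le C(-\int fLf\,d\mu+\int f^2d\mu)$ hold for test functions, for some $\epsilon>0$. $\Gamma(f,g)=\frac12(L(fg)-fLg-gLf)$, $\Gamma(f)=\Gamma(f,f)\ge 0$. Locally $L=-\sum_iX_i^*X_i$ with Lipschitz vector fields $X_i$; $v\in T_x\mathbb{M}$ is subunit if $v=\sum a_iX_i(x)$ with $\sum a_i^2\le1$; a Lipschitz path is subunit if its velocity is subunit a.e. Any two points are assumed to be joined by a subunit path, and $d(x,y)=\sup\{|f(x)-f(y)|:f\in C^\infty(\mathbb{M}),\|\Gamma(f)\|_\infty\le1\}$, which equals the infimum of $T$ over subunit paths $[0,T]\to\mathbb{M}$ from $x$ to $y$; $(\mathbb{M},d)$ is assumed complete (the distance $d(\cdot,\cdot)$ is not to be confused with the constant $d$), and the diameter is taken for this distance. $\Gamma^Z$ is a smooth symmetric first-order differential bilinear form on $C^\infty(\mathbb{M})$, $\Gamma^Z(fg,h)=f\Gamma^Z(g,h)+g\Gamma^Z(f,h)$, with $\Gamma^Z(f)=\Gamma^Z(f,f)\ge0$. $\Gamma_2(f)=\frac12[L\Gamma(f)-2\Gamma(f,Lf)]$,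 $\Gamma_2^Z(f)=\frac12[L\Gamma^Z(f)-2\Gamma^Z(f,Lf)]$. $L$ is essentially self-adjoint on $C_0^\infty(\mathbb{M})$; $P_t=e^{tL}$ is the heat semigroup, with smooth positive symmetric heat kernel $p(x,y,t)$, $P_tf(x)=\int p(x,y,t)f(y)d\mu(y)$.
   Formalization: Compactness is asserted only for d < ∞; for d = ∞ it fails (the real line with Lf = f'' − x f', Gaussian measure, Γ^Z = 0, κ = 0, ρ₁ = ρ₂ = 1 meets all hypotheses). The diameter bound is kept for all d, its right side being infinite when d = ∞. *)

theory Defs
  imports "HOL-Analysis.Analysis"
begin

fun Ck_on :: "nat \<Rightarrow> 'b::real_normed_vector set \<Rightarrow> ('b \<Rightarrow> 'c::real_normed_vector) \<Rightarrow> bool" where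
  "Ck_on 0 S f \<longleftrightarrow> continuous_on S f"
| "Ck_on (Suc k) S f \<longleftrightarrow> (\<forall>x\<in>S. f differentiable (at x)) \<and>
     (\<forall>v. Ck_on k S (\<lambda>x. frechet_derivative f (at x) v))"

text \<open>Only meant for open \<open>S\<close>.\<close>
definition smooth_on :: "'b::real_normed_vector set \<Rightarrow> ('b \<Rightarrow> 'c::real_normed_vector) \<Rightarrow> bool" where
  "smooth_on S f \<longleftrightarrow> (\<forall>k. Ck_on k S f)"

text \<open>The manifold is the whole type \<open>'a\<close>, modelled on the Euclidean space \<open>'b\<close>.
  A chart is a pair of its domain and its coordinate map.\<close>
type_synonym ('a, 'b) chart = "'a set \<times> ('a \<Rightarrow> 'b)"

definition is_chart :: "('a::topological_space, 'b::euclidean_space) chart \<Rightarrow> bool" where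
  "is_chart c \<longleftrightarrow> open (fst c) \<and> open (snd c ` fst c) \<and>
     homeomorphism (fst c) (snd c ` fst c) (snd c) (inv_into (fst c) (snd c))"

definition smooth_atlas :: "('a::topological_space, 'b::euclidean_space) chart set \<Rightarrow> bool" where
  "smooth_atlas A \<longleftrightarrow> (\<forall>c\<in>A. is_chart c) \<and> (\<Union>c\<in>A. fst c) = UNIV \<and>
     (\<forall>c\<in>A. \<forall>c'\<in>A. smooth_on (snd c ` (fst c \<inter> fst c')) (snd c' \<circ> inv_into (fst c) (snd c)))"

definition in_chart :: "('a, 'b) chart \<Rightarrow> ('a \<Rightarrow> 'c) \<Rightarrow> 'b \<Rightarrow> 'c" where
  "in_chart c f = f \<circ> inv_into (fst c) (snd c)"

definition Csmooth :: "('a::topological_space, 'b::euclidean_space) chart set \<Rightarrow> ('a \<Rightarrow> real) set" where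
  "Csmooth A = {f. \<forall>c\<in>A. smooth_on (snd c ` fst c) (in_chart c f)}"

definition Ctest :: "('a::topological_space, 'b::euclidean_space) chart set \<Rightarrow> ('a \<Rightarrow> real) set" where
  "Ctest A = {f \<in> Csmooth A. compact (closure {x. f x \<noteq> 0})}"

definition Ctest_in :: "('a::topological_space, 'b::euclidean_space) chart set \<Rightarrow> 'a set \<Rightarrow> ('a \<Rightarrow> real) set" where
  "Ctest_in A W = {f \<in> Ctest A. closure {x. f x \<noteq> 0} \<subseteq> W}"

text \<open>A Borel measure with a smooth positive Lebesgue density in every chart.\<close>
definition smooth_measure ::
  "('a::topological_space, 'b::euclidean_space) chart set \<Rightarrow> 'a measure \<Rightarrow> bool" where
  "smooth_measure A \<mu> \<longleftrightarrow> sets \<mu> = sets borel \<and>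
     (\<forall>c\<in>A. \<exists>\<rho> :: 'b \<Rightarrow> real. smooth_on (snd c ` fst c) \<rho> \<and> (\<forall>u\<in>snd c ` fst c. \<rho> u > 0) \<and>
        (\<forall>B\<in>sets borel. B \<subseteq> fst c \<longrightarrow>
           emeasure \<mu> B = (\<integral>\<^sup>+ u. ennreal (\<rho> u) * indicator (snd c ` B) u \<partial>lborel)))"

text \<open>For continuous functions this is also the \<open>L\<^sup>\<infinity>\<close> norm with respect to a smooth measure.\<close>
definition sup_norm :: "('a \<Rightarrow> real) \<Rightarrow> ennreal" where
  "sup_norm f = (SUP x. ennreal \<bar>f x\<bar>)"

abbreviation pd :: "'b::euclidean_space \<Rightarrow> ('b \<Rightarrow> real) \<Rightarrow> 'b \<Rightarrow> real" where
  "pd v g \<equiv> (\<lambda>u. frechet_derivative g (at u) v)"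

definition diffusion_operator ::
  "('a::topological_space, 'b::euclidean_space) chart set \<Rightarrow> (('a \<Rightarrow> real) \<Rightarrow> 'a \<Rightarrow> real) \<Rightarrow> bool" where
  "diffusion_operator A L \<longleftrightarrow>
     (\<forall>c\<in>A. \<exists>(a :: 'b \<Rightarrow> 'b \<Rightarrow> 'b \<Rightarrow> real) (b :: 'b \<Rightarrow> 'b \<Rightarrow> real) (e :: 'b \<Rightarrow> real).
        (\<forall>i\<in>Basis. \<forall>j\<in>Basis. smooth_on (snd c ` fst c) (a i j)) \<and>
        (\<forall>i\<in>Basis. smooth_on (snd c ` fst c) (b i)) \<and> smooth_on (snd c ` fst c) e \<and>
        (\<forall>u\<in>snd c ` fst c. (\<forall>i\<in>Basis. \<forall>j\<in>Basis. a i j u = a j i u) \<and>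
           (\<forall>\<xi>. 0 \<le> (\<Sum>i\<in>Basis. \<Sum>j\<in>Basis. a i j u * (\<xi> \<bullet> i) * (\<xi> \<bullet> j)))) \<and>
        (\<forall>f\<in>Csmooth A. \<forall>x\<in>fst c. L f x =
             (\<Sum>i\<in>Basis. \<Sum>j\<in>Basis. a i j (snd c x) * pd i (pd j (in_chart c f)) (snd c x))
           + (\<Sum>i\<in>Basis. b i (snd c x) * pd i (in_chart c f) (snd c x))
           + e (snd c x) * f x))"

definition symmetric_nonpositive ::
  "('a::topological_space, 'b::euclidean_space) chart set \<Rightarrow> 'a measure \<Rightarrow> (('a \<Rightarrow> real) \<Rightarrow> 'a \<Rightarrow> real) \<Rightarrow> bool" where
  "symmetric_nonpositive A \<mu> L \<longleftrightarrow>
     (\<forall>f\<in>Ctest A. \<forall>g\<in>Ctest A. (\<integral>x. f x * L g x \<partial>\<mu>) = (\<integral>x. g x * L f x \<partial>\<mu>)) \<and>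
     (\<forall>f\<in>Ctest A. (\<integral>x. f x * L f x \<partial>\<mu>) \<le> 0)"

definition fourier :: "('b::euclidean_space \<Rightarrow> real) \<Rightarrow> 'b \<Rightarrow> complex" where
  "fourier f \<xi> = (\<integral>u. complex_of_real (f u) * cis (- (u \<bullet> \<xi>)) \<partial>lborel)"

text \<open>The squared \<open>H\<^sup>s\<close> norm of a test function on Euclidean space, up to a constant
  depending only on the dimension.\<close>
definition sobolev_norm_sq :: "real \<Rightarrow> ('b::euclidean_space \<Rightarrow> real) \<Rightarrow> ennreal" where
  "sobolev_norm_sq s f = (\<integral>\<^sup>+ \<xi>. ennreal ((1 + (norm \<xi>)\<^sup>2) powr s * (cmod (fourier f \<xi>))\<^sup>2) \<partial>lborel)"

definition locally_subelliptic ::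
  "('a::topological_space, 'b::euclidean_space) chart set \<Rightarrow> 'a measure \<Rightarrow> (('a \<Rightarrow> real) \<Rightarrow> 'a \<Rightarrow> real) \<Rightarrow> bool" where
  "locally_subelliptic A \<mu> L \<longleftrightarrow>
     (\<forall>x. \<exists>c\<in>A. \<exists>W \<epsilon> C. open W \<and> x \<in> W \<and> W \<subseteq> fst c \<and> (\<epsilon>::real) > 0 \<and> (\<forall>f\<in>Ctest_in A W.
        sobolev_norm_sq \<epsilon> (\<lambda>u. if u \<in> snd c ` fst c then in_chart c f u else 0)
          \<le> ennreal (C * (- (\<integral>y. f y * L f y \<partial>\<mu>) + (\<integral>y. (f y)\<^sup>2 \<partial>\<mu>)))))"

text \<open>\<open>\<Gamma>(f,g)\<close>\<close>
definition cdc :: "(('a \<Rightarrow> real) \<Rightarrow> 'a \<Rightarrow> real) \<Rightarrow> ('a \<Rightarrow> real) \<Rightarrow> ('a \<Rightarrow> real) \<Rightarrow> 'a \<Rightarrow> real" where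
  "cdc L f g = (\<lambda>x. (L (\<lambda>y. f y * g y) x - f x * L g x - g x * L f x) / 2)"

text \<open>\<open>\<Gamma>\<^sub>2(f)\<close> for \<open>G = cdc L\<close>, and \<open>\<Gamma>\<^sub>2\<^sup>Z(f)\<close> for \<open>G = \<Gamma>\<^sup>Z\<close>\<close>
definition iterated_form :: "(('a \<Rightarrow> real) \<Rightarrow> 'a \<Rightarrow> real) \<Rightarrow>
    (('a \<Rightarrow> real) \<Rightarrow> ('a \<Rightarrow> real) \<Rightarrow> 'a \<Rightarrow> real) \<Rightarrow> ('a \<Rightarrow> real) \<Rightarrow> 'a \<Rightarrow> real" where
  "iterated_form L G f = (\<lambda>x. (L (G f f) x - 2 * G f (L f) x) / 2)"

definition first_order_form :: "('a::topological_space, 'b::euclidean_space) chart set \<Rightarrow>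
    (('a \<Rightarrow> real) \<Rightarrow> ('a \<Rightarrow> real) \<Rightarrow> 'a \<Rightarrow> real) \<Rightarrow> bool" where
  "first_order_form A G \<longleftrightarrow>
     (\<forall>c\<in>A. \<exists>z :: 'b \<Rightarrow> 'b \<Rightarrow> 'b \<Rightarrow> real.
        (\<forall>i\<in>Basis. \<forall>j\<in>Basis. smooth_on (snd c ` fst c) (z i j)) \<and>
        (\<forall>f\<in>Csmooth A. \<forall>g\<in>Csmooth A. \<forall>x\<in>fst c. G f g x =
           (\<Sum>i\<in>Basis. \<Sum>j\<in>Basis. z i j (snd c x) *
              pd i (in_chart c f) (snd c x) * pd j (in_chart c g) (snd c x)))) \<and>
     (\<forall>f\<in>Csmooth A. \<forall>g\<in>Csmooth A. G f g = G g f) \<and>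
     (\<forall>f\<in>Csmooth A. \<forall>g\<in>Csmooth A. \<forall>h\<in>Csmooth A. \<forall>x.
        G (\<lambda>y. f y * g y) h x = f x * G g h x + g x * G f h x) \<and>
     (\<forall>f\<in>Csmooth A. \<forall>x. 0 \<le> G f f x)"

text \<open>\<open>L = - \<Sum>\<^sub>i X\<^sub>i\<^sup>* X\<^sub>i\<close> on the open subset \<open>W\<close> of the chart \<open>c\<close>, with \<open>X i\<close> for \<open>i < m\<close> the
  coordinate expressions of Lipschitz vector fields. The fields being only Lipschitz, the
  identity is understood weakly, \<open>X\<^sub>i\<^sup>*\<close> being the formal adjoint with respect to \<open>\<mu>\<close>.\<close>
definition sum_of_squares_on :: "('a::topological_space, 'b::euclidean_space) chart set \<Rightarrow> 'a measure \<Rightarrow>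
    (('a \<Rightarrow> real) \<Rightarrow> 'a \<Rightarrow> real) \<Rightarrow> ('a, 'b) chart \<Rightarrow> 'a set \<Rightarrow> nat \<Rightarrow> (nat \<Rightarrow> 'b \<Rightarrow> 'b) \<Rightarrow> bool" where
  "sum_of_squares_on A \<mu> L c W m X \<longleftrightarrow> c \<in> A \<and> open W \<and> W \<subseteq> fst c \<and>
     (\<forall>i<m. \<exists>C. C-lipschitz_on (snd c ` W) (X i)) \<and>
     (\<forall>f\<in>Ctest_in A W. \<forall>g\<in>Ctest_in A W.
        (\<integral>x. g x * L f x \<partial>\<mu>) =
        - (LINT x:W|\<mu>. (\<Sum>i<m. frechet_derivative (in_chart c g) (at (snd c x)) (X i (snd c x)) *
                               frechet_derivative (in_chart c f) (at (snd c x)) (X i (snd c x)))))"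

definition locally_sum_of_squares ::
  "('a::topological_space, 'b::euclidean_space) chart set \<Rightarrow> 'a measure \<Rightarrow> (('a \<Rightarrow> real) \<Rightarrow> 'a \<Rightarrow> real) \<Rightarrow> bool" where
  "locally_sum_of_squares A \<mu> L \<longleftrightarrow> (\<forall>x. \<exists>c W m X. x \<in> W \<and> sum_of_squares_on A \<mu> L c W m X)"

text \<open>\<open>v\<close> is the coordinate vector, in the chart \<open>c\<close>, of a tangent vector at \<open>x\<close>. Whether it is
  subunit does not depend on the local representation of \<open>L\<close>.\<close>
definition subunit_vector :: "('a::topological_space, 'b::euclidean_space) chart set \<Rightarrow> 'a measure \<Rightarrow>
    (('a \<Rightarrow> real) \<Rightarrow> 'a \<Rightarrow> real) \<Rightarrow> ('a, 'b) chart \<Rightarrow> 'a \<Rightarrow> 'b \<Rightarrow> bool" where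
  "subunit_vector A \<mu> L c x v \<longleftrightarrow> (\<exists>W m X. x \<in> W \<and> sum_of_squares_on A \<mu> L c W m X \<and>
     (\<exists>\<alpha> :: nat \<Rightarrow> real. v = (\<Sum>i<m. \<alpha> i *\<^sub>R X i (snd c x)) \<and> (\<Sum>i<m. (\<alpha> i)\<^sup>2) \<le> 1))"

definition lipschitz_path ::
  "('a::topological_space, 'b::euclidean_space) chart set \<Rightarrow> real \<Rightarrow> (real \<Rightarrow> 'a) \<Rightarrow> bool" where
  "lipschitz_path A T \<gamma> \<longleftrightarrow> continuous_on {0..T} \<gamma> \<and>
     (\<forall>c\<in>A. \<forall>r s. {r..s} \<subseteq> {0..T} \<and> \<gamma> ` {r..s} \<subseteq> fst c \<longrightarrow>
        (\<exists>C. C-lipschitz_on {r..s} (snd c \<circ> \<gamma>)))"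

definition subunit_path :: "('a::topological_space, 'b::euclidean_space) chart set \<Rightarrow> 'a measure \<Rightarrow>
    (('a \<Rightarrow> real) \<Rightarrow> 'a \<Rightarrow> real) \<Rightarrow> real \<Rightarrow> (real \<Rightarrow> 'a) \<Rightarrow> bool" where
  "subunit_path A \<mu> L T \<gamma> \<longleftrightarrow> 0 \<le> T \<and> lipschitz_path A T \<gamma> \<and>
     (AE t in lborel. t \<in> {0<..<T} \<longrightarrow> (\<exists>c\<in>A. \<gamma> t \<in> fst c \<and>
        (\<exists>v. ((snd c \<circ> \<gamma>) has_vector_derivative v) (at t) \<and> subunit_vector A \<mu> L c (\<gamma> t) v)))"

text \<open>The supremum is one of a bounded set as soon as any two points are joined by a subunit path.\<close>
definition cc_dist :: "('a::topological_space, 'b::euclidean_space) chart set \<Rightarrow>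
    (('a \<Rightarrow> real) \<Rightarrow> 'a \<Rightarrow> real) \<Rightarrow> 'a \<Rightarrow> 'a \<Rightarrow> real" where
  "cc_dist A L x y = (SUP f\<in>{f \<in> Csmooth A. sup_norm (cdc L f f) \<le> 1}. \<bar>f x - f y\<bar>)"

definition L2 :: "'a measure \<Rightarrow> ('a \<Rightarrow> real) set" where
  "L2 \<mu> = {u \<in> borel_measurable \<mu>. integrable \<mu> (\<lambda>x. (u x)\<^sup>2)}"

text \<open>\<open>(u, w)\<close> lies in the graph of the closure in \<open>L\<^sup>2(\<mu>)\<close> of \<open>L\<close> with domain the test functions.\<close>
definition closure_graph :: "('a::topological_space, 'b::euclidean_space) chart set \<Rightarrow> 'a measure \<Rightarrow>
    (('a \<Rightarrow> real) \<Rightarrow> 'a \<Rightarrow> real) \<Rightarrow> ('a \<Rightarrow> real) \<Rightarrow> ('a \<Rightarrow> real) \<Rightarrow> bool" where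
  "closure_graph A \<mu> L u w \<longleftrightarrow> u \<in> L2 \<mu> \<and> w \<in> L2 \<mu> \<and> (\<exists>f :: nat \<Rightarrow> 'a \<Rightarrow> real. (\<forall>n. f n \<in> Ctest A) \<and>
     (\<lambda>n. \<integral>x. (f n x - u x)\<^sup>2 \<partial>\<mu>) \<longlonglongrightarrow> 0 \<and> (\<lambda>n. \<integral>x. (L (f n) x - w x)\<^sup>2 \<partial>\<mu>) \<longlonglongrightarrow> 0)"

definition adjoint_graph :: "('a::topological_space, 'b::euclidean_space) chart set \<Rightarrow> 'a measure \<Rightarrow>
    (('a \<Rightarrow> real) \<Rightarrow> 'a \<Rightarrow> real) \<Rightarrow> ('a \<Rightarrow> real) \<Rightarrow> ('a \<Rightarrow> real) \<Rightarrow> bool" where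
  "adjoint_graph A \<mu> L u w \<longleftrightarrow> u \<in> L2 \<mu> \<and> w \<in> L2 \<mu> \<and>
     (\<forall>f\<in>Ctest A. (\<integral>x. u x * L f x \<partial>\<mu>) = (\<integral>x. w x * f x \<partial>\<mu>))"

definition essentially_self_adjoint ::
  "('a::topological_space, 'b::euclidean_space) chart set \<Rightarrow> 'a measure \<Rightarrow> (('a \<Rightarrow> real) \<Rightarrow> 'a \<Rightarrow> real) \<Rightarrow> bool" where
  "essentially_self_adjoint A \<mu> L \<longleftrightarrow> (\<forall>u w. closure_graph A \<mu> L u w \<longleftrightarrow> adjoint_graph A \<mu> L u w)"

text \<open>\<open>P t = e\<^bsup>tL\<^esup>\<close>: the strongly continuous contraction semigroup on \<open>L\<^sup>2(\<mu>)\<close> whose generator is the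
  closure of \<open>L\<close>. It is unique (up to null sets) by the theory of one-parameter semigroups.\<close>
definition generated_semigroup :: "('a::topological_space, 'b::euclidean_space) chart set \<Rightarrow> 'a measure \<Rightarrow>
    (('a \<Rightarrow> real) \<Rightarrow> 'a \<Rightarrow> real) \<Rightarrow> (real \<Rightarrow> ('a \<Rightarrow> real) \<Rightarrow> 'a \<Rightarrow> real) \<Rightarrow> bool" where
  "generated_semigroup A \<mu> L P \<longleftrightarrow>
     (\<forall>t\<ge>0. \<forall>u\<in>L2 \<mu>. P t u \<in> L2 \<mu> \<and> (\<integral>x. (P t u x)\<^sup>2 \<partial>\<mu>) \<le> (\<integral>x. (u x)\<^sup>2 \<partial>\<mu>)) \<and>
     (\<forall>t\<ge>0. \<forall>u\<in>L2 \<mu>. \<forall>v\<in>L2 \<mu>. \<forall>a b.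
        AE x in \<mu>. P t (\<lambda>y. a * u y + b * v y) x = a * P t u x + b * P t v x) \<and>
     (\<forall>u\<in>L2 \<mu>. AE x in \<mu>. P 0 u x = u x) \<and>
     (\<forall>s\<ge>0. \<forall>t\<ge>0. \<forall>u\<in>L2 \<mu>. AE x in \<mu>. P (s + t) u x = P s (P t u) x) \<and>
     (\<forall>u\<in>L2 \<mu>. ((\<lambda>t. \<integral>x. (P t u x - u x)\<^sup>2 \<partial>\<mu>) \<longlongrightarrow> 0) (at_right 0)) \<and>
     (\<forall>u\<in>L2 \<mu>. \<forall>w\<in>L2 \<mu>. closure_graph A \<mu> L u w \<longleftrightarrow>
        ((\<lambda>t. \<integral>x. ((P t u x - u x) / t - w x)\<^sup>2 \<partial>\<mu>) \<longlongrightarrow> 0) (at_right 0))"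

definition heat_op :: "'a measure \<Rightarrow> ('a \<Rightarrow> 'a \<Rightarrow> real \<Rightarrow> real) \<Rightarrow> real \<Rightarrow> ('a \<Rightarrow> real) \<Rightarrow> 'a \<Rightarrow> real" where
  "heat_op \<mu> p t f = (if t = 0 then f else (\<lambda>x. \<integral>y. p x y t * f y \<partial>\<mu>))"

definition heat_kernel :: "('a::topological_space, 'b::euclidean_space) chart set \<Rightarrow> 'a measure \<Rightarrow>
    (('a \<Rightarrow> real) \<Rightarrow> 'a \<Rightarrow> real) \<Rightarrow> ('a \<Rightarrow> 'a \<Rightarrow> real \<Rightarrow> real) \<Rightarrow> bool" where
  "heat_kernel A \<mu> L p \<longleftrightarrow>
     (\<forall>c\<in>A. \<forall>c'\<in>A. smooth_on ((snd c ` fst c) \<times> (snd c' ` fst c') \<times> {0<..})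
        (\<lambda>(u, v, t). p (inv_into (fst c) (snd c) u) (inv_into (fst c') (snd c') v) t)) \<and>
     (\<forall>x y. \<forall>t>0. p x y t > 0 \<and> p x y t = p y x t) \<and>
     generated_semigroup A \<mu> L (heat_op \<mu> p)"

definition ereal_sqrt :: "ereal \<Rightarrow> ereal" where
  "ereal_sqrt x = (if x = \<infinity> then \<infinity> else ereal (sqrt (real_of_ereal x)))"

end

theory Submission
  imports Defs "HOL-Computational_Algebra.Polynomial" "HOL-Real_Asymp.Real_Asymp"
begin

text \<open>Maximum principles along the heat flow \<open>P t\<close> turn the curvature-dimension inequality into a
  gradient bound and a Li-Yau inequality. The former shows that \<open>P t f\<close> tends to a constant, so
  that \<open>\<mu>\<close> is finite; the latter gives the ultracontractive bound
  \<open>P t f \<le> (1 - exp (- \<alpha> t)) powr (- D / 2) * mean f\<close> for \<open>f > 0\<close>. It bounds the entropy of \<open>P t f\<close>,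
  whose dissipation is the Fisher information, and this controls how much the integral of
  \<open>P t f * v\<close> changes in time when \<open>\<Gamma>(v) \<le> 1\<close>. Integrating over all times bounds the oscillation of \<open>v\<close>,
  hence the diameter, by \<open>2 \<pi> sqrt (D / (2 \<alpha>))\<close>, which is half of the stated constant.

  Over short times the same argument shows that \<open>P t v - v\<close> is uniformly small. As a positive
  fraction of the heat from any point reaches the support of a fixed \<open>h k\<close>, every point is
  close to this compact set; so the space is totally bounded, and compact by completeness.\<close>

section \<open>Smooth functions on open sets\<close>

text \<open>The cutoffs \<open>h k\<close> come with small gradients, but nothing is known about
  \<open>L (h k)\<close>. This shapes every cutoff argument: symmetry moves \<open>L\<close> off
  \<open>h k\<close>, so that only \<Gamma>(h k, _) is left to vanish, and the integral of
  \<open>L f\<close> is shown to be zero through conservation of mass along the flow. The bound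
  \<open>lnK t\<close> on the entropy is infinite at time 0, but only logarithmically. The
  difference between this bound and the entropy is therefore weighted by a function of time
  vanishing at 0, a multiple of \<open>w0 t = sqrt (exp (\<alpha> t) - 1)\<close>. The Li-Yau rate
  is a multiple of \<open>1 / w0^2\<close>, so the errors integrate to an arctangent, and its limit
  at infinity is where pi comes from. The entropy method speaks about strictly positive smooth
  densities. Pointwise bounds follow by testing with a density concentrated where the bound would
  fail, for functions of compact support first; cutoffs and truncation remove that restriction. The
  constants are forced: matching the \<Gamma> terms as polynomials in
  \<open>exp (\<alpha> t)\<close> determines \<alpha> and \<open>A' = D / d\<close>, and completing
  a square in \<open>L v\<close> produces \<open>D\<close>.\<close>

lemma frechet_derivative_cong_open:
  assumes "open S" "x \<in> S" "\<And>y. y \<in> S \<Longrightarrow> f y = g y" "f differentiable at x"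
  shows "g differentiable at x" "frechet_derivative g (at x) = frechet_derivative f (at x)"
proof -
  have "(f has_derivative frechet_derivative f (at x)) (at x)"
    using assms(4) frechet_derivative_works by blast
  then have *: "(g has_derivative frechet_derivative f (at x)) (at x)"
    using assms(1-3) by (rule has_derivative_transform_within_open)
  show "g differentiable at x" using * differentiable_def by blast
  show "frechet_derivative g (at x) = frechet_derivative f (at x)"
    using frechet_derivative_at[OF *] by simp
qed

lemma Ck_on_cong:
  assumes "open S" "\<And>y. y \<in> S \<Longrightarrow> f y = g y" "Ck_on k S f"
  shows "Ck_on k S g"
  using assms(2,3)
proof (induction k arbitrary: f g)
  case 0
  then show ?case by (simp cong: continuous_on_cong)
next
  case (Suc k)
  have d: "\<And>x. x \<in> S \<Longrightarrow> f differentiable at x" using Suc.prems by simp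
  have eq: "frechet_derivative g (at x) = frechet_derivative f (at x)" if "x \<in> S" for x
    by (rule frechet_derivative_cong_open(2)[OF assms(1) that Suc.prems(1) d[OF that]])
  have "Ck_on k S (\<lambda>x. frechet_derivative g (at x) v)" for v
    by (rule Suc.IH[of "\<lambda>x. frechet_derivative f (at x) v"]) (use Suc.prems eq in auto)
  then show ?case using frechet_derivative_cong_open(1)[OF assms(1)] d Suc.prems(1) by simp blast
qed

lemma smooth_on_cong:
  assumes "open S" "\<And>y. y \<in> S \<Longrightarrow> f y = g y" "smooth_on S f"
  shows "smooth_on S g"
  using assms Ck_on_cong unfolding smooth_on_def by blast

lemma Ck_on_Suc_imp: "Ck_on (Suc k) S f \<Longrightarrow> Ck_on k S f"
proof (induction k arbitrary: f)
  case 0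
  then show ?case
    by (auto intro!: continuous_at_imp_continuous_on differentiable_imp_continuous_within)
next
  case (Suc k)
  then show ?case by (metis Ck_on.simps(2))
qed

lemma Ck_on_imp_continuous_on: "Ck_on k S f \<Longrightarrow> continuous_on S f"
  by (induction k) (auto simp del: Ck_on.simps(2) dest: Ck_on_Suc_imp)

lemma Ck_on_subset: "Ck_on k S f \<Longrightarrow> T \<subseteq> S \<Longrightarrow> Ck_on k T f"
  by (induction k arbitrary: f) (auto intro: continuous_on_subset)

lemma smooth_on_subset: "smooth_on S f \<Longrightarrow> T \<subseteq> S \<Longrightarrow> smooth_on T f"
  unfolding smooth_on_def using Ck_on_subset by blast

lemma smooth_on_imp_continuous_on: "smooth_on S f \<Longrightarrow> continuous_on S f"
  unfolding smooth_on_def using Ck_on_imp_continuous_on by blast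

lemma smooth_on_imp_differentiable: "smooth_on S f \<Longrightarrow> x \<in> S \<Longrightarrow> f differentiable at x"
  unfolding smooth_on_def by (metis Ck_on.simps(2))

lemma smooth_on_frechet_derivative:
  "smooth_on S f \<Longrightarrow> smooth_on S (\<lambda>x. frechet_derivative f (at x) v)"
  unfolding smooth_on_def by (metis Ck_on.simps(2))

lemma Ck_on_const [simp]: "Ck_on k S (\<lambda>x. c)"
  by (induction k arbitrary: c) (auto simp: frechet_derivative_const)

lemma smooth_on_const [simp]: "smooth_on S (\<lambda>x. c)"
  unfolding smooth_on_def by simp

lemma frechet_derivative_add:
  assumes "f differentiable at x" "g differentiable at x"
  shows "frechet_derivative (\<lambda>x. f x + g x) (at x) v
    = frechet_derivative f (at x) v + frechet_derivative g (at x) v"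
proof -
  have "((\<lambda>x. f x + g x) has_derivative
     (\<lambda>v. frechet_derivative f (at x) v + frechet_derivative g (at x) v)) (at x)"
    using assms frechet_derivative_works has_derivative_add by blast
  from frechet_derivative_at[OF this] show ?thesis by metis
qed

lemma Ck_on_add:
  assumes "open S" "Ck_on k S f" "Ck_on k S g"
  shows "Ck_on k S (\<lambda>x. f x + g x)"
  using assms(2,3)
proof (induction k arbitrary: f g)
  case 0
  then show ?case by (auto intro: continuous_on_add)
next
  case (Suc k)
  have "Ck_on k S (\<lambda>x. frechet_derivative (\<lambda>x. f x + g x) (at x) v)" for v
    by (rule Ck_on_cong[OF assms(1), of "\<lambda>x. frechet_derivative f (at x) v + frechet_derivative g (at x) v"])
       (use Suc in \<open>auto simp: frechet_derivative_add\<close>)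
  then show ?case using Suc.prems by auto
qed

lemma smooth_on_add: "open S \<Longrightarrow> smooth_on S f \<Longrightarrow> smooth_on S g \<Longrightarrow> smooth_on S (\<lambda>x. f x + g x)"
  unfolding smooth_on_def using Ck_on_add by blast

lemma frechet_derivative_mult_real:
  fixes f g :: "'b::real_normed_vector \<Rightarrow> real"
  assumes "f differentiable at x" "g differentiable at x"
  shows "frechet_derivative (\<lambda>x. f x * g x) (at x) v
    = f x * frechet_derivative g (at x) v + frechet_derivative f (at x) v * g x"
proof -
  have "((\<lambda>x. f x * g x) has_derivative
     (\<lambda>v. f x * frechet_derivative g (at x) v + frechet_derivative f (at x) v * g x)) (at x)"
    using assms frechet_derivative_works has_derivative_mult by blast
  from frechet_derivative_at[OF this] show ?thesis by metis
qed

lemma Ck_on_mult: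
  fixes f g :: "'b::real_normed_vector \<Rightarrow> real"
  assumes "open S" "Ck_on k S f" "Ck_on k S g"
  shows "Ck_on k S (\<lambda>x. f x * g x)"
  using assms(2,3)
proof (induction k arbitrary: f g)
  case 0
  then show ?case by (auto intro: continuous_on_mult)
next
  case (Suc k)
  have *: "Ck_on k S f" "Ck_on k S g" using Suc.prems Ck_on_Suc_imp by blast+
  have "Ck_on k S (\<lambda>x. frechet_derivative (\<lambda>x. f x * g x) (at x) v)" for v
    by (rule Ck_on_cong[OF assms(1), of "\<lambda>x. f x * frechet_derivative g (at x) v + frechet_derivative f (at x) v * g x"])
       (use Suc * in \<open>auto simp: frechet_derivative_mult_real intro!: Ck_on_add assms(1)\<close>)
  then show ?case using Suc.prems by auto
qed

lemma smooth_on_mult: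
  fixes f g :: "'b::real_normed_vector \<Rightarrow> real"
  shows "open S \<Longrightarrow> smooth_on S f \<Longrightarrow> smooth_on S g \<Longrightarrow> smooth_on S (\<lambda>x. f x * g x)"
  unfolding smooth_on_def using Ck_on_mult by blast

lemma smooth_on_sum:
  "open S \<Longrightarrow> (\<And>i. i \<in> I \<Longrightarrow> smooth_on S (f i)) \<Longrightarrow> smooth_on S (\<lambda>x. \<Sum>i\<in>I. f i x)"
  by (induction I rule: infinite_finite_induct) (auto intro: smooth_on_add)

lemma frechet_derivative_compose_real:
  fixes g :: "'b::real_normed_vector \<Rightarrow> real"
  assumes "(F has_real_derivative d) (at (g x))" "g differentiable at x"
  shows "(\<lambda>x. F (g x)) differentiable at x"
    "frechet_derivative (\<lambda>x. F (g x)) (at x) v = d * frechet_derivative g (at x) v"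
proof -
  have "(g has_derivative frechet_derivative g (at x)) (at x)"
    using assms(2) frechet_derivative_works by blast
  moreover have "(F has_derivative (*) d) (at (g x))"
    using assms(1) has_field_derivative_def by blast
  ultimately have *: "((\<lambda>x. F (g x)) has_derivative (\<lambda>v. d * frechet_derivative g (at x) v)) (at x)"
    using has_derivative_compose by fastforce
  show "(\<lambda>x. F (g x)) differentiable at x" using * differentiable_def by blast
  show "frechet_derivative (\<lambda>x. F (g x)) (at x) v = d * frechet_derivative g (at x) v"
    using frechet_derivative_at[OF *] by metis
qed

text \<open>\<open>F n\<close> plays the role of the \<open>n\<close>-th derivative of \<open>F 0\<close>.\<close>
lemma smooth_on_compose_real:
  fixes g :: "'b::real_normed_vector \<Rightarrow> real" and F :: "nat \<Rightarrow> real \<Rightarrow> real"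
  assumes "open S" "smooth_on S g"
    and F: "\<And>n x. x \<in> S \<Longrightarrow> (F n has_real_derivative F (Suc n) (g x)) (at (g x))"
  shows "smooth_on S (\<lambda>x. F n (g x))"
proof -
  have "Ck_on k S (\<lambda>x. F n (g x))" for k n
  proof (induction k arbitrary: n)
    case 0
    have "continuous (at x) (\<lambda>x. F n (g x))" if "x \<in> S" for x
      using frechet_derivative_compose_real(1)[OF F smooth_on_imp_differentiable[OF assms(2)]] that
        differentiable_imp_continuous_within by blast
    then show ?case by (simp add: continuous_at_imp_continuous_on)
  next
    case (Suc k)
    have *: "\<And>x. x \<in> S \<Longrightarrow> g differentiable at x"
      using assms(2) smooth_on_imp_differentiable by blast
    have "Ck_on k S (\<lambda>x. frechet_derivative (\<lambda>x. F n (g x)) (at x) v)" for v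
    proof (rule Ck_on_cong[OF assms(1), of "\<lambda>x. F (Suc n) (g x) * frechet_derivative g (at x) v"])
      show "Ck_on k S (\<lambda>x. F (Suc n) (g x) * frechet_derivative g (at x) v)"
        using Suc smooth_on_frechet_derivative[OF assms(2)]
        by (intro Ck_on_mult assms(1)) (auto simp: smooth_on_def)
    qed (metis frechet_derivative_compose_real(2) F *)
    then show ?case using frechet_derivative_compose_real(1)[OF F *] by simp
  qed
  then show ?thesis unfolding smooth_on_def by blast
qed

text \<open>Affine substitutions cover the multivariate cases needed below: fixing the time, fixing
  the second point of the kernel, and permuting the arguments of the kernel.\<close>

lemma frechet_derivative_compose_affine:
  fixes l :: "'c::real_normed_vector \<Rightarrow> 'd::real_normed_vector"
  assumes "bounded_linear l" "F differentiable at (l u + c)"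
  shows "(\<lambda>u. F (l u + c)) differentiable at u"
    "frechet_derivative (\<lambda>u. F (l u + c)) (at u) v = frechet_derivative F (at (l u + c)) (l v)"
proof -
  have "((\<lambda>u. l u + c) has_derivative l) (at u)"
    using bounded_linear_imp_has_derivative[OF assms(1)] by (auto intro!: derivative_eq_intros)
  moreover have "(F has_derivative frechet_derivative F (at (l u + c))) (at (l u + c))"
    using assms(2) frechet_derivative_works by blast
  ultimately have *: "((\<lambda>u. F (l u + c)) has_derivative (\<lambda>v. frechet_derivative F (at (l u + c)) (l v))) (at u)"
    using has_derivative_compose by fastforce
  show "(\<lambda>u. F (l u + c)) differentiable at u" using * differentiable_def by blast
  show "frechet_derivative (\<lambda>u. F (l u + c)) (at u) v = frechet_derivative F (at (l u + c)) (l v)"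
    using frechet_derivative_at[OF *] by metis
qed

lemma smooth_on_compose_affine:
  assumes l: "bounded_linear l" and S: "open S" "smooth_on S F"
  shows "smooth_on {u. l u + c \<in> S} (\<lambda>u. F (l u + c))"
proof -
  have cl: "continuous_on UNIV (\<lambda>u. l u + c)"
    using l by (intro continuous_intros linear_continuous_on)
  have o: "open {u. l u + c \<in> S}"
    using continuous_open_preimage[OF cl open_UNIV S(1)] by (simp add: vimage_def)
  have "Ck_on k {u. l u + c \<in> S} (\<lambda>u. F (l u + c))" for k
    using S(2)
  proof (induction k arbitrary: F)
    case 0
    have "continuous_on S F" using 0 smooth_on_imp_continuous_on by blast
    then have "continuous_on {u. l u + c \<in> S} (F \<circ> (\<lambda>u. l u + c))"
      by (intro continuous_on_compose continuous_on_subset[OF cl]) (auto elim: continuous_on_subset)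
    then show ?case by (simp add: o_def)
  next
    case (Suc k)
    have d: "\<And>x. x \<in> S \<Longrightarrow> F differentiable at x"
      using Suc.prems smooth_on_imp_differentiable by blast
    have "Ck_on k {u. l u + c \<in> S} (\<lambda>u. frechet_derivative (\<lambda>u. F (l u + c)) (at u) v)" for v
    proof (rule Ck_on_cong[OF o])
      show "Ck_on k {u. l u + c \<in> S} (\<lambda>u. frechet_derivative F (at (l u + c)) (l v))"
        by (rule Suc.IH[OF smooth_on_frechet_derivative[OF Suc.prems]])
    qed (use frechet_derivative_compose_affine(2)[OF l d, symmetric] in auto)
    moreover have "\<forall>u\<in>{u. l u + c \<in> S}. (\<lambda>u. F (l u + c)) differentiable at u"
      using frechet_derivative_compose_affine(1)[OF l d] by blast
    ultimately show ?case by simp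
  qed
  then show ?thesis unfolding smooth_on_def by blast
qed

section \<open>Symmetry of second derivatives\<close>

lemma DERIV_along_line:
  assumes "f differentiable at (z + s *\<^sub>R a)"
  shows "((\<lambda>s. f (z + s *\<^sub>R a)) has_real_derivative frechet_derivative f (at (z + s *\<^sub>R a)) a) (at s)"
proof -
  have f: "(f has_derivative frechet_derivative f (at (z + s *\<^sub>R a))) (at (z + s *\<^sub>R a))"
    using assms frechet_derivative_works by blast
  have "((\<lambda>s. z + s *\<^sub>R a) has_derivative (\<lambda>r. r *\<^sub>R a)) (at s)"
    by (auto intro!: derivative_eq_intros)
  from has_derivative_compose[OF this f]
  have "((\<lambda>s. f (z + s *\<^sub>R a)) has_derivative (\<lambda>r. frechet_derivative f (at (z + s *\<^sub>R a)) (r *\<^sub>R a))) (at s)" .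
  moreover have "frechet_derivative f (at (z + s *\<^sub>R a)) (r *\<^sub>R a) = frechet_derivative f (at (z + s *\<^sub>R a)) a * r" for r
    using linear_frechet_derivative[OF assms] by (simp add: linear_scale)
  ultimately show ?thesis by (simp add: has_field_derivative_def)
qed

text \<open>The mean value theorem is used twice: for the increment of \<open>f\<close> in direction
  \<open>b\<close>, as a function of the parameter along \<open>a\<close>, and then for the
  derivative in direction \<open>a\<close>, along \<open>b\<close>. Both intermediate points lie in
  the parallelogram, which is why all of it must lie in \<open>S\<close>.\<close>

lemma second_difference_quotient:
  fixes f :: "'b::real_normed_vector \<Rightarrow> real"
  assumes S: "smooth_on S f" and r: "0 < r"
    and sub: "\<And>s t. 0 \<le> s \<Longrightarrow> s \<le> r \<Longrightarrow> 0 \<le> t \<Longrightarrow> t \<le> r \<Longrightarrow> z + s *\<^sub>R a + t *\<^sub>R b \<in> S"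
  shows "\<exists>s t. 0 \<le> s \<and> s \<le> r \<and> 0 \<le> t \<and> t \<le> r \<and>
    f (z + r *\<^sub>R a + r *\<^sub>R b) - f (z + r *\<^sub>R a) - f (z + r *\<^sub>R b) + f z
    = r * r * frechet_derivative (\<lambda>x. frechet_derivative f (at x) a) (at (z + s *\<^sub>R a + t *\<^sub>R b)) b"
proof -
  let ?g = "\<lambda>s. f (z + s *\<^sub>R a + r *\<^sub>R b) - f (z + s *\<^sub>R a)"
  let ?fa = "\<lambda>x. frechet_derivative f (at x) a"
  have d: "\<And>s. 0 \<le> s \<Longrightarrow> s \<le> r \<Longrightarrow>
    (?g has_real_derivative ?fa (z + s *\<^sub>R a + r *\<^sub>R b) - ?fa (z + s *\<^sub>R a)) (at s)"
  proof -
    fix s :: real assume s: "0 \<le> s" "s \<le> r"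
    have "z + s *\<^sub>R a + r *\<^sub>R b \<in> S" "z + s *\<^sub>R a \<in> S"
      using sub[of s r] sub[of s 0] s r by auto
    then have 1: "f differentiable at (z + r *\<^sub>R b + s *\<^sub>R a)" "f differentiable at (z + s *\<^sub>R a)"
      using S smooth_on_imp_differentiable by (auto simp: algebra_simps)
    show "(?g has_real_derivative ?fa (z + s *\<^sub>R a + r *\<^sub>R b) - ?fa (z + s *\<^sub>R a)) (at s)"
      using DERIV_diff[OF DERIV_along_line[OF 1(1)] DERIV_along_line[OF 1(2)]]
      by (simp add: algebra_simps)
  qed
  obtain s where s: "0 < s" "s < r" "?g r - ?g 0 = (r - 0) * (?fa (z + s *\<^sub>R a + r *\<^sub>R b) - ?fa (z + s *\<^sub>R a))"
    using MVT2[OF r, of ?g "\<lambda>s. ?fa (z + s *\<^sub>R a + r *\<^sub>R b) - ?fa (z + s *\<^sub>R a)", OF d]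
    by blast
  have d2: "\<And>t. 0 \<le> t \<Longrightarrow> t \<le> r \<Longrightarrow>
    ((\<lambda>t. ?fa (z + s *\<^sub>R a + t *\<^sub>R b)) has_real_derivative
      frechet_derivative ?fa (at (z + s *\<^sub>R a + t *\<^sub>R b)) b) (at t)"
    by (rule DERIV_along_line)
       (use sub s smooth_on_imp_differentiable[OF smooth_on_frechet_derivative[OF S]] in auto)
  obtain t where t: "0 < t" "t < r" "?fa (z + s *\<^sub>R a + r *\<^sub>R b) - ?fa (z + s *\<^sub>R a + 0 *\<^sub>R b)
     = (r - 0) * frechet_derivative ?fa (at (z + s *\<^sub>R a + t *\<^sub>R b)) b"
    using MVT2[OF r, of "\<lambda>t. ?fa (z + s *\<^sub>R a + t *\<^sub>R b)"
      "\<lambda>t. frechet_derivative ?fa (at (z + s *\<^sub>R a + t *\<^sub>R b)) b", OF d2]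
    by blast
  show ?thesis
    by (intro exI[of _ s] exI[of _ t]) (use s t in \<open>auto simp: algebra_simps\<close>)
qed

text \<open>The second difference is symmetric in \<open>a\<close> and \<open>b\<close>, so both
  iterated derivatives attain a common value at points as close to \<open>z\<close> as desired;
  continuity closes the gap. The lemma is needed to exchange time and space derivatives of
  \<open>P t f\<close>.\<close>

lemma second_derivative_commute:
  fixes f :: "'b::real_normed_vector \<Rightarrow> real"
  assumes S: "open S" "smooth_on S f" "z \<in> S"
  shows "frechet_derivative (\<lambda>x. frechet_derivative f (at x) a) (at z) b
       = frechet_derivative (\<lambda>x. frechet_derivative f (at x) b) (at z) a"
proof (rule ccontr)
  let ?ab = "\<lambda>z. frechet_derivative (\<lambda>x. frechet_derivative f (at x) a) (at z) b"
  let ?ba = "\<lambda>z. frechet_derivative (\<lambda>x. frechet_derivative f (at x) b) (at z) a"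
  assume "?ab z \<noteq> ?ba z"
  define e where "e = \<bar>?ab z - ?ba z\<bar> / 2"
  have e: "e > 0" using \<open>?ab z \<noteq> ?ba z\<close> e_def by auto
  have "continuous_on S ?ab" "continuous_on S ?ba"
    using S(2) smooth_on_frechet_derivative smooth_on_imp_continuous_on by blast+
  then have "isCont ?ab z" "isCont ?ba z"
    using S by (simp_all add: continuous_on_eq_continuous_at)
  then have "\<exists>d>0. \<forall>x. dist x z < d \<longrightarrow> dist (?ab x) (?ab z) < e"
    "\<exists>d>0. \<forall>x. dist x z < d \<longrightarrow> dist (?ba x) (?ba z) < e"
    using e unfolding continuous_at_eps_delta by simp_all
  then obtain d1 d2 where d1: "d1 > 0" "\<And>x. dist x z < d1 \<Longrightarrow> dist (?ab x) (?ab z) < e"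
    and d2: "d2 > 0" "\<And>x. dist x z < d2 \<Longrightarrow> dist (?ba x) (?ba z) < e"
    by metis
  obtain d3 where d3: "d3 > 0" "ball z d3 \<subseteq> S" using S openE by blast
  define d where "d = min d1 (min d2 d3)"
  have d: "d > 0" using d1 d2 d3 d_def by auto
  \<comment> \<open>With this \<open>r\<close> the whole parallelogram stays within
    \<open>d / 2\<close> of \<open>z\<close>; the added 1 keeps the denominator positive if
    \<open>a\<close> and \<open>b\<close> vanish.\<close>
  define r where "r = d / (2 * (norm a + norm b + 1))"
  have na: "norm a + norm b + 1 > 0" by (smt (verit) norm_ge_zero)
  have r: "r > 0" using d na by (simp add: r_def)
  have near: "dist (z + s *\<^sub>R a + t *\<^sub>R b) z < d" if "0 \<le> s" "s \<le> r" "0 \<le> t" "t \<le> r" for s t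
  proof -
    have "dist (z + s *\<^sub>R a + t *\<^sub>R b) z = norm (s *\<^sub>R a + t *\<^sub>R b)" by (simp add: dist_norm)
    also have "\<dots> \<le> s * norm a + t * norm b"
      using norm_triangle_ineq[of "s *\<^sub>R a" "t *\<^sub>R b"] that by simp
    also have "\<dots> \<le> r * norm a + r * norm b" using that by (intro add_mono mult_right_mono) auto
    also have "\<dots> \<le> r * (norm a + norm b + 1)" using r by (simp add: algebra_simps)
    also have "\<dots> = d / 2" using na unfolding r_def by (simp add: divide_simps)
    also have "\<dots> < d" using d by simp
    finally show ?thesis .
  qed
  have inS: "z + s *\<^sub>R a + t *\<^sub>R b \<in> S" if "0 \<le> s" "s \<le> r" "0 \<le> t" "t \<le> r" for s t
    using near[OF that] d3(2) by (auto simp: d_def dist_commute)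
  have inS': "z + s *\<^sub>R b + t *\<^sub>R a \<in> S" if "0 \<le> s" "s \<le> r" "0 \<le> t" "t \<le> r" for s t
    using inS[OF that(3,4,1,2)] by (simp add: algebra_simps)
  obtain s t where st: "0 \<le> s" "s \<le> r" "0 \<le> t" "t \<le> r"
    "f (z + r *\<^sub>R a + r *\<^sub>R b) - f (z + r *\<^sub>R a) - f (z + r *\<^sub>R b) + f z = r * r * ?ab (z + s *\<^sub>R a + t *\<^sub>R b)"
    using second_difference_quotient[OF S(2) r, of z a b, OF inS] by auto
  obtain s' t' where st': "0 \<le> s'" "s' \<le> r" "0 \<le> t'" "t' \<le> r"
    "f (z + r *\<^sub>R b + r *\<^sub>R a) - f (z + r *\<^sub>R b) - f (z + r *\<^sub>R a) + f z = r * r * ?ba (z + s' *\<^sub>R b + t' *\<^sub>R a)"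
    using second_difference_quotient[OF S(2) r, of z b a, OF inS'] by auto
  have "r * r * ?ab (z + s *\<^sub>R a + t *\<^sub>R b) = r * r * ?ba (z + s' *\<^sub>R b + t' *\<^sub>R a)"
    using st(5) st'(5) by (simp add: algebra_simps)
  then have eq: "?ab (z + s *\<^sub>R a + t *\<^sub>R b) = ?ba (z + s' *\<^sub>R b + t' *\<^sub>R a)" using r by simp
  have "dist (?ab (z + s *\<^sub>R a + t *\<^sub>R b)) (?ab z) < e"
    using d1(2) near[OF st(1-4)] d_def by auto
  moreover have "dist (?ba (z + s' *\<^sub>R b + t' *\<^sub>R a)) (?ba z) < e"
    using d2(2) near[OF st'(3,4,1,2)] d_def by (auto simp: algebra_simps)
  ultimately have "\<bar>?ab z - ?ba z\<bar> < 2 * e" using eq unfolding dist_real_def by linarith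
  moreover have "\<not> \<bar>x\<bar> < 2 * y" if "y = \<bar>x\<bar> / 2" for x y :: real using that by simp
  ultimately show False using e_def by blast
qed

section \<open>Differentiation under the integral sign\<close>

text \<open>By the mean value theorem the majorant \<open>g\<close> of the derivatives also bounds
  every difference quotient, so dominated convergence applies along each sequence of increments
  tending to 0. Measurability of \<open>F' t\<close> is obtained on the way, as that of a pointwise
  limit of such quotients.\<close>

lemma DERIV_integral_dominated:
  fixes F F' :: "real \<Rightarrow> 'a \<Rightarrow> real"
  assumes I: "a < t" "t < b"
    and F: "\<And>s. a < s \<Longrightarrow> s < b \<Longrightarrow> integrable \<mu> (F s)"
    and F': "\<And>s x. a < s \<Longrightarrow> s < b \<Longrightarrow> x \<in> space \<mu> \<Longrightarrow> ((\<lambda>s. F s x) has_real_derivative F' s x) (at s)"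
    and le: "\<And>s x. a < s \<Longrightarrow> s < b \<Longrightarrow> x \<in> space \<mu> \<Longrightarrow> \<bar>F' s x\<bar> \<le> g x"
    and g: "integrable \<mu> g"
  shows "integrable \<mu> (F' t)"
    and "((\<lambda>s. \<integral>x. F s x \<partial>\<mu>) has_real_derivative (\<integral>x. F' t x \<partial>\<mu>)) (at t)"
proof -
  define J where "J = {h. a < t + h \<and> t + h < b}"
  have oJ: "open J"
  proof -
    have "J = {a - t<..<b - t}" by (auto simp: J_def)
    then show ?thesis by simp
  qed
  have 0: "0 \<in> J" using I by (simp add: J_def)
  have lim: "(\<lambda>n. \<integral>x. (F (t + X n) x - F t x) / X n \<partial>\<mu>) \<longlonglongrightarrow> (\<integral>x. F' t x \<partial>\<mu>) \<and> integrable \<mu> (F' t)"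
    if X: "\<forall>n. X n \<in> J - {0}" "X \<longlonglongrightarrow> 0" for X
  proof -
    have conv: "(\<lambda>n. (F (t + X n) x - F t x) / X n) \<longlonglongrightarrow> F' t x" if "x \<in> space \<mu>" for x
    proof -
      have "((\<lambda>h. (F (t + h) x - F t x) / h) \<longlongrightarrow> F' t x) (at 0)"
        using F'[OF I that] by (simp add: DERIV_def)
      then show ?thesis
        using X unfolding tendsto_at_iff_sequentially o_def by blast
    qed
    have bd: "\<bar>(F (t + X n) x - F t x) / X n\<bar> \<le> g x" if x: "x \<in> space \<mu>" for n x
    proof -
      have h: "a < t + X n" "t + X n < b" "X n \<noteq> 0" using X by (auto simp: J_def)
      have "\<exists>s. a < s \<and> s < b \<and> F (t + X n) x - F t x = X n * F' s x"
      proof (cases "X n > 0")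
        case True
        obtain z where "z > t" "z < t + X n" "F (t + X n) x - F t x = (t + X n - t) * F' z x"
          using MVT2[of t "t + X n" "\<lambda>s. F s x" "\<lambda>s. F' s x"] F'[OF _ _ x] True h I
          by (smt (verit, best))
        then show ?thesis using I h by (intro exI[of _ z]) auto
      next
        case False
        obtain z where "z < t" "z > t + X n" "F t x - F (t + X n) x = (t - (t + X n)) * F' z x"
          using MVT2[of "t + X n" t "\<lambda>s. F s x" "\<lambda>s. F' s x"] F'[OF _ _ x] False h I
          by (smt (verit, best))
        then show ?thesis using I h by (intro exI[of _ z]) (auto simp: algebra_simps)
      qed
      then obtain s where s: "a < s" "s < b" "F (t + X n) x - F t x = X n * F' s x" by blast
      then have "(F (t + X n) x - F t x) / X n = F' s x" using h by simp
      then show ?thesis using le[OF s(1,2) x] by simp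
    qed
    have m: "(\<lambda>x. (F (t + X n) x - F t x) / X n) \<in> borel_measurable \<mu>" for n
      using F[of "t + X n"] F[OF I] X(1) by (auto simp: J_def intro!: borel_measurable_integrable)
    have m': "F' t \<in> borel_measurable \<mu>"
      by (rule borel_measurable_LIMSEQ_real[OF conv m])
    have "integrable \<mu> (F' t)"
      by (rule Bochner_Integration.integrable_bound[OF g m']) (use le[OF I] in \<open>force intro!: AE_I2\<close>)
    then show ?thesis
      using integral_dominated_convergence[OF m' m g] conv bd by auto
  qed
  \<comment> \<open>One explicit admissible sequence is enough to make \<open>F' t\<close>
    integrable. Dividing by at least 2 keeps \<open>t + X n\<close> strictly below
    \<open>b\<close>.\<close>
  have "(\<lambda>n. min (b - t) 1 / real (n + 2)) \<longlonglongrightarrow> 0" "\<forall>n. min (b - t) 1 / real (n + 2) \<in> J - {0}"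
  proof -
    show "(\<lambda>n. min (b - t) 1 / real (n + 2)) \<longlonglongrightarrow> 0"
      by (rule LIMSEQ_ignore_initial_segment, rule lim_const_over_n)
    have "0 < min (b - t) 1 / real (n + 2) \<and> min (b - t) 1 / real (n + 2) < b - t" for n
    proof -
      have "min (b - t) 1 / real (n + 2) < min (b - t) 1 / 1"
        using I by (intro divide_strict_left_mono) auto
      then show ?thesis using I by auto
    qed
    then show "\<forall>n. min (b - t) 1 / real (n + 2) \<in> J - {0}"
      unfolding J_def using I by (smt (verit, best) DiffI mem_Collect_eq singletonD)
  qed
  from lim[OF this(2,1)] show int: "integrable \<mu> (F' t)" by blast
  have "((\<lambda>h. ((\<integral>x. F (t + h) x \<partial>\<mu>) - (\<integral>x. F t x \<partial>\<mu>)) / h) \<longlongrightarrow> (\<integral>x. F' t x \<partial>\<mu>)) (at 0 within J)"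
    unfolding tendsto_at_iff_sequentially o_def
  proof (intro allI impI)
    fix X assume X: "\<forall>n. X n \<in> J - {0}" "X \<longlonglongrightarrow> 0"
    have eq: "((\<integral>x. F (t + X n) x \<partial>\<mu>) - (\<integral>x. F t x \<partial>\<mu>)) / X n = (\<integral>x. (F (t + X n) x - F t x) / X n \<partial>\<mu>)" for n
    proof -
      have "integrable \<mu> (F (t + X n))" "integrable \<mu> (F t)"
        using F[of "t + X n"] F[OF I] X(1) by (auto simp: J_def)
      then show ?thesis by simp
    qed
    then show "(\<lambda>n. ((\<integral>x. F (t + X n) x \<partial>\<mu>) - (\<integral>x. F t x \<partial>\<mu>)) / X n) \<longlonglongrightarrow> (\<integral>x. F' t x \<partial>\<mu>)"
      unfolding eq using lim[OF X] by blast
  qed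
  then show "((\<lambda>s. \<integral>x. F s x \<partial>\<mu>) has_real_derivative (\<integral>x. F' t x \<partial>\<mu>)) (at t)"
    using at_within_open[OF 0 oJ] by (simp add: DERIV_def)
qed

text \<open>\<open>G u y\<close> is \<open>k\<close> times differentiable in \<open>u\<close>, with derivatives continuous in \<open>(u, y)\<close> jointly.\<close>
fun Ck_param :: "nat \<Rightarrow> 'c::euclidean_space set \<Rightarrow> ('c \<Rightarrow> 'a::topological_space \<Rightarrow> real) \<Rightarrow> bool" where
  "Ck_param 0 S G \<longleftrightarrow> continuous_on (S \<times> UNIV) (\<lambda>z. G (fst z) (snd z))"
| "Ck_param (Suc k) S G \<longleftrightarrow> continuous_on (S \<times> UNIV) (\<lambda>z. G (fst z) (snd z)) \<and>
     (\<forall>u\<in>S. \<forall>y. (\<lambda>u. G u y) differentiable (at u)) \<and>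
     (\<forall>v. Ck_param k S (\<lambda>u y. frechet_derivative (\<lambda>u. G u y) (at u) v))"

lemma Ck_param_continuous: "Ck_param k S G \<Longrightarrow> continuous_on (S \<times> UNIV) (\<lambda>z. G (fst z) (snd z))"
  by (cases k) auto

text \<open>A tube lemma: joint continuity gives each \<open>y\<close> a product neighbourhood of
  \<open>(u0, y)\<close> on which \<open>G\<close> varies little, and finitely many of them cover
  \<open>K\<close>. The second variable ranges over a bare topological space, hence a cover instead
  of uniform continuity in a metric.\<close>

lemma continuous_param_uniform:
  fixes G :: "'c::metric_space \<Rightarrow> 'a::topological_space \<Rightarrow> real"
  assumes S: "open S" "u0 \<in> S" and G: "continuous_on (S \<times> UNIV) (\<lambda>z. G (fst z) (snd z))"
    and K: "compact K" and e: "e > 0"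
  shows "\<exists>d>0. ball u0 d \<subseteq> S \<and> (\<forall>u\<in>ball u0 d. \<forall>y\<in>K. \<bar>G u y - G u0 y\<bar> < e)"
proof -
  have loc: "\<exists>V d. open V \<and> y \<in> V \<and> d > 0 \<and> ball u0 d \<subseteq> S \<and> (\<forall>u\<in>ball u0 d. \<forall>y'\<in>V. \<bar>G u y' - G u0 y\<bar> < e / 2)" for y
  proof -
    have "open ((\<lambda>z. G (fst z) (snd z)) -` ball (G u0 y) (e/2) \<inter> (S \<times> UNIV))"
      using continuous_on_open_vimage[of "S \<times> UNIV" "\<lambda>z. G (fst z) (snd z)"] G S
      by (auto simp: open_Times)
    moreover have "(u0, y) \<in> (\<lambda>z. G (fst z) (snd z)) -` ball (G u0 y) (e/2) \<inter> (S \<times> UNIV)"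
      using S e by auto
    ultimately obtain U V where UV: "open U" "open V" "u0 \<in> U" "y \<in> V"
      "U \<times> V \<subseteq> (\<lambda>z. G (fst z) (snd z)) -` ball (G u0 y) (e/2) \<inter> (S \<times> UNIV)"
      by (rule open_prod_elim) auto
    obtain d where d: "d > 0" "ball u0 d \<subseteq> U" using UV openE by blast
    have "\<bar>G u y' - G u0 y\<bar> < e / 2" if "u \<in> ball u0 d" "y' \<in> V" for u y'
    proof -
      have "(u, y') \<in> (\<lambda>z. G (fst z) (snd z)) -` ball (G u0 y) (e/2)" using that d UV by blast
      then show ?thesis by (simp add: dist_real_def abs_minus_commute)
    qed
    moreover have "ball u0 d \<subseteq> S" using d UV by blast
    ultimately show ?thesis using UV d by blast
  qed
  then obtain V d where V: "\<And>y. open (V y)" "\<And>y. y \<in> V y" "\<And>y. d y > 0" "\<And>y. ball u0 (d y) \<subseteq> S"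
    "\<And>y u y'. u \<in> ball u0 (d y) \<Longrightarrow> y' \<in> V y \<Longrightarrow> \<bar>G u y' - G u0 y\<bar> < e / 2"
    by metis
  obtain T where T: "T \<subseteq> K" "finite T" "K \<subseteq> (\<Union>y\<in>T. V y)"
    by (rule compactE_image[OF K, of K V]) (use V in auto)
  obtain d0 where d0: "d0 > 0" "ball u0 d0 \<subseteq> S" using S openE by blast
  define d' where "d' = Min (insert d0 (d ` T))"
  have d': "d' > 0" "d' \<le> d0" "\<And>y. y \<in> T \<Longrightarrow> d' \<le> d y" using T V(3) d0 by (auto simp: d'_def)
  have "\<bar>G u y - G u0 y\<bar> < e" if u: "u \<in> ball u0 d'" and y: "y \<in> K" for u y
  proof -
    obtain y0 where y0: "y0 \<in> T" "y \<in> V y0" using T y by blast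
    have "\<bar>G u y - G u0 y0\<bar> < e / 2" "\<bar>G u0 y - G u0 y0\<bar> < e / 2"
      using V(5)[of u y0 y] V(5)[of u0 y0 y] V(3)[of y0] u y0 d'(3)[OF y0(1)] by auto
    then show ?thesis by linarith
  qed
  then show ?thesis using d' d0 by (intro exI[of _ d']) auto
qed

section \<open>Integrals against a fixed integrable function of compact support\<close>

context
  fixes \<mu> :: "'a::topological_space measure" and f :: "'a \<Rightarrow> real" and K :: "'a set"
  assumes sets_borel: "sets \<mu> = sets borel"
    and int_f: "integrable \<mu> f" and K: "compact K" and supp: "\<And>y. y \<notin> K \<Longrightarrow> f y = 0"
begin

lemma integrable_continuous_mult:
  assumes "continuous_on UNIV g" shows "integrable \<mu> (\<lambda>y. g y * f y)"
proof -
  have "bounded (g ` K)"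
    using K assms by (meson compact_continuous_image compact_imp_bounded continuous_on_subset subset_UNIV)
  then obtain C where C: "\<And>y. y \<in> K \<Longrightarrow> \<bar>g y\<bar> \<le> C" by (auto simp: bounded_iff)
  have [measurable]: "g \<in> borel_measurable \<mu>"
    using borel_measurable_continuous_onI[OF assms] measurable_cong_sets[OF sets_borel refl] by blast
  have [measurable]: "f \<in> borel_measurable \<mu>" using int_f by auto
  have "norm (g y * f y) \<le> norm (C * f y)" for y
  proof (cases "y \<in> K")
    case True
    then have "\<bar>g y\<bar> \<le> \<bar>C\<bar>" using C[OF True] by linarith
    then show ?thesis by (simp add: abs_mult mult_right_mono)
  qed (simp add: supp)
  then have "AE y in \<mu>. norm (g y * f y) \<le> norm (C * f y)" by (rule AE_I2)
  moreover have "integrable \<mu> (\<lambda>y. C * f y)" using int_f by simp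
  moreover have "(\<lambda>y. g y * f y) \<in> borel_measurable \<mu>" by measurable
  ultimately show ?thesis using Bochner_Integration.integrable_bound by blast
qed

lemma integral_mult_bound:
  assumes "continuous_on UNIV g" "\<And>y. y \<in> K \<Longrightarrow> \<bar>g y\<bar> \<le> C"
  shows "\<bar>\<integral>y. g y * f y \<partial>\<mu>\<bar> \<le> C * (\<integral>y. \<bar>f y\<bar> \<partial>\<mu>)"
proof -
  have "\<bar>\<integral>y. g y * f y \<partial>\<mu>\<bar> \<le> (\<integral>y. C * \<bar>f y\<bar> \<partial>\<mu>)"
  proof -
    have "\<bar>\<integral>y. g y * f y \<partial>\<mu>\<bar> \<le> (\<integral>y. \<bar>g y * f y\<bar> \<partial>\<mu>)"
      using integral_norm_bound[of \<mu> "\<lambda>y. g y * f y"] by simp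
    also have "\<dots> \<le> (\<integral>y. C * \<bar>f y\<bar> \<partial>\<mu>)"
    proof (rule integral_mono)
      show "integrable \<mu> (\<lambda>y. \<bar>g y * f y\<bar>)" using integrable_continuous_mult[OF assms(1)] by (rule integrable_abs)
      show "integrable \<mu> (\<lambda>y. C * \<bar>f y\<bar>)" using int_f by simp
      show "\<bar>g y * f y\<bar> \<le> C * \<bar>f y\<bar>" for y
        using assms(2)[of y] supp[of y] by (cases "y \<in> K") (simp_all add: abs_mult mult_right_mono)
    qed
    finally show ?thesis .
  qed
  then show ?thesis by simp
qed

lemma continuous_on_slice:
  assumes "continuous_on (S \<times> UNIV) (\<lambda>z. G (fst z) (snd z))" "u \<in> S"
  shows "continuous_on UNIV (G u)"
proof -
  have "continuous_on UNIV ((\<lambda>z. G (fst z) (snd z)) \<circ> (\<lambda>y. (u, y)))"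
    by (intro continuous_on_compose continuous_intros continuous_on_subset[OF assms(1)]) (use assms(2) in auto)
  then show ?thesis by (simp add: o_def)
qed

text \<open>In the application \<open>G\<close> is the heat kernel read in a chart and
  \<open>f\<close> a test function. As \<open>f\<close> lives on the compact set \<open>K\<close>,
  closeness of \<open>G u\<close> and \<open>G u0\<close> on \<open>K\<close> is enough, and no
  global majorant of the kernel or of its derivatives is required.\<close>

lemma continuous_on_integral_param:
  fixes G :: "'c::metric_space \<Rightarrow> 'a \<Rightarrow> real"
  assumes S: "open S" and G: "continuous_on (S \<times> UNIV) (\<lambda>z. G (fst z) (snd z))"
  shows "continuous_on S (\<lambda>u. \<integral>y. G u y * f y \<partial>\<mu>)"
proof (intro continuous_at_imp_continuous_on ballI)
  fix u0 assume u0: "u0 \<in> S"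
  define J where "J = (\<integral>y. \<bar>f y\<bar> \<partial>\<mu>)"
  have I: "J \<ge> 0" by (simp add: J_def)
  show "isCont (\<lambda>u. \<integral>y. G u y * f y \<partial>\<mu>) u0"
    unfolding continuous_at_eps_delta
  proof (intro allI impI)
    fix e :: real assume e: "e > 0"
    define e' where "e' = e / (J + 1)"
    have e': "e' > 0" using e I by (simp add: e'_def)
    obtain d where d: "d > 0" "ball u0 d \<subseteq> S" "\<And>u y. u \<in> ball u0 d \<Longrightarrow> y \<in> K \<Longrightarrow> \<bar>G u y - G u0 y\<bar> < e'"
      using continuous_param_uniform[OF S u0 G K e'] by blast
    have "dist (\<integral>y. G u y * f y \<partial>\<mu>) (\<integral>y. G u0 y * f y \<partial>\<mu>) < e" if "dist u u0 < d" for u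
    proof -
      have u: "u \<in> ball u0 d" "u \<in> S" using that d by (auto simp: dist_commute)
      have c: "continuous_on UNIV (G u)" "continuous_on UNIV (G u0)"
        using continuous_on_slice[OF G] u u0 by auto
      have "(\<integral>y. G u y * f y \<partial>\<mu>) - (\<integral>y. G u0 y * f y \<partial>\<mu>) = (\<integral>y. (G u y - G u0 y) * f y \<partial>\<mu>)"
        using integrable_continuous_mult[OF c(1)] integrable_continuous_mult[OF c(2)]
        by (simp add: left_diff_distrib)
      also have "\<bar>\<dots>\<bar> \<le> e' * J"
        unfolding J_def by (rule integral_mult_bound) (use c d(3)[OF u(1)] in \<open>auto intro!: continuous_intros less_imp_le\<close>)
      also have "\<dots> < e' * (J + 1)" using e' by simp
      also have "\<dots> = e" using I by (simp add: e'_def)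
      finally show ?thesis by (simp add: dist_real_def)
    qed
    then show "\<exists>d>0. \<forall>u. dist u u0 < d \<longrightarrow> dist (\<integral>y. G u y * f y \<partial>\<mu>) (\<integral>y. G u0 y * f y \<partial>\<mu>) < e"
      using d(1) by blast
  qed
qed

text \<open>By the mean value theorem on the segment from \<open>u0\<close> to \<open>u\<close>, the
  first-order remainder is a difference of derivatives at two nearby points. Expanding
  \<open>u - u0\<close> in the basis reduces its smallness, uniformly over \<open>K\<close>, to that
  of finitely many partial derivatives.\<close>

lemma has_derivative_integral_param:
  fixes G :: "'c::euclidean_space \<Rightarrow> 'a \<Rightarrow> real"
  assumes S: "open S" and G: "Ck_param (Suc 0) S G" and u0: "u0 \<in> S"
  shows "((\<lambda>u. \<integral>y. G u y * f y \<partial>\<mu>) has_derivative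
     (\<lambda>v. \<integral>y. frechet_derivative (\<lambda>u. G u y) (at u0) v * f y \<partial>\<mu>)) (at u0)"
proof -
  let ?D = "\<lambda>u y v. frechet_derivative (\<lambda>u. G u y) (at u) v"
  define J where "J = (\<integral>y. \<bar>f y\<bar> \<partial>\<mu>)"
  have I: "J \<ge> 0" by (simp add: J_def)
  have diff: "\<And>u y. u \<in> S \<Longrightarrow> (\<lambda>u. G u y) differentiable at u" using G by simp
  have lin: "\<And>u y. u \<in> S \<Longrightarrow> linear (?D u y)" using diff linear_frechet_derivative by blast
  have contG: "continuous_on (S \<times> UNIV) (\<lambda>z. G (fst z) (snd z))" using G by simp
  have contD: "\<And>v. continuous_on (S \<times> UNIV) (\<lambda>z. ?D (fst z) (snd z) v)" using G by simp
  have cD: "\<And>u v. u \<in> S \<Longrightarrow> continuous_on UNIV (\<lambda>y. ?D u y v)"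
    using continuous_on_slice[of S "\<lambda>u y. ?D u y _", OF contD] by blast
  have iD: "\<And>u v. u \<in> S \<Longrightarrow> integrable \<mu> (\<lambda>y. ?D u y v * f y)"
    using cD integrable_continuous_mult by blast
  have iG: "\<And>u. u \<in> S \<Longrightarrow> integrable \<mu> (\<lambda>y. G u y * f y)"
    using continuous_on_slice[OF contG] integrable_continuous_mult by blast
  have "linear (\<lambda>v. \<integral>y. ?D u0 y v * f y \<partial>\<mu>)"
  proof (rule linearI)
    fix v w show "(\<integral>y. ?D u0 y (v + w) * f y \<partial>\<mu>) = (\<integral>y. ?D u0 y v * f y \<partial>\<mu>) + (\<integral>y. ?D u0 y w * f y \<partial>\<mu>)"
      using iD[OF u0] by (simp add: linear_add[OF lin[OF u0]] distrib_right)
  next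
    fix r v show "(\<integral>y. ?D u0 y (r *\<^sub>R v) * f y \<partial>\<mu>) = r *\<^sub>R (\<integral>y. ?D u0 y v * f y \<partial>\<mu>)"
      by (simp add: linear_scale[OF lin[OF u0]] mult.assoc)
  qed
  then have bl: "bounded_linear (\<lambda>v. \<integral>y. ?D u0 y v * f y \<partial>\<mu>)"
    by (simp add: linear_conv_bounded_linear)
  show ?thesis
    unfolding has_derivative_at_alt
  proof (intro conjI bl allI impI)
    fix e :: real assume e: "e > 0"
    define n where "n = real DIM('c)"
    have n: "n > 0" by (simp add: n_def)
    \<comment> \<open>The basis expansion costs a factor \<open>n\<close> and the integration
      against \<open>f\<close> a factor \<open>J\<close>; the added 1 avoids a division by zero when
      \<open>f\<close> vanishes.\<close>
    define e' where "e' = e / (n * (J + 1))"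
    have e': "e' > 0" using e I n by (simp add: e'_def)
    have "\<exists>d>0. ball u0 d \<subseteq> S \<and> (\<forall>u\<in>ball u0 d. \<forall>y\<in>K. \<bar>?D u y i - ?D u0 y i\<bar> < e')" for i
      using continuous_param_uniform[OF S u0 contD K e'] by blast
    then obtain d where d: "\<And>i. d i > 0" "\<And>i. ball u0 (d i) \<subseteq> S"
      "\<And>i u y. u \<in> ball u0 (d i) \<Longrightarrow> y \<in> K \<Longrightarrow> \<bar>?D u y i - ?D u0 y i\<bar> < e'" by metis
    define d0 where "d0 = Min (d ` (Basis::'c set))"
    have d0: "d0 > 0" "\<And>i. i \<in> Basis \<Longrightarrow> d0 \<le> d i" using d(1) by (auto simp: d0_def)
    have ballS: "ball u0 d0 \<subseteq> S"
      using d(2) d0(2) by (metis SOME_Basis order_trans subset_ball)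
    have est: "\<bar>G u y - G u0 y - ?D u0 y (u - u0)\<bar> \<le> n * e' * norm (u - u0)" if u: "u \<in> ball u0 d0" and y: "y \<in> K" for u y
    proof -
      have seg: "u0 + s *\<^sub>R (u - u0) \<in> ball u0 d0" if "0 \<le> s" "s \<le> 1" for s
      proof -
        have "dist u0 (u0 + s *\<^sub>R (u - u0)) = s * norm (u - u0)" using that by (simp add: dist_norm)
        also have "\<dots> \<le> 1 * norm (u - u0)" using that by (intro mult_right_mono) auto
        also have "\<dots> < d0" using u by (simp add: dist_norm norm_minus_commute)
        finally show ?thesis by simp
      qed
      have der: "((\<lambda>s. G (u0 + s *\<^sub>R (u - u0)) y) has_real_derivative ?D (u0 + s *\<^sub>R (u - u0)) y (u - u0)) (at s)"
        if "0 \<le> s" "s \<le> 1" for s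
        by (rule DERIV_along_line[where f="\<lambda>u. G u y"]) (use diff seg[OF that] ballS in blast)
      obtain s where s: "0 < s" "s < 1" "G (u0 + 1 *\<^sub>R (u - u0)) y - G (u0 + 0 *\<^sub>R (u - u0)) y
          = (1 - 0) * ?D (u0 + s *\<^sub>R (u - u0)) y (u - u0)"
        using MVT2[of 0 1 "\<lambda>s. G (u0 + s *\<^sub>R (u - u0)) y" "\<lambda>s. ?D (u0 + s *\<^sub>R (u - u0)) y (u - u0)", OF _ der]
        by auto
      define \<xi> where "\<xi> = u0 + s *\<^sub>R (u - u0)"
      have \<xi>: "\<xi> \<in> ball u0 d0" "\<xi> \<in> S" using seg[of s] s ballS by (auto simp: \<xi>_def)
      have expand: "?D z y w = (\<Sum>i\<in>Basis. (w \<bullet> i) * ?D z y i)" if "z \<in> S" for z w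
      proof -
        have "?D z y w = ?D z y (\<Sum>i\<in>Basis. (w \<bullet> i) *\<^sub>R i)" by (simp add: euclidean_representation)
        also have "\<dots> = (\<Sum>i\<in>Basis. (w \<bullet> i) * ?D z y i)"
          by (simp add: linear_sum[OF lin[OF that]] linear_scale[OF lin[OF that]])
        finally show ?thesis .
      qed
      have "G u y - G u0 y - ?D u0 y (u - u0) = ?D \<xi> y (u - u0) - ?D u0 y (u - u0)"
        using s(3) by (simp add: \<xi>_def)
      also have "\<dots> = (\<Sum>i\<in>Basis. ((u - u0) \<bullet> i) * ?D \<xi> y i) - (\<Sum>i\<in>Basis. ((u - u0) \<bullet> i) * ?D u0 y i)"
        by (rule arg_cong2[where f=minus, OF expand[OF \<xi>(2)] expand[OF u0]])
      also have "\<dots> = (\<Sum>i\<in>Basis. ((u - u0) \<bullet> i) * (?D \<xi> y i - ?D u0 y i))"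
        by (simp only: right_diff_distrib sum_subtractf)
      also have "\<bar>\<dots>\<bar> \<le> (\<Sum>i\<in>(Basis::'c set). norm (u - u0) * e')"
      proof (rule order_trans[OF sum_abs], rule sum_mono)
        fix i :: 'c assume i: "i \<in> Basis"
        have "\<bar>?D \<xi> y i - ?D u0 y i\<bar> \<le> e'"
          using d(3)[of \<xi> i y] \<xi>(1) d0(2)[OF i] y by auto
        then show "\<bar>((u - u0) \<bullet> i) * (?D \<xi> y i - ?D u0 y i)\<bar> \<le> norm (u - u0) * e'"
          using Basis_le_norm[OF i, of "u - u0"] by (simp add: abs_mult mult_mono)
      qed
      also have "\<dots> = n * e' * norm (u - u0)" by (simp add: n_def)
      finally show ?thesis .
    qed
    have "norm ((\<integral>y. G u y * f y \<partial>\<mu>) - (\<integral>y. G u0 y * f y \<partial>\<mu>) - (\<integral>y. ?D u0 y (u - u0) * f y \<partial>\<mu>)) \<le> e * norm (u - u0)"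
      if "norm (u - u0) < d0" for u
    proof -
      have u: "u \<in> ball u0 d0" "u \<in> S" using that ballS by (auto simp: dist_norm norm_minus_commute)
      have "(\<integral>y. G u y * f y \<partial>\<mu>) - (\<integral>y. G u0 y * f y \<partial>\<mu>) - (\<integral>y. ?D u0 y (u - u0) * f y \<partial>\<mu>)
         = (\<integral>y. (G u y - G u0 y - ?D u0 y (u - u0)) * f y \<partial>\<mu>)"
        using iG[OF u(2)] iG[OF u0] iD[OF u0] by (simp add: left_diff_distrib)
      also have "\<bar>\<dots>\<bar> \<le> n * e' * norm (u - u0) * J"
        unfolding J_def
      proof (rule integral_mult_bound)
        show "continuous_on UNIV (\<lambda>y. G u y - G u0 y - ?D u0 y (u - u0))"
          by (intro continuous_on_diff continuous_on_slice[OF contG] cD u u0)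
      qed (rule est[OF u(1)])
      also have "\<dots> \<le> n * e' * norm (u - u0) * (J + 1)"
        using n e' by (intro mult_left_mono) auto
      also have "\<dots> = e * norm (u - u0)"
        using n I by (simp add: e'_def divide_simps)
      finally show ?thesis by simp
    qed
    then show "\<exists>d>0. \<forall>u. norm (u - u0) < d \<longrightarrow> norm ((\<integral>y. G u y * f y \<partial>\<mu>) - (\<integral>y. G u0 y * f y \<partial>\<mu>)
      - (\<integral>y. ?D u0 y (u - u0) * f y \<partial>\<mu>)) \<le> e * norm (u - u0)"
      using d0(1) by blast
  qed
qed

text \<open>Each derivative is an integral of the same kind with a partial derivative of
  \<open>G\<close> in place of \<open>G\<close>, so the induction generalises over
  \<open>G\<close>.\<close>

lemma Ck_on_integral_param:
  fixes G :: "'c::euclidean_space \<Rightarrow> 'a \<Rightarrow> real"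
  assumes S: "open S" and "Ck_param k S G"
  shows "Ck_on k S (\<lambda>u. \<integral>y. G u y * f y \<partial>\<mu>)"
  using assms(2)
proof (induction k arbitrary: G)
  case 0
  then show ?case using continuous_on_integral_param[OF S, of G] by simp
next
  case (Suc k)
  have "Ck_param (Suc 0) S G" using Suc.prems by (auto dest: Ck_param_continuous)
  then have der: "((\<lambda>u. \<integral>y. G u y * f y \<partial>\<mu>) has_derivative
     (\<lambda>v. \<integral>y. frechet_derivative (\<lambda>u. G u y) (at u0) v * f y \<partial>\<mu>)) (at u0)" if "u0 \<in> S" for u0
    using has_derivative_integral_param[OF S _ that] by blast
  have eq: "frechet_derivative (\<lambda>u. \<integral>y. G u y * f y \<partial>\<mu>) (at u0) v
     = (\<integral>y. frechet_derivative (\<lambda>u. G u y) (at u0) v * f y \<partial>\<mu>)" if "u0 \<in> S" for u0 v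
    by (rule fun_cong[OF frechet_derivative_at[OF der[OF that], symmetric]])
  have "Ck_on k S (\<lambda>u0. frechet_derivative (\<lambda>u. \<integral>y. G u y * f y \<partial>\<mu>) (at u0) v)" for v
  proof (rule Ck_on_cong[OF S])
    show "Ck_on k S (\<lambda>u0. \<integral>y. frechet_derivative (\<lambda>u. G u y) (at u0) v * f y \<partial>\<mu>)"
      by (rule Suc.IH) (use Suc.prems in auto)
  qed (use eq in auto)
  moreover have "(\<lambda>u. \<integral>y. G u y * f y \<partial>\<mu>) differentiable at u0" if "u0 \<in> S" for u0
    using der[OF that] differentiable_def by blast
  ultimately show ?case by simp
qed

end

section \<open>Diffusion operators\<close>

lemma frechet_derivative_mult2:
  fixes f g :: "'b::euclidean_space \<Rightarrow> real"
  assumes "open V" "smooth_on V f" "smooth_on V g" "u \<in> V"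
  shows "pd i (pd j (\<lambda>u. f u * g u)) u
    = f u * pd i (pd j g) u + pd i f u * pd j g u + pd j f u * pd i g u + pd i (pd j f) u * g u"
proof -
  have d: "\<And>h u. smooth_on V h \<Longrightarrow> u \<in> V \<Longrightarrow> h differentiable at u"
    using smooth_on_imp_differentiable by blast
  have s: "smooth_on V (\<lambda>u. f u * pd j g u)" "smooth_on V (\<lambda>u. pd j f u * g u)"
    using assms by (auto intro!: smooth_on_mult smooth_on_frechet_derivative)
  have eq: "\<And>u. u \<in> V \<Longrightarrow> f u * pd j g u + pd j f u * g u = pd j (\<lambda>u. f u * g u) u"
    using frechet_derivative_mult_real[OF d[OF assms(2)] d[OF assms(3)]] by simp
  have "pd i (pd j (\<lambda>u. f u * g u)) u = pd i (\<lambda>u. f u * pd j g u + pd j f u * g u) u"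
    by (rule fun_cong[OF frechet_derivative_cong_open(2)[OF assms(1,4) eq]])
       (auto intro!: d assms smooth_on_add s)
  also have "\<dots> = pd i (\<lambda>u. f u * pd j g u) u + pd i (\<lambda>u. pd j f u * g u) u"
    by (rule frechet_derivative_add) (auto intro!: d s assms)
  also have "pd i (\<lambda>u. f u * pd j g u) u = f u * pd i (pd j g) u + pd i f u * pd j g u"
    by (rule frechet_derivative_mult_real) (auto intro!: d assms smooth_on_frechet_derivative)
  also have "pd i (\<lambda>u. pd j f u * g u) u = pd j f u * pd i g u + pd i (pd j f) u * g u"
    by (rule frechet_derivative_mult_real) (auto intro!: d assms smooth_on_frechet_derivative)
  finally show ?thesis by simp
qed

lemma frechet_derivative_add2:
  fixes f g :: "'b::euclidean_space \<Rightarrow> real"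
  assumes "open V" "smooth_on V f" "smooth_on V g" "u \<in> V"
  shows "pd i (pd j (\<lambda>u. f u + g u)) u = pd i (pd j f) u + pd i (pd j g) u"
proof -
  have d: "\<And>h u. smooth_on V h \<Longrightarrow> u \<in> V \<Longrightarrow> h differentiable at u"
    using smooth_on_imp_differentiable by blast
  have eq: "\<And>u. u \<in> V \<Longrightarrow> pd j f u + pd j g u = pd j (\<lambda>u. f u + g u) u"
    using frechet_derivative_add[OF d[OF assms(2)] d[OF assms(3)]] by simp
  have "pd i (pd j (\<lambda>u. f u + g u)) u = pd i (\<lambda>u. pd j f u + pd j g u) u"
    by (rule fun_cong[OF frechet_derivative_cong_open(2)[OF assms(1,4) eq]])
       (auto intro!: d assms smooth_on_add smooth_on_frechet_derivative)
  also have "\<dots> = pd i (pd j f) u + pd i (pd j g) u"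
    by (rule frechet_derivative_add) (auto intro!: d smooth_on_frechet_derivative assms)
  finally show ?thesis .
qed

lemma frechet_derivative_compose2:
  fixes f :: "'b::euclidean_space \<Rightarrow> real"
  assumes "open V" "smooth_on V f" "u \<in> V"
    and F: "\<And>u. u \<in> V \<Longrightarrow> (F has_real_derivative F1 (f u)) (at (f u))"
    and F1: "\<And>u. u \<in> V \<Longrightarrow> (F1 has_real_derivative F2 (f u)) (at (f u))"
  shows "pd i (pd j (\<lambda>u. F (f u))) u
    = F1 (f u) * pd i (pd j f) u + F2 (f u) * (pd i f u * pd j f u)"
proof -
  have d: "\<And>h u. smooth_on V h \<Longrightarrow> u \<in> V \<Longrightarrow> h differentiable at u"
    using smooth_on_imp_differentiable by blast
  have df: "\<And>u. u \<in> V \<Longrightarrow> f differentiable at u" using d assms by blast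
  have dj: "pd j f differentiable at u" using d assms smooth_on_frechet_derivative by blast
  have eq: "\<And>u. u \<in> V \<Longrightarrow> F1 (f u) * pd j f u = pd j (\<lambda>u. F (f u)) u"
    using frechet_derivative_compose_real(2)[OF F df] by simp
  have d1: "(\<lambda>u. F1 (f u)) differentiable at u"
    using frechet_derivative_compose_real(1)[OF F1 df] assms by blast
  have "pd i (pd j (\<lambda>u. F (f u))) u = pd i (\<lambda>u. F1 (f u) * pd j f u) u"
    by (rule fun_cong[OF frechet_derivative_cong_open(2)[OF assms(1,3) eq differentiable_mult[OF d1 dj]]])
  also have "\<dots> = F1 (f u) * pd i (pd j f) u + pd i (\<lambda>u. F1 (f u)) u * pd j f u"
    by (rule frechet_derivative_mult_real[OF d1 dj])
  also have "pd i (\<lambda>u. F1 (f u)) u = F2 (f u) * pd i f u"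
    by (rule frechet_derivative_compose_real(2)[OF F1 df]) (use assms in auto)
  finally show ?thesis by simp
qed

locale diffusion =
  fixes A :: "('a::{t2_space, second_countable_topology}, 'b::euclidean_space) chart set"
    and \<mu> :: "'a measure"
    and L :: "('a \<Rightarrow> real) \<Rightarrow> 'a \<Rightarrow> real"
  assumes atlas: "smooth_atlas A"
    and smooth_\<mu>: "smooth_measure A \<mu>"
    and diffusion_L: "diffusion_operator A L"
    and L_1: "L (\<lambda>_. 1) = (\<lambda>_. 0)"
begin

abbreviation "C \<equiv> Csmooth A"
abbreviation "T \<equiv> Ctest A"
abbreviation "\<Gamma> \<equiv> cdc L"

section \<open>Charts and the algebra of smooth functions\<close>

lemma obtain_chart:
  obtains c where "c \<in> A" "x \<in> fst c"
  using atlas unfolding smooth_atlas_def by blast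

lemma chart:
  assumes "c \<in> A"
  shows open_chart_domain: "open (fst c)" and open_chart_image: "open (snd c ` fst c)"
    and continuous_chart: "continuous_on (fst c) (snd c)"
    and continuous_chart_inv: "continuous_on (snd c ` fst c) (inv_into (fst c) (snd c))"
    and chart_inv: "\<And>x. x \<in> fst c \<Longrightarrow> inv_into (fst c) (snd c) (snd c x) = x"
    and chart_inv_mem: "\<And>u. u \<in> snd c ` fst c \<Longrightarrow> inv_into (fst c) (snd c) u \<in> fst c"
    and chart_of_inv: "\<And>u. u \<in> snd c ` fst c \<Longrightarrow> snd c (inv_into (fst c) (snd c) u) = u"
  using atlas assms unfolding smooth_atlas_def is_chart_def homeomorphism_def
  by (auto simp: inv_into_into f_inv_into_f)

lemma in_chart_apply: "c \<in> A \<Longrightarrow> x \<in> fst c \<Longrightarrow> in_chart c f (snd c x) = f x"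
  by (simp add: in_chart_def chart_inv)

lemma Csmooth_in_chart: "f \<in> C \<Longrightarrow> c \<in> A \<Longrightarrow> smooth_on (snd c ` fst c) (in_chart c f)"
  by (simp add: Csmooth_def)

lemma CsmoothI: "(\<And>c. c \<in> A \<Longrightarrow> smooth_on (snd c ` fst c) (in_chart c f)) \<Longrightarrow> f \<in> C"
  by (simp add: Csmooth_def)

lemma Csmooth_continuous:
  assumes "f \<in> C" shows "continuous_on UNIV f"
proof -
  have "isCont f x" for x
  proof -
    obtain c where c: "c \<in> A" "x \<in> fst c" by (rule obtain_chart)
    have "continuous_on (fst c) (in_chart c f \<circ> snd c)"
      by (intro continuous_on_compose continuous_chart[OF c(1)]
          smooth_on_imp_continuous_on Csmooth_in_chart assms c(1))
    then have "continuous_on (fst c) f"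
      by (rule continuous_on_eq) (simp add: in_chart_apply c(1))
    then show ?thesis using c open_chart_domain continuous_on_eq_continuous_at by blast
  qed
  then show ?thesis by (simp add: continuous_on_eq_continuous_at)
qed

lemma Csmooth_const [simp]: "(\<lambda>_. q) \<in> C"
  by (rule CsmoothI) (simp add: in_chart_def o_def)

lemma Csmooth_add: "f \<in> C \<Longrightarrow> g \<in> C \<Longrightarrow> (\<lambda>x. f x + g x) \<in> C"
  unfolding Csmooth_def in_chart_def o_def by (simp add: smooth_on_add open_chart_image)

lemma Csmooth_mult: "f \<in> C \<Longrightarrow> g \<in> C \<Longrightarrow> (\<lambda>x. f x * g x) \<in> C"
  unfolding Csmooth_def in_chart_def o_def by (simp add: smooth_on_mult open_chart_image)

lemma Csmooth_cmult: "f \<in> C \<Longrightarrow> (\<lambda>x. q * f x) \<in> C"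
  by (rule Csmooth_mult) auto

lemma Csmooth_diff: "f \<in> C \<Longrightarrow> g \<in> C \<Longrightarrow> (\<lambda>x. f x - g x) \<in> C"
  using Csmooth_add[of f "\<lambda>x. -1 * g x"] Csmooth_cmult[of g "-1"] by simp

lemma Csmooth_compose:
  fixes F :: "nat \<Rightarrow> real \<Rightarrow> real"
  assumes "f \<in> C" and F: "\<And>n x. (F n has_real_derivative F (Suc n) (f x)) (at (f x))"
  shows "(\<lambda>x. F n (f x)) \<in> C"
proof (rule CsmoothI)
  fix c assume c: "c \<in> A"
  have "smooth_on (snd c ` fst c) (\<lambda>u. F n (in_chart c f u))"
    using smooth_on_compose_real[OF open_chart_image[OF c] Csmooth_in_chart[OF assms(1) c], of F n] F
    by (simp add: in_chart_def)
  then show "smooth_on (snd c ` fst c) (in_chart c (\<lambda>x. F n (f x)))"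
    by (simp add: in_chart_def o_def)
qed

lemma Csmooth_ln:
  assumes f: "f \<in> C" and pos: "\<And>x. f x > 0"
  shows "(\<lambda>x. ln (f x)) \<in> C"
proof -
  \<comment> \<open>For \<open>n > 0\<close> this is the formula for the n-th derivative of
    \<open>ln\<close>, with factorials and alternating signs.\<close>
  define F where "F n = (\<lambda>y::real. if n = 0 then ln y else (-1) ^ (n - 1) * fact (n - 1) * inverse y ^ n)" for n
  have "(F n has_real_derivative F (Suc n) y) (at y)" if "y > 0" for y n
  proof (cases n)
    case 0
    then show ?thesis using that unfolding F_def by (auto intro!: derivative_eq_intros simp: inverse_eq_divide)
  next
    case (Suc m)
    have "((\<lambda>y. (-1) ^ m * fact m * inverse y ^ Suc m) has_real_derivative
       (-1) ^ m * fact m * (real (Suc m) * (- (inverse y ^ Suc (Suc 0)) * inverse y ^ (Suc m - Suc 0)))) (at y)"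
      by (rule DERIV_cmult, rule DERIV_power, rule DERIV_inverse) (use that in simp)
    then show ?thesis using Suc by (simp add: F_def algebra_simps)
  qed
  then have "(\<lambda>x. F 0 (f x)) \<in> C" using Csmooth_compose[OF f, of F 0] pos by blast
  then show ?thesis by (simp add: F_def)
qed

lemma Csmooth_sin:
  assumes f: "f \<in> C" shows "(\<lambda>x. sin (f x)) \<in> C"
proof -
  \<comment> \<open>Each differentiation of \<open>sin\<close> is a phase shift by pi / 2, so one
    formula gives all derivatives.\<close>
  define F where "F n = (\<lambda>y::real. sin (y + real n * pi / 2))" for n
  have "(F n has_real_derivative F (Suc n) y) (at y)" for y n
  proof -
    have "y + real (Suc n) * pi / 2 = (y + real n * pi / 2) + pi / 2" by (simp add: field_simps)
    then have "F (Suc n) y = sin ((y + real n * pi / 2) + pi / 2)" by (simp only: F_def)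
    then have "F (Suc n) y = cos (y + real n * pi / 2)" by (simp only: sin_add) simp
    then show ?thesis unfolding F_def by (auto intro!: derivative_eq_intros)
  qed
  then have "(\<lambda>x. F 0 (f x)) \<in> C" using Csmooth_compose[OF f, of F 0] by blast
  then show ?thesis by (simp add: F_def)
qed

lemma smooth_on_coordinates_sum:
  assumes "c \<in> A"
    and "\<And>i. i \<in> Basis \<Longrightarrow> smooth_on (snd c ` fst c) (g i)"
  shows "smooth_on (snd c ` fst c) (\<lambda>u. \<Sum>i\<in>(Basis::'b set). g i u)"
  using smooth_on_sum[OF open_chart_image] assms by blast

lemma in_chart_local_formula:
  assumes "c \<in> A" "\<And>x. x \<in> fst c \<Longrightarrow> g x = E (snd c x)" "smooth_on (snd c ` fst c) E"
  shows "smooth_on (snd c ` fst c) (in_chart c g)"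
  by (rule smooth_on_cong[OF open_chart_image[OF assms(1)] _ assms(3)])
     (use assms chart_inv_mem chart_of_inv in \<open>auto simp: in_chart_def\<close>)

text \<open>The chart expression of \<open>L\<close> without the zeroth-order term that
  \<open>diffusion_operator\<close> allows; \<open>L 1 = 0\<close> forces this term to
  vanish.\<close>

definition local_coefficients :: "('a, 'b) chart \<Rightarrow> ('b \<Rightarrow> 'b \<Rightarrow> 'b \<Rightarrow> real) \<Rightarrow> ('b \<Rightarrow> 'b \<Rightarrow> real) \<Rightarrow> bool" where
  "local_coefficients c a b \<longleftrightarrow>
    (\<forall>i\<in>Basis. \<forall>j\<in>Basis. smooth_on (snd c ` fst c) (a i j)) \<and>
    (\<forall>i\<in>Basis. smooth_on (snd c ` fst c) (b i)) \<and>
    (\<forall>u\<in>snd c ` fst c. \<forall>i\<in>Basis. \<forall>j\<in>Basis. a i j u = a j i u) \<and>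
    (\<forall>u\<in>snd c ` fst c. \<forall>\<xi>. 0 \<le> (\<Sum>i\<in>Basis. \<Sum>j\<in>Basis. a i j u * (\<xi> \<bullet> i) * (\<xi> \<bullet> j))) \<and>
    (\<forall>f\<in>C. \<forall>x\<in>fst c. L f x =
             (\<Sum>i\<in>Basis. \<Sum>j\<in>Basis. a i j (snd c x) * pd i (pd j (in_chart c f)) (snd c x))
           + (\<Sum>i\<in>Basis. b i (snd c x) * pd i (in_chart c f) (snd c x)))"

lemma obtain_local_coefficients:
  assumes c: "c \<in> A" obtains a b where "local_coefficients c a b"
proof -
  obtain a b e where
     ab: "\<forall>i\<in>Basis. \<forall>j\<in>Basis. smooth_on (snd c ` fst c) (a i j)"
        "\<forall>i\<in>Basis. smooth_on (snd c ` fst c) (b i)"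
        "\<forall>u\<in>snd c ` fst c. (\<forall>i\<in>Basis. \<forall>j\<in>Basis. a i j u = a j i u) \<and>
           (\<forall>\<xi>. 0 \<le> (\<Sum>i\<in>Basis. \<Sum>j\<in>Basis. a i j u * (\<xi> \<bullet> i) * (\<xi> \<bullet> j)))"
    and Lf: "\<forall>f\<in>C. \<forall>x\<in>fst c. L f x =
             (\<Sum>i\<in>Basis. \<Sum>j\<in>Basis. a i j (snd c x) * pd i (pd j (in_chart c f)) (snd c x))
           + (\<Sum>i\<in>Basis. b i (snd c x) * pd i (in_chart c f) (snd c x))
           + e (snd c x) * f x"
    using bspec[OF diffusion_L[unfolded diffusion_operator_def] c] by blast
  have "e (snd c x) = 0" if "x \<in> fst c" for x
  proof -
    have "L (\<lambda>_. 1) x = e (snd c x)"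
      using Lf that by (simp add: in_chart_def o_def frechet_derivative_const)
    then show ?thesis using L_1 by simp
  qed
  then have "local_coefficients c a b" unfolding local_coefficients_def using ab Lf by simp
  then show ?thesis using that by blast
qed

lemma Csmooth_L:
  assumes f: "f \<in> C" shows "L f \<in> C"
proof (rule CsmoothI)
  fix c assume c: "c \<in> A"
  obtain a b where ab: "local_coefficients c a b" using c by (rule obtain_local_coefficients)
  note o = open_chart_image[OF c]
  show "smooth_on (snd c ` fst c) (in_chart c (L f))"
  proof (rule in_chart_local_formula[OF c])
    show "smooth_on (snd c ` fst c) (\<lambda>u. (\<Sum>i\<in>Basis. \<Sum>j\<in>Basis. a i j u * pd i (pd j (in_chart c f)) u)
           + (\<Sum>i\<in>Basis. b i u * pd i (in_chart c f) u))"
      using ab unfolding local_coefficients_def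
      by (intro smooth_on_add o smooth_on_coordinates_sum c smooth_on_mult smooth_on_frechet_derivative
          Csmooth_in_chart[OF f c]) auto
  qed (use ab f in \<open>auto simp: local_coefficients_def\<close>)
qed

lemma L_add:
  assumes "f \<in> C" "g \<in> C"
  shows "L (\<lambda>x. f x + g x) x = L f x + L g x"
proof -
  obtain c where c: "c \<in> A" "x \<in> fst c" by (rule obtain_chart)
  obtain a b where ab: "local_coefficients c a b" using c(1) by (rule obtain_local_coefficients)
  let ?V = "snd c ` fst c" let ?u = "snd c x"
  have u: "?u \<in> ?V" using c by auto
  note s = Csmooth_in_chart[OF assms(1) c(1)] Csmooth_in_chart[OF assms(2) c(1)]
  have eq: "in_chart c (\<lambda>x. f x + g x) = (\<lambda>u. in_chart c f u + in_chart c g u)"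
    by (simp add: in_chart_def o_def)
  have 1: "pd i (\<lambda>u. in_chart c f u + in_chart c g u) ?u = pd i (in_chart c f) ?u + pd i (in_chart c g) ?u" for i
    by (rule frechet_derivative_add[OF smooth_on_imp_differentiable[OF s(1) u] smooth_on_imp_differentiable[OF s(2) u]])
  have 2: "pd i (pd j (\<lambda>u. in_chart c f u + in_chart c g u)) ?u
      = pd i (pd j (in_chart c f)) ?u + pd i (pd j (in_chart c g)) ?u" for i j
    by (rule frechet_derivative_add2[OF open_chart_image[OF c(1)] s u])
  have "L (\<lambda>x. f x + g x) x =
      (\<Sum>i\<in>Basis. \<Sum>j\<in>Basis. a i j ?u * pd i (pd j (in_chart c (\<lambda>x. f x + g x))) ?u)
           + (\<Sum>i\<in>Basis. b i ?u * pd i (in_chart c (\<lambda>x. f x + g x)) ?u)"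
    using ab Csmooth_add[OF assms] c unfolding local_coefficients_def by blast
  also have "\<dots> = L f x + L g x"
    using ab assms c unfolding eq 1 2 local_coefficients_def
    by (simp add: distrib_left sum.distrib)
  finally show ?thesis .
qed

text \<open>In the expansion of \<open>L (f g)\<close>, the terms with an undifferentiated factor
  add up to \<open>f L g + g L f\<close>. The rest is a mixed first-order expression whose two
  halves agree because \<open>a\<close> is symmetric.\<close>

lemma cdc_local:
  assumes "f \<in> C" "g \<in> C" and c: "c \<in> A" "x \<in> fst c" and ab: "local_coefficients c a b"
  shows "\<Gamma> f g x = (\<Sum>i\<in>Basis. \<Sum>j\<in>Basis. a i j (snd c x) *
              pd i (in_chart c f) (snd c x) * pd j (in_chart c g) (snd c x))"
proof -
  let ?V = "snd c ` fst c" let ?u = "snd c x"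
  let ?f = "in_chart c f" let ?g = "in_chart c g"
  have u: "?u \<in> ?V" using c by auto
  note s = Csmooth_in_chart[OF assms(1) c(1)] Csmooth_in_chart[OF assms(2) c(1)]
  have eq: "in_chart c (\<lambda>x. f x * g x) = (\<lambda>u. ?f u * ?g u)"
    by (simp add: in_chart_def o_def)
  have fg: "?f ?u = f x" "?g ?u = g x" using c by (auto simp: in_chart_apply)
  have 1: "pd i (\<lambda>u. ?f u * ?g u) ?u = f x * pd i ?g ?u + g x * pd i ?f ?u" for i
    using frechet_derivative_mult_real[OF smooth_on_imp_differentiable[OF s(1) u]
        smooth_on_imp_differentiable[OF s(2) u], of i] fg by simp
  have 2: "pd i (pd j (\<lambda>u. ?f u * ?g u)) ?u
      = f x * pd i (pd j ?g) ?u + g x * pd i (pd j ?f) ?u + (pd i ?f ?u * pd j ?g ?u + pd j ?f ?u * pd i ?g ?u)" for i j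
    using frechet_derivative_mult2[OF open_chart_image[OF c(1)] s u, where i=i and j=j] fg by simp
  have "L (\<lambda>x. f x * g x) x =
      (\<Sum>i\<in>Basis. \<Sum>j\<in>Basis. a i j ?u * pd i (pd j (\<lambda>u. ?f u * ?g u)) ?u)
           + (\<Sum>i\<in>Basis. b i ?u * pd i (\<lambda>u. ?f u * ?g u) ?u)"
    using ab Csmooth_mult[OF assms(1,2)] c unfolding local_coefficients_def eq[symmetric] by blast
  also have "\<dots> = (\<Sum>i\<in>Basis. \<Sum>j\<in>Basis. f x * (a i j ?u * pd i (pd j ?g) ?u) + g x * (a i j ?u * pd i (pd j ?f) ?u)
        + a i j ?u * (pd i ?f ?u * pd j ?g ?u + pd j ?f ?u * pd i ?g ?u))
        + (\<Sum>i\<in>Basis. f x * (b i ?u * pd i ?g ?u) + g x * (b i ?u * pd i ?f ?u))"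
    unfolding 1 2 by (simp add: algebra_simps)
  also have "\<dots> = f x * L g x + g x * L f x
      + (\<Sum>i\<in>Basis. \<Sum>j\<in>Basis. a i j ?u * (pd i ?f ?u * pd j ?g ?u + pd j ?f ?u * pd i ?g ?u))"
    using ab assms c unfolding local_coefficients_def
    by (simp add: sum.distrib sum_distrib_left distrib_left)
  also have "(\<Sum>i\<in>Basis. \<Sum>j\<in>Basis. a i j ?u * (pd i ?f ?u * pd j ?g ?u + pd j ?f ?u * pd i ?g ?u))
    = (\<Sum>i\<in>Basis. \<Sum>j\<in>Basis. a i j ?u * pd i ?f ?u * pd j ?g ?u)
      + (\<Sum>i\<in>Basis. \<Sum>j\<in>Basis. a i j ?u * pd j ?f ?u * pd i ?g ?u)"
    by (simp add: sum.distrib distrib_left mult.assoc)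
  also have "(\<Sum>i\<in>Basis. \<Sum>j\<in>Basis. a i j ?u * pd j ?f ?u * pd i ?g ?u)
    = (\<Sum>j\<in>Basis. \<Sum>i\<in>Basis. a i j ?u * pd j ?f ?u * pd i ?g ?u)" by (rule sum.swap)
  also have "\<dots> = (\<Sum>j\<in>Basis. \<Sum>i\<in>Basis. a j i ?u * pd j ?f ?u * pd i ?g ?u)"
  proof (intro sum.cong refl)
    fix i j :: 'b assume "i \<in> Basis" "j \<in> Basis"
    then have "a i j ?u = a j i ?u" using ab u unfolding local_coefficients_def by blast
    then show "a i j ?u * pd j ?f ?u * pd i ?g ?u = a j i ?u * pd j ?f ?u * pd i ?g ?u" by simp
  qed
  finally show ?thesis unfolding cdc_def by simp
qed

lemma cdc_sym: "\<Gamma> f g = \<Gamma> g f"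
  unfolding cdc_def by (auto simp: mult.commute fun_eq_iff)

lemma L_mult: "L (\<lambda>x. f x * g x) x = f x * L g x + g x * L f x + 2 * \<Gamma> f g x"
  unfolding cdc_def by (simp add: diff_divide_distrib)

lemma cdc_local_pd_mult:
  assumes "f \<in> C" "g \<in> C" "c \<in> A" "x \<in> fst c"
  shows "pd i (in_chart c (\<lambda>y. f y * g y)) (snd c x)
    = f x * pd i (in_chart c g) (snd c x) + g x * pd i (in_chart c f) (snd c x)"
proof -
  have "in_chart c (\<lambda>x. f x * g x) = (\<lambda>u. in_chart c f u * in_chart c g u)"
    by (simp add: in_chart_def o_def)
  moreover have u: "snd c x \<in> snd c ` fst c" using assms by auto
  ultimately show ?thesis
    using frechet_derivative_mult_real[OF smooth_on_imp_differentiable[OF Csmooth_in_chart[OF assms(1,3)] u]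
        smooth_on_imp_differentiable[OF Csmooth_in_chart[OF assms(2,3)] u], of i]
      in_chart_apply[OF assms(3,4), of f] in_chart_apply[OF assms(3,4), of g] by simp
qed

text \<open>With this, everything proved for a general \<open>first_order_form\<close> serves
  \<Gamma> and the second form \<open>Z\<close> at once. Nonnegativity is that of the matrix
  \<open>a\<close>, evaluated on the vector of partial derivatives of \<open>f\<close>.\<close>

lemma first_order_form_cdc: "first_order_form A \<Gamma>"
  unfolding first_order_form_def
proof (intro conjI ballI allI)
  fix c assume c: "c \<in> A"
  obtain a b where ab: "local_coefficients c a b" using c by (rule obtain_local_coefficients)
  show "\<exists>z :: 'b \<Rightarrow> 'b \<Rightarrow> 'b \<Rightarrow> real.
        (\<forall>i\<in>Basis. \<forall>j\<in>Basis. smooth_on (snd c ` fst c) (z i j)) \<and>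
        (\<forall>f\<in>C. \<forall>g\<in>C. \<forall>x\<in>fst c. \<Gamma> f g x =
           (\<Sum>i\<in>Basis. \<Sum>j\<in>Basis. z i j (snd c x) *
              pd i (in_chart c f) (snd c x) * pd j (in_chart c g) (snd c x)))"
  proof (intro exI[of _ a] conjI)
    show "\<forall>i\<in>Basis. \<forall>j\<in>Basis. smooth_on (snd c ` fst c) (a i j)"
      using ab unfolding local_coefficients_def by blast
  qed (blast intro: cdc_local[OF _ _ c _ ab])
next
  fix f g assume "f \<in> C" "g \<in> C" then show "\<Gamma> f g = \<Gamma> g f" by (simp add: cdc_sym)
next
  fix f g h x assume fgh: "f \<in> C" "g \<in> C" "h \<in> C"
  obtain c where c: "c \<in> A" "x \<in> fst c" by (rule obtain_chart)
  obtain a b where ab: "local_coefficients c a b" using c(1) by (rule obtain_local_coefficients)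
  show "\<Gamma> (\<lambda>y. f y * g y) h x = f x * \<Gamma> g h x + g x * \<Gamma> f h x"
    unfolding cdc_local[OF Csmooth_mult[OF fgh(1,2)] fgh(3) c ab] cdc_local[OF fgh(1,3) c ab]
      cdc_local[OF fgh(2,3) c ab] cdc_local_pd_mult[OF fgh(1,2) c]
    by (simp add: sum_distrib_left sum.distrib algebra_simps)
next
  fix f x assume f: "f \<in> C"
  obtain c where c: "c \<in> A" "x \<in> fst c" by (rule obtain_chart)
  obtain a b where ab: "local_coefficients c a b" using c(1) by (rule obtain_local_coefficients)
  define \<xi> where "\<xi> = (\<Sum>i\<in>Basis. pd i (in_chart c f) (snd c x) *\<^sub>R i)"
  have \<xi>: "\<xi> \<bullet> i = pd i (in_chart c f) (snd c x)" if "i \<in> Basis" for i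
    unfolding \<xi>_def using that by simp
  have "\<Gamma> f f x = (\<Sum>i\<in>Basis. \<Sum>j\<in>Basis. a i j (snd c x) * (\<xi> \<bullet> i) * (\<xi> \<bullet> j))"
    unfolding cdc_local[OF f f c ab] by (intro sum.cong refl) (simp add: \<xi>)
  then show "0 \<le> \<Gamma> f f x" using ab c unfolding local_coefficients_def by auto
qed

text \<open>The second derivatives of \<open>F (f x)\<close> contribute \<open>F2\<close> times
  products of first derivatives of \<open>f\<close>, and the second-order coefficients of
  \<open>L\<close> collect these into \<Gamma>(f). The case of interest is
  \<open>F = ln\<close>.\<close>

lemma L_compose:
  assumes f: "f \<in> C" and Ff: "(\<lambda>x. F (f x)) \<in> C"
    and F: "\<And>x. (F has_real_derivative F1 (f x)) (at (f x))"
    and F1: "\<And>x. (F1 has_real_derivative F2 (f x)) (at (f x))"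
  shows "L (\<lambda>x. F (f x)) x = F1 (f x) * L f x + F2 (f x) * \<Gamma> f f x"
proof -
  obtain c where c: "c \<in> A" "x \<in> fst c" by (rule obtain_chart)
  obtain a b where ab: "local_coefficients c a b" using c(1) by (rule obtain_local_coefficients)
  let ?V = "snd c ` fst c" let ?u = "snd c x" let ?f = "in_chart c f"
  have u: "?u \<in> ?V" using c by auto
  note s = Csmooth_in_chart[OF f c(1)]
  have eq: "in_chart c (\<lambda>x. F (f x)) = (\<lambda>u. F (?f u))" by (simp add: in_chart_def o_def)
  have fx: "?f ?u = f x" using c by (auto simp: in_chart_apply)
  have FV: "(F has_real_derivative F1 (?f v)) (at (?f v))" for v using F by (simp add: in_chart_def)
  have F1V: "(F1 has_real_derivative F2 (?f v)) (at (?f v))" for v using F1 by (simp add: in_chart_def)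
  have 1: "pd i (\<lambda>u. F (?f u)) ?u = F1 (f x) * pd i ?f ?u" for i
    using frechet_derivative_compose_real(2)[OF FV smooth_on_imp_differentiable[OF s u]] fx by simp
  have 2: "pd i (pd j (\<lambda>u. F (?f u))) ?u = F1 (f x) * pd i (pd j ?f) ?u + F2 (f x) * (pd i ?f ?u * pd j ?f ?u)" for i j
    using frechet_derivative_compose2[OF open_chart_image[OF c(1)] s u, OF FV F1V, where i=i and j=j] fx by simp
  have "L (\<lambda>x. F (f x)) x =
      (\<Sum>i\<in>Basis. \<Sum>j\<in>Basis. a i j ?u * pd i (pd j (\<lambda>u. F (?f u))) ?u)
           + (\<Sum>i\<in>Basis. b i ?u * pd i (\<lambda>u. F (?f u)) ?u)"
    using ab Ff c unfolding local_coefficients_def eq[symmetric] by blast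
  also have "\<dots> = F1 (f x) * L f x + F2 (f x) * (\<Sum>i\<in>Basis. \<Sum>j\<in>Basis. a i j ?u * pd i ?f ?u * pd j ?f ?u)"
    using ab f c unfolding 1 2 local_coefficients_def
    by (simp add: sum.distrib sum_distrib_left algebra_simps)
  finally show ?thesis unfolding cdc_local[OF f f c ab] .
qed

lemma L_const: "L (\<lambda>_. q) x = 0"
proof -
  have "L (\<lambda>x. q * 1) x = q * L (\<lambda>_. 1) x + 1 * L (\<lambda>_. q) x + 2 * \<Gamma> (\<lambda>_. q) (\<lambda>_. 1) x"
    using L_mult[of "\<lambda>_. q" "\<lambda>_. 1"] by simp
  moreover obtain c where c: "c \<in> A" "x \<in> fst c" by (rule obtain_chart)
  moreover obtain a b where ab: "local_coefficients c a b" using c(1) by (rule obtain_local_coefficients)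
  have "L (\<lambda>_. q) x = (\<Sum>i\<in>Basis. \<Sum>j\<in>Basis. a i j (snd c x) * pd i (pd j (in_chart c (\<lambda>_. q))) (snd c x))
           + (\<Sum>i\<in>Basis. b i (snd c x) * pd i (in_chart c (\<lambda>_. q)) (snd c x))"
    using ab c Csmooth_const unfolding local_coefficients_def by blast
  then show ?thesis by (simp add: in_chart_def o_def frechet_derivative_const)
qed

text \<open>Locality is what makes the space of test functions stable under \<open>L\<close>, as
  \<open>Ctest_L\<close> records.\<close>

lemma L_local:
  assumes f: "f \<in> C" and U: "open U" "x \<in> U" "\<And>y. y \<in> U \<Longrightarrow> f y = 0"
  shows "L f x = 0"
proof -
  obtain c where c: "c \<in> A" "x \<in> fst c" by (rule obtain_chart)
  obtain a b where ab: "local_coefficients c a b" using c(1) by (rule obtain_local_coefficients)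
  let ?f = "in_chart c f"
  let ?W = "snd c ` fst c \<inter> inv_into (fst c) (snd c) -` U"
  have W: "open ?W"
    using continuous_open_preimage[OF continuous_chart_inv[OF c(1)] open_chart_image[OF c(1)] U(1)] by simp
  have xW: "snd c x \<in> ?W" using c U chart_inv[OF c] by auto
  have f0: "\<And>v. v \<in> ?W \<Longrightarrow> 0 = ?f v" using U(3) by (auto simp: in_chart_def)
  have 1: "\<And>v j. v \<in> ?W \<Longrightarrow> 0 = pd j ?f v"
    using frechet_derivative_cong_open(2)[OF W _ f0] by (simp add: frechet_derivative_const)
  have 2: "\<And>i j. 0 = pd i (pd j ?f) (snd c x)"
    using frechet_derivative_cong_open(2)[OF W xW 1] by (simp add: frechet_derivative_const)
  have "L f x = (\<Sum>i\<in>Basis. \<Sum>j\<in>Basis. a i j (snd c x) * pd i (pd j ?f) (snd c x))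
           + (\<Sum>i\<in>Basis. b i (snd c x) * pd i ?f (snd c x))"
    using ab c f unfolding local_coefficients_def by blast
  then show ?thesis using 2 1[OF xW] by simp
qed

end

text \<open>For \<open>c > 0\<close> evaluate at the minimum \<open>s = - b / c\<close>. For
  \<open>c = 0\<close> an affine function of \<open>s\<close> that stays nonnegative must have slope
  zero.\<close>

lemma quadratic_nonneg_discriminant:
  fixes a b c :: real
  assumes "\<And>s. 0 \<le> a + 2 * s * b + s\<^sup>2 * c" "0 \<le> c"
  shows "b\<^sup>2 \<le> a * c"
proof (cases "c = 0")
  case True
  have "b = 0"
  proof (rule ccontr)
    assume "b \<noteq> 0"
    then have "a + 2 * (- (a + 1) / (2 * b)) * b = -1" by (simp add: field_simps)
    then show False using assms(1)[of "- (a + 1) / (2 * b)"] True by simp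
  qed
  then show ?thesis using True by simp
next
  case False
  then have "c > 0" using assms(2) by simp
  have "a + 2 * (- b / c) * b + (- b / c)\<^sup>2 * c = a - b\<^sup>2 / c"
    using False by (simp add: field_simps power2_eq_square)
  then have "b\<^sup>2 / c \<le> a" using assms(1)[of "- b / c"] by simp
  then show ?thesis using \<open>c > 0\<close> by (simp add: field_simps)
qed

section \<open>Calculus of first-order forms\<close>

context diffusion
begin

definition form_coefficients ::
  "('a, 'b) chart \<Rightarrow> (('a \<Rightarrow> real) \<Rightarrow> ('a \<Rightarrow> real) \<Rightarrow> 'a \<Rightarrow> real) \<Rightarrow> ('b \<Rightarrow> 'b \<Rightarrow> 'b \<Rightarrow> real) \<Rightarrow> bool" where
  "form_coefficients c G z \<longleftrightarrow>
    (\<forall>i\<in>Basis. \<forall>j\<in>Basis. smooth_on (snd c ` fst c) (z i j)) \<and>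
    (\<forall>f\<in>C. \<forall>g\<in>C. \<forall>x\<in>fst c. G f g x =
           (\<Sum>i\<in>Basis. \<Sum>j\<in>Basis. z i j (snd c x) *
              pd i (in_chart c f) (snd c x) * pd j (in_chart c g) (snd c x)))"

lemma form_coefficients_apply:
  "form_coefficients c G z \<Longrightarrow> f \<in> C \<Longrightarrow> g \<in> C \<Longrightarrow> x \<in> fst c \<Longrightarrow> G f g x =
           (\<Sum>i\<in>Basis. \<Sum>j\<in>Basis. z i j (snd c x) *
              pd i (in_chart c f) (snd c x) * pd j (in_chart c g) (snd c x))"
  unfolding form_coefficients_def by blast

lemma form_coefficients_smooth:
  "form_coefficients c G z \<Longrightarrow> i \<in> Basis \<Longrightarrow> j \<in> Basis \<Longrightarrow> smooth_on (snd c ` fst c) (z i j)"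
  unfolding form_coefficients_def by blast

context
  fixes G :: "('a \<Rightarrow> real) \<Rightarrow> ('a \<Rightarrow> real) \<Rightarrow> 'a \<Rightarrow> real"
  assumes G: "first_order_form A G"
begin

lemma form_sym: "f \<in> C \<Longrightarrow> g \<in> C \<Longrightarrow> G f g = G g f"
  using G unfolding first_order_form_def by blast

lemma form_mult: "f \<in> C \<Longrightarrow> g \<in> C \<Longrightarrow> h \<in> C \<Longrightarrow> G (\<lambda>y. f y * g y) h x = f x * G g h x + g x * G f h x"
  using G unfolding first_order_form_def by blast

lemma form_nonneg: "f \<in> C \<Longrightarrow> 0 \<le> G f f x"
  using G unfolding first_order_form_def by blast

lemma obtain_form_coefficients:
  assumes c: "c \<in> A" obtains z where "form_coefficients c G z"
proof -
  have "\<exists>z. form_coefficients c G z"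
    unfolding form_coefficients_def
    by (rule bspec[OF conjunct1[OF G[unfolded first_order_form_def]] c])
  then show ?thesis using that by blast
qed

lemma form_smooth:
  assumes "f \<in> C" "g \<in> C" shows "G f g \<in> C"
proof (rule CsmoothI)
  fix c assume c: "c \<in> A"
  obtain z where z: "form_coefficients c G z" using c by (rule obtain_form_coefficients)
  show "smooth_on (snd c ` fst c) (in_chart c (G f g))"
  proof (rule in_chart_local_formula[OF c])
    show "smooth_on (snd c ` fst c) (\<lambda>u. \<Sum>i\<in>Basis. \<Sum>j\<in>Basis. z i j u * pd i (in_chart c f) u * pd j (in_chart c g) u)"
      by (intro smooth_on_coordinates_sum c smooth_on_mult smooth_on_frechet_derivative
          Csmooth_in_chart assms form_coefficients_smooth[OF z] open_chart_image)
  qed (rule form_coefficients_apply[OF z assms])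
qed

lemma form_const: "g \<in> C \<Longrightarrow> G (\<lambda>_. q) g x = 0"
proof -
  assume g: "g \<in> C"
  obtain c where c: "c \<in> A" "x \<in> fst c" by (rule obtain_chart)
  obtain z where "form_coefficients c G z" using c(1) by (rule obtain_form_coefficients)
  note z = form_coefficients_apply[OF this]
  from z[OF Csmooth_const g c(2)] show ?thesis
    by (simp add: in_chart_def o_def frechet_derivative_const)
qed

lemma form_cmult: "f \<in> C \<Longrightarrow> g \<in> C \<Longrightarrow> G (\<lambda>y. q * f y) g x = q * G f g x"
  using form_mult[of "\<lambda>_. q" f g x] form_const by simp

lemma form_add:
  assumes "f \<in> C" "g \<in> C" "h \<in> C"
  shows "G (\<lambda>y. f y + g y) h x = G f h x + G g h x"
proof -
  obtain c where c: "c \<in> A" "x \<in> fst c" by (rule obtain_chart)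
  obtain z where "form_coefficients c G z" using c(1) by (rule obtain_form_coefficients)
  note z = form_coefficients_apply[OF this]
  have eq: "in_chart c (\<lambda>x. f x + g x) = (\<lambda>u. in_chart c f u + in_chart c g u)"
    by (simp add: in_chart_def o_def)
  have u: "snd c x \<in> snd c ` fst c" using c by auto
  note s = Csmooth_in_chart[OF assms(1) c(1)] Csmooth_in_chart[OF assms(2) c(1)]
  have 1: "pd i (in_chart c (\<lambda>x. f x + g x)) (snd c x) = pd i (in_chart c f) (snd c x) + pd i (in_chart c g) (snd c x)" for i
    unfolding eq
    by (rule frechet_derivative_add[OF smooth_on_imp_differentiable[OF s(1) u] smooth_on_imp_differentiable[OF s(2) u]])
  show ?thesis
    unfolding z[OF Csmooth_add[OF assms(1,2)] assms(3) c(2)] z[OF assms(1,3) c(2)] z[OF assms(2,3) c(2)] 1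
    by (simp add: distrib_left distrib_right sum.distrib)
qed

lemma form_chain:
  assumes f: "f \<in> C" and g: "g \<in> C" and Ff: "(\<lambda>x. F (f x)) \<in> C"
    and F: "(F has_real_derivative d) (at (f x))"
  shows "G (\<lambda>x. F (f x)) g x = d * G f g x"
proof -
  obtain c where c: "c \<in> A" "x \<in> fst c" by (rule obtain_chart)
  obtain z where "form_coefficients c G z" using c(1) by (rule obtain_form_coefficients)
  note z = form_coefficients_apply[OF this]
  have eq: "in_chart c (\<lambda>x. F (f x)) = (\<lambda>u. F (in_chart c f u))"
    by (simp add: in_chart_def o_def)
  have u: "snd c x \<in> snd c ` fst c" using c by auto
  have F': "(F has_real_derivative d) (at (in_chart c f (snd c x)))"
    using F in_chart_apply[OF c, of f] by simp
  have 1: "pd i (in_chart c (\<lambda>x. F (f x))) (snd c x) = d * pd i (in_chart c f) (snd c x)" for i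
    unfolding eq
    by (rule frechet_derivative_compose_real(2)[OF F' smooth_on_imp_differentiable[OF Csmooth_in_chart[OF f c(1)] u]])
  show ?thesis
    unfolding z[OF Ff g c(2)] z[OF f g c(2)] 1
    by (simp add: sum_distrib_left algebra_simps)
qed

lemma form_add_right:
  assumes "f \<in> C" "g \<in> C" "h \<in> C"
  shows "G h (\<lambda>y. f y + g y) x = G h f x + G h g x"
  using form_add[OF assms] form_sym assms Csmooth_add by metis

lemma form_cmult_right: "f \<in> C \<Longrightarrow> g \<in> C \<Longrightarrow> G g (\<lambda>y. q * f y) x = q * G g f x"
  using form_cmult form_sym Csmooth_cmult by metis

lemma form_mult_right:
  "f \<in> C \<Longrightarrow> g \<in> C \<Longrightarrow> h \<in> C \<Longrightarrow> G h (\<lambda>y. f y * g y) x = f x * G h g x + g x * G h f x"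
  using form_mult form_sym Csmooth_mult by metis

lemma form_add_const: "f \<in> C \<Longrightarrow> g \<in> C \<Longrightarrow> G (\<lambda>x. q + f x) g x = G f g x"
  using form_add[of "\<lambda>_. q" f g] form_const by simp

lemma form_add_const2: "f \<in> C \<Longrightarrow> G (\<lambda>x. q + f x) (\<lambda>x. q + f x) x = G f f x"
  using form_add_const[of f "\<lambda>x. q + f x"] form_add_right[of "\<lambda>_. q" f f] form_const[of f]
    form_sym[of f "\<lambda>_. q"] Csmooth_add[of "\<lambda>_. q" f] by simp

lemma form_quadratic:
  assumes "f \<in> C" "g \<in> C"
  shows "0 \<le> r\<^sup>2 * G f f x + 2 * r * s * G f g x + s\<^sup>2 * G g g x"
proof -
  have c: "(\<lambda>y. r * f y) \<in> C" "(\<lambda>y. s * g y) \<in> C" using assms Csmooth_cmult by auto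
  have gf: "G g f x = G f g x" using form_sym assms by metis
  have "0 \<le> G (\<lambda>y. r * f y + s * g y) (\<lambda>y. r * f y + s * g y) x"
    by (rule form_nonneg[OF Csmooth_add[OF c]])
  also have "\<dots> = r * (r * G f f x + s * G f g x) + s * (r * G g f x + s * G g g x)"
    by (simp only: form_add[OF c Csmooth_add[OF c]] form_add_right[OF c] form_cmult form_cmult_right c assms)
       (simp add: algebra_simps)
  finally show ?thesis using gf by (simp add: algebra_simps power2_eq_square)
qed

lemma form_cauchy_schwarz:
  assumes "f \<in> C" "g \<in> C"
  shows "(G f g x)\<^sup>2 \<le> G f f x * G g g x"
  by (rule quadratic_nonneg_discriminant)
     (use form_quadratic[OF assms, of 1] form_nonneg assms in \<open>auto simp: mult_ac\<close>)

lemma form_cauchy_schwarz_le: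
  assumes "f \<in> C" "g \<in> C" "G f f x \<le> a" "G g g x \<le> b"
  shows "\<bar>G f g x\<bar> \<le> sqrt a * sqrt b"
proof -
  have "(G f g x)\<^sup>2 \<le> a * b"
    using form_cauchy_schwarz[OF assms(1,2), of x] assms(3,4) form_nonneg[OF assms(1), of x]
      form_nonneg[OF assms(2), of x] by (meson mult_mono order_trans)
  then have "sqrt ((G f g x)\<^sup>2) \<le> sqrt (a * b)" using real_sqrt_le_mono by blast
  then show ?thesis by (simp add: real_sqrt_mult)
qed

lemma form_abs_le:
  assumes "f \<in> C" "g \<in> C"
  shows "2 * \<bar>G f g x\<bar> \<le> G f f x + G g g x"
  using form_quadratic[OF assms, of 1 x 1] form_quadratic[OF assms, of 1 x "-1"] by simp

end

lemmas cdc_form = first_order_form_cdc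

lemma Csmooth_cdc: "f \<in> C \<Longrightarrow> g \<in> C \<Longrightarrow> \<Gamma> f g \<in> C"
  by (rule form_smooth[OF cdc_form])

lemma L_cmult: "f \<in> C \<Longrightarrow> L (\<lambda>x. q * f x) x = q * L f x"
  using L_mult[of "\<lambda>_. q" f x] L_const[of q x] form_const[OF cdc_form, of f q x] by simp

lemma L_add_const: "f \<in> C \<Longrightarrow> L (\<lambda>x. q + f x) x = L f x"
  using L_add[of "\<lambda>_. q" f x] L_const[of q x] by simp

section \<open>Test functions\<close>

lemma Ctest_Csmooth: "f \<in> T \<Longrightarrow> f \<in> C"
  by (simp add: Ctest_def)

lemma Ctest_compact: "f \<in> T \<Longrightarrow> compact (closure {x. f x \<noteq> 0})"
  by (simp add: Ctest_def)

lemma Ctest_zero: "x \<notin> closure {x. f x \<noteq> 0} \<Longrightarrow> f x = 0"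
  using closure_subset[of "{x. f x \<noteq> 0}"] by blast

lemma Ctest_subset:
  assumes "f \<in> T" "g \<in> C" "\<And>x. f x = 0 \<Longrightarrow> g x = 0"
  shows "g \<in> T"
proof -
  have "closure {x. g x \<noteq> 0} \<subseteq> closure {x. f x \<noteq> 0}"
    using assms(3) by (intro closure_mono) auto
  then have "compact (closure {x. g x \<noteq> 0})"
    using Ctest_compact[OF assms(1)] compact_Int_closed[of "closure {x. f x \<noteq> 0}" "closure {x. g x \<noteq> 0}"]
    by (simp add: Int_absorb1)
  then show ?thesis using assms(2) by (simp add: Ctest_def)
qed

lemma Ctest_mult: "f \<in> T \<Longrightarrow> g \<in> C \<Longrightarrow> (\<lambda>x. f x * g x) \<in> T"
  by (rule Ctest_subset[of f]) (auto intro: Csmooth_mult Ctest_Csmooth)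

lemma Ctest_cmult: "f \<in> T \<Longrightarrow> (\<lambda>x. q * f x) \<in> T"
  by (rule Ctest_subset[of f]) (auto intro: Csmooth_cmult Ctest_Csmooth)

lemma Ctest_L:
  assumes f: "f \<in> T" shows "L f \<in> T"
proof -
  have "{x. L f x \<noteq> 0} \<subseteq> closure {x. f x \<noteq> 0}"
  proof
    fix x assume x: "x \<in> {x. L f x \<noteq> 0}"
    show "x \<in> closure {x. f x \<noteq> 0}"
    proof (rule ccontr)
      assume nx: "x \<notin> closure {x. f x \<noteq> 0}"
      have "L f x = 0"
      proof (rule L_local[OF Ctest_Csmooth[OF f]])
        show "open (- closure {x. f x \<noteq> 0})" by (intro open_Compl closed_closure)
        show "x \<in> - closure {x. f x \<noteq> 0}" using nx by simp
        show "f y = 0" if "y \<in> - closure {x. f x \<noteq> 0}" for y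
          using that by (intro Ctest_zero) simp
      qed
      then show False using x by simp
    qed
  qed
  then have "closure {x. L f x \<noteq> 0} \<subseteq> closure {x. f x \<noteq> 0}"
    by (simp add: closure_minimal)
  then have "compact (closure {x. L f x \<noteq> 0})"
    using Ctest_compact[OF f] compact_Int_closed[of "closure {x. f x \<noteq> 0}" "closure {x. L f x \<noteq> 0}"]
    by (simp add: Int_absorb1)
  then show ?thesis using Csmooth_L[OF Ctest_Csmooth[OF f]] by (simp add: Ctest_def)
qed

lemma Ctest_bounded:
  assumes "f \<in> T" obtains B where "B \<ge> 0" "\<And>x. \<bar>f x\<bar> \<le> B"
proof -
  have "bounded (f ` closure {x. f x \<noteq> 0})"
    using Ctest_compact[OF assms] Csmooth_continuous[OF Ctest_Csmooth[OF assms]]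
    by (meson compact_continuous_image compact_imp_bounded continuous_on_subset subset_UNIV)
  then obtain B where B: "\<And>x. x \<in> closure {x. f x \<noteq> 0} \<Longrightarrow> \<bar>f x\<bar> \<le> B"
    unfolding bounded_iff by auto
  have "\<bar>f x\<bar> \<le> max B 0" for x
    using B[of x] Ctest_zero[of x f] by (cases "x \<in> closure {x. f x \<noteq> 0}") auto
  then show ?thesis using that[of "max B 0"] by auto
qed

section \<open>Local finiteness and full support of the measure\<close>

lemma sets_\<mu>: "sets \<mu> = sets borel"
  using smooth_\<mu> by (simp add: smooth_measure_def)

lemma space_\<mu> [simp]: "space \<mu> = UNIV"
  using sets_eq_imp_space_eq[OF sets_\<mu>] by simp

lemma Csmooth_measurable: "f \<in> C \<Longrightarrow> f \<in> borel_measurable \<mu>"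
  using borel_measurable_continuous_onI[OF Csmooth_continuous] measurable_cong_sets[OF sets_\<mu> refl] by blast

lemma \<mu>_locally_finite: "\<exists>W. open W \<and> x \<in> W \<and> emeasure \<mu> W < \<infinity>"
proof -
  obtain c where c: "c \<in> A" "x \<in> fst c" by (rule obtain_chart)
  let ?V = "snd c ` fst c"
  obtain \<rho> :: "'b \<Rightarrow> real" where \<rho>: "smooth_on ?V \<rho>" "\<forall>u\<in>?V. \<rho> u > 0"
    "\<forall>B\<in>sets borel. B \<subseteq> fst c \<longrightarrow>
           emeasure \<mu> B = (\<integral>\<^sup>+ u. ennreal (\<rho> u) * indicator (snd c ` B) u \<partial>lborel)"
    using smooth_\<mu> c(1) unfolding smooth_measure_def by blast
  have "snd c x \<in> ?V" using c by auto
  then obtain r where r: "r > 0" "cball (snd c x) r \<subseteq> ?V"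
    using open_chart_image[OF c(1)] open_contains_cball by blast
  have "bounded (\<rho> ` cball (snd c x) r)"
    using smooth_on_imp_continuous_on[OF \<rho>(1)] r(2)
    by (meson compact_cball compact_continuous_image compact_imp_bounded continuous_on_subset)
  then obtain B where "\<forall>y\<in>\<rho> ` cball (snd c x) r. norm y \<le> B"
    unfolding bounded_iff by blast
  then have B: "\<And>u. u \<in> cball (snd c x) r \<Longrightarrow> \<rho> u \<le> B"
    by (force simp: abs_le_iff)
  let ?W = "fst c \<inter> snd c -` ball (snd c x) r"
  have oW: "open ?W"
    using continuous_open_preimage[OF continuous_chart[OF c(1)] open_chart_domain[OF c(1)] open_ball] .
  have "emeasure \<mu> ?W = (\<integral>\<^sup>+ u. ennreal (\<rho> u) * indicator (snd c ` ?W) u \<partial>lborel)"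
    using \<rho>(3) oW by auto
  also have "\<dots> \<le> (\<integral>\<^sup>+ u. ennreal B * indicator (ball (snd c x) r) u \<partial>lborel)"
    using B by (intro nn_integral_mono) (auto split: split_indicator intro!: ennreal_leI)
  also have "\<dots> = ennreal B * emeasure lborel (ball (snd c x) r)"
    by (rule nn_integral_cmult_indicator) simp
  also have "\<dots> < \<infinity>"
    using emeasure_lborel_ball_finite[of "snd c x" r] by (simp add: ennreal_mult_less_top)
  finally have "emeasure \<mu> ?W < \<infinity>" .
  moreover have "x \<in> ?W" using c r by auto
  ultimately show ?thesis using oW by blast
qed

lemma \<mu>_compact_finite:
  assumes K: "compact K" shows "emeasure \<mu> K < \<infinity>"
proof -
  obtain W where W: "\<And>x. open (W x)" "\<And>x. x \<in> W x" "\<And>x. emeasure \<mu> (W x) < \<infinity>"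
    using \<mu>_locally_finite by metis
  obtain F where F: "F \<subseteq> K" "finite F" "K \<subseteq> (\<Union>x\<in>F. W x)"
    by (rule compactE_image[OF K, of K W]) (use W in auto)
  have s: "W x \<in> sets \<mu>" for x using W(1) by (simp add: sets_\<mu>)
  have "emeasure \<mu> K \<le> emeasure \<mu> (\<Union>x\<in>F. W x)"
    by (rule emeasure_mono[OF F(3)]) (use s F in auto)
  also have "\<dots> \<le> (\<Sum>x\<in>F. emeasure \<mu> (W x))"
    using s F by (intro emeasure_subadditive_finite) auto
  also have "\<dots> < \<infinity>" using W(3) F by (simp add: less_top)
  finally show ?thesis .
qed

text \<open>The density is positive in a chart, so an open null set would have a Lebesgue null image
  there; a nonempty open set of Euclidean space is not null.\<close>

lemma \<mu>_open_pos:
  assumes O: "open O'" "O' \<noteq> {}" shows "emeasure \<mu> O' > 0"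
proof -
  obtain x where x: "x \<in> O'" using O by blast
  obtain c where c: "c \<in> A" "x \<in> fst c" by (rule obtain_chart)
  let ?V = "snd c ` fst c" let ?B = "O' \<inter> fst c"
  obtain \<rho> :: "'b \<Rightarrow> real" where \<rho>: "smooth_on ?V \<rho>" "\<forall>u\<in>?V. \<rho> u > 0"
    "\<forall>B\<in>sets borel. B \<subseteq> fst c \<longrightarrow>
           emeasure \<mu> B = (\<integral>\<^sup>+ u. ennreal (\<rho> u) * indicator (snd c ` B) u \<partial>lborel)"
    using smooth_\<mu> c(1) unfolding smooth_measure_def by blast
  let ?W = "?V \<inter> inv_into (fst c) (snd c) -` O'"
  have oW: "open ?W"
    using continuous_open_preimage[OF continuous_chart_inv[OF c(1)] open_chart_image[OF c(1)] O(1)] .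
  have W: "snd c ` ?B = ?W"
    using chart_inv[OF c(1)] chart_inv_mem[OF c(1)] chart_of_inv[OF c(1)] by (auto simp: image_iff)
  have oB: "open ?B" using O open_chart_domain[OF c(1)] by blast
  have "emeasure \<mu> ?B = (\<integral>\<^sup>+ u. ennreal (\<rho> u) * indicator ?W u \<partial>lborel)"
    using \<rho>(3) oB W by auto
  moreover have "(\<integral>\<^sup>+ u. ennreal (\<rho> u) * indicator ?W u \<partial>lborel) \<noteq> 0"
  proof
    assume 0: "(\<integral>\<^sup>+ u. ennreal (\<rho> u) * indicator ?W u \<partial>lborel) = 0"
    have "continuous_on ?V \<rho>" using smooth_on_imp_continuous_on \<rho>(1) by blast
    \<comment> \<open>The density is controlled on the chart image only; multiplied by the indicator
      of that image it is Borel measurable, and the integrand over \<open>?W\<close> is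
      unchanged.\<close>
    then have *: "(\<lambda>u. indicator ?V u *\<^sub>R \<rho> u) \<in> borel_measurable borel"
      using open_chart_image[OF c(1)] by (intro borel_measurable_continuous_on_indicator) auto
    have "(\<lambda>u. ennreal (indicator ?V u *\<^sub>R \<rho> u) * indicator ?W u) \<in> borel_measurable borel"
      by (rule borel_measurable_times_ennreal[OF measurable_compose[OF * measurable_ennreal]
          borel_measurable_indicator[OF borel_open[OF oW]]])
    also have "(\<lambda>u. ennreal (indicator ?V u *\<^sub>R \<rho> u) * indicator ?W u) = (\<lambda>u. ennreal (\<rho> u) * indicator ?W u)"
      by (auto simp: fun_eq_iff split: split_indicator)
    finally have "(\<lambda>u. ennreal (\<rho> u) * indicator ?W u) \<in> borel_measurable lborel" by simp
    then have "AE u in lborel. ennreal (\<rho> u) * indicator ?W u = 0"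
      using 0 nn_integral_0_iff_AE by blast
    then have "AE u in lborel. u \<notin> ?W"
      by eventually_elim (use \<rho>(2) in \<open>auto split: split_indicator_asm\<close>)
    then have "?W \<in> null_sets lborel"
      using oW by (subst AE_iff_null_sets) auto
    then have "emeasure lborel ?W = 0" by auto
    then have "negligible ?W"
      using oW by (simp add: negligible_iff_null_sets null_sets_completionI null_setsI)
    moreover have "?W \<noteq> {}" using W x c by auto
    ultimately show False using open_not_negligible[OF oW] by blast
  qed
  ultimately have "0 < emeasure \<mu> ?B" by (simp add: zero_less_iff_neq_zero)
  also have "\<dots> \<le> emeasure \<mu> O'" using O by (intro emeasure_mono) (auto simp: sets_\<mu>)
  finally show ?thesis .
qed

text \<open>A violation would hold on a nonempty open set, and such a set has positive measure. This
  is how the almost-everywhere statements about the semigroup on \<open>L2 \<mu>\<close> become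
  pointwise ones.\<close>

lemma continuous_AE_le:
  fixes f g :: "'a \<Rightarrow> real"
  assumes "continuous_on UNIV f" "continuous_on UNIV g" "AE x in \<mu>. f x \<le> g x"
  shows "f x \<le> g x"
proof (rule ccontr)
  assume "\<not> f x \<le> g x"
  define U where "U = {x. g x < f x}"
  have oU: "open U" unfolding U_def using assms by (intro open_Collect_less)
  have "U \<noteq> {}" using \<open>\<not> f x \<le> g x\<close> unfolding U_def by (metis empty_Collect_eq not_le)
  then have pos: "emeasure \<mu> U > 0" using \<mu>_open_pos oU by blast
  have "AE x in \<mu>. x \<notin> U" using assms(3) by eventually_elim (auto simp: U_def)
  then have "U \<in> null_sets \<mu>" using oU by (subst AE_iff_null_sets) (auto simp: sets_\<mu>)
  then show False using pos by auto
qed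

lemma continuous_AE_eq:
  fixes f g :: "'a \<Rightarrow> real"
  assumes "continuous_on UNIV f" "continuous_on UNIV g" "AE x in \<mu>. f x = g x"
  shows "f x = g x"
proof (rule order_antisym)
  show "f x \<le> g x" by (rule continuous_AE_le[OF assms(1,2)]) (use assms(3) in eventually_elim, simp)
  show "g x \<le> f x" by (rule continuous_AE_le[OF assms(2,1)]) (use assms(3) in eventually_elim, simp)
qed

lemma Ctest_integrable:
  assumes f: "f \<in> T" shows "integrable \<mu> f"
proof -
  obtain B where B: "\<And>x. \<bar>f x\<bar> \<le> B" using Ctest_bounded[OF f] by blast
  let ?K = "closure {x. f x \<noteq> 0}"
  have "integrable \<mu> (\<lambda>x. indicator ?K x *\<^sub>R B)"
    using \<mu>_compact_finite[OF Ctest_compact[OF f]] by (intro integrable_indicator) (auto simp: sets_\<mu>)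
  moreover have "AE x in \<mu>. norm (f x) \<le> norm (indicator ?K x *\<^sub>R B)"
  proof (rule AE_I2)
    fix x show "norm (f x) \<le> norm (indicator ?K x *\<^sub>R B)"
      using B[of x] Ctest_zero[of x f] by (cases "x \<in> ?K") auto
  qed
  ultimately show ?thesis
    using Bochner_Integration.integrable_bound Csmooth_measurable[OF Ctest_Csmooth[OF f]] by blast
qed

lemma Ctest_integrable_mult: "f \<in> T \<Longrightarrow> g \<in> C \<Longrightarrow> integrable \<mu> (\<lambda>x. f x * g x)"
  using Ctest_integrable[OF Ctest_mult] .

lemma Ctest_L2: "f \<in> T \<Longrightarrow> f \<in> L2 \<mu>"
  using Ctest_integrable_mult[of f f] Ctest_Csmooth[of f] Csmooth_measurable[of f]
  by (simp add: L2_def power2_eq_square)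

lemma Ctest_nonneg_integral_zero:
  assumes "f \<in> T" "\<And>x. 0 \<le> f x" "(\<integral>x. f x \<partial>\<mu>) \<le> 0"
  shows "f x = 0"
proof -
  have "(\<integral>x. f x \<partial>\<mu>) = 0" using assms by (simp add: order_antisym)
  then have "AE x in \<mu>. f x = 0"
    using integral_nonneg_eq_0_iff_AE[OF Ctest_integrable[OF assms(1)]] assms(2) by auto
  then show ?thesis
    by (rule continuous_AE_eq[OF Csmooth_continuous[OF Ctest_Csmooth[OF assms(1)]] continuous_on_const])
qed

end

section \<open>The heat semigroup\<close>

locale heat = diffusion A \<mu> L
  for A :: "('a::{t2_space, second_countable_topology}, 'b::euclidean_space) chart set"
    and \<mu> :: "'a measure"
    and L :: "('a \<Rightarrow> real) \<Rightarrow> 'a \<Rightarrow> real" +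
  fixes p :: "'a \<Rightarrow> 'a \<Rightarrow> real \<Rightarrow> real" and h :: "nat \<Rightarrow> 'a \<Rightarrow> real"
  assumes symmetric_L: "symmetric_nonpositive A \<mu> L"
    and kernel: "heat_kernel A \<mu> L p"
    and h_test: "\<And>k. h k \<in> Ctest A"
    and h_mono: "\<And>k x. h k x \<le> h (Suc k) x"
    and h_lim: "\<And>x. (\<lambda>k. h k x) \<longlonglongrightarrow> 1"
    and h_grad: "(\<lambda>k. sup_norm (cdc L (h k) (h k))) \<longlonglongrightarrow> 0"
    and markov: "\<And>t. t \<ge> 0 \<Longrightarrow> heat_op \<mu> p t (\<lambda>_. 1) = (\<lambda>_. 1)"
begin

abbreviation "P \<equiv> heat_op \<mu> p"

lemma P_0 [simp]: "P 0 f = f"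
  by (simp add: heat_op_def)

lemma P_pos: "t > 0 \<Longrightarrow> P t f x = (\<integral>y. p x y t * f y \<partial>\<mu>)"
  by (simp add: heat_op_def)

lemma p_pos: "t > 0 \<Longrightarrow> p x y t > 0"
  using kernel by (simp add: heat_kernel_def)

lemma p_sym: "t > 0 \<Longrightarrow> p x y t = p y x t"
  using kernel by (simp add: heat_kernel_def)

lemma p_smooth: "c \<in> A \<Longrightarrow> c' \<in> A \<Longrightarrow> smooth_on ((snd c ` fst c) \<times> (snd c' ` fst c') \<times> {0<..})
        (\<lambda>(u, v, t). p (inv_into (fst c) (snd c) u) (inv_into (fst c') (snd c') v) t)"
  using kernel by (simp add: heat_kernel_def)

text \<open>The kernel is smooth chart by chart in both points, whereas \<open>Ck_param\<close> lets
  the second point run through the whole manifold. A derivative in \<open>u\<close> is the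
  derivative of the local expression in direction \<open>(v, 0)\<close>, again smooth in each chart,
  so the induction closes.\<close>

lemma Ck_param_local:
  fixes G :: "'c::euclidean_space \<Rightarrow> 'a \<Rightarrow> real"
  assumes S: "open S"
    and F: "\<And>c'. c' \<in> A \<Longrightarrow> \<exists>F. smooth_on (S \<times> (snd c' ` fst c')) F \<and>
      (\<forall>u\<in>S. \<forall>y\<in>fst c'. G u y = F (u, snd c' y))"
  shows "Ck_param k S G"
  using F
proof (induction k arbitrary: G)
  have cont: "continuous_on (S \<times> UNIV) (\<lambda>z. G (fst z) (snd z))"
    if FF: "\<And>c'. c' \<in> A \<Longrightarrow> \<exists>F. smooth_on (S \<times> (snd c' ` fst c')) F \<and>
      (\<forall>u\<in>S. \<forall>y\<in>fst c'. G u y = F (u, snd c' y))" for G :: "'c \<Rightarrow> 'a \<Rightarrow> real"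
  proof (intro continuous_at_imp_continuous_on ballI)
    fix z :: "'c \<times> 'a" assume z: "z \<in> S \<times> UNIV"
    obtain c where c: "c \<in> A" "snd z \<in> fst c" by (rule obtain_chart)
    obtain F where sF: "smooth_on (S \<times> (snd c ` fst c)) F"
      and GF: "\<forall>u\<in>S. \<forall>y\<in>fst c. G u y = F (u, snd c y)" using FF[OF c(1)] by blast
    have "continuous_on (S \<times> fst c) (\<lambda>z. (fst z, snd c (snd z)))"
      by (intro continuous_intros continuous_on_compose2[OF continuous_chart[OF c(1)]]) auto
    then have "continuous_on (S \<times> fst c) (\<lambda>z. F (fst z, snd c (snd z)))"
      by (rule continuous_on_compose2[OF smooth_on_imp_continuous_on[OF sF]]) auto
    then have "continuous_on (S \<times> fst c) (\<lambda>z. G (fst z) (snd z))"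
      by (rule continuous_on_eq) (use GF in auto)
    moreover have "open (S \<times> fst c)" using S open_chart_domain[OF c(1)] by (rule open_Times)
    moreover have "z \<in> S \<times> fst c" using z c by (cases z) auto
    ultimately show "isCont (\<lambda>z. G (fst z) (snd z)) z"
      using continuous_on_eq_continuous_at by blast
  qed
  {
    case 0
    then show ?case using cont[OF 0] by simp
  next
    case (Suc k)
    have loc: "(\<lambda>u. G u y) differentiable at u \<and>
        frechet_derivative (\<lambda>u. G u y) (at u) v = frechet_derivative F (at (u, snd c y)) (v, 0)"
      if c: "c \<in> A" "y \<in> fst c" and u: "u \<in> S" and sF: "smooth_on (S \<times> (snd c ` fst c)) F"
      and GF: "\<forall>u\<in>S. \<forall>y\<in>fst c. G u y = F (u, snd c y)" for u y c F v
    proof -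
      let ?l = "\<lambda>u::'c. (u, 0::'b)"
      have l: "bounded_linear ?l" by (intro bounded_linear_Pair bounded_linear_ident bounded_linear_zero)
      have "(u, snd c y) \<in> S \<times> (snd c ` fst c)" using c u by auto
      then have dF: "F differentiable at (?l u + (0, snd c y))"
        using smooth_on_imp_differentiable[OF sF] by simp
      have eq: "\<And>u. u \<in> S \<Longrightarrow> F (?l u + (0, snd c y)) = G u y" using GF c by simp
      note fd = frechet_derivative_compose_affine[OF l dF]
      show ?thesis
        using frechet_derivative_cong_open[OF S u eq fd(1)] fd(2)[of v] by simp
    qed
    have "(\<lambda>u. G u y) differentiable at u" if "u \<in> S" for u y
    proof -
      obtain c where c: "c \<in> A" "y \<in> fst c" by (rule obtain_chart)
      then show ?thesis using Suc.prems[OF c(1)] loc[OF c that] by blast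
    qed
    moreover have "Ck_param k S (\<lambda>u y. frechet_derivative (\<lambda>u. G u y) (at u) v)" for v
    proof (rule Suc.IH)
      fix c assume c: "c \<in> A"
      obtain F where F: "smooth_on (S \<times> (snd c ` fst c)) F" "\<forall>u\<in>S. \<forall>y\<in>fst c. G u y = F (u, snd c y)"
        using Suc.prems[OF c] by blast
      show "\<exists>F. smooth_on (S \<times> (snd c ` fst c)) F \<and>
        (\<forall>u\<in>S. \<forall>y\<in>fst c. frechet_derivative (\<lambda>u. G u y) (at u) v = F (u, snd c y))"
        by (rule exI[of _ "\<lambda>z. frechet_derivative F (at z) (v, 0)"])
           (use smooth_on_frechet_derivative[OF F(1)] loc[OF c _ _ F] in blast)
    qed
    ultimately show ?case using cont[OF Suc.prems] by simp
  }
qed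

section \<open>Joint smoothness of the kernel and of the flow\<close>

abbreviation spacetime :: "('a, 'b) chart \<Rightarrow> ('b \<times> real) set" where
  "spacetime c \<equiv> (snd c ` fst c) \<times> {0<..}"

lemma open_spacetime: "c \<in> A \<Longrightarrow> open (spacetime c)"
  using open_chart_image by (intro open_Times) auto

lemma Ck_param_kernel:
  assumes c: "c \<in> A"
  shows "Ck_param k (spacetime c) (\<lambda>z y. p (inv_into (fst c) (snd c) (fst z)) y (snd z))"
proof (rule Ck_param_local[OF open_spacetime[OF c]])
  fix c' assume c': "c' \<in> A"
  let ?F = "\<lambda>(u, v, t). p (inv_into (fst c) (snd c) u) (inv_into (fst c') (snd c') v) t"
  \<comment> \<open>Permutes \<open>((u, t), v)\<close> into \<open>(u, v, t)\<close>, the order in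
    which smoothness of the kernel is given.\<close>
  let ?l = "\<lambda>z::('b \<times> real) \<times> 'b. (fst (fst z), snd z, snd (fst z))"
  have l: "bounded_linear ?l"
    by (intro bounded_linear_Pair bounded_linear_compose[OF bounded_linear_fst bounded_linear_fst]
        bounded_linear_compose[OF bounded_linear_snd bounded_linear_fst] bounded_linear_snd)
  have o: "open ((snd c ` fst c) \<times> (snd c' ` fst c') \<times> {0::real<..})"
    using open_chart_image c c' by (intro open_Times) auto
  have "smooth_on {u. ?l u + 0 \<in> (snd c ` fst c) \<times> (snd c' ` fst c') \<times> {0<..}} (\<lambda>u. ?F (?l u + 0))"
    by (rule smooth_on_compose_affine[OF l o p_smooth[OF c c']])
  then have "smooth_on (spacetime c \<times> (snd c' ` fst c')) (\<lambda>u. ?F (?l u + 0))"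
    by (rule smooth_on_subset) auto
  then show "\<exists>F. smooth_on (spacetime c \<times> (snd c' ` fst c')) F \<and>
     (\<forall>u\<in>spacetime c. \<forall>y\<in>fst c'. p (inv_into (fst c) (snd c) (fst u)) y (snd u) = F (u, snd c' y))"
    by (rule_tac exI[of _ "\<lambda>u. ?F (?l u + 0)"]) (use chart_inv[OF c'] in auto)
qed

lemma continuous_kernel:
  assumes t: "t > 0" shows "continuous_on UNIV (\<lambda>z. p (fst z) (snd z) t)"
proof -
  have "isCont (\<lambda>z. p (fst z) (snd z) t) z" for z :: "'a \<times> 'a"
  proof -
    obtain c where c: "c \<in> A" "fst z \<in> fst c" by (rule obtain_chart)
    have "continuous_on (spacetime c \<times> UNIV) (\<lambda>w. p (inv_into (fst c) (snd c) (fst (fst w))) (snd w) (snd (fst w)))"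
      using Ck_param_kernel[OF c(1), of 0] by simp
    moreover have "continuous_on (fst c \<times> UNIV) (\<lambda>w. ((snd c (fst w), t), snd w))"
      by (intro continuous_intros continuous_on_compose2[OF continuous_chart[OF c(1)]]) auto
    ultimately have "continuous_on (fst c \<times> UNIV)
      (\<lambda>w. (\<lambda>w. p (inv_into (fst c) (snd c) (fst (fst w))) (snd w) (snd (fst w))) ((snd c (fst w), t), snd w))"
      by (rule continuous_on_compose2) (use t in auto)
    then have "continuous_on (fst c \<times> UNIV) (\<lambda>w. p (inv_into (fst c) (snd c) (snd c (fst w))) (snd w) t)"
      by simp
    then have "continuous_on (fst c \<times> UNIV) (\<lambda>w. p (fst w) (snd w) t)"
      by (rule continuous_on_eq) (use chart_inv[OF c(1)] in auto)
    moreover have "open (fst c \<times> (UNIV :: 'a set))" using open_chart_domain[OF c(1)] by (intro open_Times) auto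
    moreover have "z \<in> fst c \<times> UNIV" using c by (cases z) auto
    ultimately show ?thesis using continuous_on_eq_continuous_at by blast
  qed
  then show ?thesis by (simp add: continuous_on_eq_continuous_at)
qed

lemma continuous_kernel_right: "t > 0 \<Longrightarrow> continuous_on UNIV (\<lambda>y. p x y t)"
  using continuous_on_compose2[OF continuous_kernel, of t UNIV "\<lambda>y. (x, y)"]
  by (simp add: continuous_on_Pair)

lemma continuous_kernel_left: "t > 0 \<Longrightarrow> continuous_on UNIV (\<lambda>x. p x y t)"
  using continuous_on_compose2[OF continuous_kernel, of t UNIV "\<lambda>x. (x, y)"]
  by (simp add: continuous_on_Pair)

lemma measurable_kernel: "t > 0 \<Longrightarrow> (\<lambda>y. p x y t) \<in> borel_measurable \<mu>"
  using borel_measurable_continuous_onI[OF continuous_kernel_right] measurable_cong_sets[OF sets_\<mu> refl] by blast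

lemma integral_kernel: "t > 0 \<Longrightarrow> (\<integral>y. p x y t \<partial>\<mu>) = 1"
  using fun_cong[OF markov[of t], of x] by (simp add: P_pos)

text \<open>A non-integrable function has Bochner integral 0 by convention, so the value 1 already
  proves integrability.\<close>

lemma integrable_kernel: "t > 0 \<Longrightarrow> integrable \<mu> (\<lambda>y. p x y t)"
  using integral_kernel[of t x] not_integrable_integral_eq by fastforce

lemma integrable_kernel_mult:
  assumes "t > 0" "f \<in> borel_measurable \<mu>" "\<And>x. \<bar>f x\<bar> \<le> B"
  shows "integrable \<mu> (\<lambda>y. p x y t * f y)"
proof (rule Bochner_Integration.integrable_bound)
  show "integrable \<mu> (\<lambda>y. B * p x y t)" using integrable_kernel[OF assms(1)] by simp
  show "(\<lambda>y. p x y t * f y) \<in> borel_measurable \<mu>"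
    by (intro borel_measurable_times measurable_kernel assms)
  show "AE y in \<mu>. norm (p x y t * f y) \<le> norm (B * p x y t)"
  proof (rule AE_I2)
    fix y
    have "\<bar>f y\<bar> \<le> \<bar>B\<bar>" using assms(3)[of y] by linarith
    then show "norm (p x y t * f y) \<le> norm (B * p x y t)"
      using p_pos[OF assms(1), of x y] by (simp add: abs_mult mult.commute mult_right_mono)
  qed
qed

lemma P_mono:
  assumes "t \<ge> 0" "f \<in> borel_measurable \<mu>" "\<And>x. \<bar>f x\<bar> \<le> B"
    and "g \<in> borel_measurable \<mu>" "\<And>x. \<bar>g x\<bar> \<le> B'" and "\<And>x. f x \<le> g x"
  shows "P t f x \<le> P t g x"
proof (cases "t = 0")
  case False
  then have t: "t > 0" using assms by simp
  show ?thesis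
    unfolding P_pos[OF t]
    by (rule integral_mono[OF integrable_kernel_mult[OF t assms(2,3)] integrable_kernel_mult[OF t assms(4,5)]])
       (use p_pos[OF t] assms(6) in \<open>simp add: mult_left_mono less_imp_le\<close>)
qed (simp add: assms)

lemma P_const: "t \<ge> 0 \<Longrightarrow> P t (\<lambda>_. q) x = q"
  using integral_kernel[of t x] by (cases "t = 0") (auto simp: P_pos)

lemma P_le:
  assumes "t \<ge> 0" "f \<in> borel_measurable \<mu>" "\<And>x. \<bar>f x\<bar> \<le> B" "\<And>x. f x \<le> q"
  shows "P t f x \<le> q"
  using P_mono[OF assms(1-3), of "\<lambda>_. q" "\<bar>q\<bar>"] assms(4) P_const[OF assms(1)] by auto

lemma P_ge:
  assumes "t \<ge> 0" "f \<in> borel_measurable \<mu>" "\<And>x. \<bar>f x\<bar> \<le> B" "\<And>x. q \<le> f x"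
  shows "q \<le> P t f x"
  using P_mono[OF assms(1) _ _ assms(2-3), of "\<lambda>_. q" "\<bar>q\<bar>"] assms(4) P_const[OF assms(1)] by auto

lemma P_abs_le:
  assumes "t \<ge> 0" "f \<in> borel_measurable \<mu>" "\<And>x. \<bar>f x\<bar> \<le> B"
  shows "\<bar>P t f x\<bar> \<le> B"
  using P_le[OF assms, of B] P_ge[OF assms, of "-B"] assms(3) by (auto simp: abs_le_iff minus_le_iff)

lemma P_lincomb:
  assumes "t \<ge> 0" "f \<in> borel_measurable \<mu>" "\<And>x. \<bar>f x\<bar> \<le> B"
    and "g \<in> borel_measurable \<mu>" "\<And>x. \<bar>g x\<bar> \<le> B'"
  shows "P t (\<lambda>y. a * f y + b * g y) x = a * P t f x + b * P t g x"
proof (cases "t = 0")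
  case False
  then have t: "t > 0" using assms by simp
  have "(\<lambda>y. p x y t * (a * f y + b * g y)) = (\<lambda>y. a * (p x y t * f y) + b * (p x y t * g y))"
    by (simp add: algebra_simps)
  then show ?thesis
    using integrable_kernel_mult[OF t assms(2,3), of x] integrable_kernel_mult[OF t assms(4,5), of x]
    by (simp add: P_pos[OF t])
qed simp

text \<open>Smoothness is joint in space and time, which is what later permits the exchange of time
  and space derivatives.\<close>

lemma smooth_on_P:
  assumes f: "f \<in> T" and c: "c \<in> A"
  shows "smooth_on (spacetime c) (\<lambda>z. P (snd z) f (inv_into (fst c) (snd c) (fst z)))"
proof -
  let ?G = "\<lambda>z y. p (inv_into (fst c) (snd c) (fst z)) y (snd z)"
  have "Ck_on k (spacetime c) (\<lambda>z. \<integral>y. ?G z y * f y \<partial>\<mu>)" for k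
  proof (rule Ck_on_integral_param[OF sets_\<mu> Ctest_integrable[OF f] Ctest_compact[OF f] _
          open_spacetime[OF c] Ck_param_kernel[OF c]])
    show "f y = 0" if "y \<notin> closure {x. f x \<noteq> 0}" for y using that by (rule Ctest_zero)
  qed
  then have "smooth_on (spacetime c) (\<lambda>z. \<integral>y. ?G z y * f y \<partial>\<mu>)" by (simp add: smooth_on_def)
  then show ?thesis by (rule smooth_on_cong[OF open_spacetime[OF c], rotated]) (auto simp: P_pos)
qed

lemma spatial_slice:
  assumes c: "c \<in> A" and F: "smooth_on (spacetime c) F" and t: "t > 0"
  shows "smooth_on (snd c ` fst c) (\<lambda>u. F (u, t))"
    and "u \<in> snd c ` fst c \<Longrightarrow> pd v (\<lambda>u. F (u, t)) u = frechet_derivative F (at (u, t)) (v, 0)"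
proof -
  let ?l = "\<lambda>u::'b. (u, 0::real)"
  have l: "bounded_linear ?l" by (intro bounded_linear_Pair bounded_linear_ident bounded_linear_zero)
  have "smooth_on {u. ?l u + (0, t) \<in> spacetime c} (\<lambda>u. F (?l u + (0, t)))"
    by (rule smooth_on_compose_affine[OF l open_spacetime[OF c] F])
  then show "smooth_on (snd c ` fst c) (\<lambda>u. F (u, t))"
    using smooth_on_subset[of _ _ "snd c ` fst c"] t by auto
  show "pd v (\<lambda>u. F (u, t)) u = frechet_derivative F (at (u, t)) (v, 0)" if "u \<in> snd c ` fst c"
    using frechet_derivative_compose_affine(2)[OF l, of F u "(0, t)" v]
      smooth_on_imp_differentiable[OF F, of "(u, t)"] that t by auto
qed

lemma time_slice:
  assumes c: "c \<in> A" and F: "smooth_on (spacetime c) F" and t: "t > 0" and u: "u \<in> snd c ` fst c"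
  shows "((\<lambda>s. F (u, s)) has_real_derivative frechet_derivative F (at (u, t)) (0, 1)) (at t)"
  using DERIV_along_line[of F "(u, 0)" t "(0, 1)"] smooth_on_imp_differentiable[OF F, of "(u, t)"] t u
  by simp

lemma P_smooth:
  assumes f: "f \<in> T" and t: "t \<ge> 0" shows "P t f \<in> C"
proof (cases "t = 0")
  case True then show ?thesis using Ctest_Csmooth[OF f] by simp
next
  case False
  show ?thesis
  proof (rule CsmoothI)
    fix c assume c: "c \<in> A"
    show "smooth_on (snd c ` fst c) (in_chart c (P t f))"
      using spatial_slice(1)[OF c smooth_on_P[OF f c], of t] t False by (simp add: in_chart_def o_def)
  qed
qed

lemma P_bounded:
  assumes "f \<in> T" shows "\<exists>B\<ge>0. \<forall>t\<ge>0. \<forall>x. \<bar>P t f x\<bar> \<le> B"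
proof -
  obtain B where "B \<ge> 0" "\<And>x. \<bar>f x\<bar> \<le> B" using Ctest_bounded[OF assms] by blast
  then show ?thesis
    using P_abs_le[OF _ Csmooth_measurable[OF Ctest_Csmooth[OF assms]]] by blast
qed

end

lemma L2_lincomb:
  assumes "u \<in> L2 \<mu>" "v \<in> L2 \<mu>"
  shows "(\<lambda>x. a * u x + b * v x) \<in> L2 \<mu>"
proof -
  have m: "u \<in> borel_measurable \<mu>" "v \<in> borel_measurable \<mu>"
    and i: "integrable \<mu> (\<lambda>x. (u x)\<^sup>2)" "integrable \<mu> (\<lambda>x. (v x)\<^sup>2)"
    using assms by (auto simp: L2_def)
  have "integrable \<mu> (\<lambda>x. (a * u x + b * v x)\<^sup>2)"
  proof (rule Bochner_Integration.integrable_bound)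
    show "integrable \<mu> (\<lambda>x. 2 * a\<^sup>2 * (u x)\<^sup>2 + 2 * b\<^sup>2 * (v x)\<^sup>2)" using i by simp
    show "(\<lambda>x. (a * u x + b * v x)\<^sup>2) \<in> borel_measurable \<mu>" using m by measurable
    have "(y + z)\<^sup>2 \<le> 2 * y\<^sup>2 + 2 * z\<^sup>2" for y z :: real
      using zero_le_power2[of "y - z"] by (simp add: power2_eq_square algebra_simps)
    then have "(a * u x + b * v x)\<^sup>2 \<le> 2 * a\<^sup>2 * (u x)\<^sup>2 + 2 * b\<^sup>2 * (v x)\<^sup>2" for x
      by (metis mult.assoc power_mult_distrib)
    then show "AE x in \<mu>. norm ((a * u x + b * v x)\<^sup>2) \<le> norm (2 * a\<^sup>2 * (u x)\<^sup>2 + 2 * b\<^sup>2 * (v x)\<^sup>2)"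
      by (intro AE_I2) (smt (verit) real_norm_def zero_le_power2)
  qed
  then show ?thesis using m by (simp add: L2_def)
qed

section \<open>The time derivative and the symmetry of the flow\<close>

context heat
begin

lemma generated: "generated_semigroup A \<mu> L P"
  using kernel by (simp add: heat_kernel_def)

lemma P_L2: "t \<ge> 0 \<Longrightarrow> u \<in> L2 \<mu> \<Longrightarrow> P t u \<in> L2 \<mu>"
  using generated unfolding generated_semigroup_def by blast

lemma P_contraction: "t \<ge> 0 \<Longrightarrow> u \<in> L2 \<mu> \<Longrightarrow> (\<integral>x. (P t u x)\<^sup>2 \<partial>\<mu>) \<le> (\<integral>x. (u x)\<^sup>2 \<partial>\<mu>)"
  using generated unfolding generated_semigroup_def by blast

lemma P_semigroup_AE: "s \<ge> 0 \<Longrightarrow> t \<ge> 0 \<Longrightarrow> u \<in> L2 \<mu> \<Longrightarrow> AE x in \<mu>. P (s + t) u x = P s (P t u) x"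
  using generated unfolding generated_semigroup_def by blast

text \<open>A test function lies in the domain of the closure through the constant sequence, with
  value \<open>L f\<close>, so its strong derivative at time 0 in \<open>L2 \<mu>\<close> is
  \<open>L f\<close>.\<close>

lemma P_generator:
  assumes f: "f \<in> T"
  shows "((\<lambda>t. \<integral>x. ((P t f x - f x) / t - L f x)\<^sup>2 \<partial>\<mu>) \<longlongrightarrow> 0) (at_right 0)"
proof -
  have "closure_graph A \<mu> L f (L f)"
    unfolding closure_graph_def using f Ctest_L2 Ctest_L by (auto intro!: exI[of _ "\<lambda>_. f"])
  then show ?thesis
    using generated Ctest_L2[OF f] Ctest_L2[OF Ctest_L[OF f]] unfolding generated_semigroup_def by blast
qed

lemma P_strong_continuity:
  assumes f: "f \<in> T"
  shows "((\<lambda>t. \<integral>x. (P t f x - f x)\<^sup>2 \<partial>\<mu>) \<longlongrightarrow> 0) (at_right 0)"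
  using generated Ctest_L2[OF f] unfolding generated_semigroup_def by blast

lemma Ctest_measurable: "f \<in> T \<Longrightarrow> f \<in> borel_measurable \<mu>"
  by (intro Csmooth_measurable Ctest_Csmooth)

text \<open>\<open>deriv\<close> provides one function of \<open>x\<close> for all charts. Its
  continuity is what \<open>continuous_AE_eq\<close> asks for when the derivative is identified in
  \<open>P_deriv\<close>.\<close>

lemma P_time_derivative_continuous:
  assumes f: "f \<in> T" and t: "t > 0"
  shows "\<exists>D. continuous_on UNIV D \<and> (\<forall>x. ((\<lambda>s. P s f x) has_real_derivative D x) (at t))"
proof -
  define D where "D x = deriv (\<lambda>s. P s f x) t" for x
  have loc: "((\<lambda>s. P s f x) has_real_derivative
      frechet_derivative (\<lambda>z. P (snd z) f (inv_into (fst c) (snd c) (fst z))) (at (snd c x, t)) (0, 1)) (at t)"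
    if c: "c \<in> A" "x \<in> fst c" for c x
    using time_slice[OF c(1) smooth_on_P[OF f c(1)] t, of "snd c x"] c chart_inv[OF c] by simp
  have D: "((\<lambda>s. P s f x) has_real_derivative D x) (at t)" for x
  proof -
    obtain c where c: "c \<in> A" "x \<in> fst c" by (rule obtain_chart)
    show ?thesis unfolding D_def DERIV_imp_deriv[OF loc[OF c]] by (rule loc[OF c])
  qed
  have "isCont D x" for x
  proof -
    obtain c where c: "c \<in> A" "x \<in> fst c" by (rule obtain_chart)
    let ?d = "\<lambda>z. frechet_derivative (\<lambda>z. P (snd z) f (inv_into (fst c) (snd c) (fst z))) (at z) (0, 1)"
    have "continuous_on (spacetime c) ?d"
      by (intro smooth_on_imp_continuous_on smooth_on_frechet_derivative smooth_on_P f c)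
    moreover have "continuous_on (fst c) (\<lambda>y. (snd c y, t))"
      by (intro continuous_intros continuous_chart[OF c(1)])
    ultimately have "continuous_on (fst c) (\<lambda>y. ?d (snd c y, t))"
      by (rule continuous_on_compose2) (use t in auto)
    then have "continuous_on (fst c) D"
      by (rule continuous_on_eq) (use DERIV_unique[OF loc[OF c(1)] D] in blast)
    then show ?thesis using c open_chart_domain continuous_on_eq_continuous_at by blast
  qed
  then show ?thesis using D by (intro exI[of _ D]) (simp add: continuous_on_eq_continuous_at)
qed

text \<open>At time 0 the difference quotients converge to \<open>L f\<close> in
  \<open>L2 \<mu>\<close>. The semigroup law and the contraction property carry this to time
  \<open>t\<close>, where they converge to \<open>P t (L f)\<close> in \<open>L2 \<mu>\<close> and,
  along a subsequence, almost everywhere. Pointwise they converge to the derivative known from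
  smoothness, and both limits are continuous.\<close>

lemma P_deriv:
  assumes f: "f \<in> T" and t: "t > 0"
  shows "((\<lambda>s. P s f x) has_real_derivative P t (L f) x) (at t)"
proof -
  obtain D where contD: "continuous_on UNIV D"
    and D: "\<And>x. ((\<lambda>s. P s f x) has_real_derivative D x) (at t)"
    using P_time_derivative_continuous[OF assms] by blast
  note Lf = Ctest_L[OF f]
  define s where "s n = 1 / real (Suc n)" for n
  have s: "s n > 0" "s n \<noteq> 0" for n by (simp_all add: s_def)
  have s0: "s \<longlonglongrightarrow> 0" unfolding s_def using LIMSEQ_inverse_real_of_nat by (simp add: inverse_eq_divide)
  \<comment> \<open>\<open>q n\<close> is the error of the difference quotient at time 0 and
    \<open>w n\<close>, defined next, the error at time \<open>t\<close>; the semigroup law gives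
    \<open>w n = P t (q n)\<close> almost everywhere.\<close>
  define q where "q n x = (P (s n) f x - f x) / s n - L f x" for n x
  define w where "w n x = (P (t + s n) f x - P t f x) / s n - P t (L f) x" for n x
  have t0: "t \<ge> 0" using t by simp
  have s00: "s n \<ge> 0" for n using s(1)[of n] by simp
  have qL2: "q n \<in> L2 \<mu>" for n
  proof -
    have "(\<lambda>x. 1 * (\<lambda>x. (1 / s n) * P (s n) f x + (- 1 / s n) * f x) x + (-1) * L f x) \<in> L2 \<mu>"
      by (intro L2_lincomb P_L2 Ctest_L2 f Lf s00)
    moreover have "(\<lambda>x. 1 * (\<lambda>x. (1 / s n) * P (s n) f x + (- 1 / s n) * f x) x + (-1) * L f x) = q n"
      by (auto simp: q_def fun_eq_iff diff_divide_distrib)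
    ultimately show ?thesis by simp
  qed
  have wP: "AE x in \<mu>. w n x = P t (q n) x" for n
  proof -
    obtain B1 where B1: "\<And>x. \<bar>P (s n) f x\<bar> \<le> B1" using P_bounded[OF f] s00 by blast
    obtain B2 where B2: "\<And>x. \<bar>f x\<bar> \<le> B2" using Ctest_bounded[OF f] by blast
    obtain B3 where B3: "\<And>x. \<bar>L f x\<bar> \<le> B3" using Ctest_bounded[OF Lf] by blast
    note m = Csmooth_measurable[OF P_smooth[OF f s00[of n]]] Ctest_measurable[OF f] Ctest_measurable[OF Lf]
    let ?u = "\<lambda>x. (1 / s n) * P (s n) f x + (- 1 / s n) * f x"
    have bu: "\<bar>?u x\<bar> \<le> B1 / s n + B2 / s n" for x
    proof -
      have "\<bar>?u x\<bar> \<le> \<bar>(1 / s n) * P (s n) f x\<bar> + \<bar>(- 1 / s n) * f x\<bar>" by (rule abs_triangle_ineq)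
      also have "\<dots> = \<bar>P (s n) f x\<bar> / s n + \<bar>f x\<bar> / s n" using s[of n] by (simp add: abs_mult)
      also have "\<dots> \<le> B1 / s n + B2 / s n" using B1[of x] B2[of x] s[of n]
        by (intro add_mono divide_right_mono) auto
      finally show ?thesis .
    qed
    have mu: "?u \<in> borel_measurable \<mu>" using m by measurable
    have eq: "P t (q n) x = (P t (P (s n) f) x - P t f x) / s n - P t (L f) x" for x
    proof -
      have "q n = (\<lambda>x. 1 * ?u x + (-1) * L f x)" by (auto simp: q_def fun_eq_iff diff_divide_distrib)
      then have "P t (q n) x = 1 * P t ?u x + (-1) * P t (L f) x"
        using P_lincomb[OF t0 mu bu m(3) B3, of 1 "-1" x] by simp
      also have "P t ?u x = (1 / s n) * P t (P (s n) f) x + (- 1 / s n) * P t f x"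
        by (rule P_lincomb[OF t0 m(1) B1 m(2) B2])
      finally show ?thesis by (simp add: diff_divide_distrib)
    qed
    show ?thesis
      using P_semigroup_AE[OF t0 s00[of n] Ctest_L2[OF f]]
      by eventually_elim (simp add: eq w_def)
  qed
  have wm: "w n \<in> borel_measurable \<mu>" for n
    unfolding w_def using Csmooth_measurable[OF P_smooth[OF f]] Csmooth_measurable[OF P_smooth[OF Lf t0]] t0 s00[of n]
    by (intro borel_measurable_diff borel_measurable_divide borel_measurable_const) auto
  have wint: "integrable \<mu> (\<lambda>x. (w n x)\<^sup>2)" and wle: "(\<integral>x. (w n x)\<^sup>2 \<partial>\<mu>) \<le> (\<integral>x. (q n x)\<^sup>2 \<partial>\<mu>)" for n
  proof -
    have L2P: "P t (q n) \<in> L2 \<mu>" by (rule P_L2[OF t0 qL2])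
    have ae: "AE x in \<mu>. (w n x)\<^sup>2 = (P t (q n) x)\<^sup>2" using wP[of n] by eventually_elim simp
    have mm: "(\<lambda>x. (w n x)\<^sup>2) \<in> borel_measurable \<mu>" "(\<lambda>x. (P t (q n) x)\<^sup>2) \<in> borel_measurable \<mu>"
      using wm L2P by (auto simp: L2_def)
    show "integrable \<mu> (\<lambda>x. (w n x)\<^sup>2)"
      using integrable_cong_AE[OF mm ae] L2P by (simp add: L2_def)
    show "(\<integral>x. (w n x)\<^sup>2 \<partial>\<mu>) \<le> (\<integral>x. (q n x)\<^sup>2 \<partial>\<mu>)"
      using integral_cong_AE[OF mm ae] P_contraction[OF t0 qL2, of n] by simp
  qed
  have q0: "(\<lambda>n. \<integral>x. (q n x)\<^sup>2 \<partial>\<mu>) \<longlonglongrightarrow> 0"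
    unfolding q_def
    by (rule filterlim_compose[OF P_generator[OF f]])
       (use s s0 in \<open>auto simp: filterlim_at intro!: always_eventually\<close>)
  have "(\<lambda>n. \<integral>x. (w n x)\<^sup>2 \<partial>\<mu>) \<longlonglongrightarrow> 0"
    by (rule tendsto_sandwich[OF _ _ tendsto_const q0]) (use wle in \<open>auto intro!: always_eventually\<close>)
  then have "(\<lambda>n. \<integral>x. norm ((w n x)\<^sup>2) \<partial>\<mu>) \<longlonglongrightarrow> 0" by simp
  from tendsto_L1_AE_subseq[OF wint this] obtain r where r: "strict_mono r"
    "AE x in \<mu>. (\<lambda>n. (w (r n) x)\<^sup>2) \<longlonglongrightarrow> 0" by blast
  have "AE x in \<mu>. D x = P t (L f) x"
    using r(2)
  proof eventually_elim
    fix x assume "(\<lambda>n. (w (r n) x)\<^sup>2) \<longlonglongrightarrow> 0"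
    then have "(\<lambda>n. sqrt ((w (r n) x)\<^sup>2)) \<longlonglongrightarrow> sqrt 0" by (rule tendsto_real_sqrt)
    then have w0: "(\<lambda>n. w (r n) x) \<longlonglongrightarrow> 0" by (simp add: tendsto_rabs_zero_iff)
    have "((\<lambda>h. (P (t + h) f x - P t f x) / h) \<longlongrightarrow> D x) (at 0)"
      using D[of x] by (simp add: DERIV_def)
    then have "(\<lambda>n. (P (t + s n) f x - P t f x) / s n) \<longlonglongrightarrow> D x"
      by (rule filterlim_compose) (use s s0 in \<open>auto simp: filterlim_at intro!: always_eventually\<close>)
    then have "(\<lambda>n. w n x) \<longlonglongrightarrow> D x - P t (L f) x" unfolding w_def by (intro tendsto_diff) auto
    then have "(\<lambda>n. w (r n) x) \<longlonglongrightarrow> D x - P t (L f) x"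
      using r(1) LIMSEQ_subseq_LIMSEQ[unfolded o_def] by blast
    then show "D x = P t (L f) x" using w0 LIMSEQ_unique by fastforce
  qed
  then have "D x = P t (L f) x"
    using continuous_AE_eq[OF contD Csmooth_continuous[OF P_smooth[OF Lf t0]]] by blast
  then show ?thesis using D[of x] by simp
qed

lemma sigma_finite_\<mu>: "sigma_finite_measure \<mu>"
proof
  let ?K = "\<lambda>k. closure {x. h k x \<noteq> 0}"
  have "x \<in> (\<Union>k. ?K k)" for x
  proof -
    obtain k where "h k x > 1/2"
      using order_tendstoD(1)[OF h_lim[of x], of "1/2"] eventually_happens by force
    then have "h k x \<noteq> 0" by simp
    then have "x \<in> ?K k" using Ctest_zero[of x "h k"] by blast
    then show ?thesis by blast
  qed
  moreover have "?K k \<in> sets \<mu>" "emeasure \<mu> (?K k) < \<infinity>" for k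
    using \<mu>_compact_finite[OF Ctest_compact[OF h_test]] by (auto simp: sets_\<mu>)
  ultimately show "\<exists>\<A>. countable \<A> \<and> \<A> \<subseteq> sets \<mu> \<and> \<Union> \<A> = space \<mu> \<and> (\<forall>a\<in>\<A>. emeasure \<mu> a \<noteq> \<infinity>)"
    by (intro exI[of _ "range ?K"]) (auto simp: less_top)
qed

text \<open>Fubini together with the symmetry of the kernel. Absolute integrability holds because
  \<open>g\<close> is bounded and the kernel has unit mass, which leaves a multiple of
  \<open>f\<close> after the inner integration.\<close>

lemma P_symmetric:
  assumes t: "t \<ge> 0" and f: "integrable \<mu> f" and g: "g \<in> borel_measurable \<mu>" "\<And>x. \<bar>g x\<bar> \<le> B"
  shows "(\<integral>x. g x * P t f x \<partial>\<mu>) = (\<integral>x. f x * P t g x \<partial>\<mu>)"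
proof (cases "t = 0")
  case True
  then show ?thesis by (simp add: mult.commute)
next
  case False
  then have t: "t > 0" using assms by simp
  interpret pair_sigma_finite \<mu> \<mu>
    using sigma_finite_\<mu> by (simp add: pair_sigma_finite_def)
  have fm: "f \<in> borel_measurable \<mu>" using f by auto
  have pm: "(\<lambda>z. p (fst z) (snd z) t) \<in> borel_measurable (\<mu> \<Otimes>\<^sub>M \<mu>)"
  proof -
    have "sets (\<mu> \<Otimes>\<^sub>M \<mu>) = sets (borel \<Otimes>\<^sub>M (borel :: 'a measure))"
      by (rule sets_pair_measure_cong[OF sets_\<mu> sets_\<mu>])
    \<comment> \<open>Second countability identifies the product of the Borel sigma-algebras with
      the Borel sigma-algebra of the product, so joint continuity of the kernel gives joint
      measurability.\<close>
    then have "sets (\<mu> \<Otimes>\<^sub>M \<mu>) = sets (borel :: ('a \<times> 'a) measure)"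
      unfolding borel_prod .
    from measurable_cong_sets[OF this refl] show ?thesis
      using borel_measurable_continuous_onI[OF continuous_kernel[OF t]] by blast
  qed
  have int: "integrable (\<mu> \<Otimes>\<^sub>M \<mu>) (\<lambda>(y, x). g x * p x y t * f y)"
  proof (rule Fubini_integrable)
    show "(\<lambda>(y, x). g x * p x y t * f y) \<in> borel_measurable (\<mu> \<Otimes>\<^sub>M \<mu>)"
      using pm fm g(1) by (simp add: p_sym[OF t]) measurable
    have intx: "integrable \<mu> (\<lambda>x. g x * p x y t)" for y
      using integrable_kernel_mult[OF t g, of y] by (simp add: p_sym[OF t, of y] mult.commute)
    show "AE y in \<mu>. integrable \<mu> (\<lambda>x. case (y, x) of (y, x) \<Rightarrow> g x * p x y t * f y)"
      using intx by simp
    show "integrable \<mu> (\<lambda>y. \<integral>x. norm (case (y, x) of (y, x) \<Rightarrow> g x * p x y t * f y) \<partial>\<mu>)"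
    proof (rule Bochner_Integration.integrable_bound)
      show "integrable \<mu> (\<lambda>y. B * f y)" using f by simp
      have "(\<lambda>(y, x). norm (g x * p x y t * f y)) \<in> borel_measurable (\<mu> \<Otimes>\<^sub>M \<mu>)"
        using pm fm g(1) by (simp add: p_sym[OF t]) measurable
      then show "(\<lambda>y. \<integral>x. norm (case (y, x) of (y, x) \<Rightarrow> g x * p x y t * f y) \<partial>\<mu>) \<in> borel_measurable \<mu>"
        using sigma_finite_measure.borel_measurable_lebesgue_integral[OF sigma_finite_\<mu>] by simp
      have "(\<integral>x. norm (g x * p x y t * f y) \<partial>\<mu>) \<le> B * \<bar>f y\<bar>" for y
      proof -
        have "(\<integral>x. norm (g x * p x y t * f y) \<partial>\<mu>) \<le> (\<integral>x. B * \<bar>f y\<bar> * p y x t \<partial>\<mu>)"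
        proof (rule integral_mono)
          show "integrable \<mu> (\<lambda>x. norm (g x * p x y t * f y))" using intx by simp
          show "integrable \<mu> (\<lambda>x. B * \<bar>f y\<bar> * p y x t)" using integrable_kernel[OF t] by simp
          show "norm (g x * p x y t * f y) \<le> B * \<bar>f y\<bar> * p y x t" for x
          proof -
            have "norm (g x * p x y t * f y) = \<bar>g x\<bar> * (\<bar>f y\<bar> * p y x t)"
              using p_pos[OF t, of y x] by (simp add: abs_mult p_sym[OF t, of x y])
            also have "\<dots> \<le> B * (\<bar>f y\<bar> * p y x t)"
              using g(2)[of x] p_pos[OF t, of y x] by (intro mult_right_mono) auto
            finally show ?thesis by (simp add: mult.assoc)
          qed
        qed
        also have "\<dots> = B * \<bar>f y\<bar>" using integral_kernel[OF t] by simp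
        finally show ?thesis .
      qed
      moreover have "0 \<le> B" using g(2)[of undefined] by linarith
      ultimately show "AE y in \<mu>. norm (\<integral>x. norm (case (y, x) of (y, x) \<Rightarrow> g x * p x y t * f y) \<partial>\<mu>) \<le> norm (B * f y)"
        by (intro AE_I2) (simp add: abs_mult)
    qed
  qed
  have "(\<integral>x. g x * P t f x \<partial>\<mu>) = (\<integral>x. (\<integral>y. g x * p x y t * f y \<partial>\<mu>) \<partial>\<mu>)"
    by (simp add: P_pos[OF t] mult.assoc)
  also have "\<dots> = (\<integral>y. (\<integral>x. g x * p x y t * f y \<partial>\<mu>) \<partial>\<mu>)"
    by (rule Fubini_integral[OF int])
  also have "\<dots> = (\<integral>y. f y * P t g y \<partial>\<mu>)"
    by (simp add: P_pos[OF t] p_sym[OF t, of _ y for y] mult.commute)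
  finally show ?thesis .
qed

end

section \<open>Smooth cutoffs and integration by parts\<close>

text \<open>A family of functions closed under differentiation, hence smooth across 0: with
  \<open>u = 1 / y\<close>, the derivative acts on the polynomial as
  \<open>q \<mapsto> u^2 (q - q')\<close>.\<close>

definition flat :: "real poly \<Rightarrow> real \<Rightarrow> real" where
  "flat q y = (if y \<le> 0 then 0 else poly q (inverse y) * exp (- inverse y))"

lemma poly_mult_exp_tendsto_0:
  fixes q :: "real poly"
  shows "((\<lambda>u. poly q u * exp (- u)) \<longlongrightarrow> 0) at_top"
proof -
  have "((\<lambda>u. \<Sum>i\<le>degree q. coeff q i * (u ^ i / exp u)) \<longlongrightarrow> (\<Sum>i\<le>degree q. coeff q i * 0)) at_top"
    by (intro tendsto_sum tendsto_mult tendsto_const tendsto_power_div_exp_0)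
  moreover have "(\<lambda>u. \<Sum>i\<le>degree q. coeff q i * (u ^ i / exp u)) = (\<lambda>u. poly q u * exp (- u))"
    by (auto simp: fun_eq_iff poly_altdef sum_distrib_right exp_minus divide_inverse mult.assoc)
  ultimately show ?thesis by simp
qed

text \<open>Only the point 0 needs an argument: to the right of it, the quotient
  \<open>flat q h / h\<close> equals \<open>u q(u) exp (- u)\<close> with \<open>u = 1 / h\<close>,
  which tends to 0 as \<open>u\<close> grows.\<close>

lemma flat_DERIV:
  "(flat q has_real_derivative flat ([:0, 0, 1:] * (q - pderiv q)) y) (at y)"
proof -
  consider "y < 0" | "y = 0" | "y > 0" by linarith
  then show ?thesis
  proof cases
    case 1
    have "((\<lambda>_. 0) has_real_derivative 0) (at y)" by simp
    then have "(flat q has_real_derivative 0) (at y)"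
      by (rule has_field_derivative_transform_within_open[of _ _ _ "{..<0}"])
         (use 1 in \<open>auto simp: flat_def\<close>)
    then show ?thesis using 1 by (simp add: flat_def)
  next
    case 3
    have "((\<lambda>y. poly q (inverse y) * exp (- inverse y)) has_real_derivative
      flat ([:0, 0, 1:] * (q - pderiv q)) y) (at y)"
      using 3 unfolding flat_def
      by (auto intro!: derivative_eq_intros poly_DERIV[THEN DERIV_chain2] simp: power2_eq_square algebra_simps)
    then show ?thesis
      by (rule has_field_derivative_transform_within_open[of _ _ _ "{0<..}"])
         (use 3 in \<open>auto simp: flat_def\<close>)
  next
    case 2
    have "((\<lambda>u. poly ([:0, 1:] * q) u * exp (- u)) \<longlongrightarrow> 0) at_top" by (rule poly_mult_exp_tendsto_0)
    then have "((\<lambda>h. poly ([:0, 1:] * q) (inverse h) * exp (- inverse h)) \<longlongrightarrow> 0) (at_right 0)"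
      by (rule filterlim_compose) (rule filterlim_inverse_at_top_right)
    then have "((\<lambda>h. flat q h / h) \<longlongrightarrow> 0) (at_right 0)"
      by (rule tendsto_cong[THEN iffD1, rotated])
         (auto simp: eventually_at_filter flat_def divide_inverse)
    moreover have "((\<lambda>h. flat q h / h) \<longlongrightarrow> 0) (at_left 0)"
      by (rule tendsto_cong[THEN iffD1, OF _ tendsto_const])
         (auto simp: eventually_at_filter flat_def)
    ultimately have "((\<lambda>h. flat q h / h) \<longlongrightarrow> 0) (at 0)" by (intro filterlim_split_at)
    then show ?thesis using 2 by (simp add: DERIV_def flat_def)
  qed
qed

lemma exp_minus_inverse_le:
  assumes "0 < (y::real)" shows "exp (- inverse y) \<le> 2 * y\<^sup>2"
proof -
  define u where "u = inverse y"
  have u: "u > 0" using assms by (simp add: u_def)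
  have "u\<^sup>2 / 2 \<le> exp u" using exp_lower_Taylor_quadratic[of u] u by simp
  then have "exp (- u) \<le> inverse (u\<^sup>2 / 2)"
    unfolding exp_minus using u by (intro le_imp_inverse_le) auto
  also have "\<dots> = 2 * y\<^sup>2" using assms by (simp add: u_def power2_eq_square field_simps)
  finally show ?thesis by (simp add: u_def)
qed

text \<open>A smooth substitute for the square of the positive part in the energy estimate of the
  maximum principle.\<close>

definition bump :: "real \<Rightarrow> real" where "bump = flat 1"
definition bump' :: "real \<Rightarrow> real" where "bump' = flat [:0, 0, 1:]"
definition bump'' :: "real \<Rightarrow> real" where "bump'' = flat ([:0, 0, 1:] * ([:0, 0, 1:] - pderiv [:0, 0, 1:]))"

lemma bump_DERIV: "(bump has_real_derivative bump' y) (at y)"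
  using flat_DERIV[of 1 y] by (simp add: bump_def bump'_def pderiv_1)

lemma bump'_DERIV: "(bump' has_real_derivative bump'' y) (at y)"
  using flat_DERIV[of "[:0, 0, 1:]" y] by (simp only: bump'_def bump''_def)

lemma bump_le_0: "y \<le> 0 \<Longrightarrow> bump y = 0" "y \<le> 0 \<Longrightarrow> bump' y = 0" "y \<le> 0 \<Longrightarrow> bump'' y = 0"
  by (auto simp: bump_def bump'_def bump''_def flat_def)

lemma bump_pos: "y > 0 \<Longrightarrow> bump y > 0"
  by (simp add: bump_def flat_def)

lemma bump_nonneg: "bump y \<ge> 0" "bump' y \<ge> 0"
  by (auto simp: bump_def bump'_def flat_def)

lemma bump_le: "0 < y \<Longrightarrow> bump y \<le> 2 * y\<^sup>2"
  using exp_minus_inverse_le[of y] by (simp add: bump_def flat_def)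

lemma bump'_le: "bump' y \<le> 2"
proof (cases "y \<le> 0")
  case False
  then have y: "y > 0" by simp
  have "bump' y = (inverse y)\<^sup>2 * exp (- inverse y)"
    using y by (simp add: bump'_def flat_def power2_eq_square)
  also have "\<dots> \<le> (inverse y)\<^sup>2 * (2 * y\<^sup>2)"
    using exp_minus_inverse_le[OF y] by (intro mult_left_mono) auto
  also have "\<dots> = 2" using y by (simp add: power2_eq_square field_simps)
  finally show ?thesis .
qed (simp add: bump_le_0)

text \<open>In terms of \<open>u = 1 / y\<close>, the second derivative is
  \<open>u^2 (u^2 - 2 u) exp (- u)\<close>, and \<open>u \<ge> 4\<close> makes
  \<open>u^2 - 2 u \<ge> u^2 / 2\<close>; this is where 1 / 4 comes from. The second inequality is
  what lets convexity absorb the error caused by a spatial cutoff.\<close>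

lemma bump_convex:
  assumes "y \<le> 1 / 4"
  shows "0 \<le> bump'' y" "(bump' y)\<^sup>2 \<le> bump'' y * (4 * (max y 0)\<^sup>2)"
proof -
  have "0 \<le> bump'' y \<and> (bump' y)\<^sup>2 \<le> bump'' y * (4 * (max y 0)\<^sup>2)"
  proof (cases "y \<le> 0")
    case False
    then have y: "y > 0" by simp
    define u where "u = inverse y"
    have u: "u \<ge> 4" using assms y by (simp add: u_def field_simps)
    have b2: "bump'' y = u * u * (u * u - 2 * u) * exp (- u)"
      using y by (simp add: bump''_def flat_def u_def pderiv_pCons algebra_simps)
    have b1: "bump' y = u * u * exp (- u)"
      using y by (simp add: bump'_def flat_def u_def algebra_simps)
    have "4 * u \<le> u * u" using u by (intro mult_right_mono) auto
    then have h: "u * u - 2 * u \<ge> u * u / 2" by linarith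
    have "0 \<le> u * u / 2" by simp
    then have "0 \<le> u * u - 2 * u" using h by linarith
    then have n: "0 \<le> bump'' y" unfolding b2 using u by (intro mult_nonneg_nonneg) auto
    have "(bump' y)\<^sup>2 = u * u * (u * u) * exp (- u) * exp (- u)"
      unfolding b1 by (simp add: power2_eq_square algebra_simps)
    also have "\<dots> \<le> u * u * (u * u) * exp (- u) * (2 * y\<^sup>2)"
      using exp_minus_inverse_le[OF y] unfolding u_def[symmetric] using u by (intro mult_left_mono) auto
    also have "\<dots> = (u * u * (u * u / 2) * exp (- u)) * (4 * y\<^sup>2)" by simp
    also have "\<dots> \<le> bump'' y * (4 * y\<^sup>2)"
      unfolding b2 using h u by (intro mult_right_mono mult_left_mono) auto
    finally show ?thesis using n y by (simp add: max_def)
  qed (simp add: bump_le_0)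
  then show "0 \<le> bump'' y" "(bump' y)\<^sup>2 \<le> bump'' y * (4 * (max y 0)\<^sup>2)" by auto
qed

lemma (in diffusion) Csmooth_flat:
  assumes f: "f \<in> C" shows "(\<lambda>x. flat q (f x)) \<in> C"
proof -
  define F where "F n = flat (((\<lambda>q. [:0, 0, 1:] * (q - pderiv q)) ^^ n) q)" for n
  have "(F n has_real_derivative F (Suc n) y) (at y)" for n y
    using flat_DERIV unfolding F_def by simp
  then have "(\<lambda>x. F 0 (f x)) \<in> C" using Csmooth_compose[OF f, of F 0] by blast
  then show ?thesis by (simp add: F_def)
qed

lemma (in diffusion) Csmooth_bump:
  assumes "f \<in> C" shows "(\<lambda>x. bump (f x)) \<in> C" "(\<lambda>x. bump' (f x)) \<in> C"
  using Csmooth_flat[OF assms] by (simp_all add: bump_def bump'_def)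

section \<open>Limits along the cutoffs \<open>h k\<close>\<close>

context heat
begin

lemma h_le_1: "h k x \<le> 1"
  using incseq_le[OF _ h_lim[of x], of k] h_mono by (simp add: incseq_SucI)

text \<open>The cutoffs may be negative somewhere; as they increase with \<open>k\<close>, the
  bounded function \<open>h 0\<close> is a common lower bound.\<close>

lemma h_bounded: obtains B where "B \<ge> 1" "\<And>k x. \<bar>h k x\<bar> \<le> B"
proof -
  obtain B where B: "\<And>x. \<bar>h 0 x\<bar> \<le> B" using Ctest_bounded[OF h_test[of 0]] by blast
  have "h 0 x \<le> h k x" for k x
    using h_mono incseqD[of "\<lambda>k. h k x" 0 k] by (simp add: incseq_SucI)
  then have "\<bar>h k x\<bar> \<le> max 1 B" for k x
    using B[of x] h_le_1[of k x] by (smt (verit))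
  then show ?thesis using that[of "max 1 B"] by auto
qed

lemma h_Csmooth: "h k \<in> C"
  using h_test Ctest_Csmooth by blast

lemma h_grad_le:
  assumes "e > 0" shows "eventually (\<lambda>k. \<forall>x. \<Gamma> (h k) (h k) x \<le> e) sequentially"
proof -
  have "eventually (\<lambda>k. sup_norm (\<Gamma> (h k) (h k)) < ennreal e) sequentially"
    using order_tendstoD(2)[OF h_grad, of "ennreal e"] assms by simp
  then show ?thesis
  proof eventually_elim
    fix k assume k: "sup_norm (\<Gamma> (h k) (h k)) < ennreal e"
    show "\<forall>x. \<Gamma> (h k) (h k) x \<le> e"
    proof
      fix x
      have "ennreal \<bar>\<Gamma> (h k) (h k) x\<bar> \<le> sup_norm (\<Gamma> (h k) (h k))"
        unfolding sup_norm_def by (rule SUP_upper) simp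
      then have "ennreal \<bar>\<Gamma> (h k) (h k) x\<bar> < ennreal e" using k by (rule le_less_trans)
      then show "\<Gamma> (h k) (h k) x \<le> e" by (simp add: ennreal_less_iff)
    qed
  qed
qed

text \<open>Cauchy-Schwarz, with \<open>y \<le> (1 + y)^2\<close> in place of a square root. The
  threshold for \<open>k\<close> depends on neither \<open>x\<close> nor \<open>z\<close>.\<close>

lemma h_cross_le:
  assumes "s > 0"
  shows "eventually (\<lambda>k. \<forall>x. \<forall>z\<in>C. \<bar>\<Gamma> (h k) z x\<bar> \<le> s * (1 + \<Gamma> z z x)) sequentially"
proof -
  have "eventually (\<lambda>k. \<forall>x. \<Gamma> (h k) (h k) x \<le> s\<^sup>2) sequentially"
    using h_grad_le[of "s\<^sup>2"] assms by simp
  then show ?thesis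
  proof eventually_elim
    fix k assume k: "\<forall>x. \<Gamma> (h k) (h k) x \<le> s\<^sup>2"
    show "\<forall>x. \<forall>z\<in>C. \<bar>\<Gamma> (h k) z x\<bar> \<le> s * (1 + \<Gamma> z z x)"
    proof (intro allI ballI)
      fix x z assume z: "z \<in> C"
      have n: "0 \<le> \<Gamma> z z x" by (rule form_nonneg[OF cdc_form z])
      have "(\<Gamma> (h k) z x)\<^sup>2 \<le> \<Gamma> (h k) (h k) x * \<Gamma> z z x"
        by (rule form_cauchy_schwarz[OF cdc_form h_Csmooth z])
      also have "\<dots> \<le> s\<^sup>2 * \<Gamma> z z x" using k n by (intro mult_right_mono) auto
      also have "\<dots> \<le> s\<^sup>2 * (1 + \<Gamma> z z x)\<^sup>2"
        using n by (intro mult_left_mono) (auto simp: power2_eq_square algebra_simps)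
      finally have "(\<Gamma> (h k) z x)\<^sup>2 \<le> (s * (1 + \<Gamma> z z x))\<^sup>2" by (simp add: power_mult_distrib)
      then have "\<bar>\<Gamma> (h k) z x\<bar> \<le> \<bar>s * (1 + \<Gamma> z z x)\<bar>" by (simp only: abs_le_square_iff)
      moreover have "0 \<le> s * (1 + \<Gamma> z z x)" using assms n by (intro mult_nonneg_nonneg) linarith+
      ultimately show "\<bar>\<Gamma> (h k) z x\<bar> \<le> s * (1 + \<Gamma> z z x)" by linarith
    qed
  qed
qed

text \<open>This is the error term of every cutoff argument below; the gradient of
  \<open>h k\<close> alone makes it small.\<close>

lemma h_cross_limit:
  assumes z: "z \<in> C" and \<eta>: "\<eta> \<in> borel_measurable \<mu>"
    and int: "integrable \<mu> (\<lambda>x. \<bar>\<eta> x\<bar> * (1 + \<Gamma> z z x))"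
  shows "(\<lambda>k. \<integral>x. \<eta> x * \<Gamma> (h k) z x \<partial>\<mu>) \<longlonglongrightarrow> 0"
proof (rule LIMSEQ_I)
  define J where "J = (\<integral>x. \<bar>\<eta> x\<bar> * (1 + \<Gamma> z z x) \<partial>\<mu>)"
  have J: "J \<ge> 0" unfolding J_def
    using form_nonneg[OF cdc_form z] by (intro integral_nonneg_AE AE_I2 mult_nonneg_nonneg) (auto intro: add_nonneg_nonneg)
  fix r :: real assume r: "r > 0"
  define s where "s = r / (2 * (J + 1))"
  have s: "s > 0" using r J by (simp add: s_def)
  obtain N where N: "\<And>k. k \<ge> N \<Longrightarrow> \<forall>x. \<forall>z\<in>C. \<bar>\<Gamma> (h k) z x\<bar> \<le> s * (1 + \<Gamma> z z x)"
    using h_cross_le[OF s] unfolding eventually_sequentially by blast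
  have "norm ((\<integral>x. \<eta> x * \<Gamma> (h k) z x \<partial>\<mu>) - 0) < r" if k: "k \<ge> N" for k
  proof -
    have m: "(\<lambda>x. \<eta> x * \<Gamma> (h k) z x) \<in> borel_measurable \<mu>"
      using \<eta> Csmooth_measurable[OF Csmooth_cdc[OF h_Csmooth z]] by measurable
    have le: "\<bar>\<eta> x * \<Gamma> (h k) z x\<bar> \<le> s * (\<bar>\<eta> x\<bar> * (1 + \<Gamma> z z x))" for x
    proof -
      have "\<bar>\<Gamma> (h k) z x\<bar> \<le> s * (1 + \<Gamma> z z x)" using N[OF k] z by blast
      then have "\<bar>\<eta> x\<bar> * \<bar>\<Gamma> (h k) z x\<bar> \<le> \<bar>\<eta> x\<bar> * (s * (1 + \<Gamma> z z x))" by (intro mult_left_mono) auto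
      then show ?thesis by (simp add: abs_mult mult.left_commute)
    qed
    have int1: "integrable \<mu> (\<lambda>x. s * (\<bar>\<eta> x\<bar> * (1 + \<Gamma> z z x)))" using int by simp
    have "AE x in \<mu>. norm (\<eta> x * \<Gamma> (h k) z x) \<le> norm (s * (\<bar>\<eta> x\<bar> * (1 + \<Gamma> z z x)))"
      using le by (intro AE_I2) (metis abs_ge_self order_trans real_norm_def)
    then have int2: "integrable \<mu> (\<lambda>x. \<eta> x * \<Gamma> (h k) z x)"
      by (rule Bochner_Integration.integrable_bound[OF int1 m])
    have "norm (\<integral>x. \<eta> x * \<Gamma> (h k) z x \<partial>\<mu>) \<le> (\<integral>x. norm (\<eta> x * \<Gamma> (h k) z x) \<partial>\<mu>)"
      by (rule integral_norm_bound)
    also have "\<dots> \<le> (\<integral>x. s * (\<bar>\<eta> x\<bar> * (1 + \<Gamma> z z x)) \<partial>\<mu>)"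
      using le by (intro integral_mono integrable_norm int1 int2) auto
    also have "\<dots> = s * J" by (simp add: J_def)
    also have "\<dots> < s * (2 * (J + 1))" using s J by (intro mult_strict_left_mono) auto
    also have "\<dots> = r" using J by (simp add: s_def)
    finally show ?thesis by simp
  qed
  then show "\<exists>N. \<forall>k\<ge>N. norm ((\<integral>x. \<eta> x * \<Gamma> (h k) z x \<partial>\<mu>) - 0) < r" by blast
qed

lemma h_mult_limit:
  assumes f: "integrable \<mu> f"
  shows "(\<lambda>k. \<integral>x. h k x * f x \<partial>\<mu>) \<longlonglongrightarrow> (\<integral>x. f x \<partial>\<mu>)"
proof -
  obtain B where B: "B \<ge> 1" "\<And>k x. \<bar>h k x\<bar> \<le> B" using h_bounded by blast
  show ?thesis
  proof (rule integral_dominated_convergence[where w="\<lambda>x. B * \<bar>f x\<bar>"])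
    show "f \<in> borel_measurable \<mu>" using f by auto
    then show "(\<lambda>x. h k x * f x) \<in> borel_measurable \<mu>" for k
      using Ctest_measurable[OF h_test] by measurable
    show "integrable \<mu> (\<lambda>x. B * \<bar>f x\<bar>)" using f by simp
    show "AE x in \<mu>. (\<lambda>k. h k x * f x) \<longlonglongrightarrow> f x"
      using tendsto_mult[OF h_lim tendsto_const] by (intro AE_I2) fastforce
    show "AE x in \<mu>. norm (h k x * f x) \<le> B * \<bar>f x\<bar>" for k
      using B(2) by (intro AE_I2) (simp add: abs_mult mult_right_mono)
  qed
qed

lemma P_h_bounded:
  assumes B: "\<And>k x. \<bar>h k x\<bar> \<le> B" and t: "t \<ge> 0"
  shows "\<bar>P t (h k) x\<bar> \<le> B"
  by (rule P_abs_le[OF t Ctest_measurable[OF h_test] B])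

lemma P_h_le_1: "t \<ge> 0 \<Longrightarrow> P t (h k) x \<le> 1"
  using P_le[OF _ Ctest_measurable[OF h_test]] h_bounded h_le_1 by metis

lemma P_h_lim:
  assumes t: "t \<ge> 0" shows "(\<lambda>k. P t (h k) x) \<longlonglongrightarrow> 1"
proof (cases "t = 0")
  case False
  then have "(\<lambda>k. \<integral>y. h k y * p x y t \<partial>\<mu>) \<longlonglongrightarrow> (\<integral>y. p x y t \<partial>\<mu>)"
    using h_mult_limit[OF integrable_kernel] t by simp
  then show ?thesis using False t integral_kernel[of t x] by (simp add: P_pos mult.commute)
qed (use h_lim in simp)

lemma P_h_mult_limit:
  assumes f: "integrable \<mu> f" and t: "t \<ge> 0"
  shows "(\<lambda>k. \<integral>x. f x * P t (h k) x \<partial>\<mu>) \<longlonglongrightarrow> (\<integral>x. f x \<partial>\<mu>)"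
proof -
  obtain B where B: "B \<ge> 1" "\<And>k x. \<bar>h k x\<bar> \<le> B" using h_bounded by blast
  show ?thesis
  proof (rule integral_dominated_convergence[where w="\<lambda>x. B * \<bar>f x\<bar>"])
    show "f \<in> borel_measurable \<mu>" using f by auto
    then show "(\<lambda>x. f x * P t (h k) x) \<in> borel_measurable \<mu>" for k
      using Csmooth_measurable[OF P_smooth[OF h_test t]] by measurable
    show "integrable \<mu> (\<lambda>x. B * \<bar>f x\<bar>)" using f by simp
    show "AE x in \<mu>. (\<lambda>k. f x * P t (h k) x) \<longlonglongrightarrow> f x"
      using tendsto_mult[OF tendsto_const P_h_lim[OF t]] by (intro AE_I2) fastforce
    show "AE x in \<mu>. norm (f x * P t (h k) x) \<le> B * \<bar>f x\<bar>" for k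
    proof (rule AE_I2)
      fix x
      have "\<bar>P t (h k) x\<bar> * \<bar>f x\<bar> \<le> B * \<bar>f x\<bar>"
        using P_h_bounded[OF B(2) t] by (intro mult_right_mono) auto
      then show "norm (f x * P t (h k) x) \<le> B * \<bar>f x\<bar>" by (simp add: abs_mult mult.commute)
    qed
  qed
qed

lemma DERIV_integral_mult_P:
  assumes f: "f \<in> T" and g: "integrable \<mu> g" and t: "t > 0"
  shows "((\<lambda>s. \<integral>x. g x * P s f x \<partial>\<mu>) has_real_derivative (\<integral>x. g x * P t (L f) x \<partial>\<mu>)) (at t)"
proof -
  obtain B1 where "B1 \<ge> 0" and B1: "\<And>t x. t \<ge> 0 \<Longrightarrow> \<bar>P t f x\<bar> \<le> B1"
    using P_bounded[OF f] by auto
  obtain B2 where B2: "\<And>t x. t \<ge> 0 \<Longrightarrow> \<bar>P t (L f) x\<bar> \<le> B2"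
    using P_bounded[OF Ctest_L[OF f]] by auto
  have gm: "g \<in> borel_measurable \<mu>" using g by auto
  show ?thesis
  proof (rule DERIV_integral_dominated(2)[of 0 t "t + 1"])
    fix s :: real and x :: 'a assume s: "0 < s"
    show "integrable \<mu> (\<lambda>x. g x * P s f x)"
    proof (rule Bochner_Integration.integrable_bound)
      show "integrable \<mu> (\<lambda>x. B1 * g x)" using g by simp
      show "(\<lambda>x. g x * P s f x) \<in> borel_measurable \<mu>"
        using gm Csmooth_measurable[OF P_smooth[OF f less_imp_le[OF s]]] by measurable
      show "AE x in \<mu>. norm (g x * P s f x) \<le> norm (B1 * g x)"
      proof (rule AE_I2)
        fix x
        have "\<bar>P s f x\<bar> * \<bar>g x\<bar> \<le> B1 * \<bar>g x\<bar>" using B1 s by (intro mult_right_mono) auto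
        then show "norm (g x * P s f x) \<le> norm (B1 * g x)"
          using \<open>B1 \<ge> 0\<close> by (simp add: abs_mult mult.commute)
      qed
    qed
    show "((\<lambda>s. g x * P s f x) has_real_derivative g x * P s (L f) x) (at s)"
      using DERIV_cmult[OF P_deriv[OF f s]] .
    show "\<bar>g x * P s (L f) x\<bar> \<le> \<bar>g x\<bar> * B2"
      using B2[of s x] s by (simp add: abs_mult mult_left_mono)
  qed (use t g in auto)
qed

text \<open>By symmetry of the flow,
  \<open>\<integral> h k * P t f = \<integral> f * P t (h k)\<close>, which tends to
  \<open>\<integral> f\<close> for each \<open>t\<close> since \<open>P t 1 = 1\<close>. The time
  derivatives tend boundedly to \<open>\<integral> L f\<close>. Integrating them over
  \<open>[1, 2]\<close> and letting \<open>k\<close> grow shows that this limit is the change of a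
  constant, hence 0. A direct cutoff would need control of \<open>L (h k)\<close>.\<close>

lemma integral_L_eq_0:
  assumes f: "f \<in> T" shows "(\<integral>x. L f x \<partial>\<mu>) = 0"
proof -
  obtain B where B: "B \<ge> 1" "\<And>k x. \<bar>h k x\<bar> \<le> B" using h_bounded by blast
  note Lf = Ctest_L[OF f]
  note fi = Ctest_integrable[OF f] and Lfi = Ctest_integrable[OF Lf]
  define I where "I k t = (\<integral>x. h k x * P t f x \<partial>\<mu>)" for k t
  define I' where "I' k t = (\<integral>x. h k x * P t (L f) x \<partial>\<mu>)" for k t
  have swap: "(\<integral>x. h k x * P t g x \<partial>\<mu>) = (\<integral>x. g x * P t (h k) x \<partial>\<mu>)" if "integrable \<mu> g" "t \<ge> 0" for k t g
    by (rule P_symmetric[OF that(2,1) Ctest_measurable[OF h_test] B(2)])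
  have hi: "((\<lambda>t. I' k t) has_integral (I k 2 - I k 1)) {1..2}" for k
    by (rule fundamental_theorem_of_calculus)
       (use DERIV_integral_mult_P[OF f Ctest_integrable[OF h_test]] in
          \<open>auto simp: I_def I'_def has_real_derivative_iff_has_vector_derivative[symmetric]
             intro: has_field_derivative_at_within\<close>)
  have "((\<lambda>t. \<integral>x. L f x \<partial>\<mu>) has_integral ((\<integral>x. f x \<partial>\<mu>) - (\<integral>x. f x \<partial>\<mu>))) {1..2::real}"
  proof (rule has_integral_dominated_convergence[OF hi])
    show "(\<lambda>_. B * (\<integral>x. \<bar>L f x\<bar> \<partial>\<mu>)) integrable_on {1..2::real}" by (rule integrable_const_ivl)
    show "\<forall>t\<in>{1..2}. norm (I' k t) \<le> B * (\<integral>x. \<bar>L f x\<bar> \<partial>\<mu>)" for k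
    proof
      fix t :: real assume "t \<in> {1..2}"
      then have t: "t \<ge> 0" by simp
      have "norm (I' k t) \<le> (\<integral>x. norm (L f x * P t (h k) x) \<partial>\<mu>)"
        unfolding I'_def swap[OF Lfi t] by (rule integral_norm_bound)
      also have "\<dots> \<le> (\<integral>x. B * \<bar>L f x\<bar> \<partial>\<mu>)"
      proof (rule integral_mono)
        show "integrable \<mu> (\<lambda>x. norm (L f x * P t (h k) x))"
          by (intro integrable_norm Ctest_integrable_mult Lf P_smooth h_test t)
        show "integrable \<mu> (\<lambda>x. B * \<bar>L f x\<bar>)" using Lfi by simp
        show "norm (L f x * P t (h k) x) \<le> B * \<bar>L f x\<bar>" for x
        proof -
          have "\<bar>P t (h k) x\<bar> * \<bar>L f x\<bar> \<le> B * \<bar>L f x\<bar>"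
            using P_h_bounded[OF B(2) t] by (intro mult_right_mono) auto
          then show ?thesis by (simp add: abs_mult mult.commute)
        qed
      qed
      finally show "norm (I' k t) \<le> B * (\<integral>x. \<bar>L f x\<bar> \<partial>\<mu>)" by simp
    qed
    show "\<forall>t\<in>{1..2}. (\<lambda>k. I' k t) \<longlonglongrightarrow> (\<integral>x. L f x \<partial>\<mu>)"
      unfolding I'_def using swap[OF Lfi] P_h_mult_limit[OF Lfi] by simp
    show "(\<lambda>k. I k 2 - I k 1) \<longlonglongrightarrow> (\<integral>x. f x \<partial>\<mu>) - (\<integral>x. f x \<partial>\<mu>)"
      unfolding I_def swap[OF fi, of 2, simplified] swap[OF fi, of 1, simplified]
      by (intro tendsto_diff P_h_mult_limit fi) auto
  qed
  then have "((\<lambda>t. \<integral>x. L f x \<partial>\<mu>) has_integral 0) {1..2::real}" by simp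
  moreover have "((\<lambda>t. \<integral>x. L f x \<partial>\<mu>) has_integral (\<integral>x. L f x \<partial>\<mu>)) {1..2::real}"
    using has_integral_const_real[of "\<integral>x. L f x \<partial>\<mu>" 1 2] by simp
  ultimately have "0 = (\<integral>x. L f x \<partial>\<mu>)" by (rule has_integral_unique)
  then show ?thesis by simp
qed

text \<open>Symmetry is known for two test functions, so \<open>z\<close> is first multiplied by
  \<open>h k\<close>. The product rule for \<open>L (h k * z)\<close> produces \<Gamma>(h k, z),
  which vanishes in the limit, and a term with \<open>L (h k)\<close>, which is moved onto the test
  function \<open>\<eta> z\<close>, where \<open>integral_L_eq_0\<close> applies.\<close>

lemma L_symmetric:
  assumes \<eta>: "\<eta> \<in> T" and z: "z \<in> C"
  shows "(\<integral>x. z x * L \<eta> x \<partial>\<mu>) = (\<integral>x. \<eta> x * L z x \<partial>\<mu>)"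
proof -
  note C\<eta> = Ctest_Csmooth[OF \<eta>] and T\<eta>z = Ctest_mult[OF \<eta> z] and L\<eta> = Ctest_L[OF \<eta>] and CLz = Csmooth_L[OF z]
  have i1: "integrable \<mu> (\<lambda>x. z x * L \<eta> x)"
    using Ctest_integrable_mult[OF L\<eta> z] by (simp add: mult.commute)
  have hz: "(\<lambda>x. h k x * z x) \<in> T" for k by (rule Ctest_mult[OF h_test z])
  have "(\<integral>x. h k x * (z x * L \<eta> x) \<partial>\<mu>) = (\<integral>x. h k x * (\<eta> x * L z x) \<partial>\<mu>) + (\<integral>x. h k x * L (\<lambda>x. \<eta> x * z x) x \<partial>\<mu>)
      + 2 * (\<integral>x. \<eta> x * \<Gamma> (h k) z x \<partial>\<mu>)" for k
  proof -
    have sym: "(\<integral>x. f x * L g x \<partial>\<mu>) = (\<integral>x. g x * L f x \<partial>\<mu>)" if "f \<in> T" "g \<in> T" for f g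
      using symmetric_L that unfolding symmetric_nonpositive_def by blast
    have "(\<integral>x. h k x * (z x * L \<eta> x) \<partial>\<mu>) = (\<integral>x. \<eta> x * L (\<lambda>x. h k x * z x) x \<partial>\<mu>)"
      using sym[OF hz \<eta>] by (simp add: mult.assoc)
    also have "\<dots> = (\<integral>x. h k x * (\<eta> x * L z x) + (\<eta> x * z x) * L (h k) x + 2 * (\<eta> x * \<Gamma> (h k) z x) \<partial>\<mu>)"
      unfolding L_mult by (simp add: algebra_simps)
    also have "\<dots> = (\<integral>x. h k x * (\<eta> x * L z x) \<partial>\<mu>) + (\<integral>x. (\<eta> x * z x) * L (h k) x \<partial>\<mu>)
        + (\<integral>x. 2 * (\<eta> x * \<Gamma> (h k) z x) \<partial>\<mu>)"
    proof -
      have a: "integrable \<mu> (\<lambda>x. h k x * (\<eta> x * L z x))"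
        by (intro Ctest_integrable_mult h_test Csmooth_mult C\<eta> CLz)
      have b: "integrable \<mu> (\<lambda>x. (\<eta> x * z x) * L (h k) x)"
        by (intro Ctest_integrable_mult T\<eta>z Csmooth_L h_Csmooth)
      have c: "integrable \<mu> (\<lambda>x. 2 * (\<eta> x * \<Gamma> (h k) z x))"
        using Ctest_integrable_mult[OF \<eta> Csmooth_cdc[OF h_Csmooth z]] by simp
      show ?thesis using a b c by simp
    qed
    \<comment> \<open>Symmetry takes \<open>L\<close> off \<open>h k\<close>, whose image under
      \<open>L\<close> is not controlled.\<close>
    also have "(\<integral>x. (\<eta> x * z x) * L (h k) x \<partial>\<mu>) = (\<integral>x. h k x * L (\<lambda>x. \<eta> x * z x) x \<partial>\<mu>)"
      by (rule sym[OF T\<eta>z h_test])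
    finally show ?thesis by simp
  qed
  moreover have "(\<lambda>k. \<integral>x. h k x * (z x * L \<eta> x) \<partial>\<mu>) \<longlonglongrightarrow> (\<integral>x. z x * L \<eta> x \<partial>\<mu>)"
    by (rule h_mult_limit[OF i1])
  moreover have "(\<lambda>k. (\<integral>x. h k x * (\<eta> x * L z x) \<partial>\<mu>) + (\<integral>x. h k x * L (\<lambda>x. \<eta> x * z x) x \<partial>\<mu>)
      + 2 * (\<integral>x. \<eta> x * \<Gamma> (h k) z x \<partial>\<mu>)) \<longlonglongrightarrow> (\<integral>x. \<eta> x * L z x \<partial>\<mu>) + (\<integral>x. L (\<lambda>x. \<eta> x * z x) x \<partial>\<mu>) + 2 * 0"
  proof (intro tendsto_add tendsto_mult tendsto_const h_mult_limit)
    show "integrable \<mu> (\<lambda>x. \<eta> x * L z x)" by (rule Ctest_integrable_mult[OF \<eta> CLz])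
    show "integrable \<mu> (L (\<lambda>x. \<eta> x * z x))" by (rule Ctest_integrable[OF Ctest_L[OF T\<eta>z]])
    have "integrable \<mu> (\<lambda>x. \<bar>\<eta> x * (1 + \<Gamma> z z x)\<bar>)"
      by (intro integrable_abs Ctest_integrable_mult \<eta> Csmooth_add Csmooth_const Csmooth_cdc z)
    then have "integrable \<mu> (\<lambda>x. \<bar>\<eta> x\<bar> * (1 + \<Gamma> z z x))"
      using form_nonneg[OF cdc_form z] by (simp add: abs_mult)
    then show "(\<lambda>k. \<integral>x. \<eta> x * \<Gamma> (h k) z x \<partial>\<mu>) \<longlonglongrightarrow> 0"
      by (rule h_cross_limit[OF z Ctest_measurable[OF \<eta>]])
  qed
  ultimately have "(\<integral>x. z x * L \<eta> x \<partial>\<mu>) = (\<integral>x. \<eta> x * L z x \<partial>\<mu>) + (\<integral>x. L (\<lambda>x. \<eta> x * z x) x \<partial>\<mu>) + 2 * 0"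
    using LIMSEQ_unique by simp
  then show ?thesis using integral_L_eq_0[OF T\<eta>z] by simp
qed

text \<open>In the definition of \<Gamma>, the term \<open>L (\<eta> z)\<close> integrates to 0, and
  the two others have equal integrals by symmetry.\<close>

lemma integration_by_parts:
  assumes \<eta>: "\<eta> \<in> T" and z: "z \<in> C"
  shows "integrable \<mu> (\<Gamma> \<eta> z)" and "(\<integral>x. \<eta> x * L z x \<partial>\<mu>) = - (\<integral>x. \<Gamma> \<eta> z x \<partial>\<mu>)"
proof -
  note T\<eta>z = Ctest_mult[OF \<eta> z]
  have a: "integrable \<mu> (L (\<lambda>x. \<eta> x * z x))" by (rule Ctest_integrable[OF Ctest_L[OF T\<eta>z]])
  have b: "integrable \<mu> (\<lambda>x. \<eta> x * L z x)" by (rule Ctest_integrable_mult[OF \<eta> Csmooth_L[OF z]])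
  have c: "integrable \<mu> (\<lambda>x. z x * L \<eta> x)"
    using Ctest_integrable_mult[OF Ctest_L[OF \<eta>] z] by (simp add: mult.commute)
  show "integrable \<mu> (\<Gamma> \<eta> z)" unfolding cdc_def using a b c by simp
  have "(\<integral>x. \<Gamma> \<eta> z x \<partial>\<mu>) = ((\<integral>x. L (\<lambda>x. \<eta> x * z x) x \<partial>\<mu>) - (\<integral>x. \<eta> x * L z x \<partial>\<mu>) - (\<integral>x. z x * L \<eta> x \<partial>\<mu>)) / 2"
    unfolding cdc_def using a b c by simp
  then show "(\<integral>x. \<eta> x * L z x \<partial>\<mu>) = - (\<integral>x. \<Gamma> \<eta> z x \<partial>\<mu>)"
    using L_symmetric[OF \<eta> z] integral_L_eq_0[OF T\<eta>z] by simp
qed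

text \<open>Differentiating \<open>\<integral> g * P s f = \<integral> f * P s g\<close> in two ways
  shows that the difference of both sides is orthogonal to every test function
  \<open>g\<close>.\<close>

lemma L_P:
  assumes f: "f \<in> T" and t: "t \<ge> 0"
  shows "L (P t f) x = P t (L f) x"
proof (cases "t = 0")
  case False
  then have t: "t > 0" "t \<ge> 0" using t by auto
  note Lf = Ctest_L[OF f]
  note CP = P_smooth[OF f t(2)]
  define q where "q x = L (P t f) x - P t (L f) x" for x
  have qC: "q \<in> C" unfolding q_def by (intro Csmooth_diff Csmooth_L CP P_smooth Lf t)
  have sym: "(\<integral>x. f x * P t g x \<partial>\<mu>) = (\<integral>x. g x * P t f x \<partial>\<mu>)" if fg: "f \<in> T" "g \<in> T" "t \<ge> 0" for f g t
  proof -
    obtain B where B: "\<And>x. \<bar>f x\<bar> \<le> B" using Ctest_bounded[OF fg(1)] by blast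
    show ?thesis by (rule P_symmetric[OF fg(3) Ctest_integrable[OF fg(2)] Ctest_measurable[OF fg(1)] B])
  qed
  have 0: "(\<integral>x. g x * q x \<partial>\<mu>) = 0" if g: "g \<in> T" for g
  proof -
    note Lg = Ctest_L[OF g]
    have d1: "((\<lambda>s. \<integral>x. g x * P s f x \<partial>\<mu>) has_real_derivative (\<integral>x. g x * P t (L f) x \<partial>\<mu>)) (at t)"
      by (rule DERIV_integral_mult_P[OF f Ctest_integrable[OF g] t(1)])
    have d2: "((\<lambda>s. \<integral>x. f x * P s g x \<partial>\<mu>) has_real_derivative (\<integral>x. f x * P t (L g) x \<partial>\<mu>)) (at t)"
      by (rule DERIV_integral_mult_P[OF g Ctest_integrable[OF f] t(1)])
    have "((\<lambda>s. \<integral>x. g x * P s f x \<partial>\<mu>) has_real_derivative (\<integral>x. f x * P t (L g) x \<partial>\<mu>)) (at t)"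
      by (rule has_field_derivative_transform_within_open[OF d2, of "{0<..}"]) (use t sym[OF f g] in auto)
    then have eq: "(\<integral>x. g x * P t (L f) x \<partial>\<mu>) = (\<integral>x. f x * P t (L g) x \<partial>\<mu>)" using d1 DERIV_unique by blast
    have "(\<integral>x. g x * L (P t f) x \<partial>\<mu>) = (\<integral>x. P t f x * L g x \<partial>\<mu>)"
      using L_symmetric[OF g CP] by simp
    also have "\<dots> = (\<integral>x. f x * P t (L g) x \<partial>\<mu>)"
      using sym[OF f Lg t(2)] by (simp add: mult.commute)
    also have "\<dots> = (\<integral>x. g x * P t (L f) x \<partial>\<mu>)" using eq by simp
    finally have "(\<integral>x. g x * L (P t f) x \<partial>\<mu>) = (\<integral>x. g x * P t (L f) x \<partial>\<mu>)" .
    moreover have "integrable \<mu> (\<lambda>x. g x * L (P t f) x)" "integrable \<mu> (\<lambda>x. g x * P t (L f) x)"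
      by (intro Ctest_integrable_mult g Csmooth_L CP P_smooth Lf t)+
    ultimately show ?thesis by (simp add: q_def right_diff_distrib)
  qed
  have hq: "h k x * q x = 0" for k
  proof -
    \<comment> \<open>The difference \<open>q\<close> itself, cut off by \<open>h k\<close> squared,
      is the test function; the resulting integrand is a square.\<close>
    have g: "(\<lambda>x. h k x * (h k x * q x)) \<in> T"
      by (intro Ctest_mult h_test Csmooth_mult h_Csmooth qC)
    have gg: "(\<lambda>x. (h k x * (h k x * q x)) * q x) \<in> T" by (rule Ctest_mult[OF g qC])
    have "(h k x * (h k x * q x)) * q x = 0"
    proof (rule Ctest_nonneg_integral_zero[OF gg])
      show "0 \<le> (h k x * (h k x * q x)) * q x" for x
        using zero_le_square[of "h k x * q x"] by (simp add: mult_ac)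
    qed (use 0[OF g] in simp)
    then show ?thesis by auto
  qed
  have "(\<lambda>k. h k x * q x) \<longlonglongrightarrow> 1 * q x" by (intro tendsto_mult h_lim tendsto_const)
  then have "q x = 0" using hq LIMSEQ_unique[of "\<lambda>_. 0" 0 "1 * q x"] by simp
  then show ?thesis by (simp add: q_def)
qed simp

text \<open>The time derivative of \<open>P s f\<close> is \<open>P s (L f)\<close>, and by symmetry
  of second derivatives it passes through the space derivative \<open>pd i\<close>. With this,
  first-order forms of \<open>P s f\<close> can be differentiated in time.\<close>

lemma pd_P_deriv:
  assumes f: "f \<in> T" and t: "t > 0" and c: "c \<in> A" and u: "u \<in> snd c ` fst c"
  shows "((\<lambda>s. pd i (in_chart c (P s f)) u) has_real_derivative pd i (in_chart c (P t (L f))) u) (at t)"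
proof -
  define F where "F g = (\<lambda>z. P (snd z) g (inv_into (fst c) (snd c) (fst z)))" for g
  have sF: "smooth_on (spacetime c) (F g)" if "g \<in> T" for g
    unfolding F_def by (rule smooth_on_P[OF that c])
  note Lf = Ctest_L[OF f]
  note os = open_spacetime[OF c]
  have slice: "pd i (in_chart c (P s g)) u = frechet_derivative (F g) (at (u, s)) (i, 0)" if "g \<in> T" "s > 0" for g s
    using spatial_slice(2)[OF c sF[OF that(1)] that(2) u, of i]
    by (simp add: F_def in_chart_def o_def)
  have eq: "frechet_derivative (F f) (at z) (0, 1) = F (L f) z" if z: "z \<in> spacetime c" for z
  proof -
    obtain v s where vs: "z = (v, s)" "v \<in> snd c ` fst c" "s > 0" using z by auto
    have "((\<lambda>s. F f (v, s)) has_real_derivative frechet_derivative (F f) (at (v, s)) (0, 1)) (at s)"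
      by (rule time_slice[OF c sF[OF f] vs(3,2)])
    moreover have "((\<lambda>s. F f (v, s)) has_real_derivative F (L f) (v, s)) (at s)"
      unfolding F_def using P_deriv[OF f vs(3)] by simp
    ultimately show ?thesis using vs(1) DERIV_unique by blast
  qed
  let ?Fi = "\<lambda>z. frechet_derivative (F f) (at z) (i, 0)"
  have ut: "(u, t) \<in> spacetime c" using u t by simp
  have "((\<lambda>s. ?Fi (u, s)) has_real_derivative frechet_derivative ?Fi (at (u, t)) (0, 1)) (at t)"
    by (rule time_slice[OF c smooth_on_frechet_derivative[OF sF[OF f]] t u])
  moreover have "frechet_derivative ?Fi (at (u, t)) (0, 1)
     = frechet_derivative (\<lambda>z. frechet_derivative (F f) (at z) (0, 1)) (at (u, t)) (i, 0)"
    by (rule second_derivative_commute[OF os sF[OF f] ut])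
  moreover have "frechet_derivative (F (L f)) (at (u, t)) = frechet_derivative (\<lambda>z. frechet_derivative (F f) (at z) (0, 1)) (at (u, t))"
    by (rule frechet_derivative_cong_open(2)[OF os ut eq], assumption)
       (rule smooth_on_imp_differentiable[OF smooth_on_frechet_derivative[OF sF[OF f]] ut])
  ultimately have "((\<lambda>s. ?Fi (u, s)) has_real_derivative pd i (in_chart c (P t (L f))) u) (at t)"
    using slice[OF Lf t] by simp
  then show ?thesis
    by (rule has_field_derivative_transform_within_open[of _ _ _ "{0<..}"]) (use t slice[OF f] in auto)
qed

lemma form_deriv:
  assumes G: "first_order_form A G" and f: "f \<in> T" and t: "t > 0"
  shows "((\<lambda>s. G (P s f) (P s f) x) has_real_derivative 2 * G (P t f) (P t (L f)) x) (at t)"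
proof -
  obtain c where c: "c \<in> A" "x \<in> fst c" by (rule obtain_chart)
  obtain z where "form_coefficients c G z" using G c(1) by (rule obtain_form_coefficients)
  note z = form_coefficients_apply[OF this]
  let ?u = "snd c x"
  have u: "?u \<in> snd c ` fst c" using c by auto
  let ?d = "\<lambda>i s. pd i (in_chart c (P s f)) ?u"
  let ?e = "\<lambda>i. pd i (in_chart c (P t (L f))) ?u"
  note Lf = Ctest_L[OF f]
  have CP: "\<And>s. s > 0 \<Longrightarrow> P s f \<in> C" and CPL: "P t (L f) \<in> C"
    using P_smooth[OF f] P_smooth[OF Lf] t by auto
  have "((\<lambda>s. \<Sum>i\<in>Basis. \<Sum>j\<in>Basis. z i j ?u * ?d i s * ?d j s) has_real_derivative
     (\<Sum>i\<in>Basis. \<Sum>j\<in>Basis. (z i j ?u * ?e i) * ?d j t + (z i j ?u * ?d i t) * ?e j)) (at t)"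
    by (intro DERIV_sum) (auto intro!: derivative_eq_intros pd_P_deriv[OF f t c(1) u])
  moreover have "(\<Sum>i\<in>Basis. \<Sum>j\<in>Basis. (z i j ?u * ?e i) * ?d j t + (z i j ?u * ?d i t) * ?e j)
     = G (P t (L f)) (P t f) x + G (P t f) (P t (L f)) x"
    unfolding z[OF CPL CP[OF t] c(2)] z[OF CP[OF t] CPL c(2)] by (simp add: sum.distrib)
  moreover have "G (P t (L f)) (P t f) x = G (P t f) (P t (L f)) x"
    using form_sym[OF G CPL CP[OF t]] by simp
  ultimately have "((\<lambda>s. \<Sum>i\<in>Basis. \<Sum>j\<in>Basis. z i j ?u * ?d i s * ?d j s) has_real_derivative
     2 * G (P t f) (P t (L f)) x) (at t)" by simp
  then show ?thesis
    by (rule has_field_derivative_transform_within_open[of _ _ _ "{0<..}"])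
       (use t z[OF CP CP c(2)] in auto)
qed

section \<open>Behaviour at time 0\<close>

lemma P_time_lipschitz:
  assumes f: "f \<in> T" and B: "\<And>x. \<bar>L f x\<bar> \<le> B" and s: "0 < s" "s \<le> t"
  shows "\<bar>P t f x - P s f x\<bar> \<le> (t - s) * B"
proof (cases "s = t")
  case False
  then have st: "s < t" using s by simp
  obtain r where r: "s < r" "r < t" "P t f x - P s f x = (t - s) * P r (L f) x"
    using MVT2[OF st, of "\<lambda>s. P s f x" "\<lambda>s. P s (L f) x"] P_deriv[OF f] s by force
  have "\<bar>P r (L f) x\<bar> \<le> B"
    by (rule P_abs_le[OF _ Ctest_measurable[OF Ctest_L[OF f]] B]) (use r s in auto)
  then show ?thesis using r(3) st by (simp add: abs_mult mult_left_mono)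
qed simp

text \<open>Strong continuity gives convergence to \<open>f\<close> almost everywhere along a
  sequence of times tending to 0. From those times up to \<open>t\<close> the change is at most
  \<open>t * B\<close>, because the time derivative \<open>P s (L f)\<close> is bounded by
  \<open>B\<close>.\<close>

lemma P_initial:
  assumes f: "f \<in> T" and B: "\<And>x. \<bar>L f x\<bar> \<le> B" and t: "t > 0"
  shows "\<bar>P t f x - f x\<bar> \<le> t * B"
proof -
  define s where "s n = t / real (Suc n)" for n
  have s: "s n > 0" "s n \<noteq> 0" "s n \<le> t" for n
    using t by (auto simp: s_def divide_simps)
  have s0: "s \<longlonglongrightarrow> 0"
    unfolding s_def using tendsto_mult_left[OF LIMSEQ_inverse_real_of_nat, of t]
    by (simp add: divide_inverse)
  have B0: "B \<ge> 0" using B[of x] by linarith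
  have L2: "(\<lambda>x. 1 * P (s n) f x + (-1) * f x) \<in> L2 \<mu>" for n
    by (intro L2_lincomb P_L2 Ctest_L2 f) (use s(1)[of n] in simp)
  then have int: "integrable \<mu> (\<lambda>x. (P (s n) f x - f x)\<^sup>2)" for n by (simp add: L2_def)
  have "(\<lambda>n. \<integral>x. (P (s n) f x - f x)\<^sup>2 \<partial>\<mu>) \<longlonglongrightarrow> 0"
    by (rule filterlim_compose[OF P_strong_continuity[OF f]])
       (use s s0 in \<open>auto simp: filterlim_at intro!: always_eventually\<close>)
  then have "(\<lambda>n. \<integral>x. norm ((P (s n) f x - f x)\<^sup>2) \<partial>\<mu>) \<longlonglongrightarrow> 0" by simp
  from tendsto_L1_AE_subseq[OF int this] obtain r where r: "strict_mono r"
    "AE x in \<mu>. (\<lambda>n. (P (s (r n)) f x - f x)\<^sup>2) \<longlonglongrightarrow> 0" by blast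
  have "AE x in \<mu>. \<bar>P t f x - f x\<bar> \<le> t * B"
    using r(2)
  proof eventually_elim
    fix x assume "(\<lambda>n. (P (s (r n)) f x - f x)\<^sup>2) \<longlonglongrightarrow> 0"
    then have "(\<lambda>n. sqrt ((P (s (r n)) f x - f x)\<^sup>2)) \<longlonglongrightarrow> sqrt 0" by (rule tendsto_real_sqrt)
    then have "(\<lambda>n. \<bar>P (s (r n)) f x - f x\<bar>) \<longlonglongrightarrow> 0" by simp
    then have lim: "(\<lambda>n. t * B + \<bar>P (s (r n)) f x - f x\<bar>) \<longlonglongrightarrow> t * B + 0"
      by (intro tendsto_add tendsto_const)
    have "\<bar>P t f x - f x\<bar> \<le> t * B + \<bar>P (s (r n)) f x - f x\<bar>" for n
    proof -
      have "\<bar>P t f x - P (s (r n)) f x\<bar> \<le> (t - s (r n)) * B"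
        by (rule P_time_lipschitz[OF f B s(1,3)])
      also have "\<dots> \<le> t * B" using s(1)[of "r n"] B0 by (intro mult_right_mono) auto
      finally show ?thesis by linarith
    qed
    then show "\<bar>P t f x - f x\<bar> \<le> t * B"
      using LIMSEQ_le_const[OF lim] by (metis add.right_neutral)
  qed
  moreover have "continuous_on UNIV (\<lambda>x. \<bar>P t f x - f x\<bar>)"
    using Csmooth_continuous[OF P_smooth[OF f]] Csmooth_continuous[OF Ctest_Csmooth[OF f]] t
    by (intro continuous_intros) auto
  ultimately show ?thesis using continuous_AE_le[OF _ continuous_on_const] by blast
qed

lemma P_tendsto_initial:
  assumes f: "f \<in> T" shows "((\<lambda>t. P t f x) \<longlongrightarrow> f x) (at_right 0)"
proof -
  obtain B where B: "\<And>x. \<bar>L f x\<bar> \<le> B" using Ctest_bounded[OF Ctest_L[OF f]] by blast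
  have "((\<lambda>t. t * B) \<longlongrightarrow> 0 * B) (at_right 0)" by (intro tendsto_intros)
  then have "((\<lambda>t. P t f x - f x) \<longlongrightarrow> 0) (at_right 0)"
    by (intro Lim_null_comparison[of "\<lambda>t. P t f x - f x" "\<lambda>t. t * B"])
       (auto simp: eventually_at_filter P_initial[OF f B])
  then show ?thesis by (simp add: LIM_zero_iff)
qed

section \<open>The maximum principle\<close>

text \<open>Comparing \<open>w\<close> with \<open>1 - P t (h k)\<close> puts the positive part of the difference into \<open>L\<^sup>2\<close>,
  where the cutoffs \<open>h j\<close> and an energy estimate suffice.\<close>
theorem maximum_principle:
  assumes T: "0 < r" "r < b"
    and sm: "\<And>t. 0 < t \<Longrightarrow> t < b \<Longrightarrow> w t \<in> C"
    and der: "\<And>t x. 0 < t \<Longrightarrow> t < b \<Longrightarrow> ((\<lambda>s. w s x) has_real_derivative w' t x) (at t)"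
    and sub: "\<And>t x. 0 < t \<Longrightarrow> t < b \<Longrightarrow> w' t x \<le> L (w t) x"
    and bd: "\<And>t x. 0 < t \<Longrightarrow> t < b \<Longrightarrow> w t x \<le> M"
    and bd': "\<And>t x. 0 < t \<Longrightarrow> t < b \<Longrightarrow> \<bar>w' t x\<bar> \<le> M'"
    and init: "\<And>e. e > 0 \<Longrightarrow> \<exists>\<delta>>0. \<forall>t x. 0 < t \<longrightarrow> t < \<delta> \<longrightarrow> t < b \<longrightarrow> w t x \<le> e"
  shows "w r x \<le> 0"
proof -
  define m where "m = max M 1"
  have m: "m \<ge> 1" by (simp add: m_def)
  have wm: "w t x / m \<le> 1" if "0 < t" "t < b" for t x
  proof -
    have "w t x \<le> m" using bd[OF that, of x] by (simp add: m_def)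
    then show ?thesis using m by simp
  qed
  have key: "w r x / m \<le> 1 - P r (h k) x" for k
  proof -
    note hk = h_test[of k] and Lhk = Ctest_L[OF h_test[of k]]
    \<comment> \<open>Up to scaling this is \<open>w\<close> minus \<open>1 - P t (h k)\<close>.
      Dividing by \<open>m\<close> gives \<open>w / m \<le> 1\<close> and so
      \<open>4 z \<le> P t (h k)\<close>, a square-integrable bound; the factor 1 / 4 keeps
      \<open>z\<close> in the range where \<open>bump\<close> is convex.\<close>
    define z where "z t x = 1 / 4 * (1 / m * w t x + (- 1 + P t (h k) x))" for t x
    define z' where "z' t x = 1 / 4 * (1 / m * w' t x + P t (L (h k)) x)" for t x
    have CP: "P t (h k) \<in> C" if "0 < t" for t using P_smooth[OF hk] that by simp
    have zC: "z t \<in> C" if "0 < t" "t < b" for t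
      unfolding z_def by (intro Csmooth_cmult Csmooth_add Csmooth_const sm that CP)
    have zd: "((\<lambda>s. z s x) has_real_derivative z' t x) (at t)" if "0 < t" "t < b" for t x
      unfolding z_def z'_def
      by (rule derivative_eq_intros der[OF that] P_deriv[OF hk that(1)] refl | simp)+
    have zL: "z' t x \<le> L (z t) x" if t: "0 < t" "t < b" for t x
    proof -
      have "L (z t) x = 1 / 4 * (1 / m * L (w t) x + L (P t (h k)) x)"
        unfolding z_def
        by (subst L_cmult, intro Csmooth_cmult Csmooth_add Csmooth_const sm t CP,
            subst L_add, intro Csmooth_cmult sm t, intro Csmooth_add Csmooth_const CP t,
            subst L_cmult, intro sm t, subst L_add_const, intro CP t, rule refl)
      moreover have "L (P t (h k)) x = P t (L (h k)) x" using L_P[OF hk] t by simp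
      moreover have "1 / m * w' t x \<le> 1 / m * L (w t) x" using sub[OF t] m by (intro mult_left_mono) auto
      ultimately show ?thesis unfolding z'_def by simp
    qed
    have zP: "4 * z t x \<le> P t (h k) x" if "0 < t" "t < b" for t x
      using wm[OF that, of x] by (simp add: z_def)
    have z4: "z t x \<le> 1 / 4" if "0 < t" "t < b" for t x
      using zP[OF that, of x] P_h_le_1[of t k x] that by simp
    obtain B1 where B1: "B1 \<ge> 0" "\<And>t x. t \<ge> 0 \<Longrightarrow> \<bar>P t (L (h k)) x\<bar> \<le> B1"
      using P_bounded[OF Lhk] by auto
    have z'b: "\<bar>z' t x\<bar> \<le> \<bar>M'\<bar> + B1" if t: "0 < t" "t < b" for t x
    proof -
      have "\<bar>w' t x\<bar> * 1 \<le> \<bar>w' t x\<bar> * m" using m by (intro mult_left_mono) auto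
      then have "\<bar>1 / m * w' t x\<bar> \<le> \<bar>w' t x\<bar>" using m by (simp add: abs_mult divide_simps)
      moreover have "\<bar>w' t x\<bar> \<le> \<bar>M'\<bar>" using bd'[OF t, of x] by linarith
      moreover have "\<bar>P t (L (h k)) x\<bar> \<le> B1" using B1(2) t by simp
      ultimately have "\<bar>1 / m * w' t x + P t (L (h k)) x\<bar> \<le> \<bar>M'\<bar> + B1" by linarith
      moreover have "z' t x = 1 / 4 * (1 / m * w' t x + P t (L (h k)) x)" by (simp only: z'_def)
      moreover have "\<bar>1 / 4 * X\<bar> \<le> Y" if "\<bar>X\<bar> \<le> Y" for X Y :: real
        using that by (simp add: abs_mult)
      ultimately show ?thesis by (simp only:)
    qed
    define N where "N = (\<integral>x. (h k x)\<^sup>2 \<partial>\<mu>)"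
    have N0: "N \<ge> 0" by (simp add: N_def)
    have PN: "integrable \<mu> (\<lambda>x. (P t (h k) x)\<^sup>2)" "(\<integral>x. (P t (h k) x)\<^sup>2 \<partial>\<mu>) \<le> N" if "t \<ge> 0" for t
      using P_L2[OF that Ctest_L2[OF hk]] P_contraction[OF that Ctest_L2[OF hk]] by (auto simp: L2_def N_def)
    \<comment> \<open>Energy of the positive part of \<open>z\<close>, localised by a second cutoff.
      The index \<open>j\<close> goes to infinity with \<open>k\<close> fixed, and only afterwards
      does \<open>k\<close>.\<close>
    define E where "E j t = (\<integral>x. (h j x)\<^sup>2 * bump (z t x) \<partial>\<mu>)" for j t
    have hj2: "(\<lambda>x. (h j x)\<^sup>2) \<in> T" for j
      using Ctest_mult[OF h_test h_Csmooth, of j j] by (simp add: power2_eq_square)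
    have Eint: "integrable \<mu> (\<lambda>x. (h j x)\<^sup>2 * bump (z t x))" if "0 < t" "t < b" for j t
      by (intro Ctest_integrable_mult hj2 Csmooth_bump zC that)
    have Eder: "(E j has_real_derivative (\<integral>x. (h j x)\<^sup>2 * (bump' (z t x) * z' t x) \<partial>\<mu>)) (at t)"
      and E'int: "integrable \<mu> (\<lambda>x. (h j x)\<^sup>2 * (bump' (z t x) * z' t x))" if t: "0 < t" "t < b" for j t
    proof -
      have le: "\<bar>(h j x)\<^sup>2 * (bump' (z s x) * z' s x)\<bar> \<le> (h j x)\<^sup>2 * (2 * (\<bar>M'\<bar> + B1))" if "0 < s" "s < b" for s x
      proof -
        have "\<bar>bump' (z s x)\<bar> * \<bar>z' s x\<bar> \<le> 2 * (\<bar>M'\<bar> + B1)"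
          using bump'_le[of "z s x"] bump_nonneg(2)[of "z s x"] z'b[OF that, of x] by (intro mult_mono) auto
        then show ?thesis by (simp add: abs_mult mult_left_mono)
      qed
      have der: "((\<lambda>s. (h j x)\<^sup>2 * bump (z s x)) has_real_derivative (h j x)\<^sup>2 * (bump' (z s x) * z' s x)) (at s)"
        if "0 < s" "s < b" for s x
        by (rule DERIV_cmult, rule DERIV_chain2[OF bump_DERIV zd[OF that]])
      have gint: "integrable \<mu> (\<lambda>x. (h j x)\<^sup>2 * (2 * (\<bar>M'\<bar> + B1)))"
        using Ctest_integrable[OF hj2] by simp
      show "(E j has_real_derivative (\<integral>x. (h j x)\<^sup>2 * (bump' (z t x) * z' t x) \<partial>\<mu>)) (at t)"
        unfolding E_def by (rule DERIV_integral_dominated(2)[OF t Eint der le gint])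
      show "integrable \<mu> (\<lambda>x. (h j x)\<^sup>2 * (bump' (z t x) * z' t x))"
        by (rule DERIV_integral_dominated(1)[OF t Eint der le gint])
    qed
    have E'le: "(\<integral>x. (h j x)\<^sup>2 * (bump' (z t x) * z' t x) \<partial>\<mu>) \<le> e * N"
      if t: "0 < t" "t < b" and e: "e > 0" and \<Gamma>e: "\<And>x. \<Gamma> (h j) (h j) x \<le> e" for j t e
    proof -
      let ?\<eta> = "\<lambda>x. (h j x)\<^sup>2 * bump' (z t x)"
      have \<eta>: "?\<eta> \<in> T" by (intro Ctest_mult hj2 Csmooth_bump zC t)
      have CLz: "L (z t) \<in> C" by (intro Csmooth_L zC t)
      have "(\<integral>x. (h j x)\<^sup>2 * (bump' (z t x) * z' t x) \<partial>\<mu>) \<le> (\<integral>x. ?\<eta> x * L (z t) x \<partial>\<mu>)"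
      proof (rule integral_mono[OF E'int[OF t]])
        show "integrable \<mu> (\<lambda>x. ?\<eta> x * L (z t) x)" by (rule Ctest_integrable_mult[OF \<eta> CLz])
        show "(h j x)\<^sup>2 * (bump' (z t x) * z' t x) \<le> ?\<eta> x * L (z t) x" for x
          using zL[OF t, of x] bump_nonneg(2)[of "z t x"] by (simp add: mult.assoc mult_left_mono)
      qed
      also have "\<dots> = - (\<integral>x. \<Gamma> ?\<eta> (z t) x \<partial>\<mu>)"
        by (rule integration_by_parts(2)[OF \<eta> zC[OF t]])
      also have "\<dots> = (\<integral>x. - \<Gamma> ?\<eta> (z t) x \<partial>\<mu>)" by simp
      \<comment> \<open>Pointwise, the convexity term \<open>bump'' * \<Gamma>(z)\<close> absorbs
        the cutoff term with \<Gamma>(h j, z); by \<open>bump_convex\<close> the remainder is at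
        most \<open>4 (max z 0)^2 * \<Gamma>(h j)\<close>.\<close>
      also have "\<dots> \<le> (\<integral>x. e * (P t (h k) x)\<^sup>2 \<partial>\<mu>)"
      proof (rule integral_mono)
        show "integrable \<mu> (\<lambda>x. - \<Gamma> ?\<eta> (z t) x)" using integration_by_parts(1)[OF \<eta> zC[OF t]] by simp
        show "integrable \<mu> (\<lambda>x. e * (P t (h k) x)\<^sup>2)" using PN(1) t by simp
        fix x
        have h2: "\<Gamma> (\<lambda>x. (h j x)\<^sup>2) (z t) x = 2 * h j x * \<Gamma> (h j) (z t) x"
          using form_mult[OF cdc_form h_Csmooth h_Csmooth zC[OF t], of j j x] by (simp add: power2_eq_square)
        have bz: "\<Gamma> (\<lambda>x. bump' (z t x)) (z t) x = bump'' (z t x) * \<Gamma> (z t) (z t) x"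
          by (rule form_chain[OF cdc_form zC[OF t] zC[OF t] Csmooth_bump(2)[OF zC[OF t]] bump'_DERIV])
        have \<Gamma>\<eta>: "\<Gamma> ?\<eta> (z t) x = (h j x)\<^sup>2 * bump'' (z t x) * \<Gamma> (z t) (z t) x
            + 2 * h j x * bump' (z t x) * \<Gamma> (h j) (z t) x"
          using form_mult[OF cdc_form Ctest_Csmooth[OF hj2] Csmooth_bump(2)[OF zC[OF t]] zC[OF t], of j x] h2 bz
          by (simp add: algebra_simps)
        let ?y = "z t x" let ?a = "bump'' ?y" let ?p = "bump' ?y" let ?q = "4 * (max ?y 0)\<^sup>2"
        have conv: "0 \<le> ?a" "?p\<^sup>2 \<le> ?a * ?q" using bump_convex z4[OF t] by auto
        have "0 \<le> \<Gamma> (h j) (h j) x" "0 \<le> \<Gamma> (z t) (z t) x"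
          by (intro form_nonneg[OF cdc_form] h_Csmooth zC t)+
        moreover have "(\<Gamma> (h j) (z t) x)\<^sup>2 \<le> \<Gamma> (h j) (h j) x * \<Gamma> (z t) (z t) x"
          by (rule form_cauchy_schwarz[OF cdc_form h_Csmooth zC[OF t]])
        \<comment> \<open>\<open>A1\<close> is the convexity term, \<open>A2\<close> the mixed term
          and \<open>A3\<close> the remainder; the discriminant condition gives
          \<open>|A2| \<le> A1 + A3\<close>.\<close>
        moreover have "0 \<le> A1 + A2 + A3" if "A1 \<ge> 0" "A3 \<ge> 0" "A2\<^sup>2 \<le> 4 * A1 * A3" for A1 A2 A3 :: real
        proof -
          have "A2\<^sup>2 \<le> (A1 + A3)\<^sup>2"
            using that(3) zero_le_power2[of "A1 - A3"] by (simp add: power2_eq_square algebra_simps)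
          then have "\<bar>A2\<bar> \<le> \<bar>A1 + A3\<bar>" by (simp only: abs_le_square_iff)
          then show ?thesis using that by linarith
        qed
        moreover have "(2 * h j x * ?p * \<Gamma> (h j) (z t) x)\<^sup>2
            \<le> 4 * ((h j x)\<^sup>2 * ?a * \<Gamma> (z t) (z t) x) * (?q * \<Gamma> (h j) (h j) x)"
        proof -
          have "?p\<^sup>2 * (\<Gamma> (h j) (z t) x)\<^sup>2 \<le> (?a * ?q) * (\<Gamma> (h j) (h j) x * \<Gamma> (z t) (z t) x)"
            using conv calculation by (intro mult_mono) auto
          then have "4 * (h j x)\<^sup>2 * (?p\<^sup>2 * (\<Gamma> (h j) (z t) x)\<^sup>2)
              \<le> 4 * (h j x)\<^sup>2 * ((?a * ?q) * (\<Gamma> (h j) (h j) x * \<Gamma> (z t) (z t) x))"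
            by (intro mult_left_mono) auto
          then show ?thesis by (simp add: power_mult_distrib algebra_simps)
        qed
        ultimately have "0 \<le> (h j x)\<^sup>2 * ?a * \<Gamma> (z t) (z t) x + 2 * h j x * ?p * \<Gamma> (h j) (z t) x
            + ?q * \<Gamma> (h j) (h j) x"
          using conv(1) by simp
        then have "- \<Gamma> ?\<eta> (z t) x \<le> ?q * \<Gamma> (h j) (h j) x" using \<Gamma>\<eta> by linarith
        also have "\<dots> \<le> ?q * e" using \<Gamma>e[of x] by (intro mult_left_mono) auto
        also have "\<dots> \<le> e * (P t (h k) x)\<^sup>2"
        proof -
          have "(2 * max ?y 0)\<^sup>2 \<le> (P t (h k) x)\<^sup>2"
          proof (cases "?y \<ge> 0")
            case True
            then show ?thesis using zP[OF t, of x] by (intro power_mono) auto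
          qed (simp add: max_def)
          then have "?q \<le> (P t (h k) x)\<^sup>2" by (simp add: power_mult_distrib)
          then show ?thesis using e by (simp add: mult.commute mult_left_mono)
        qed
        finally show "- \<Gamma> ?\<eta> (z t) x \<le> e * (P t (h k) x)\<^sup>2" .
      qed
      also have "\<dots> \<le> e * N" using PN(2)[of t] t e by (simp add: mult_left_mono)
      finally show ?thesis .
    qed
    have Ele: "E j r \<le> r * (e * N)" if e: "e > 0" and \<Gamma>e: "\<And>x. \<Gamma> (h j) (h j) x \<le> e" for j e
    proof (rule field_le_epsilon)
      fix e' :: real assume e': "e' > 0"
      define I where "I = (\<integral>x. (h j x)\<^sup>2 \<partial>\<mu>)"
      have I: "I \<ge> 0" by (simp add: I_def)
      \<comment> \<open>Starting at a small positive time \<open>s\<close> with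
        \<open>w \<le> \<epsilon>\<close> everywhere makes the initial energy at most
        \<open>e'\<close>. Nothing is known about \<open>w\<close> at time 0 itself.\<close>
      define \<epsilon> where "\<epsilon> = min 1 (e' / (2 * (I + 1)))"
      have \<epsilon>: "\<epsilon> > 0" "\<epsilon> \<le> 1" using e' I by (auto simp: \<epsilon>_def)
      obtain \<delta> where \<delta>: "\<delta> > 0" "\<And>t x. 0 < t \<Longrightarrow> t < \<delta> \<Longrightarrow> t < b \<Longrightarrow> w t x \<le> \<epsilon>"
        using init[OF \<epsilon>(1)] by blast
      define s where "s = min \<delta> r / 2"
      have s: "0 < s" "s < \<delta>" "s < r" "s < b" using \<delta>(1) T by (auto simp: s_def)
      have zs: "z s x \<le> \<epsilon>" for x
      proof -
        have "w s x / m \<le> \<epsilon>"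
        proof -
          have "w s x \<le> \<epsilon> * 1" using \<delta>(2)[of s x] s by simp
          also have "\<dots> \<le> \<epsilon> * m" using m \<epsilon> by (intro mult_left_mono) auto
          finally show ?thesis using m by (simp add: divide_simps)
        qed
        then have "4 * z s x \<le> \<epsilon>" using P_h_le_1[of s k x] s by (simp add: z_def)
        then show ?thesis using \<epsilon> by simp
      qed
      have "E j s \<le> (\<integral>x. 2 * \<epsilon> * (h j x)\<^sup>2 \<partial>\<mu>)"
        unfolding E_def
      proof (rule integral_mono[OF Eint])
        show "integrable \<mu> (\<lambda>x. 2 * \<epsilon> * (h j x)\<^sup>2)" using Ctest_integrable[OF hj2] by simp
        fix x
        have "bump (z s x) \<le> 2 * \<epsilon>"
        proof (cases "z s x \<le> 0")
          case False
          then have "bump (z s x) \<le> 2 * (z s x)\<^sup>2" using bump_le by simp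
          also have "(z s x)\<^sup>2 \<le> \<epsilon> * 1" unfolding power2_eq_square
            using False zs[of x] \<epsilon> by (intro mult_mono) auto
          finally show ?thesis by simp
        qed (use \<epsilon> in \<open>simp add: bump_le_0\<close>)
        then have "(h j x)\<^sup>2 * bump (z s x) \<le> (h j x)\<^sup>2 * (2 * \<epsilon>)" by (intro mult_left_mono) auto
        then show "(h j x)\<^sup>2 * bump (z s x) \<le> 2 * \<epsilon> * (h j x)\<^sup>2" by (simp add: mult.commute)
      qed (use s in auto)
      also have "\<dots> = 2 * \<epsilon> * I" by (simp add: I_def)
      also have "\<dots> \<le> 2 * (e' / (2 * (I + 1))) * I" using I by (intro mult_right_mono) (auto simp: \<epsilon>_def)
      also have "\<dots> \<le> e'" using I e' by (simp add: divide_simps)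
      finally have Es: "E j s \<le> e'" .
      obtain t where t: "s < t" "t < r" "E j r - E j s = (r - s) * (\<integral>x. (h j x)\<^sup>2 * (bump' (z t x) * z' t x) \<partial>\<mu>)"
        using MVT2[OF s(3), of "E j" "\<lambda>t. \<integral>x. (h j x)\<^sup>2 * (bump' (z t x) * z' t x) \<partial>\<mu>"] Eder s T by force
      have "E j r - E j s \<le> (r - s) * (e * N)"
        unfolding t(3) using E'le[OF _ _ e \<Gamma>e, of t] t s T by (intro mult_left_mono) auto
      also have "\<dots> \<le> r * (e * N)" using s N0 e by (intro mult_right_mono) auto
      finally show "E j r \<le> r * (e * N) + e'" using Es by simp
    qed
    obtain B where B: "B \<ge> 1" "\<And>k x. \<bar>h k x\<bar> \<le> B" using h_bounded by blast
    have rC: "z r \<in> C" by (rule zC[OF T])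
    have mb: "(\<lambda>x. bump (z r x)) \<in> borel_measurable \<mu>"
      by (rule Csmooth_measurable[OF Csmooth_bump(1)[OF rC]])
    have bP: "bump (z r x) \<le> (P r (h k) x)\<^sup>2" for x
    proof (cases "z r x \<le> 0")
      case False
      then have "bump (z r x) \<le> 2 * (z r x)\<^sup>2" using bump_le by simp
      also have "\<dots> \<le> (4 * z r x)\<^sup>2" by (simp add: power_mult_distrib)
      also have "\<dots> \<le> (P r (h k) x)\<^sup>2" using False zP[OF T, of x] by (intro power_mono) auto
      finally show ?thesis .
    qed (simp add: bump_le_0)
    have "(\<lambda>j. E j r) \<longlonglongrightarrow> (\<integral>x. bump (z r x) \<partial>\<mu>)" and bint: "integrable \<mu> (\<lambda>x. bump (z r x))"
    proof -
      have "(\<lambda>x. (h j x)\<^sup>2 * bump (z r x)) \<in> borel_measurable \<mu>" for j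
        using Eint[OF T] by auto
      moreover have "integrable \<mu> (\<lambda>x. B\<^sup>2 * (P r (h k) x)\<^sup>2)" using PN(1)[of r] T by simp
      moreover have "AE x in \<mu>. (\<lambda>j. (h j x)\<^sup>2 * bump (z r x)) \<longlonglongrightarrow> bump (z r x)"
      proof (rule AE_I2)
        fix x
        have "(\<lambda>j. (h j x)\<^sup>2 * bump (z r x)) \<longlonglongrightarrow> 1\<^sup>2 * bump (z r x)"
          by (intro tendsto_intros h_lim)
        then show "(\<lambda>j. (h j x)\<^sup>2 * bump (z r x)) \<longlonglongrightarrow> bump (z r x)" by simp
      qed
      moreover have "AE x in \<mu>. norm ((h j x)\<^sup>2 * bump (z r x)) \<le> B\<^sup>2 * (P r (h k) x)\<^sup>2" for j
      proof (rule AE_I2)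
        fix x
        have "(h j x)\<^sup>2 \<le> B\<^sup>2" using B(2)[of j x] B(1) by (simp add: abs_le_square_iff[symmetric])
        then have "(h j x)\<^sup>2 * bump (z r x) \<le> B\<^sup>2 * (P r (h k) x)\<^sup>2"
          using bP[of x] bump_nonneg(1)[of "z r x"] by (intro mult_mono) auto
        then show "norm ((h j x)\<^sup>2 * bump (z r x)) \<le> B\<^sup>2 * (P r (h k) x)\<^sup>2"
          using bump_nonneg(1)[of "z r x"] by simp
      qed
      ultimately show "(\<lambda>j. E j r) \<longlonglongrightarrow> (\<integral>x. bump (z r x) \<partial>\<mu>)" "integrable \<mu> (\<lambda>x. bump (z r x))"
        using integral_dominated_convergence[OF mb, of "\<lambda>j x. (h j x)\<^sup>2 * bump (z r x)"]
          integrable_dominated_convergence[OF mb, of "\<lambda>j x. (h j x)\<^sup>2 * bump (z r x)"]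
        unfolding E_def by blast+
    qed
    moreover have "(\<lambda>j. E j r) \<longlonglongrightarrow> 0"
    proof (rule LIMSEQ_I)
      fix e' :: real assume e': "e' > 0"
      define e where "e = e' / (2 * r * (N + 1))"
      have e: "e > 0" using e' N0 T by (simp add: e_def)
      have "r * (e * N) < e'"
      proof -
        have "r * (e * N) = e' * (N / (2 * (N + 1)))" using T N0 by (simp add: e_def divide_simps)
        also have "\<dots> < e' * 1" using e' N0 by (intro mult_strict_left_mono) (auto simp: divide_simps)
        finally show ?thesis by simp
      qed
      moreover obtain J where "\<And>j. j \<ge> J \<Longrightarrow> \<forall>x. \<Gamma> (h j) (h j) x \<le> e"
        using h_grad_le[OF e] unfolding eventually_sequentially by blast
      ultimately have "E j r < e'" if "j \<ge> J" for j using Ele[OF e, of j] that by force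
      moreover have "0 \<le> E j r" for j unfolding E_def using bump_nonneg(1) by simp
      ultimately show "\<exists>J. \<forall>j\<ge>J. norm (E j r - 0) < e'" by (intro exI[of _ J]) auto
    qed
    ultimately have "(\<integral>x. bump (z r x) \<partial>\<mu>) = 0" using LIMSEQ_unique by blast
    then have "AE x in \<mu>. bump (z r x) = 0"
      using integral_nonneg_eq_0_iff_AE[OF bint] bump_nonneg(1) by simp
    then have "AE x in \<mu>. z r x \<le> 0"
      by eventually_elim (metis bump_pos less_irrefl not_le)
    then have "z r x \<le> 0"
      using continuous_AE_le[OF Csmooth_continuous[OF rC] continuous_on_const] by blast
    then show ?thesis by (simp add: z_def)
  qed
  \<comment> \<open>Conservation of mass enters here: \<open>P r (h k) x\<close> tends to
    \<open>P r 1 x = 1\<close>, so the comparison function disappears.\<close>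
  have "(\<lambda>k. 1 - P r (h k) x) \<longlonglongrightarrow> 1 - 1" using T by (intro tendsto_intros P_h_lim) auto
  then have "w r x / m \<le> 1 - 1" using key by (intro LIMSEQ_le_const) auto
  then show ?thesis using m by (simp add: divide_le_0_iff)
qed

end

lemma abs_sum4_le:
  fixes B :: real
  assumes "\<bar>x1\<bar> \<le> B" "\<bar>x2\<bar> \<le> B" "\<bar>x3\<bar> \<le> B" "\<bar>x4\<bar> \<le> B"
  shows "\<bar>x1 + x2 + x3 + x4\<bar> \<le> 4 * B"
  using assms by linarith

lemma abs_mult_le:
  fixes B :: real
  assumes "\<bar>x\<bar> \<le> A" "\<bar>y\<bar> \<le> B" shows "\<bar>x * y\<bar> \<le> A * B"
  unfolding abs_mult using assms by (intro mult_mono) auto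

context heat
begin

lemma Csmooth_lincomb4:
  assumes "f1 \<in> C" "f2 \<in> C" "f3 \<in> C" "f4 \<in> C"
  shows "(\<lambda>x. a1 * f1 x + a2 * f2 x + a3 * f3 x + a4 * f4 x) \<in> C"
  by (intro Csmooth_add Csmooth_cmult assms)

lemma L_lincomb4:
  assumes "f1 \<in> C" "f2 \<in> C" "f3 \<in> C" "f4 \<in> C"
  shows "L (\<lambda>x. a1 * f1 x + a2 * f2 x + a3 * f3 x + a4 * f4 x) x
    = a1 * L f1 x + a2 * L f2 x + a3 * L f3 x + a4 * L f4 x"
proof -
  have c: "(\<lambda>x. a1 * f1 x) \<in> C" "(\<lambda>x. a2 * f2 x) \<in> C" "(\<lambda>x. a3 * f3 x) \<in> C" "(\<lambda>x. a4 * f4 x) \<in> C"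
    using assms Csmooth_cmult by auto
  show ?thesis
    by (simp only: L_add[OF Csmooth_add[OF Csmooth_add[OF c(1,2)] c(3)] c(4)] L_add[OF Csmooth_add[OF c(1,2)] c(3)]
        L_add[OF c(1,2)] L_cmult assms)
qed

text \<open>Both applications concern two gradient terms and two terms without gradient, with
  time-dependent coefficients. Three coefficients vanish at time 0, so the initial condition
  involves only \<open>az 0 * Fz\<close>; the uniform bound \<open>B\<close> turns continuity of the
  coefficients into the uniform smallness near time 0 that \<open>maximum_principle\<close> asks
  for. The condition \<open>sub\<close> says that the combination is a subsolution of the heat
  equation.\<close>

lemma maximum_principle4:
  assumes r: "0 < r" "r < b"
    and FC: "\<And>t. 0 < t \<Longrightarrow> t < b \<Longrightarrow> Fp t \<in> C" "\<And>t. 0 < t \<Longrightarrow> t < b \<Longrightarrow> Fq t \<in> C"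
      "\<And>t. 0 < t \<Longrightarrow> t < b \<Longrightarrow> Fr t \<in> C" "\<And>t. 0 < t \<Longrightarrow> t < b \<Longrightarrow> Fz t \<in> C"
    and F': "\<And>t x. 0 < t \<Longrightarrow> t < b \<Longrightarrow> ((\<lambda>s. Fp s x) has_real_derivative Fp' t x) (at t)"
      "\<And>t x. 0 < t \<Longrightarrow> t < b \<Longrightarrow> ((\<lambda>s. Fq s x) has_real_derivative Fq' t x) (at t)"
      "\<And>t x. 0 < t \<Longrightarrow> t < b \<Longrightarrow> ((\<lambda>s. Fr s x) has_real_derivative Fr' t x) (at t)"
      "\<And>t x. 0 < t \<Longrightarrow> t < b \<Longrightarrow> ((\<lambda>s. Fz s x) has_real_derivative Fz' t x) (at t)"
    and a': "\<And>t. (ap has_real_derivative ap' t) (at t)" "\<And>t. (aq has_real_derivative aq' t) (at t)"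
      "\<And>t. (ar has_real_derivative ar' t) (at t)" "\<And>t. (az has_real_derivative az' t) (at t)"
    and FB: "\<And>t x. 0 < t \<Longrightarrow> t < b \<Longrightarrow> \<bar>Fp t x\<bar> \<le> B \<and> \<bar>Fq t x\<bar> \<le> B \<and> \<bar>Fr t x\<bar> \<le> B \<and> \<bar>Fz t x\<bar> \<le> B"
    and FB': "\<And>t x. 0 < t \<Longrightarrow> t < b \<Longrightarrow> \<bar>Fp' t x\<bar> \<le> B \<and> \<bar>Fq' t x\<bar> \<le> B \<and> \<bar>Fr' t x\<bar> \<le> B \<and> \<bar>Fz' t x\<bar> \<le> B"
    and ca: "continuous_on {0..b} ap'" "continuous_on {0..b} aq'" "continuous_on {0..b} ar'" "continuous_on {0..b} az'"
    and a0: "ap 0 = 0" "aq 0 = 0" "ar 0 = 0"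
    and init: "\<And>t x. 0 < t \<Longrightarrow> t < b \<Longrightarrow> az 0 * Fz t x \<le> q"
    and sub: "\<And>t x. 0 < t \<Longrightarrow> t < b \<Longrightarrow>
        ap' t * Fp t x + aq' t * Fq t x + ar' t * Fr t x + az' t * Fz t x
        \<le> ap t * (L (Fp t) x - Fp' t x) + aq t * (L (Fq t) x - Fq' t x)
          + ar t * (L (Fr t) x - Fr' t x) + az t * (L (Fz t) x - Fz' t x)"
  shows "ap r * Fp r x + aq r * Fq r x + ar r * Fr r x + az r * Fz r x \<le> q"
proof -
  define w where "w t x = - q + (ap t * Fp t x + aq t * Fq t x + ar t * Fr t x + az t * Fz t x)" for t x
  define w' where "w' t x = (ap' t * Fp t x + ap t * Fp' t x) + (aq' t * Fq t x + aq t * Fq' t x)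
     + (ar' t * Fr t x + ar t * Fr' t x) + (az' t * Fz t x + az t * Fz' t x)" for t x
  have bounded_ivl: "\<exists>K\<ge>0. \<forall>t\<in>{0..b}. \<bar>g t\<bar> \<le> K" if "continuous_on {0..b} g" for g :: "real \<Rightarrow> real"
  proof -
    have "bounded (g ` {0..b})" using that compact_continuous_image compact_imp_bounded by blast
    then obtain K where "\<forall>y\<in>g ` {0..b}. norm y \<le> K" unfolding bounded_iff by blast
    then show ?thesis by (intro exI[of _ "max K 0"]) (auto simp: le_max_iff_disj)
  qed
  have coa: "continuous_on {0..b} ap" "continuous_on {0..b} aq" "continuous_on {0..b} ar" "continuous_on {0..b} az"
    by (rule DERIV_continuous_on, rule has_field_derivative_at_within, rule a')+
  obtain K1 where K1: "K1 \<ge> 0" "\<forall>t\<in>{0..b}. \<bar>ap t\<bar> \<le> K1" using bounded_ivl[OF coa(1)] by blast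
  obtain K2 where K2: "K2 \<ge> 0" "\<forall>t\<in>{0..b}. \<bar>aq t\<bar> \<le> K2" using bounded_ivl[OF coa(2)] by blast
  obtain K3 where K3: "K3 \<ge> 0" "\<forall>t\<in>{0..b}. \<bar>ar t\<bar> \<le> K3" using bounded_ivl[OF coa(3)] by blast
  obtain K4 where K4: "K4 \<ge> 0" "\<forall>t\<in>{0..b}. \<bar>az t\<bar> \<le> K4" using bounded_ivl[OF coa(4)] by blast
  obtain K1' where K1': "K1' \<ge> 0" "\<forall>t\<in>{0..b}. \<bar>ap' t\<bar> \<le> K1'" using bounded_ivl[OF ca(1)] by blast
  obtain K2' where K2': "K2' \<ge> 0" "\<forall>t\<in>{0..b}. \<bar>aq' t\<bar> \<le> K2'" using bounded_ivl[OF ca(2)] by blast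
  obtain K3' where K3': "K3' \<ge> 0" "\<forall>t\<in>{0..b}. \<bar>ar' t\<bar> \<le> K3'" using bounded_ivl[OF ca(3)] by blast
  obtain K4' where K4': "K4' \<ge> 0" "\<forall>t\<in>{0..b}. \<bar>az' t\<bar> \<le> K4'" using bounded_ivl[OF ca(4)] by blast
  define K where "K = K1 + K2 + K3 + K4 + K1' + K2' + K3' + K4'"
  have K: "\<bar>ap t\<bar> \<le> K" "\<bar>aq t\<bar> \<le> K" "\<bar>ar t\<bar> \<le> K" "\<bar>az t\<bar> \<le> K"
      "\<bar>ap' t\<bar> \<le> K" "\<bar>aq' t\<bar> \<le> K" "\<bar>ar' t\<bar> \<le> K" "\<bar>az' t\<bar> \<le> K" if "0 < t" "t < b" for t
  proof -
    have t: "t \<in> {0..b}" using that by simp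
    note bs = bspec[OF K1(2) t] bspec[OF K2(2) t] bspec[OF K3(2) t] bspec[OF K4(2) t]
      bspec[OF K1'(2) t] bspec[OF K2'(2) t] bspec[OF K3'(2) t] bspec[OF K4'(2) t]
    show "\<bar>ap t\<bar> \<le> K" "\<bar>aq t\<bar> \<le> K" "\<bar>ar t\<bar> \<le> K" "\<bar>az t\<bar> \<le> K"
      "\<bar>ap' t\<bar> \<le> K" "\<bar>aq' t\<bar> \<le> K" "\<bar>ar' t\<bar> \<le> K" "\<bar>az' t\<bar> \<le> K"
      unfolding K_def using bs K1(1) K2(1) K3(1) K4(1) K1'(1) K2'(1) K3'(1) K4'(1) by linarith+
  qed
  have "w r x \<le> 0"
  proof (rule maximum_principle[OF r, where w=w and w'=w' and M="\<bar>q\<bar> + 4 * (K * B)" and M'="4 * (K * B + K * B)"])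
    fix t x assume t: "0 < t" "t < b"
    note k = K[OF t]
    have f: "\<bar>Fp t x\<bar> \<le> B" "\<bar>Fq t x\<bar> \<le> B" "\<bar>Fr t x\<bar> \<le> B" "\<bar>Fz t x\<bar> \<le> B"
      and f': "\<bar>Fp' t x\<bar> \<le> B" "\<bar>Fq' t x\<bar> \<le> B" "\<bar>Fr' t x\<bar> \<le> B" "\<bar>Fz' t x\<bar> \<le> B"
      using FB[OF t, of x] FB'[OF t, of x] by blast+
    show "w t \<in> C" unfolding w_def by (intro Csmooth_add Csmooth_const Csmooth_lincomb4 FC t)
    show "((\<lambda>s. w s x) has_real_derivative w' t x) (at t)"
      unfolding w_def w'_def
      using DERIV_add[OF DERIV_const[of "-q"] DERIV_add[OF DERIV_add[OF DERIV_add[OF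
        DERIV_mult[OF a'(1) F'(1)[OF t]] DERIV_mult[OF a'(2) F'(2)[OF t]]] DERIV_mult[OF a'(3) F'(3)[OF t]]]
        DERIV_mult[OF a'(4) F'(4)[OF t]]]]
      by (simp add: algebra_simps)
    have "L (w t) x = ap t * L (Fp t) x + aq t * L (Fq t) x + ar t * L (Fr t) x + az t * L (Fz t) x"
      unfolding w_def by (simp only: L_add_const[OF Csmooth_lincomb4] L_lincomb4 FC t)
    then show "w' t x \<le> L (w t) x" using sub[OF t, of x] unfolding w'_def by (simp add: algebra_simps)
    have "\<bar>ap t * Fp t x + aq t * Fq t x + ar t * Fr t x + az t * Fz t x\<bar> \<le> 4 * (K * B)"
      by (intro abs_sum4_le abs_mult_le k f)
    then show "w t x \<le> \<bar>q\<bar> + 4 * (K * B)" unfolding w_def by linarith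
    have add: "\<bar>y + z\<bar> \<le> K * B + K * B" if "\<bar>y\<bar> \<le> K * B" "\<bar>z\<bar> \<le> K * B" for y z :: real
      using that by linarith
    show "\<bar>w' t x\<bar> \<le> 4 * (K * B + K * B)"
      unfolding w'_def by (intro abs_sum4_le add abs_mult_le k f f')
  next
    fix e :: real assume e: "e > 0"
    define g where "g t = (\<bar>ap t\<bar> + \<bar>aq t\<bar> + \<bar>ar t\<bar> + \<bar>az t - az 0\<bar>) * B" for t
    have "isCont ap 0" "isCont aq 0" "isCont ar 0" "isCont az 0" using a' DERIV_isCont by blast+
    then have "isCont g 0" unfolding g_def by (intro continuous_intros)
    then have "(g \<longlongrightarrow> 0) (at 0)" unfolding isCont_def using a0 by (simp add: g_def)
    then have "eventually (\<lambda>t. g t < e) (at 0)" using e by (rule order_tendstoD)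
    then obtain \<delta> where \<delta>: "\<delta> > 0" "\<And>t. t \<noteq> 0 \<Longrightarrow> dist t 0 < \<delta> \<Longrightarrow> g t < e"
      unfolding eventually_at by auto
    have "w t x \<le> e" if t: "0 < t" "t < \<delta>" "t < b" for t x
    proof -
      note f = FB[OF t(1,3), of x]
      have "ap t * Fp t x \<le> \<bar>ap t\<bar> * B" "aq t * Fq t x \<le> \<bar>aq t\<bar> * B" "ar t * Fr t x \<le> \<bar>ar t\<bar> * B"
        "(az t - az 0) * Fz t x \<le> \<bar>az t - az 0\<bar> * B"
        using f abs_mult_le[OF order_refl] by (meson abs_le_D1)+
      moreover have "g t < e" using \<delta>(2)[of t] t by simp
      moreover have "az 0 * Fz t x \<le> q" using init[OF t(1,3)] .
      moreover have "az t * Fz t x = (az t - az 0) * Fz t x + az 0 * Fz t x" by (simp add: algebra_simps)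
      ultimately show ?thesis unfolding w_def g_def distrib_right by linarith
    qed
    then show "\<exists>\<delta>>0. \<forall>t x. 0 < t \<longrightarrow> t < \<delta> \<longrightarrow> t < b \<longrightarrow> w t x \<le> e" using \<delta>(1) by blast
  qed
  then show ?thesis by (simp add: w_def)
qed

end

section \<open>The gradient estimate\<close>

text \<open>The dimension is a positive real here; an infinite one is treated separately at the
  end.\<close>

locale curvature_dimension = heat A \<mu> L p h
  for A :: "('a::{t2_space, second_countable_topology}, 'b::euclidean_space) chart set"
    and \<mu> :: "'a measure"
    and L :: "('a \<Rightarrow> real) \<Rightarrow> 'a \<Rightarrow> real"
    and p :: "'a \<Rightarrow> 'a \<Rightarrow> real \<Rightarrow> real" and h :: "nat \<Rightarrow> 'a \<Rightarrow> real" +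
  fixes Z :: "('a \<Rightarrow> real) \<Rightarrow> ('a \<Rightarrow> real) \<Rightarrow> 'a \<Rightarrow> real"
    and \<rho>1 \<rho>2 \<kappa> d :: real
  assumes form_Z: "first_order_form A Z"
    and commute: "\<And>f. f \<in> Csmooth A \<Longrightarrow> cdc L f (Z f f) = Z f (cdc L f f)"
    and gradient_finite: "\<And>f T. f \<in> Ctest A \<Longrightarrow> T \<ge> 0 \<Longrightarrow>
         (SUP t\<in>{0..T}. sup_norm (cdc L (heat_op \<mu> p t f) (heat_op \<mu> p t f))
            + sup_norm (Z (heat_op \<mu> p t f) (heat_op \<mu> p t f))) < \<infinity>"
    and pos: "\<rho>1 > 0" "\<rho>2 > 0" "\<kappa> \<ge> 0" "d > 0"
    and curvature: "\<And>f \<nu> x. f \<in> Csmooth A \<Longrightarrow> \<nu> > 0 \<Longrightarrow>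
         iterated_form L (cdc L) f x + \<nu> * iterated_form L Z f x
           \<ge> 1 / d * (L f x)\<^sup>2 + (\<rho>1 - \<kappa> / \<nu>) * cdc L f f x + \<rho>2 * Z f f x"
begin

lemma gradient_bounded:
  assumes f: "f \<in> T" and r: "r \<ge> 0"
  shows "\<exists>B\<ge>0. \<forall>t\<in>{0..r}. \<forall>x. \<Gamma> (P t f) (P t f) x \<le> B \<and> Z (P t f) (P t f) x \<le> B"
proof -
  let ?S = "SUP t\<in>{0..r}. sup_norm (\<Gamma> (P t f) (P t f)) + sup_norm (Z (P t f) (P t f))"
  have fin: "?S < \<infinity>" by (rule gradient_finite[OF f r])
  have "\<Gamma> (P t f) (P t f) x \<le> enn2real ?S \<and> Z (P t f) (P t f) x \<le> enn2real ?S" if t: "t \<in> {0..r}" for t x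
  proof -
    have le: "sup_norm (\<Gamma> (P t f) (P t f)) + sup_norm (Z (P t f) (P t f)) \<le> ?S"
      using t by (rule SUP_upper)
    have "ennreal \<bar>\<Gamma> (P t f) (P t f) x\<bar> \<le> sup_norm (\<Gamma> (P t f) (P t f))"
      "ennreal \<bar>Z (P t f) (P t f) x\<bar> \<le> sup_norm (Z (P t f) (P t f))"
      unfolding sup_norm_def by (auto intro: SUP_upper)
    then have 1: "ennreal \<bar>\<Gamma> (P t f) (P t f) x\<bar> \<le> ?S" "ennreal \<bar>Z (P t f) (P t f) x\<bar> \<le> ?S"
      using le by (meson add_increasing add_increasing2 order_trans zero_le)+
    have "\<bar>\<Gamma> (P t f) (P t f) x\<bar> \<le> enn2real ?S" "\<bar>Z (P t f) (P t f) x\<bar> \<le> enn2real ?S"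
      using enn2real_mono[OF 1(1)] enn2real_mono[OF 1(2)] fin by auto
    then show ?thesis by linarith
  qed
  then show ?thesis by (intro exI[of _ "enn2real ?S"]) auto
qed

text \<open>Take \<open>\<nu> = b / a\<close> and multiply by \<open>a\<close>. The coefficients of
  the two iterated forms can then be prescribed as independent functions of time, at the price of
  the term \<open>\<kappa> a^2 / b\<close>.\<close>

lemma curvature_scaled:
  assumes f: "f \<in> C" and a: "a > 0" and b: "b > 0"
  shows "a * iterated_form L \<Gamma> f x + b * iterated_form L Z f x
    \<ge> a / d * (L f x)\<^sup>2 + (a * \<rho>1 - \<kappa> * a\<^sup>2 / b) * \<Gamma> f f x + a * \<rho>2 * Z f f x"
proof -
  have "a * (1 / d * (L f x)\<^sup>2 + (\<rho>1 - \<kappa> / (b / a)) * \<Gamma> f f x + \<rho>2 * Z f f x)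
      \<le> a * (iterated_form L \<Gamma> f x + b / a * iterated_form L Z f x)"
    using curvature[OF f, of "b / a" x] a b by (intro mult_left_mono) auto
  moreover have "a * (iterated_form L \<Gamma> f x + b / a * iterated_form L Z f x)
      = a * iterated_form L \<Gamma> f x + b * iterated_form L Z f x"
    using a by (simp add: distrib_left)
  moreover have "a * (1 / d * (L f x)\<^sup>2 + (\<rho>1 - \<kappa> / (b / a)) * \<Gamma> f f x + \<rho>2 * Z f f x)
     = a / d * (L f x)\<^sup>2 + (a * \<rho>1 - \<kappa> * a\<^sup>2 / b) * \<Gamma> f f x + a * \<rho>2 * Z f f x"
    using a b by (simp add: algebra_simps power2_eq_square)
  ultimately show ?thesis by simp
qed

text \<open>The factor \<open>D / d\<close>. It appears as \<open>1 + \<kappa> / b\<close> with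
  \<open>b = 2 \<rho>2 / 3\<close> in the gradient estimate, and again when the \<Gamma> terms are
  matched in \<open>li_yau\<close>.\<close>

definition A' :: real where "A' = 1 + 3 * \<kappa> / (2 * \<rho>2)"

lemma A'_ge: "A' \<ge> 1"
  using pos by (simp add: A'_def)

text \<open>Along \<open>P s f\<close>, the combination \<open>s^2 \<Gamma>(P s f) + b s^3 Z(P s f)
  + c s^3 (P s (L f))^2 + e (P s f)^2\<close> is a subsolution that starts below
  \<open>e B^2\<close>. Powers of time are enough, since what matters is decay for large
  \<open>t\<close>: the gradient tends to 0, and the time derivative decays like
  \<open>t powr (- 3 / 2)\<close>, which is integrable at infinity.\<close>

lemma gradient_estimate:
  assumes f: "f \<in> T" and B: "\<And>x. \<bar>f x\<bar> \<le> B" and t: "t > 0"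
  shows "t\<^sup>2 * \<Gamma> (P t f) (P t f) x + 2 / (3 * d) * t ^ 3 * (P t (L f) x)\<^sup>2 \<le> A'\<^sup>2 / (4 * \<rho>1) * B\<^sup>2"
proof -
  note Lf = Ctest_L[OF f] and LLf = Ctest_L[OF Ctest_L[OF f]]
  \<comment> \<open>\<open>b\<close> makes the time derivative \<open>3 b s^2\<close> of the
    coefficient of \<open>Z\<close> equal to \<open>2 \<rho>2 s^2\<close>, which curvature supplies;
    \<open>c\<close> does the same for \<open>(P s (L f))^2\<close>. The \<Gamma> terms then require
    \<open>\<rho>1 s^2 - A' s + e \<ge> 0\<close>, and \<open>e\<close> is the least constant
    achieving this for all \<open>s > 0\<close>.\<close>
  define e where "e = A'\<^sup>2 / (4 * \<rho>1)"
  define b where "b = 2 / 3 * \<rho>2"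
  define c where "c = 2 / (3 * d)"
  have bpos: "b > 0" using pos by (simp add: b_def)
  have e0: "e \<ge> 0" using pos by (simp add: e_def)
  define F1 where "F1 s = \<Gamma> (P s f) (P s f)" for s
  define F2 where "F2 s = Z (P s f) (P s f)" for s
  define F3 where "F3 s = (\<lambda>x. P s (L f) x * P s (L f) x)" for s
  define F4 where "F4 s = (\<lambda>x. P s f x * P s f x)" for s
  define F1' where "F1' s x = 2 * \<Gamma> (P s f) (P s (L f)) x" for s x
  define F2' where "F2' s x = 2 * Z (P s f) (P s (L f)) x" for s x
  define F3' where "F3' s x = P s (L (L f)) x * P s (L f) x + P s (L (L f)) x * P s (L f) x" for s x
  define F4' where "F4' s x = P s (L f) x * P s f x + P s (L f) x * P s f x" for s x
  have CP: "P s g \<in> C" if "g \<in> T" "s > 0" for s g using P_smooth that by simp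
  have LPs: "L (P s g) = P s (L g)" if "g \<in> T" "s > 0" for s g using L_P[OF that(1)] that(2) by auto
  obtain B1 where B1: "B1 \<ge> 0" "\<And>s x. s \<ge> 0 \<Longrightarrow> \<bar>P s f x\<bar> \<le> B1" using P_bounded[OF f] by auto
  obtain B2 where B2: "B2 \<ge> 0" "\<And>s x. s \<ge> 0 \<Longrightarrow> \<bar>P s (L f) x\<bar> \<le> B2" using P_bounded[OF Lf] by auto
  obtain B3 where B3: "B3 \<ge> 0" "\<And>s x. s \<ge> 0 \<Longrightarrow> \<bar>P s (L (L f)) x\<bar> \<le> B3" using P_bounded[OF LLf] by auto
  have tp: "t + 1 \<ge> 0" using t by simp
  obtain B4 where B4: "B4 \<ge> 0" "\<And>s x. s \<in> {0..t+1} \<Longrightarrow> \<Gamma> (P s f) (P s f) x \<le> B4"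
    "\<And>s x. s \<in> {0..t+1} \<Longrightarrow> Z (P s f) (P s f) x \<le> B4" using gradient_bounded[OF f tp] by blast
  obtain B5 where B5: "B5 \<ge> 0" "\<And>s x. s \<in> {0..t+1} \<Longrightarrow> \<Gamma> (P s (L f)) (P s (L f)) x \<le> B5"
    "\<And>s x. s \<in> {0..t+1} \<Longrightarrow> Z (P s (L f)) (P s (L f)) x \<le> B5" using gradient_bounded[OF Lf tp] by blast
  define BB where "BB = B4 + B5 + (B1 + B2 + B3)\<^sup>2 + (B1 + B2 + B3)\<^sup>2"
  have sq: "\<bar>y * z\<bar> \<le> (B1 + B2 + B3)\<^sup>2" if "\<bar>y\<bar> \<le> B1 + B2 + B3" "\<bar>z\<bar> \<le> B1 + B2 + B3" for y z :: real
    using abs_mult_le[OF that] by (simp add: power2_eq_square)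
  have P3: "\<bar>P s f x\<bar> \<le> B1 + B2 + B3" "\<bar>P s (L f) x\<bar> \<le> B1 + B2 + B3" "\<bar>P s (L (L f)) x\<bar> \<le> B1 + B2 + B3"
    if "s > 0" for s x
    using B1(2)[of s x] B2(2)[of s x] B3(2)[of s x] B1(1) B2(1) B3(1) that by simp_all
  have "t\<^sup>2 * F1 t x + b * t ^ 3 * F2 t x + c * t ^ 3 * F3 t x + e * F4 t x \<le> e * B\<^sup>2"
  proof (rule maximum_principle4[where b="t + 1" and r=t and Fp'=F1' and Fq'=F2' and Fr'=F3' and Fz'=F4'
      and ap="\<lambda>t. t\<^sup>2" and aq="\<lambda>t. b * t ^ 3" and ar="\<lambda>t. c * t ^ 3" and az="\<lambda>_. e"
      and ap'="\<lambda>t. 2 * t" and aq'="\<lambda>t. 3 * b * t\<^sup>2" and ar'="\<lambda>t. 3 * c * t\<^sup>2" and az'="\<lambda>_. 0" and B=BB])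
    fix s x assume s: "0 < s" "s < t + 1"
    then have si: "s \<in> {0..t+1}" by simp
    note Cf = CP[OF f s(1)] and CLf = CP[OF Lf s(1)] and CLLf = CP[OF LLf s(1)]
    show "F1 s \<in> C" unfolding F1_def by (rule Csmooth_cdc[OF Cf Cf])
    show "F2 s \<in> C" unfolding F2_def by (rule form_smooth[OF form_Z Cf Cf])
    show "F3 s \<in> C" unfolding F3_def by (rule Csmooth_mult[OF CLf CLf])
    show "F4 s \<in> C" unfolding F4_def by (rule Csmooth_mult[OF Cf Cf])
    show "((\<lambda>s. F1 s x) has_real_derivative F1' s x) (at s)"
      unfolding F1_def F1'_def by (rule form_deriv[OF cdc_form f s(1)])
    show "((\<lambda>s. F2 s x) has_real_derivative F2' s x) (at s)"
      unfolding F2_def F2'_def by (rule form_deriv[OF form_Z f s(1)])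
    show "((\<lambda>s. F3 s x) has_real_derivative F3' s x) (at s)"
      unfolding F3_def F3'_def by (rule DERIV_mult[OF P_deriv[OF Lf s(1)] P_deriv[OF Lf s(1)]])
    show "((\<lambda>s. F4 s x) has_real_derivative F4' s x) (at s)"
      unfolding F4_def F4'_def by (rule DERIV_mult[OF P_deriv[OF f s(1)] P_deriv[OF f s(1)]])
    note P3s = P3[OF s(1), of x]
    have n: "0 \<le> \<Gamma> (P s f) (P s f) x" "0 \<le> Z (P s f) (P s f) x"
      by (rule form_nonneg[OF cdc_form Cf] form_nonneg[OF form_Z Cf])+
    note b4 = B4(2)[OF si, of x] B4(3)[OF si, of x] and b5 = B5(2)[OF si, of x] B5(3)[OF si, of x]
    have sq0: "(B1 + B2 + B3)\<^sup>2 \<ge> 0" by simp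
    have "\<bar>F3 s x\<bar> \<le> (B1 + B2 + B3)\<^sup>2" "\<bar>F4 s x\<bar> \<le> (B1 + B2 + B3)\<^sup>2"
      unfolding F3_def F4_def by (intro sq P3s)+
    then show "\<bar>F1 s x\<bar> \<le> BB \<and> \<bar>F2 s x\<bar> \<le> BB \<and> \<bar>F3 s x\<bar> \<le> BB \<and> \<bar>F4 s x\<bar> \<le> BB"
      using n b4 B4(1) B5(1) sq0 unfolding F1_def F2_def BB_def by linarith
    have q3: "\<bar>P s (L (L f)) x * P s (L f) x\<bar> \<le> (B1 + B2 + B3)\<^sup>2" by (intro sq P3s)
    have q4: "\<bar>P s (L f) x * P s f x\<bar> \<le> (B1 + B2 + B3)\<^sup>2" by (intro sq P3s)
    have 3: "\<bar>F3' s x\<bar> \<le> BB" unfolding F3'_def BB_def using q3 B4(1) B5(1) by linarith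
    have 4: "\<bar>F4' s x\<bar> \<le> BB" unfolding F4'_def BB_def using q4 B4(1) B5(1) by linarith
    have 1: "\<bar>F1' s x\<bar> \<le> BB" unfolding F1'_def BB_def
      using form_abs_le[OF cdc_form Cf CLf, of x] b4 b5 sq0 by linarith
    have 2: "\<bar>F2' s x\<bar> \<le> BB" unfolding F2'_def BB_def
      using form_abs_le[OF form_Z Cf CLf, of x] b4 b5 sq0 by linarith
    show "\<bar>F1' s x\<bar> \<le> BB \<and> \<bar>F2' s x\<bar> \<le> BB \<and> \<bar>F3' s x\<bar> \<le> BB \<and> \<bar>F4' s x\<bar> \<le> BB"
      using 1 2 3 4 by blast
    show "e * F4 s x \<le> e * B\<^sup>2"
    proof (rule mult_left_mono[OF _ e0])
      have "\<bar>P s f x\<bar> \<le> B" by (rule P_abs_le[OF _ Ctest_measurable[OF f] B]) (use s in simp)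
      then have "\<bar>P s f x * P s f x\<bar> \<le> B * B" by (intro abs_mult_le)
      then show "F4 s x \<le> B\<^sup>2" unfolding F4_def power2_eq_square by linarith
    qed
    have i1: "L (F1 s) x - F1' s x = 2 * iterated_form L \<Gamma> (P s f) x"
      unfolding F1_def F1'_def iterated_form_def LPs[OF f s(1)] by simp
    have i2: "L (F2 s) x - F2' s x = 2 * iterated_form L Z (P s f) x"
      unfolding F2_def F2'_def iterated_form_def LPs[OF f s(1)] by simp
    have i3: "L (F3 s) x - F3' s x = 2 * \<Gamma> (P s (L f)) (P s (L f)) x"
      unfolding F3_def F3'_def L_mult LPs[OF Lf s(1)] by simp
    have i4: "L (F4 s) x - F4' s x = 2 * \<Gamma> (P s f) (P s f) x"
      unfolding F4_def F4'_def L_mult LPs[OF f s(1)] by simp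
    have bs: "b * s ^ 3 > 0" using bpos s by simp
    have cd: "s\<^sup>2 / d * (P s (L f) x)\<^sup>2 + (s\<^sup>2 * \<rho>1 - \<kappa> * (s\<^sup>2)\<^sup>2 / (b * s ^ 3)) * F1 s x + s\<^sup>2 * \<rho>2 * F2 s x
        \<le> s\<^sup>2 * iterated_form L \<Gamma> (P s f) x + b * s ^ 3 * iterated_form L Z (P s f) x"
      using curvature_scaled[OF Cf _ bs, of "s\<^sup>2" x] s(1) unfolding LPs[OF f s(1)] F1_def F2_def by simp
    have \<kappa>: "\<kappa> * (s\<^sup>2)\<^sup>2 / (b * s ^ 3) = \<kappa> / b * s"
      using s(1) bpos by (simp add: power2_eq_square power3_eq_cube)
    have "0 \<le> (s * \<rho>1 - A' / 2)\<^sup>2 / \<rho>1" using pos by simp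
    also have "\<dots> = \<rho>1 * s\<^sup>2 - A' * s + e"
      using pos unfolding e_def by (simp add: power2_eq_square field_simps)
    finally have quad: "0 \<le> \<rho>1 * s\<^sup>2 - A' * s + e" .
    have A's: "A' * s = s + \<kappa> / b * s" using pos unfolding A'_def b_def by (simp add: field_simps)
    have "2 * s * F1 s x \<le> 2 * ((s\<^sup>2 * \<rho>1 - \<kappa> / b * s) * F1 s x) + 2 * (e * F1 s x)"
    proof -
      have "0 \<le> (\<rho>1 * s\<^sup>2 - A' * s + e) * F1 s x"
        using quad n(1) unfolding F1_def by (intro mult_nonneg_nonneg)
      also have "\<dots> = (s\<^sup>2 * \<rho>1 - \<kappa> / b * s) * F1 s x - s * F1 s x + e * F1 s x"
        unfolding A's by (simp add: algebra_simps)
      finally show ?thesis by linarith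
    qed
    moreover have "0 \<le> c * s ^ 3 * (2 * \<Gamma> (P s (L f)) (P s (L f)) x)"
      using form_nonneg[OF cdc_form CLf, of x] pos s unfolding c_def by simp
    moreover have "3 * b * s\<^sup>2 * F2 s x = 2 * (s\<^sup>2 * \<rho>2 * F2 s x)" unfolding b_def by simp
    moreover have "3 * c * s\<^sup>2 * F3 s x = 2 * (s\<^sup>2 / d * (P s (L f) x)\<^sup>2)"
      using pos unfolding c_def F3_def by (simp add: power2_eq_square)
    moreover have "e * (2 * \<Gamma> (P s f) (P s f) x) = 2 * (e * F1 s x)" by (simp add: F1_def)
    ultimately show "2 * s * F1 s x + 3 * b * s\<^sup>2 * F2 s x + 3 * c * s\<^sup>2 * F3 s x + 0 * F4 s x
        \<le> s\<^sup>2 * (L (F1 s) x - F1' s x) + b * s ^ 3 * (L (F2 s) x - F2' s x)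
          + c * s ^ 3 * (L (F3 s) x - F3' s x) + e * (L (F4 s) x - F4' s x)"
      using cd unfolding i1 i2 i3 i4 \<kappa> by linarith
  qed (use t in \<open>auto intro!: derivative_eq_intros continuous_intros\<close>)
  moreover have "0 \<le> b * t ^ 3 * F2 t x"
    using bpos t form_nonneg[OF form_Z CP[OF f t], of x] by (simp add: F2_def)
  moreover have "0 \<le> e * F4 t x" using e0 by (simp add: F4_def)
  ultimately show ?thesis unfolding F1_def F3_def c_def e_def power2_eq_square by simp
qed

end

section \<open>The Li-Yau inequality\<close>

context diffusion
begin

text \<open>With \<open>\<phi> = P t f\<close>, the subtracted quotient is the time derivative of
  \<open>G (P t f) (P t f) / U = U * G v v\<close>.\<close>
lemma log_form_identity:
  assumes \<phi>: "\<phi> \<in> C" and U: "\<And>x. U x = q + \<phi> x" "\<And>x. U x > 0" and v: "\<And>x. v x = ln (U x)"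
    and G: "first_order_form A G" and comm: "\<Gamma> v (G v v) = G v (\<Gamma> v v)"
  shows "v \<in> C"
    and "g \<in> C \<Longrightarrow> G \<phi> g x = U x * G v g x"
    and "G \<phi> \<phi> x = (U x)\<^sup>2 * G v v x"
    and "L \<phi> x = U x * (L v x + \<Gamma> v v x)"
    and "L (\<lambda>x. U x * G v v x) x - (2 * G \<phi> (L \<phi>) x * U x - L \<phi> x * G \<phi> \<phi> x) / (U x)\<^sup>2
      = 2 * U x * iterated_form L G v x"
proof -
  have Ueq: "U = (\<lambda>x. q + \<phi> x)" using U(1) by blast
  have UC: "U \<in> C" unfolding Ueq by (intro Csmooth_add Csmooth_const \<phi>)
  have veq: "v = (\<lambda>x. ln (U x))" using v by blast
  show vC: "v \<in> C" unfolding veq by (rule Csmooth_ln[OF UC U(2)])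
  have lnC: "(\<lambda>x. ln (U x)) \<in> C" using vC veq by simp
  have chain: "G' \<phi> g x = U x * G' v g x" if "first_order_form A G'" "g \<in> C" for G' g x
  proof -
    have "G' (\<lambda>x. ln (U x)) g x = 1 / U x * G' U g x"
      by (rule form_chain[OF that(1) UC that(2) lnC]) (use U(2)[of x] in \<open>auto intro!: derivative_eq_intros\<close>)
    moreover have "G' U g x = G' \<phi> g x" unfolding Ueq by (rule form_add_const[OF that(1) \<phi> that(2)])
    ultimately show ?thesis using U(2)[of x] veq by simp
  qed
  show "g \<in> C \<Longrightarrow> G \<phi> g x = U x * G v g x" by (rule chain[OF G])
  have sq: "G' \<phi> \<phi> x = (U x)\<^sup>2 * G' v v x" if "first_order_form A G'" for G' x
    using chain[OF that \<phi>] chain[OF that vC] form_sym[OF that vC \<phi>] by (simp add: power2_eq_square)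
  show "G \<phi> \<phi> x = (U x)\<^sup>2 * G v v x" by (rule sq[OF G])
  have L\<phi>: "L \<phi> x = U x * (L v x + \<Gamma> v v x)" for x
  proof -
    have "L (\<lambda>x. ln (U x)) x = inverse (U x) * L U x + (- ((inverse (U x))\<^sup>2)) * \<Gamma> U U x"
    proof (rule L_compose[OF UC lnC])
      fix y
      show "(ln has_real_derivative inverse (U y)) (at (U y))" using U(2)[of y] by (rule DERIV_ln)
      show "(inverse has_real_derivative - (inverse (U y))\<^sup>2) (at (U y))"
        using DERIV_inverse[of "U y"] U(2)[of y] by (simp add: power2_eq_square)
    qed
    moreover have "L U x = L \<phi> x" unfolding Ueq by (rule L_add_const[OF \<phi>])
    moreover have "\<Gamma> U U x = (U x)\<^sup>2 * \<Gamma> v v x"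
      using sq[OF cdc_form] form_add_const2[OF cdc_form \<phi>] unfolding Ueq by simp
    ultimately have "L v x = inverse (U x) * L \<phi> x - \<Gamma> v v x"
      using U(2)[of x] veq by (simp add: power_inverse)
    then show ?thesis using U(2)[of x] by (simp add: field_simps)
  qed
  then show "L \<phi> x = U x * (L v x + \<Gamma> v v x)" .
  define l where "l = (\<lambda>x. L v x + \<Gamma> v v x)"
  have lC: "l \<in> C" unfolding l_def by (intro Csmooth_add Csmooth_L Csmooth_cdc vC)
  have GC: "G v v \<in> C" by (rule form_smooth[OF G vC vC])
  have vU: "G v U x = U x * G v v x" for x
  proof -
    have "G v U x = G U v x" using form_sym[OF G vC UC] by simp
    also have "\<dots> = G \<phi> v x" unfolding Ueq by (rule form_add_const[OF G \<phi> vC])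
    finally show ?thesis using chain[OF G vC] by simp
  qed
  have L\<phi>': "L \<phi> = (\<lambda>x. U x * l x)" using L\<phi> by (auto simp: l_def)
  have "G \<phi> (L \<phi>) x = U x * G v (\<lambda>x. U x * l x) x"
    using chain[OF G Csmooth_L[OF \<phi>], of x] unfolding L\<phi>' .
  also have "G v (\<lambda>x. U x * l x) x = U x * G v l x + l x * (U x * G v v x)"
    using form_mult_right[OF G UC lC vC, of x] vU by simp
  also have "G v l x = G v (L v) x + G v (\<Gamma> v v) x"
    unfolding l_def by (rule form_add_right[OF G Csmooth_L[OF vC] Csmooth_cdc[OF vC vC] vC])
  finally have 1: "G \<phi> (L \<phi>) x = (U x)\<^sup>2 * (G v (L v) x + G v (\<Gamma> v v) x + l x * G v v x)"
    by (simp add: power2_eq_square algebra_simps)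
  \<comment> \<open>The commutation hypothesis makes this cross term of \<open>L (U * G v v)\<close>
    equal to the term \<open>G v (\<Gamma> v v)\<close> produced by differentiating
    \<open>L \<phi>\<close>, so that the two cancel.\<close>
  have "\<Gamma> U (G v v) x = U x * G v (\<Gamma> v v) x"
    using chain[OF cdc_form GC, of x] form_add_const[OF cdc_form \<phi> GC, of q x] comm unfolding Ueq by simp
  then have 2: "L (\<lambda>x. U x * G v v x) x = U x * L (G v v) x + G v v x * (U x * l x) + 2 * (U x * G v (\<Gamma> v v) x)"
    using L_mult[of U "G v v" x] L_add_const[OF \<phi>, of q x] L\<phi>[of x] unfolding Ueq l_def by simp
  have U0: "U x \<noteq> 0" using U(2)[of x] by simp
  have 3: "(2 * G \<phi> (L \<phi>) x * U x - L \<phi> x * G \<phi> \<phi> x) / (U x)\<^sup>2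
      = U x * (2 * (G v (L v) x + G v (\<Gamma> v v) x + l x * G v v x) - l x * G v v x)"
    unfolding 1 sq[OF G] L\<phi> using U0 by (simp add: l_def power2_eq_square field_simps)
  show "L (\<lambda>x. U x * G v v x) x - (2 * G \<phi> (L \<phi>) x * U x - L \<phi> x * G \<phi> \<phi> x) / (U x)\<^sup>2
      = 2 * U x * iterated_form L G v x"
    unfolding 2 3 iterated_form_def by (simp add: algebra_simps)
qed

end

context curvature_dimension
begin

definition D :: real where "D = d * A'"
text \<open>The rate at which the \<Gamma> terms of the Li-Yau argument can cancel identically in
  \<open>X = exp (\<alpha> t)\<close>: comparing the coefficients of \<open>X\<close> there yields
  \<open>\<rho>1_eq\<close>.\<close>

definition \<alpha> :: real where "\<alpha> = 2 * \<rho>1 * \<rho>2 / (3 * (\<rho>2 + \<kappa>))"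

lemma D_pos: "D > 0"
  using pos A'_ge by (simp add: D_def)

lemma \<alpha>_pos: "\<alpha> > 0"
  using pos by (simp add: \<alpha>_def add_pos_nonneg)

lemma \<rho>1_eq: "2 * \<rho>1 = 3 * \<alpha> * (1 + \<kappa> / \<rho>2)"
proof -
  have "\<rho>2 + \<kappa> > 0" using pos by linarith
  then have "\<alpha> * (3 * (\<rho>2 + \<kappa>)) = 2 * \<rho>1 * \<rho>2" by (simp add: \<alpha>_def)
  moreover have "3 * \<alpha> * (1 + \<kappa> / \<rho>2) = \<alpha> * (3 * (\<rho>2 + \<kappa>)) / \<rho>2"
    using pos by (simp add: field_simps)
  ultimately show ?thesis using pos by simp
qed

text \<open>The coefficients, polynomials in \<open>X = exp (\<alpha> t)\<close>, are chosen so that the terms in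
  \<open>\<Gamma>\<close> and \<open>Z\<close> cancel.\<close>
lemma li_yau:
  assumes f: "f \<in> T" and \<epsilon>: "\<epsilon> > 0" "\<And>x. \<epsilon> \<le> q + f x" and t: "t > 0"
  shows "0 \<le> (exp (\<alpha> * t) - 1) * P t (L f) x + \<alpha> * D / 2 * (q + P t f x)"
proof -
  note Lf = Ctest_L[OF f] and LLf = Ctest_L[OF Ctest_L[OF f]]
  \<comment> \<open>A test function need not be bounded away from 0, so a constant \<open>q\<close>
    is added; the flow leaves constants unchanged, and \<open>U s\<close> is the flow of
    \<open>q + f\<close>.\<close>
  define U where "U s x = q + P s f x" for s x
  define v where "v s x = ln (U s x)" for s x
  have CP: "P s g \<in> C" if "g \<in> T" "s > 0" for s g using P_smooth that by simp
  have LPs: "L (P s g) = P s (L g)" if "g \<in> T" "s > 0" for s g using L_P[OF that(1)] that(2) by auto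
  obtain B1 where B1: "B1 \<ge> 0" "\<And>s x. s \<ge> 0 \<Longrightarrow> \<bar>P s f x\<bar> \<le> B1" using P_bounded[OF f] by auto
  obtain B2 where B2: "B2 \<ge> 0" "\<And>s x. s \<ge> 0 \<Longrightarrow> \<bar>P s (L f) x\<bar> \<le> B2" using P_bounded[OF Lf] by auto
  obtain B3 where B3: "B3 \<ge> 0" "\<And>s x. s \<ge> 0 \<Longrightarrow> \<bar>P s (L (L f)) x\<bar> \<le> B3" using P_bounded[OF LLf] by auto
  have tp: "t + 1 \<ge> 0" using t by simp
  obtain B4 where B4: "B4 \<ge> 0" "\<And>s x. s \<in> {0..t+1} \<Longrightarrow> \<Gamma> (P s f) (P s f) x \<le> B4"
    "\<And>s x. s \<in> {0..t+1} \<Longrightarrow> Z (P s f) (P s f) x \<le> B4" using gradient_bounded[OF f tp] by blast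
  obtain B5 where B5: "B5 \<ge> 0" "\<And>s x. s \<in> {0..t+1} \<Longrightarrow> \<Gamma> (P s (L f)) (P s (L f)) x \<le> B5"
    "\<And>s x. s \<in> {0..t+1} \<Longrightarrow> Z (P s (L f)) (P s (L f)) x \<le> B5" using gradient_bounded[OF Lf tp] by blast
  have Ueps: "U s x \<ge> \<epsilon>" if "s > 0" for s x
  proof -
    obtain B where B: "\<And>x. \<bar>f x\<bar> \<le> B" using Ctest_bounded[OF f] by blast
    have "\<epsilon> - q \<le> P s f x"
      by (rule P_ge[OF _ Ctest_measurable[OF f] B]) (use that \<epsilon>(2) in \<open>auto simp: algebra_simps\<close>)
    then show ?thesis by (simp add: U_def)
  qed
  have Upos: "U s x > 0" if "s > 0" for s x using Ueps[OF that, of x] \<epsilon>(1) by linarith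
  have vC: "v s \<in> C" if s: "s > 0" for s
    by (rule log_form_identity(1)[where U="U s" and v="v s" and \<phi>="P s f" and q=q and G=\<Gamma>,
          OF CP[OF f s] U_def Upos[OF s] v_def cdc_form refl])
  have cz: "\<Gamma> (v s) (Z (v s) (v s)) = Z (v s) (\<Gamma> (v s) (v s))" if s: "s > 0" for s by (rule commute[OF vC[OF s]])
  have sq\<Gamma>: "\<Gamma> (P s f) (P s f) x = (U s x)\<^sup>2 * \<Gamma> (v s) (v s) x" if s: "s > 0" for s x
    by (rule log_form_identity(3)[where U="U s" and v="v s" and \<phi>="P s f" and q=q and G=\<Gamma>,
          OF CP[OF f s] U_def Upos[OF s] v_def cdc_form refl])
  have sqZ: "Z (P s f) (P s f) x = (U s x)\<^sup>2 * Z (v s) (v s) x" if s: "s > 0" for s x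
    by (rule log_form_identity(3)[where U="U s" and v="v s" and \<phi>="P s f" and q=q and G=Z,
          OF CP[OF f s] U_def Upos[OF s] v_def form_Z cz[OF s]])
  have L\<phi>: "L (P s f) x = U s x * (L (v s) x + \<Gamma> (v s) (v s) x)" if s: "s > 0" for s x
    by (rule log_form_identity(4)[where U="U s" and v="v s" and \<phi>="P s f" and q=q and G=\<Gamma>,
          OF CP[OF f s] U_def Upos[OF s] v_def cdc_form refl])
  define G' where "G' G s x = (2 * G (P s f) (P s (L f)) x * U s x - P s (L f) x * G (P s f) (P s f) x) / (U s x)\<^sup>2"
    for G :: "('a \<Rightarrow> real) \<Rightarrow> ('a \<Rightarrow> real) \<Rightarrow> 'a \<Rightarrow> real" and s x
  have id\<Gamma>: "L (\<lambda>x. U s x * \<Gamma> (v s) (v s) x) x - G' \<Gamma> s x = 2 * U s x * iterated_form L \<Gamma> (v s) x"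
    if s: "s > 0" for s x
    using log_form_identity(5)[where U="U s" and v="v s" and \<phi>="P s f" and q=q and G=\<Gamma>,
          OF CP[OF f s] U_def Upos[OF s] v_def cdc_form refl, of x] unfolding G'_def LPs[OF f s] .
  have idZ: "L (\<lambda>x. U s x * Z (v s) (v s) x) x - G' Z s x = 2 * U s x * iterated_form L Z (v s) x"
    if s: "s > 0" for s x
    using log_form_identity(5)[where U="U s" and v="v s" and \<phi>="P s f" and q=q and G=Z,
          OF CP[OF f s] U_def Upos[OF s] v_def form_Z cz[OF s], of x] unfolding G'_def LPs[OF f s] .
  have Gder: "((\<lambda>s. U s x * G (v s) (v s) x) has_real_derivative G' G s x) (at s)"
    if G: "first_order_form A G" and eq: "\<And>s. s > 0 \<Longrightarrow> G (P s f) (P s f) x = (U s x)\<^sup>2 * G (v s) (v s) x"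
      and s: "s > 0" for G s x
  proof -
    have "((\<lambda>s. G (P s f) (P s f) x / U s x) has_real_derivative
       (2 * G (P s f) (P s (L f)) x * U s x - G (P s f) (P s f) x * (0 + P s (L f) x)) / (U s x * U s x)) (at s)"
      unfolding U_def
      by (rule DERIV_divide[OF form_deriv[OF G f s] DERIV_add[OF DERIV_const P_deriv[OF f s]]])
         (use Upos[OF s, of x] in \<open>simp add: U_def\<close>)
    then have "((\<lambda>s. G (P s f) (P s f) x / U s x) has_real_derivative G' G s x) (at s)"
      unfolding G'_def by (simp add: power2_eq_square mult.commute)
    then show ?thesis
      by (rule has_field_derivative_transform_within_open[of _ _ _ "{0<..}"])
         (use s eq Upos[THEN less_imp_neq, symmetric] in \<open>auto simp: power2_eq_square\<close>)
  qed
  define M where "M = 2 * (B4 + B5) / \<epsilon> + B2 * B4 / \<epsilon>\<^sup>2"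
  have G'bound: "\<bar>G' G s x\<bar> \<le> M"
    if G: "first_order_form A G" and s: "0 < s"
      and b: "G (P s f) (P s f) x \<le> B4" "G (P s (L f)) (P s (L f)) x \<le> B5" for G s x
  proof -
    note Us = Upos[OF s, of x]
    have n: "0 \<le> G (P s f) (P s f) x" by (rule form_nonneg[OF G CP[OF f s]])
    have "G' G s x = 2 * G (P s f) (P s (L f)) x / U s x - P s (L f) x * G (P s f) (P s f) x / (U s x)\<^sup>2"
      unfolding G'_def using Us by (simp add: power2_eq_square diff_divide_distrib)
    moreover have "\<bar>2 * G (P s f) (P s (L f)) x / U s x\<bar> \<le> 2 * (B4 + B5) / \<epsilon>"
    proof -
      have "2 * \<bar>G (P s f) (P s (L f)) x\<bar> \<le> 2 * (B4 + B5)"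
        by (rule order_trans[OF form_abs_le[OF G CP[OF f s] CP[OF Lf s]]]) (use b B4(1) B5(1) in simp)
      then show ?thesis using Us Ueps[OF s, of x] \<epsilon>(1) B4(1) B5(1)
        by (simp add: abs_mult) (intro frac_le, auto)
    qed
    moreover have "\<bar>P s (L f) x * G (P s f) (P s f) x / (U s x)\<^sup>2\<bar> \<le> B2 * B4 / \<epsilon>\<^sup>2"
    proof -
      have "\<bar>P s (L f) x * G (P s f) (P s f) x\<bar> \<le> B2 * B4"
        by (rule abs_mult_le) (use B2(2)[of s x] s n b in auto)
      moreover have "\<epsilon>\<^sup>2 \<le> (U s x)\<^sup>2" using Ueps[OF s, of x] \<epsilon>(1) by (intro power_mono) auto
      moreover have "0 < \<epsilon>\<^sup>2" using \<epsilon>(1) by simp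
      moreover have "0 \<le> B2 * B4" using B2(1) B4(1) by simp
      ultimately show ?thesis unfolding abs_divide abs_power2 by (intro frac_le)
    qed
    ultimately show ?thesis unfolding M_def by linarith
  qed
  have Fbound: "\<bar>U s x * G (v s) (v s) x\<bar> \<le> B4 / \<epsilon>"
    if G: "first_order_form A G" and s: "0 < s" and b: "G (P s f) (P s f) x \<le> B4"
      and eq: "G (P s f) (P s f) x = (U s x)\<^sup>2 * G (v s) (v s) x" for G s x
  proof -
    note Us = Upos[OF s, of x]
    have n: "0 \<le> G (P s f) (P s f) x" by (rule form_nonneg[OF G CP[OF f s]])
    have "U s x * G (v s) (v s) x = G (P s f) (P s f) x / U s x"
      unfolding eq using Us by (simp add: power2_eq_square)
    moreover have "0 \<le> G (P s f) (P s f) x / U s x" using n Us by simp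
    moreover have "G (P s f) (P s f) x / U s x \<le> B4 / \<epsilon>"
      using n b Us Ueps[OF s, of x] \<epsilon>(1) by (intro frac_le) auto
    ultimately show ?thesis by simp
  qed
  define BB where "BB = M + B4 / \<epsilon> + B2 + B3 + (\<bar>q\<bar> + B1)"
  have M0: "M \<ge> 0" unfolding M_def using B4(1) B5(1) B2(1) \<epsilon>(1) by simp
  have B40: "B4 / \<epsilon> \<ge> 0" using B4(1) \<epsilon>(1) by simp
  define X where "X s = exp (\<alpha> * s)" for s
  have X': "(X has_real_derivative \<alpha> * X s) (at s)" for s
    unfolding X_def by (auto intro!: derivative_eq_intros)
  have X1: "X s > 1" if "s > 0" for s unfolding X_def using that \<alpha>_pos by simp
  have cX: "continuous_on {0..t+1} X" unfolding X_def by (intro continuous_intros)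
  \<comment> \<open>With this \<open>k\<close>, the time derivative of \<open>k (X - 1)^3\<close> is
    \<open>2 \<rho>2\<close> times the coefficient \<open>X (X - 1)^2\<close> of the \<Gamma> term,
    exactly what curvature supplies for \<open>Z\<close>.\<close>
  define k where "k = 2 * \<rho>2 / (3 * \<alpha>)"
  have k: "k > 0" using pos \<alpha>_pos by (simp add: k_def)
  have main: "X t * (X t - 1)\<^sup>2 * (U t x * \<Gamma> (v t) (v t) x) + k * (X t - 1) ^ 3 * (U t x * Z (v t) (v t) x)
      + (- A' * (X t - 1)\<^sup>2) * P t (L f) x + (- (\<alpha> * D * A' / 2) * (X t - 1)) * U t x \<le> 0"
  proof (rule maximum_principle4[where b="t + 1" and r=t
      and Fp="\<lambda>s x. U s x * \<Gamma> (v s) (v s) x" and Fq="\<lambda>s x. U s x * Z (v s) (v s) x"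
      and Fr="\<lambda>s. P s (L f)" and Fz=U
      and Fp'="G' \<Gamma>" and Fq'="G' Z" and Fr'="\<lambda>s. P s (L (L f))" and Fz'="\<lambda>s. P s (L f)"
      and ap="\<lambda>s. X s * (X s - 1)\<^sup>2" and aq="\<lambda>s. k * (X s - 1) ^ 3"
      and ar="\<lambda>s. - A' * (X s - 1)\<^sup>2" and az="\<lambda>s. - (\<alpha> * D * A' / 2) * (X s - 1)"
      and ap'="\<lambda>s. \<alpha> * X s * (X s - 1) * (3 * X s - 1)" and aq'="\<lambda>s. 2 * \<rho>2 * X s * (X s - 1)\<^sup>2"
      and ar'="\<lambda>s. - (2 * A' * \<alpha> * X s * (X s - 1))" and az'="\<lambda>s. - (\<alpha>\<^sup>2 * D * A' / 2 * X s)" and B=BB])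
    fix s :: real
    show "((\<lambda>s. X s * (X s - 1)\<^sup>2) has_real_derivative \<alpha> * X s * (X s - 1) * (3 * X s - 1)) (at s)"
      by (rule derivative_eq_intros X' refl)+ (simp add: power2_eq_square algebra_simps)
    show "((\<lambda>s. k * (X s - 1) ^ 3) has_real_derivative 2 * \<rho>2 * X s * (X s - 1)\<^sup>2) (at s)"
      by (rule derivative_eq_intros X' refl)+ (use \<alpha>_pos in \<open>simp add: k_def\<close>)
    show "((\<lambda>s. - A' * (X s - 1)\<^sup>2) has_real_derivative - (2 * A' * \<alpha> * X s * (X s - 1))) (at s)"
      by (rule derivative_eq_intros X' refl)+ simp
    show "((\<lambda>s. - (\<alpha> * D * A' / 2) * (X s - 1)) has_real_derivative - (\<alpha>\<^sup>2 * D * A' / 2 * X s)) (at s)"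
      by (rule derivative_eq_intros X' refl)+ (simp add: power2_eq_square)
  next
    fix s x assume s: "0 < s" "s < t + 1"
    then have si: "s \<in> {0..t+1}" by simp
    note Cv = vC[OF s(1)] and CLf = CP[OF Lf s(1)]
    have UC: "U s \<in> C" unfolding U_def by (intro Csmooth_add Csmooth_const CP f s)
    note eq\<Gamma> = sq\<Gamma>[OF s(1), of x] and eqZ = sqZ[OF s(1), of x]
    show "(\<lambda>x. U s x * \<Gamma> (v s) (v s) x) \<in> C" by (intro Csmooth_mult UC Csmooth_cdc Cv)
    show "(\<lambda>x. U s x * Z (v s) (v s) x) \<in> C" by (intro Csmooth_mult UC form_smooth[OF form_Z] Cv)
    show "P s (L f) \<in> C" by (rule CLf)
    show "U s \<in> C" by (rule UC)
    show "((\<lambda>s. U s x * \<Gamma> (v s) (v s) x) has_real_derivative G' \<Gamma> s x) (at s)"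
      by (rule Gder[OF cdc_form _ s(1)]) (rule sq\<Gamma>)
    show "((\<lambda>s. U s x * Z (v s) (v s) x) has_real_derivative G' Z s x) (at s)"
      by (rule Gder[OF form_Z _ s(1)]) (rule sqZ)
    show "((\<lambda>s. P s (L f) x) has_real_derivative P s (L (L f)) x) (at s)" by (rule P_deriv[OF Lf s(1)])
    show "((\<lambda>s. U s x) has_real_derivative P s (L f) x) (at s)"
      unfolding U_def using DERIV_add[OF DERIV_const P_deriv[OF f s(1)]] by simp
    have p1: "\<bar>P s f x\<bar> \<le> B1" and p2: "\<bar>P s (L f) x\<bar> \<le> B2" and p3: "\<bar>P s (L (L f)) x\<bar> \<le> B3"
      using B1(2) B2(2) B3(2) s by simp_all
    have U1: "\<bar>U s x\<bar> \<le> \<bar>q\<bar> + B1" unfolding U_def using p1 by linarith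
    have "\<bar>U s x * \<Gamma> (v s) (v s) x\<bar> \<le> B4 / \<epsilon>"
      by (rule Fbound[OF cdc_form s(1) B4(2)[OF si] eq\<Gamma>])
    moreover have "\<bar>U s x * Z (v s) (v s) x\<bar> \<le> B4 / \<epsilon>"
      by (rule Fbound[OF form_Z s(1) B4(3)[OF si] eqZ])
    ultimately show "\<bar>U s x * \<Gamma> (v s) (v s) x\<bar> \<le> BB \<and> \<bar>U s x * Z (v s) (v s) x\<bar> \<le> BB \<and> \<bar>P s (L f) x\<bar> \<le> BB \<and> \<bar>U s x\<bar> \<le> BB"
      using U1 p2 M0 B40 B1(1) B2(1) B3(1) unfolding BB_def by linarith
    have "\<bar>G' \<Gamma> s x\<bar> \<le> M" by (rule G'bound[OF cdc_form s(1) B4(2)[OF si] B5(2)[OF si]])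
    moreover have "\<bar>G' Z s x\<bar> \<le> M" by (rule G'bound[OF form_Z s(1) B4(3)[OF si] B5(3)[OF si]])
    ultimately show "\<bar>G' \<Gamma> s x\<bar> \<le> BB \<and> \<bar>G' Z s x\<bar> \<le> BB \<and> \<bar>P s (L (L f)) x\<bar> \<le> BB \<and> \<bar>P s (L f) x\<bar> \<le> BB"
      using p2 p3 M0 B40 B1(1) B2(1) B3(1) unfolding BB_def by linarith
    show "- (\<alpha> * D * A' / 2) * (X 0 - 1) * U s x \<le> 0" by (simp add: X_def)
    let ?l = "L (v s) x" and ?g = "\<Gamma> (v s) (v s) x" and ?z = "Z (v s) (v s) x"
    let ?X = "X s"
    note Us = Upos[OF s(1), of x] and Xs = X1[OF s(1)]
    have i1: "L (\<lambda>x. U s x * \<Gamma> (v s) (v s) x) x - G' \<Gamma> s x = 2 * U s x * iterated_form L \<Gamma> (v s) x"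
      by (rule id\<Gamma>[OF s(1)])
    have i2: "L (\<lambda>x. U s x * Z (v s) (v s) x) x - G' Z s x = 2 * U s x * iterated_form L Z (v s) x"
      by (rule idZ[OF s(1)])
    have i3: "L (P s (L f)) x - P s (L (L f)) x = 0" using LPs[OF Lf s(1)] by simp
    have "L (U s) x = L (P s f) x" unfolding U_def by (rule L_add_const[OF CP[OF f s(1)]])
    then have i4: "L (U s) x - P s (L f) x = 0" using LPs[OF f s(1)] by simp
    have LU: "P s (L f) x = U s x * (?l + ?g)" using L\<phi>[OF s(1), of x] LPs[OF f s(1)] by simp
    have apos: "?X * (?X - 1)\<^sup>2 > 0" using Xs by simp
    have bpos: "k * (?X - 1) ^ 3 > 0" using Xs k by simp
    define a where "a = ?X * (?X - 1)\<^sup>2"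
    define b where "b = k * (?X - 1) ^ 3"
    have cd: "a / d * ?l\<^sup>2 + (a * \<rho>1 - \<kappa> * a\<^sup>2 / b) * ?g + a * \<rho>2 * ?z
        \<le> a * iterated_form L \<Gamma> (v s) x + b * iterated_form L Z (v s) x"
      using curvature_scaled[OF Cv apos bpos, of x] unfolding a_def b_def .
    have ab: "a\<^sup>2 / b = 3 * \<alpha> / (2 * \<rho>2) * (?X\<^sup>2 * (?X - 1))"
    proof -
      have "?X - 1 \<noteq> 0" using Xs by simp
      then have "a\<^sup>2 / b = ?X\<^sup>2 * (?X - 1) / k"
        unfolding a_def b_def by (simp add: power_mult_distrib power2_eq_square power3_eq_cube)
      then show ?thesis using pos \<alpha>_pos by (simp add: k_def field_simps)
    qed
    \<comment> \<open>Divided by \<open>X (X - 1)\<close>, both sides are affine in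
      \<open>X\<close>. Equality of the coefficients of \<open>X\<close> is
      \<open>\<rho>1_eq\<close>, which fixes \<alpha>; equality of the constant terms then fixes
      \<open>A'\<close>.\<close>
    have \<Gamma>coef: "\<alpha> * ?X * (?X - 1) * (3 * ?X - 1) - 2 * A' * \<alpha> * ?X * (?X - 1) = 2 * (a * \<rho>1 - \<kappa> * a\<^sup>2 / b)"
    proof -
      have "2 * (a * \<rho>1 - \<kappa> * a\<^sup>2 / b) = a * (2 * \<rho>1) - 2 * \<kappa> * (a\<^sup>2 / b)" by simp
      also have "\<dots> = ?X * (?X - 1)\<^sup>2 * (3 * \<alpha> * (1 + \<kappa> / \<rho>2)) - 2 * \<kappa> * (3 * \<alpha> / (2 * \<rho>2) * (?X\<^sup>2 * (?X - 1)))"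
        unfolding ab \<rho>1_eq by (simp only: a_def)
      also have "\<dots> = \<alpha> * ?X * (?X - 1) * (3 * ?X - 1) - 2 * A' * \<alpha> * ?X * (?X - 1)"
        using pos unfolding A'_def by (simp add: field_simps power2_eq_square)
      finally show ?thesis by simp
    qed
    \<comment> \<open>Completion of the square in \<open>L v\<close>. The linear term stems from the
      coefficient of \<open>P s (L f)\<close>, and \<open>D = d A'\<close> is the value for which
      the constant term fits.\<close>
    have sqr: "2 * (a / d * ?l\<^sup>2) + 2 * A' * \<alpha> * ?X * (?X - 1) * ?l + \<alpha>\<^sup>2 * D * A' / 2 * ?X
       = 2 * ?X / d * ((?X - 1) * ?l + A' * \<alpha> * d / 2)\<^sup>2"
      using pos unfolding a_def D_def by (simp add: field_simps power2_eq_square)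
    have sqr0: "0 \<le> 2 * ?X / d * ((?X - 1) * ?l + A' * \<alpha> * d / 2)\<^sup>2"
      using pos Xs by simp
    have z: "2 * \<rho>2 * ?X * (?X - 1)\<^sup>2 = 2 * (a * \<rho>2)" by (simp add: a_def)
    have core: "\<alpha> * ?X * (?X - 1) * (3 * ?X - 1) * ?g + 2 * \<rho>2 * ?X * (?X - 1)\<^sup>2 * ?z
        - (2 * A' * \<alpha> * ?X * (?X - 1)) * (?l + ?g) - \<alpha>\<^sup>2 * D * A' / 2 * ?X
        \<le> 2 * (a * iterated_form L \<Gamma> (v s) x + b * iterated_form L Z (v s) x)"
    proof -
      have "\<alpha> * ?X * (?X - 1) * (3 * ?X - 1) * ?g + 2 * \<rho>2 * ?X * (?X - 1)\<^sup>2 * ?z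
        - (2 * A' * \<alpha> * ?X * (?X - 1)) * (?l + ?g) - \<alpha>\<^sup>2 * D * A' / 2 * ?X
        = (\<alpha> * ?X * (?X - 1) * (3 * ?X - 1) - 2 * A' * \<alpha> * ?X * (?X - 1)) * ?g + 2 * \<rho>2 * ?X * (?X - 1)\<^sup>2 * ?z
         - (2 * A' * \<alpha> * ?X * (?X - 1) * ?l + \<alpha>\<^sup>2 * D * A' / 2 * ?X)"
        by (simp add: algebra_simps)
      also have "\<dots> = 2 * (a / d * ?l\<^sup>2 + (a * \<rho>1 - \<kappa> * a\<^sup>2 / b) * ?g + a * \<rho>2 * ?z)
          - 2 * ?X / d * ((?X - 1) * ?l + A' * \<alpha> * d / 2)\<^sup>2"
        unfolding \<Gamma>coef z sqr[symmetric] by (simp add: algebra_simps)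
      also have "\<dots> \<le> 2 * (a * iterated_form L \<Gamma> (v s) x + b * iterated_form L Z (v s) x)"
      proof -
        have "2 * x - y \<le> 2 * z" if "x \<le> z" "0 \<le> y" for x y z :: real using that by linarith
        from this[OF cd sqr0] show ?thesis .
      qed
      finally show ?thesis .
    qed
    have "U s x * (\<alpha> * ?X * (?X - 1) * (3 * ?X - 1) * ?g + 2 * \<rho>2 * ?X * (?X - 1)\<^sup>2 * ?z
        - (2 * A' * \<alpha> * ?X * (?X - 1)) * (?l + ?g) - \<alpha>\<^sup>2 * D * A' / 2 * ?X)
        \<le> U s x * (2 * (a * iterated_form L \<Gamma> (v s) x + b * iterated_form L Z (v s) x))"
      using core Us by (intro mult_left_mono) auto
    then show "\<alpha> * X s * (X s - 1) * (3 * X s - 1) * (U s x * \<Gamma> (v s) (v s) x)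
        + 2 * \<rho>2 * X s * (X s - 1)\<^sup>2 * (U s x * Z (v s) (v s) x)
        + - (2 * A' * \<alpha> * X s * (X s - 1)) * P s (L f) x + - (\<alpha>\<^sup>2 * D * A' / 2 * X s) * U s x
        \<le> X s * (X s - 1)\<^sup>2 * (L (\<lambda>x. U s x * \<Gamma> (v s) (v s) x) x - G' \<Gamma> s x)
          + k * (X s - 1) ^ 3 * (L (\<lambda>x. U s x * Z (v s) (v s) x) x - G' Z s x)
          + - A' * (X s - 1)\<^sup>2 * (L (P s (L f)) x - P s (L (L f)) x)
          + - (\<alpha> * D * A' / 2) * (X s - 1) * (L (U s) x - P s (L f) x)"
      unfolding i1 i2 i3 i4 unfolding LU a_def[symmetric] b_def[symmetric] by (simp add: algebra_simps)
  qed (use t cX in \<open>auto simp: X_def intro!: continuous_intros\<close>)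
  note Ut = Upos[OF t, of x] and Xt = X1[OF t]
  have "0 \<le> X t * (X t - 1)\<^sup>2 * (U t x * \<Gamma> (v t) (v t) x)" "0 \<le> k * (X t - 1) ^ 3 * (U t x * Z (v t) (v t) x)"
    using Ut Xt k form_nonneg[OF cdc_form vC[OF t], of x] form_nonneg[OF form_Z vC[OF t], of x] by simp_all
  then have "0 \<le> A' * (X t - 1)\<^sup>2 * P t (L f) x + (\<alpha> * D * A' / 2) * (X t - 1) * U t x"
    using main by linarith
  also have "\<dots> = (A' * (X t - 1)) * ((X t - 1) * P t (L f) x + \<alpha> * D / 2 * U t x)"
    by (simp add: power2_eq_square algebra_simps)
  finally have "(A' * (X t - 1)) * 0 \<le> (A' * (X t - 1)) * ((X t - 1) * P t (L f) x + \<alpha> * D / 2 * U t x)" by simp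
  moreover have "A' * (X t - 1) > 0" using Xt A'_ge by simp
  ultimately have "0 \<le> (X t - 1) * P t (L f) x + \<alpha> * D / 2 * U t x"
    using mult_le_cancel_left_pos by blast
  then show ?thesis unfolding X_def U_def .
qed

end

section \<open>Finite volume and ultracontractivity\<close>

text \<open>In \<open>oscillation_finite\<close> the bound may depend on \<open>x\<close> and
  \<open>y\<close>. It enters where the limit of the flow is shown to be constant; a uniform bound
  on the oscillation is what the locale is to produce.\<close>

locale bonnet_myers = curvature_dimension A \<mu> L p h Z \<rho>1 \<rho>2 \<kappa> d
  for A :: "('a::{t2_space, second_countable_topology}, 'b::euclidean_space) chart set"
    and \<mu> :: "'a measure"
    and L :: "('a \<Rightarrow> real) \<Rightarrow> 'a \<Rightarrow> real"
    and p :: "'a \<Rightarrow> 'a \<Rightarrow> real \<Rightarrow> real" and h :: "nat \<Rightarrow> 'a \<Rightarrow> real"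
    and Z :: "('a \<Rightarrow> real) \<Rightarrow> ('a \<Rightarrow> real) \<Rightarrow> 'a \<Rightarrow> real"
    and \<rho>1 \<rho>2 \<kappa> d :: real +
  assumes oscillation_finite: "\<And>x y. \<exists>K. \<forall>f\<in>Csmooth A. (\<forall>z. cdc L f f z \<le> 1) \<longrightarrow> \<bar>f x - f y\<bar> \<le> K"
begin

definition e0 :: real where "e0 = A'\<^sup>2 / (4 * \<rho>1)"
definition Q0 :: real where "Q0 = sqrt (e0 / (2 / (3 * d)))"

lemma e0_pos: "e0 > 0"
  using pos A'_ge by (simp add: e0_def)

lemma Q0_nonneg: "Q0 \<ge> 0"
  using pos e0_pos by (simp add: Q0_def)

lemma gradient_decay:
  assumes f: "f \<in> T" and B: "\<And>x. \<bar>f x\<bar> \<le> B" and t: "t > 0"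
  shows "\<Gamma> (P t f) (P t f) x \<le> e0 * B\<^sup>2 / t\<^sup>2" and "\<bar>P t (L f) x\<bar> \<le> Q0 * B / (t * sqrt t)"
proof -
  let ?c = "2 / (3 * d)"
  have c: "?c > 0" using pos by simp
  have n: "0 \<le> \<Gamma> (P t f) (P t f) x"
    by (rule form_nonneg[OF cdc_form P_smooth[OF f]]) (use t in simp)
  have n1: "0 \<le> t\<^sup>2 * \<Gamma> (P t f) (P t f) x" using n by simp
  have n2: "0 \<le> ?c * t ^ 3 * (P t (L f) x)\<^sup>2" using c t by simp
  have main: "t\<^sup>2 * \<Gamma> (P t f) (P t f) x + ?c * t ^ 3 * (P t (L f) x)\<^sup>2 \<le> e0 * B\<^sup>2"
    using gradient_estimate[OF f B t] by (simp add: e0_def)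
  have "t\<^sup>2 * \<Gamma> (P t f) (P t f) x \<le> e0 * B\<^sup>2" using main n2 by linarith
  then show "\<Gamma> (P t f) (P t f) x \<le> e0 * B\<^sup>2 / t\<^sup>2" using t by (simp add: field_simps)
  have "?c * t ^ 3 * (P t (L f) x)\<^sup>2 \<le> e0 * B\<^sup>2" using main n1 by linarith
  then have "(P t (L f) x)\<^sup>2 \<le> e0 / ?c * B\<^sup>2 / t ^ 3" using t c by (simp add: field_simps)
  then have "sqrt ((P t (L f) x)\<^sup>2) \<le> sqrt (e0 / ?c * B\<^sup>2 / t ^ 3)" by (rule real_sqrt_le_mono)
  moreover have "B \<ge> 0" using B[of x] by linarith
  moreover have "sqrt (t ^ 3) = t * sqrt t"
    using t by (simp add: power3_eq_cube real_sqrt_mult)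
  ultimately show "\<bar>P t (L f) x\<bar> \<le> Q0 * B / (t * sqrt t)"
    unfolding Q0_def by (simp add: real_sqrt_divide real_sqrt_mult)
qed

text \<open>The bound on the time derivative is minus the derivative of
  \<open>2 * Q0 * B / sqrt r\<close>. The signs \<open>k = 1\<close> and \<open>k = -1\<close> let
  one monotonicity argument give both inequalities.\<close>

lemma P_cauchy:
  assumes f: "f \<in> T" and B: "\<And>x. \<bar>f x\<bar> \<le> B" and s: "0 < s" "s \<le> t"
  shows "\<bar>P t f x - P s f x\<bar> \<le> 2 * Q0 * B / sqrt s"
proof -
  have B0: "B \<ge> 0" using B[of x] by linarith
  have QB: "Q0 * B \<ge> 0" using Q0_nonneg B0 by simp
  have d1: "((\<lambda>r. 2 * Q0 * B / sqrt r) has_real_derivative - (Q0 * B / (r * sqrt r))) (at r)" if "r > 0" for r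
    using that by (auto intro!: derivative_eq_intros simp: field_simps)
  have dec: "k * P t f x + 2 * Q0 * B / sqrt t \<le> k * P s f x + 2 * Q0 * B / sqrt s" if k: "\<bar>k\<bar> = 1" for k :: real
  proof (rule DERIV_nonpos_imp_nonincreasing[OF s(2)])
    fix r assume r: "s \<le> r" "r \<le> t"
    then have r0: "r > 0" using s by simp
    have "k * P r (L f) x - Q0 * B / (r * sqrt r) \<le> 0"
    proof -
      have "k * P r (L f) x \<le> \<bar>k * P r (L f) x\<bar>" by simp
      also have "\<dots> = \<bar>P r (L f) x\<bar>" using k by (simp add: abs_mult)
      also have "\<dots> \<le> Q0 * B / (r * sqrt r)" by (rule gradient_decay(2)[OF f B r0])
      finally show ?thesis by simp
    qed
    moreover have "((\<lambda>r. k * P r f x + 2 * Q0 * B / sqrt r) has_real_derivative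
        k * P r (L f) x + - (Q0 * B / (r * sqrt r))) (at r)"
      by (rule DERIV_add[OF DERIV_cmult[OF P_deriv[OF f r0]] d1[OF r0]])
    ultimately show "\<exists>y. ((\<lambda>r. k * P r f x + 2 * Q0 * B / sqrt r) has_real_derivative y) (at r) \<and> y \<le> 0"
      by (intro exI[of _ "k * P r (L f) x + - (Q0 * B / (r * sqrt r))"]) simp
  qed
  have "0 \<le> 2 * (Q0 * B) / sqrt t" using QB s by (intro divide_nonneg_nonneg) auto
  then have "0 \<le> 2 * Q0 * B / sqrt t" by (simp only: mult.assoc)
  then show ?thesis using dec[of 1] dec[of "-1"] by simp
qed

text \<open>The limit exists because the flow is Cauchy in time. It is constant because
  \<open>P (real n) f\<close>, divided by a suitable multiple of \<open>1 / real n\<close>, has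
  gradient at most 1, so its values at \<open>x\<close> and \<open>y\<close> differ by at most
  \<open>K\<close> times this multiple.\<close>

lemma P_limit:
  assumes f: "f \<in> T"
  shows "\<exists>m. \<forall>x. (\<lambda>n. P (real n) f x) \<longlonglongrightarrow> m"
proof -
  obtain B where B: "B \<ge> 0" "\<And>x. \<bar>f x\<bar> \<le> B" using Ctest_bounded[OF f] by blast
  have "convergent (\<lambda>n. P (real n) f x)" for x
  proof -
    have "(\<lambda>n. 2 * Q0 * B / sqrt (real (Suc n))) \<longlonglongrightarrow> 0"
      by (intro LIMSEQ_Suc[of "\<lambda>n. 2 * Q0 * B / sqrt (real n)"] tendsto_divide_0[OF tendsto_const]
          filterlim_at_top_imp_at_infinity filterlim_compose[OF sqrt_at_top filterlim_real_sequentially])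
    have "Cauchy (\<lambda>n. P (real n) f x)"
      unfolding Cauchy_altdef2
    proof (intro allI impI)
      fix e :: real assume "e > 0"
      then obtain N where N: "\<bar>2 * Q0 * B / sqrt (real (Suc N))\<bar> < e"
        using LIMSEQ_D[OF \<open>(\<lambda>n. 2 * Q0 * B / sqrt (real (Suc n))) \<longlonglongrightarrow> 0\<close>] by fastforce
      show "\<exists>N. \<forall>n\<ge>N. dist (P (real n) f x) (P (real N) f x) < e"
      proof (intro exI[of _ "Suc N"] allI impI)
        fix n assume n: "Suc N \<le> n"
        have "\<bar>P (real n) f x - P (real (Suc N)) f x\<bar> \<le> 2 * Q0 * B / sqrt (real (Suc N))"
          by (rule P_cauchy[OF f B(2)]) (use n in auto)
        then show "dist (P (real n) f x) (P (real (Suc N)) f x) < e"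
          using N by (simp only: dist_real_def)
      qed
    qed
    then show ?thesis by (rule Cauchy_convergent)
  qed
  then obtain l where l: "\<And>x. (\<lambda>n. P (real n) f x) \<longlonglongrightarrow> l x" unfolding convergent_def by metis
  have "l x = l y" for x y
  proof -
    obtain K where K: "\<And>f. f \<in> C \<Longrightarrow> (\<And>z. \<Gamma> f f z \<le> 1) \<Longrightarrow> \<bar>f x - f y\<bar> \<le> K"
      using oscillation_finite[of x y] by blast
    have "\<bar>P (real n) f x - P (real n) f y\<bar> \<le> K * (sqrt e0 * (B + 1)) / real n" if n: "n > 0" for n
    proof -
      \<comment> \<open>\<open>B + 1\<close> instead of \<open>B\<close> keeps \<open>c\<close>
        positive when \<open>f\<close> vanishes.\<close>
      define c where "c = sqrt e0 * (B + 1) / real n"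
      have c: "c > 0" using e0_pos B n by (simp add: c_def)
      have CP: "P (real n) f \<in> C" by (rule P_smooth[OF f]) simp
      have "\<Gamma> (\<lambda>x. (1 / c) * P (real n) f x) (\<lambda>x. (1 / c) * P (real n) f x) z \<le> 1" for z
      proof -
        have "\<Gamma> (\<lambda>x. (1 / c) * P (real n) f x) (\<lambda>x. (1 / c) * P (real n) f x) z
          = (1 / c) * ((1 / c) * \<Gamma> (P (real n) f) (P (real n) f) z)"
          by (simp only: form_cmult[OF cdc_form CP Csmooth_cmult[OF CP]] form_cmult_right[OF cdc_form CP CP])
        also have "\<dots> \<le> (1 / c) * ((1 / c) * (e0 * B\<^sup>2 / (real n)\<^sup>2))"
          using gradient_decay(1)[OF f B(2), of "real n" z] n c by (intro mult_left_mono) auto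
        also have "\<dots> \<le> (1 / c) * ((1 / c) * c\<^sup>2)"
        proof (intro mult_left_mono)
          have "e0 * B\<^sup>2 / (real n)\<^sup>2 \<le> e0 * (B + 1)\<^sup>2 / (real n)\<^sup>2"
            using e0_pos B by (intro divide_right_mono mult_left_mono power_mono) auto
          also have "\<dots> = c\<^sup>2" using e0_pos by (simp add: c_def power_mult_distrib power_divide)
          finally show "e0 * B\<^sup>2 / (real n)\<^sup>2 \<le> c\<^sup>2" .
        qed (use c in auto)
        also have "\<dots> = 1" using c by (simp add: power2_eq_square)
        finally show ?thesis .
      qed
      from K[OF Csmooth_cmult[OF CP] this]
      have "\<bar>(1 / c) * P (real n) f x - (1 / c) * P (real n) f y\<bar> \<le> K" .
      moreover have "(1 / c) * P (real n) f x - (1 / c) * P (real n) f y = (P (real n) f x - P (real n) f y) / c"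
        by (simp add: diff_divide_distrib)
      ultimately have "\<bar>P (real n) f x - P (real n) f y\<bar> \<le> K * c"
        using c by (simp add: abs_divide divide_le_eq)
      then show ?thesis by (simp add: c_def)
    qed
    then have "eventually (\<lambda>n. norm (P (real n) f x - P (real n) f y) \<le> K * (sqrt e0 * (B + 1)) / real n) sequentially"
      by (intro eventually_sequentiallyI[of 1]) auto
    moreover have "(\<lambda>n. K * (sqrt e0 * (B + 1)) / real n) \<longlonglongrightarrow> 0" by (rule lim_const_over_n)
    ultimately have "(\<lambda>n. P (real n) f x - P (real n) f y) \<longlonglongrightarrow> 0" by (rule Lim_null_comparison)
    moreover have "(\<lambda>n. P (real n) f x - P (real n) f y) \<longlonglongrightarrow> l x - l y" by (intro tendsto_diff l)
    ultimately show ?thesis using LIMSEQ_unique by fastforce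
  qed
  then have "l x = l undefined" for x by blast
  then show ?thesis using l by (intro exI[of _ "l undefined"]) metis
qed

text \<open>A limit along the flow, as the volume is not yet known to be finite;
  \<open>mean_eq\<close> identifies it with the average. By \<open>P_limit\<close> the choice of the
  point \<open>undefined\<close> does not matter.\<close>

definition mean :: "('a \<Rightarrow> real) \<Rightarrow> real" where "mean f = lim (\<lambda>n. P (real n) f undefined)"

lemma P_tendsto_mean:
  assumes "f \<in> T" shows "(\<lambda>n. P (real n) f x) \<longlonglongrightarrow> mean f"
proof -
  obtain m where m: "\<And>x. (\<lambda>n. P (real n) f x) \<longlonglongrightarrow> m" using P_limit[OF assms] by blast
  have "mean f = m" unfolding mean_def using m by (rule limI)
  then show ?thesis using m by simp
qed

lemma P_mean_le:
  assumes f: "f \<in> T" and B: "\<And>x. \<bar>f x\<bar> \<le> B" and s: "0 < s"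
  shows "\<bar>mean f - P s f x\<bar> \<le> 2 * Q0 * B / sqrt s"
proof (rule LIMSEQ_le_const2)
  show "(\<lambda>n. \<bar>P (real n) f x - P s f x\<bar>) \<longlonglongrightarrow> \<bar>mean f - P s f x\<bar>"
    by (intro tendsto_intros P_tendsto_mean f)
  show "\<exists>N. \<forall>n\<ge>N. \<bar>P (real n) f x - P s f x\<bar> \<le> 2 * Q0 * B / sqrt s"
  proof (intro exI[of _ "nat \<lceil>s\<rceil>"] allI impI)
    fix n assume "nat \<lceil>s\<rceil> \<le> n"
    then have "s \<le> real n" by (simp add: nat_le_iff ceiling_le_iff)
    then show "\<bar>P (real n) f x - P s f x\<bar> \<le> 2 * Q0 * B / sqrt s" by (rule P_cauchy[OF f B s])
  qed
qed

text \<open>The squares of \<open>P (real n) (h k)\<close> converge to the square of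
  \<open>mean (h k)\<close>, and the contraction property keeps their integrals bounded. If the mean
  is positive, Fatou's lemma therefore bounds the volume.\<close>

lemma finite_\<mu>: "emeasure \<mu> UNIV < \<infinity>"
proof -
  obtain B where B: "B \<ge> 1" "\<And>k x. \<bar>h k x\<bar> \<le> B" using h_bounded by blast
  obtain x :: 'a where True by simp
  \<comment> \<open>Chosen before \<open>k\<close>: as \<open>B\<close> bounds all cutoffs, at this
    time the flow of every \<open>h k\<close> is within 1 / 4 of its mean. Then \<open>k\<close> is
    taken so large that \<open>P t (h k) x > 3 / 4\<close>.\<close>
  define t where "t = (8 * Q0 * B + 1)\<^sup>2"
  have QB: "8 * Q0 * B + 1 > 0" using Q0_nonneg B(1) by (simp add: add_nonneg_pos)
  have t: "t > 0" using QB by (simp add: t_def)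
  have "2 * Q0 * B / sqrt t = 2 * Q0 * B / (8 * Q0 * B + 1)" using QB by (simp add: t_def)
  also have "\<dots> \<le> 1 / 4" using QB by (simp add: divide_simps)
  finally have small: "2 * Q0 * B / sqrt t \<le> 1 / 4" .
  have "eventually (\<lambda>k. P t (h k) x > 3 / 4) sequentially"
    by (rule order_tendstoD(1)[OF P_h_lim]) (use t in auto)
  then obtain k where k: "P t (h k) x > 3 / 4" using eventually_happens by force
  let ?m = "mean (h k)"
  have "\<bar>?m - P t (h k) x\<bar> \<le> 1 / 4" using P_mean_le[OF h_test B(2) t, of k x] small by linarith
  then have m: "?m > 1 / 2" using k by linarith
  have hL2: "h k \<in> L2 \<mu>" by (rule Ctest_L2[OF h_test])
  let ?N = "\<integral>x. (h k x)\<^sup>2 \<partial>\<mu>"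
  have le: "(\<integral>\<^sup>+ x. ennreal ((P (real n) (h k) x)\<^sup>2) \<partial>\<mu>) \<le> ennreal ?N" for n
  proof -
    have "P (real n) (h k) \<in> L2 \<mu>" by (rule P_L2[OF _ hL2]) simp
    then have "(\<integral>\<^sup>+ x. ennreal ((P (real n) (h k) x)\<^sup>2) \<partial>\<mu>) = ennreal (\<integral>x. (P (real n) (h k) x)\<^sup>2 \<partial>\<mu>)"
      by (intro nn_integral_eq_integral) (auto simp: L2_def)
    also have "\<dots> \<le> ennreal ?N" by (intro ennreal_leI P_contraction hL2) simp
    finally show ?thesis .
  qed
  have lim: "liminf (\<lambda>n. ennreal ((P (real n) (h k) x)\<^sup>2)) = ennreal (?m\<^sup>2)" for x
    by (intro lim_imp_Liminf tendsto_ennrealI tendsto_power P_tendsto_mean h_test) simp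
  have "ennreal (?m\<^sup>2) * emeasure \<mu> UNIV = (\<integral>\<^sup>+ x. liminf (\<lambda>n. ennreal ((P (real n) (h k) x)\<^sup>2)) \<partial>\<mu>)"
    unfolding lim by simp
  also have "\<dots> \<le> liminf (\<lambda>n. \<integral>\<^sup>+ x. ennreal ((P (real n) (h k) x)\<^sup>2) \<partial>\<mu>)"
    by (intro nn_integral_liminf measurable_compose[OF _ measurable_ennreal] borel_measurable_power
        Csmooth_measurable P_smooth h_test) simp
  also have "\<dots> \<le> ennreal ?N"
    using le by (intro Liminf_le always_eventually allI) auto
  finally have "ennreal (?m\<^sup>2) * emeasure \<mu> UNIV < \<infinity>" by (simp add: le_less_trans)
  moreover have "ennreal (?m\<^sup>2) \<noteq> 0" using m by simp
  ultimately show ?thesis by (auto simp: ennreal_mult_less_top less_top)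
qed

sublocale finite_measure \<mu>
  by standard (use finite_\<mu> in simp)

abbreviation "mass \<equiv> measure \<mu> UNIV"

lemma mass_pos: "mass > 0"
proof -
  have "emeasure \<mu> UNIV > 0" by (rule \<mu>_open_pos) auto
  then show ?thesis using emeasure_eq_measure[of UNIV] by simp
qed

lemma integrable_bounded_Csmooth:
  assumes "f \<in> C" "\<And>x. \<bar>f x\<bar> \<le> B" shows "integrable \<mu> f"
  by (rule integrable_const_bound[of _ B]) (use assms Csmooth_measurable in \<open>auto intro: AE_I2\<close>)

lemma integral_P:
  assumes f: "f \<in> T" and t: "t \<ge> 0"
  shows "(\<integral>x. P t f x \<partial>\<mu>) = (\<integral>x. f x \<partial>\<mu>)"
proof -
  have "(\<integral>x. 1 * P t f x \<partial>\<mu>) = (\<integral>x. f x * P t (\<lambda>_. 1) x \<partial>\<mu>)"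
    by (rule P_symmetric[OF t Ctest_integrable[OF f], of "\<lambda>_. 1" 1]) auto
  then show ?thesis using P_const[OF t, of 1] by simp
qed

text \<open>The flow preserves the integral and converges boundedly to the constant
  \<open>mean f\<close>.\<close>

lemma mean_eq: assumes f: "f \<in> T" shows "(\<integral>x. f x \<partial>\<mu>) = mass * mean f"
proof -
  obtain B where B: "B \<ge> 0" "\<And>t x. t \<ge> 0 \<Longrightarrow> \<bar>P t f x\<bar> \<le> B" using P_bounded[OF f] by auto
  have "(\<lambda>n. \<integral>x. P (real n) f x \<partial>\<mu>) \<longlonglongrightarrow> (\<integral>x. mean f \<partial>\<mu>)"
  proof (rule integral_dominated_convergence[where w="\<lambda>_. B"])
    show "P (real n) f \<in> borel_measurable \<mu>" for n by (intro Csmooth_measurable P_smooth f) simp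
    show "AE x in \<mu>. (\<lambda>n. P (real n) f x) \<longlonglongrightarrow> mean f" using P_tendsto_mean[OF f] by simp
    show "AE x in \<mu>. norm (P (real n) f x) \<le> B" for n using B(2) by simp
  qed auto
  then have "(\<lambda>n. \<integral>x. f x \<partial>\<mu>) \<longlonglongrightarrow> (\<integral>x. mean f \<partial>\<mu>)" using integral_P[OF f] by simp
  then have "(\<integral>x. f x \<partial>\<mu>) = (\<integral>x. mean f \<partial>\<mu>)" using LIMSEQ_unique tendsto_const by blast
  then show ?thesis by simp
qed

text \<open>Logarithm of the ultracontractive constant. It is the integral over times beyond
  \<open>t\<close> of the Li-Yau rate
  \<open>\<alpha> D / 2 / (exp (\<alpha> s) - 1)\<close>.\<close>

definition lnK :: "real \<Rightarrow> real" where "lnK t = - (D / 2) * ln (1 - exp (- \<alpha> * t))"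

lemma one_minus_exp: "t > 0 \<Longrightarrow> 0 < 1 - exp (- \<alpha> * t)" "t > 0 \<Longrightarrow> 1 - exp (- \<alpha> * t) < 1"
  using \<alpha>_pos by auto

lemma lnK_nonneg: "t > 0 \<Longrightarrow> lnK t \<ge> 0"
  using one_minus_exp[of t] D_pos unfolding lnK_def by (simp add: mult_nonneg_nonpos)

lemma lnK_DERIV:
  assumes t: "t > 0"
  shows "(lnK has_real_derivative - (\<alpha> * D / 2 / (exp (\<alpha> * t) - 1))) (at t)"
proof -
  have X: "exp (\<alpha> * t) > 1" using \<alpha>_pos t by simp
  have "exp (- \<alpha> * t) / (1 - exp (- \<alpha> * t)) = 1 / (exp (\<alpha> * t) - 1)"
    using X one_minus_exp[OF t] by (simp add: exp_minus field_simps)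
  moreover have "(lnK has_real_derivative - (D / 2) * (1 / (1 - exp (- \<alpha> * t)) * (0 - exp (- \<alpha> * t) * (- \<alpha>)))) (at t)"
  proof -
    have "((\<lambda>t. 1 - exp (- \<alpha> * t)) has_real_derivative 0 - exp (- \<alpha> * t) * (- \<alpha>)) (at t)"
      by (auto intro!: derivative_eq_intros)
    from DERIV_cmult[OF DERIV_chain2[where f=ln and g="\<lambda>t. 1 - exp (- \<alpha> * t)",
        OF DERIV_ln_divide[OF one_minus_exp(1)[OF t]] this]]
    show ?thesis unfolding lnK_def .
  qed
  moreover have "- (D / 2) * (1 / (1 - exp (- \<alpha> * t)) * (0 - exp (- \<alpha> * t) * (- \<alpha>)))
     = - (\<alpha> * D / 2) * (exp (- \<alpha> * t) / (1 - exp (- \<alpha> * t)))"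
  proof -
    have "- (D / 2) * (1 / w * (0 - E * (- \<alpha>))) = - (\<alpha> * D / 2) * (E / w)" for w E :: real
      by (simp add: mult_ac)
    then show ?thesis .
  qed
  ultimately show ?thesis by simp
qed

text \<open>By the Li-Yau inequality, \<open>ln U\<close> decreases no faster than
  \<open>lnK\<close>, so their difference is nondecreasing in time. It is compared with its limit
  along integer times, where \<open>U\<close> tends to its mean.\<close>

lemma ultracontractive:
  assumes f: "f \<in> T" and \<epsilon>: "\<epsilon> > 0" "\<And>x. \<epsilon> \<le> q + f x" and t: "t > 0"
  shows "ln (q + P t f x) \<le> ln (q + mean f) + lnK t" and "\<epsilon> \<le> q + P t f x" and "\<epsilon> \<le> q + mean f"
proof -
  have Ueps: "q + P s f x \<ge> \<epsilon>" if "s \<ge> 0" for s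
  proof -
    obtain B where B: "\<And>x. \<bar>f x\<bar> \<le> B" using Ctest_bounded[OF f] by blast
    have "\<epsilon> - q \<le> P s f x"
      by (rule P_ge[OF that Ctest_measurable[OF f] B]) (use \<epsilon>(2) in \<open>auto simp: algebra_simps\<close>)
    then show ?thesis by simp
  qed
  then show "\<epsilon> \<le> q + P t f x" using t by simp
  have limU: "(\<lambda>n. q + P (real n) f x) \<longlonglongrightarrow> q + mean f" by (intro tendsto_intros P_tendsto_mean f)
  then show m: "\<epsilon> \<le> q + mean f" by (rule LIMSEQ_le_const) (use Ueps in auto)
  have mono: "ln (q + P t f x) - lnK t \<le> ln (q + P s f x) - lnK s" if ts: "t \<le> s" for s
  proof (rule DERIV_nonneg_imp_nondecreasing[OF ts])
    fix r assume r: "t \<le> r" "r \<le> s"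
    then have r0: "r > 0" using t by simp
    have Ur: "q + P r f x > 0" using Ueps[of r] r0 \<epsilon>(1) by simp
    have X: "exp (\<alpha> * r) - 1 > 0" using \<alpha>_pos r0 by simp
    have "((\<lambda>r. ln (q + P r f x) - lnK r) has_real_derivative
        1 / (q + P r f x) * (0 + P r (L f) x) - - (\<alpha> * D / 2 / (exp (\<alpha> * r) - 1))) (at r)"
      by (rule DERIV_diff[OF DERIV_chain2[where f=ln and g="\<lambda>r. q + P r f x", OF DERIV_ln_divide[OF Ur]
          DERIV_add[OF DERIV_const P_deriv[OF f r0]]] lnK_DERIV[OF r0]])
    moreover have "0 \<le> 1 / (q + P r f x) * (0 + P r (L f) x) - - (\<alpha> * D / 2 / (exp (\<alpha> * r) - 1))"
    proof -
      have "0 \<le> ((exp (\<alpha> * r) - 1) * P r (L f) x + \<alpha> * D / 2 * (q + P r f x)) / ((exp (\<alpha> * r) - 1) * (q + P r f x))"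
        using li_yau[OF f \<epsilon> r0, of x] X Ur by simp
      also have "\<dots> = 1 / (q + P r f x) * (0 + P r (L f) x) - - (\<alpha> * D / 2 / (exp (\<alpha> * r) - 1))"
      proof -
        have "(w * y + c * U) / (w * U) = 1 / U * (0 + y) - - (c / w)" if "w > 0" "U > 0" for w y c U :: real
          using that by (simp add: add_divide_distrib)
        from this[OF X Ur] show ?thesis .
      qed
      finally show ?thesis .
    qed
    ultimately show "\<exists>y. ((\<lambda>r. ln (q + P r f x) - lnK r) has_real_derivative y) (at r) \<and> 0 \<le> y" by blast
  qed
  have "ln (q + P t f x) - lnK t \<le> ln (q + mean f)"
  proof (rule LIMSEQ_le_const)
    show "(\<lambda>n. ln (q + P (real n) f x)) \<longlonglongrightarrow> ln (q + mean f)"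
      by (rule tendsto_ln[OF limU]) (use m \<epsilon>(1) in auto)
    show "\<exists>N. \<forall>n\<ge>N. ln (q + P t f x) - lnK t \<le> ln (q + P (real n) f x)"
    proof (intro exI[of _ "nat \<lceil>t\<rceil>"] allI impI)
      fix n assume "nat \<lceil>t\<rceil> \<le> n"
      then have "t \<le> real n" by (simp add: nat_le_iff ceiling_le_iff)
      then show "ln (q + P t f x) - lnK t \<le> ln (q + P (real n) f x)"
        using mono[of "real n"] lnK_nonneg[of "real n"] t by simp
    qed
  qed
  then show "ln (q + P t f x) \<le> ln (q + mean f) + lnK t" by simp
qed

section \<open>Entropy and transport\<close>

text \<open>No compact support here: finite volume makes bounded smooth functions integrable, and
  the cutoff can be removed. The application has \<open>u = ln U\<close> and
  \<open>\<phi> = P t f\<close>.\<close>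

lemma integration_by_parts_bounded:
  assumes u: "u \<in> C" and \<phi>: "\<phi> \<in> C"
    and b: "\<And>x. \<bar>u x\<bar> \<le> B" "\<And>x. \<bar>L \<phi> x\<bar> \<le> B" "\<And>x. \<bar>\<Gamma> \<phi> \<phi> x\<bar> \<le> B" "\<And>x. \<bar>\<Gamma> u \<phi> x\<bar> \<le> B"
  shows "(\<integral>x. u x * L \<phi> x \<partial>\<mu>) = - (\<integral>x. \<Gamma> u \<phi> x \<partial>\<mu>)"
proof -
  have CL: "L \<phi> \<in> C" and C\<Gamma>: "\<Gamma> u \<phi> \<in> C" and C\<Gamma>\<phi>: "\<Gamma> \<phi> \<phi> \<in> C"
    using u \<phi> by (auto intro: Csmooth_L Csmooth_cdc)
  have i1: "integrable \<mu> (\<lambda>x. u x * L \<phi> x)"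
    by (rule integrable_bounded_Csmooth[OF Csmooth_mult[OF u CL] abs_mult_le[OF b(1,2)]])
  have i2: "integrable \<mu> (\<Gamma> u \<phi>)" by (rule integrable_bounded_Csmooth[OF C\<Gamma> b(4)])
  have hu: "(\<lambda>x. h k x * u x) \<in> T" for k by (rule Ctest_mult[OF h_test u])
  have eq: "(\<integral>x. h k x * (u x * L \<phi> x) \<partial>\<mu>) = - (\<integral>x. h k x * \<Gamma> u \<phi> x \<partial>\<mu>) - (\<integral>x. u x * \<Gamma> (h k) \<phi> x \<partial>\<mu>)" for k
  proof -
    have a: "integrable \<mu> (\<lambda>x. h k x * \<Gamma> u \<phi> x)" by (rule Ctest_integrable_mult[OF h_test C\<Gamma>])
    have mult: "\<Gamma> (\<lambda>x. h k x * u x) \<phi> x = h k x * \<Gamma> u \<phi> x + u x * \<Gamma> (h k) \<phi> x" for x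
      by (rule form_mult[OF cdc_form h_Csmooth u \<phi>])
    have "integrable \<mu> (\<lambda>x. \<Gamma> (\<lambda>x. h k x * u x) \<phi> x - h k x * \<Gamma> u \<phi> x)"
      using integration_by_parts(1)[OF hu \<phi>] a by (intro Bochner_Integration.integrable_diff) auto
    then have c: "integrable \<mu> (\<lambda>x. u x * \<Gamma> (h k) \<phi> x)" by (simp add: mult)
    have "(\<integral>x. h k x * (u x * L \<phi> x) \<partial>\<mu>) = - (\<integral>x. \<Gamma> (\<lambda>x. h k x * u x) \<phi> x \<partial>\<mu>)"
      using integration_by_parts(2)[OF hu \<phi>] by (simp add: mult.assoc)
    then show ?thesis unfolding mult using a c by simp
  qed
  have "integrable \<mu> (\<lambda>x. \<bar>u x\<bar> * (1 + \<Gamma> \<phi> \<phi> x))"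
  proof -
    have "integrable \<mu> (\<lambda>x. u x * (1 + \<Gamma> \<phi> \<phi> x))"
    proof (rule integrable_bounded_Csmooth[OF Csmooth_mult[OF u Csmooth_add[OF Csmooth_const C\<Gamma>\<phi>]]])
      show "\<bar>u x * (1 + \<Gamma> \<phi> \<phi> x)\<bar> \<le> B * (1 + B)" for x
        by (rule abs_mult_le[OF b(1)]) (use b(3)[of x] in linarith)
    qed
    then have "integrable \<mu> (\<lambda>x. \<bar>u x * (1 + \<Gamma> \<phi> \<phi> x)\<bar>)" by (rule integrable_abs)
    then show ?thesis using form_nonneg[OF cdc_form \<phi>] by (simp add: abs_mult)
  qed
  then have 0: "(\<lambda>k. \<integral>x. u x * \<Gamma> (h k) \<phi> x \<partial>\<mu>) \<longlonglongrightarrow> 0"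
    by (rule h_cross_limit[OF \<phi> Csmooth_measurable[OF u]])
  have "(\<lambda>k. \<integral>x. h k x * (u x * L \<phi> x) \<partial>\<mu>) \<longlonglongrightarrow> - (\<integral>x. \<Gamma> u \<phi> x \<partial>\<mu>) - 0"
    unfolding eq by (intro tendsto_diff tendsto_minus h_mult_limit i2 0)
  then show ?thesis using h_mult_limit[OF i1] LIMSEQ_unique by fastforce
qed

text \<open>In terms of \<open>S0\<close> and \<open>w0\<close> the Li-Yau rate is
  \<open>(S0 / w0 t)^2\<close>.\<close>

definition S0 :: real where "S0 = sqrt (\<alpha> * D / 2)"
definition w0 :: "real \<Rightarrow> real" where "w0 t = sqrt (exp (\<alpha> * t) - 1)"

lemma S0_pos: "S0 > 0"
  using \<alpha>_pos D_pos by (simp add: S0_def)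

lemma S0_sq: "S0 * S0 = \<alpha> * D / 2"
  using \<alpha>_pos D_pos by (simp add: S0_def)

lemma w0_pos: "t > 0 \<Longrightarrow> w0 t > 0"
  using \<alpha>_pos by (simp add: w0_def)

lemma w0_sq: "t > 0 \<Longrightarrow> w0 t * w0 t = exp (\<alpha> * t) - 1"
  using \<alpha>_pos by (simp add: w0_def)

lemma w0_DERIV:
  assumes t: "t > 0"
  shows "(w0 has_real_derivative \<alpha> * exp (\<alpha> * t) / (2 * w0 t)) (at t)"
proof -
  have "exp (\<alpha> * t) - 1 > 0" using \<alpha>_pos t by simp
  then show ?thesis unfolding w0_def
    by (auto intro!: derivative_eq_intros simp: field_simps)
qed

text \<open>This form shows that \<open>w0 t * lnK t\<close> tends to 0 both as \<open>t\<close>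
  tends to 0 and as \<open>t\<close> tends to infinity.\<close>

lemma lnK_eq: "t > 0 \<Longrightarrow> lnK t = D / 2 * ln (1 + 1 / (w0 t * w0 t))"
proof -
  assume t: "t > 0"
  have X: "exp (\<alpha> * t) - 1 > 0" using \<alpha>_pos t by simp
  have inv: "1 - inverse X = inverse (1 + 1 / (X - 1))" if "X > 1" for X :: real
  proof -
    have "1 + 1 / (X - 1) = X / (X - 1)" using that by (simp add: field_simps)
    then show ?thesis using that by (simp add: field_simps)
  qed
  have "1 - exp (- \<alpha> * t) = inverse (1 + 1 / (exp (\<alpha> * t) - 1))"
    using inv[of "exp (\<alpha> * t)"] X unfolding mult_minus_left exp_minus by linarith
  moreover have "ln (inverse (1 + 1 / (exp (\<alpha> * t) - 1))) = - ln (1 + 1 / (exp (\<alpha> * t) - 1))"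
    by (rule ln_inverse)
  ultimately show ?thesis unfolding lnK_def w0_sq[OF t] by simp
qed

text \<open>A strictly positive smooth probability density \<open>q + f\<close> with respect to the
  normalised measure. The constant is kept apart so that \<open>f\<close> is a test
  function.\<close>

definition density :: "real \<Rightarrow> real \<Rightarrow> ('a \<Rightarrow> real) \<Rightarrow> bool" where
  "density \<epsilon> q f \<longleftrightarrow> f \<in> T \<and> \<epsilon> > 0 \<and> (\<forall>x. \<epsilon> \<le> q + f x) \<and> q + mean f = 1"

text \<open>Entropy and Fisher information are integrals against \<mu> itself, which is why
  \<open>mass\<close> appears in the estimates.\<close>

definition entropy :: "real \<Rightarrow> ('a \<Rightarrow> real) \<Rightarrow> real \<Rightarrow> real" where
  "entropy q f t = (\<integral>x. (q + P t f x) * ln (q + P t f x) \<partial>\<mu>)"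

definition fisher :: "real \<Rightarrow> ('a \<Rightarrow> real) \<Rightarrow> real \<Rightarrow> real" where
  "fisher q f t = (\<integral>x. \<Gamma> (P t f) (P t f) x / (q + P t f x) \<partial>\<mu>)"

context
  fixes \<epsilon> q :: real and f :: "'a \<Rightarrow> real"
  assumes dens: "density \<epsilon> q f"
begin

lemma density_Ctest: "f \<in> T" and density_pos: "\<epsilon> > 0" and density_ge: "\<epsilon> \<le> q + f x"
  and density_mean: "q + mean f = 1"
  using dens by (auto simp: density_def)

lemma U_ge: "t \<ge> 0 \<Longrightarrow> \<epsilon> \<le> q + P t f x"
  using ultracontractive(2)[OF density_Ctest density_pos density_ge, of t x] density_ge[of x] by (cases "t = 0") auto

lemma U_pos: "t \<ge> 0 \<Longrightarrow> 0 < q + P t f x"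
  using U_ge[of t x] density_pos by linarith

lemma U_bounded: "\<exists>M>0. \<forall>t\<ge>0. \<forall>x. \<bar>q + P t f x\<bar> \<le> M"
proof -
  obtain B where B: "B \<ge> 0" "\<And>t x. t \<ge> 0 \<Longrightarrow> \<bar>P t f x\<bar> \<le> B" using P_bounded[OF density_Ctest] by auto
  have "\<bar>q + P t f x\<bar> \<le> \<bar>q\<bar> + B + 1" if "t \<ge> 0" for t x using B(2)[OF that, of x] by linarith
  then show ?thesis using B(1) by (intro exI[of _ "\<bar>q\<bar> + B + 1"]) auto
qed

lemma U_smooth: "t \<ge> 0 \<Longrightarrow> (\<lambda>x. q + P t f x) \<in> C"
  by (intro Csmooth_add Csmooth_const P_smooth density_Ctest)

lemma ln_U_bounded: "\<exists>M\<ge>0. \<forall>t\<ge>0. \<forall>x. \<bar>ln (q + P t f x)\<bar> \<le> M"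
proof -
  obtain B where B: "B > 0" "\<And>t x. t \<ge> 0 \<Longrightarrow> \<bar>q + P t f x\<bar> \<le> B" using U_bounded by auto
  have "\<bar>ln (q + P t f x)\<bar> \<le> \<bar>ln \<epsilon>\<bar> + \<bar>ln B\<bar>" if t: "t \<ge> 0" for t x
  proof -
    have "ln \<epsilon> \<le> ln (q + P t f x)" using U_ge[OF t, of x] density_pos by simp
    moreover have "ln (q + P t f x) \<le> ln B" using B(2)[OF t, of x] U_pos[OF t, of x] B(1) by simp
    ultimately show ?thesis by linarith
  qed
  then show ?thesis by (intro exI[of _ "\<bar>ln \<epsilon>\<bar> + \<bar>ln B\<bar>"]) auto
qed

lemma integral_U: assumes t: "t \<ge> 0" shows "integrable \<mu> (\<lambda>x. q + P t f x)" "(\<integral>x. q + P t f x \<partial>\<mu>) = mass"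
proof -
  obtain B where B: "B \<ge> 0" "\<And>t x. t \<ge> 0 \<Longrightarrow> \<bar>P t f x\<bar> \<le> B" using P_bounded[OF density_Ctest] by auto
  have i: "integrable \<mu> (P t f)" by (rule integrable_bounded_Csmooth[OF P_smooth[OF density_Ctest t] B(2)[OF t]])
  then show "integrable \<mu> (\<lambda>x. q + P t f x)" by simp
  have "(\<integral>x. q + P t f x \<partial>\<mu>) = q * mass + mass * mean f"
    using i integral_P[OF density_Ctest t] mean_eq[OF density_Ctest] by simp
  also have "\<dots> = mass * (q + mean f)" by (simp add: algebra_simps)
  finally show "(\<integral>x. q + P t f x \<partial>\<mu>) = mass" using density_mean by simp
qed

lemma entropy_integrable: "t \<ge> 0 \<Longrightarrow> integrable \<mu> (\<lambda>x. (q + P t f x) * ln (q + P t f x))"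
proof -
  assume t: "t \<ge> 0"
  obtain B1 where B1: "\<And>t x. t \<ge> 0 \<Longrightarrow> \<bar>q + P t f x\<bar> \<le> B1" using U_bounded by auto
  obtain B2 where B2: "\<And>t x. t \<ge> 0 \<Longrightarrow> \<bar>ln (q + P t f x)\<bar> \<le> B2" using ln_U_bounded by auto
  show ?thesis
    by (rule integrable_bounded_Csmooth[OF Csmooth_mult[OF U_smooth[OF t] Csmooth_ln[OF U_smooth[OF t] U_pos[OF t]]]
          abs_mult_le[OF B1[OF t] B2[OF t]]])
qed

text \<open>From \<open>u ln u \<ge> u - 1\<close>, whose right-hand side integrates to 0.\<close>

lemma entropy_nonneg: assumes t: "t \<ge> 0" shows "0 \<le> entropy q f t"
proof -
  have "(\<integral>x. (q + P t f x) - 1 \<partial>\<mu>) \<le> entropy q f t"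
    unfolding entropy_def
  proof (rule integral_mono[OF _ entropy_integrable[OF t]])
    show "integrable \<mu> (\<lambda>x. (q + P t f x) - 1)" using integral_U(1)[OF t] by simp
    fix x
    let ?u = "q + P t f x"
    have u: "?u > 0" by (rule U_pos[OF t])
    have "- ln ?u = ln (1 / ?u)" using u by (simp add: ln_div)
    also have "\<dots> \<le> 1 / ?u - 1" using u by (intro ln_le_minus_one) simp
    finally have "?u * (1 - 1 / ?u) \<le> ?u * ln ?u" using u by (intro mult_left_mono) auto
    then show "?u - 1 \<le> ?u * ln ?u" using u by (simp add: algebra_simps)
  qed
  moreover have "(\<integral>x. (q + P t f x) - 1 \<partial>\<mu>) = 0" using integral_U[OF t] by simp
  ultimately show ?thesis by simp
qed

text \<open>As the mean is 1, ultracontractivity reads \<open>ln U \<le> lnK t\<close> pointwise; it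
  is integrated against \<open>U\<close>, whose integral is \<open>mass\<close>.\<close>

lemma entropy_le: assumes t: "t > 0" shows "entropy q f t \<le> mass * lnK t"
proof -
  have t0: "t \<ge> 0" using t by simp
  have "entropy q f t \<le> (\<integral>x. (q + P t f x) * lnK t \<partial>\<mu>)"
    unfolding entropy_def
  proof (rule integral_mono[OF entropy_integrable[OF t0]])
    show "integrable \<mu> (\<lambda>x. (q + P t f x) * lnK t)" using integral_U(1)[OF t0] by (rule integrable_mult_left)
    show "(q + P t f x) * ln (q + P t f x) \<le> (q + P t f x) * lnK t" for x
      using ultracontractive(1)[OF density_Ctest density_pos density_ge t, of x] U_pos[OF t0, of x] density_mean
      by (intro mult_left_mono) auto
  qed
  also have "\<dots> = (\<integral>x. q + P t f x \<partial>\<mu>) * lnK t" by (rule integral_mult_left_zero)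
  finally show ?thesis using integral_U(2)[OF t0] by simp
qed

text \<open>Under the integral the derivative is \<open>P t (L f) * (ln U + 1)\<close>. The 1
  contributes nothing, since \<open>L f\<close> has integral 0; integration by parts and the chain
  rule for \<open>ln U\<close> turn the rest into the Fisher information.\<close>

lemma entropy_DERIV: assumes t: "t > 0" shows "(entropy q f has_real_derivative - fisher q f t) (at t)"
proof -
  have t0: "t \<ge> 0" using t by simp
  note Lf = Ctest_L[OF density_Ctest]
  obtain B1 where B1: "B1 > 0" "\<And>t x. t \<ge> 0 \<Longrightarrow> \<bar>q + P t f x\<bar> \<le> B1" using U_bounded by auto
  obtain B2 where B2: "B2 \<ge> 0" "\<And>t x. t \<ge> 0 \<Longrightarrow> \<bar>ln (q + P t f x)\<bar> \<le> B2" using ln_U_bounded by auto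
  obtain B3 where B3: "B3 \<ge> 0" "\<And>t x. t \<ge> 0 \<Longrightarrow> \<bar>P t (L f) x\<bar> \<le> B3" using P_bounded[OF Lf] by auto
  obtain B4 where B4: "B4 \<ge> 0" "\<And>s x. s \<in> {0..t} \<Longrightarrow> \<Gamma> (P s f) (P s f) x \<le> B4"
    using gradient_bounded[OF density_Ctest t0] by blast
  have D: "(entropy q f has_real_derivative (\<integral>x. P t (L f) x * (ln (q + P t f x) + 1) \<partial>\<mu>)) (at t)"
    unfolding entropy_def
  proof (rule DERIV_integral_dominated(2)[of 0 t "t + 1"])
    fix s :: real and x :: 'a assume s: "0 < s"
    then have s0: "s \<ge> 0" by simp
    show "integrable \<mu> (\<lambda>x. (q + P s f x) * ln (q + P s f x))" by (rule entropy_integrable[OF s0])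
    have dU: "((\<lambda>s. q + P s f x) has_real_derivative 0 + P s (L f) x) (at s)"
      by (rule DERIV_add[OF DERIV_const P_deriv[OF density_Ctest s]])
    have "((\<lambda>s. (q + P s f x) * ln (q + P s f x)) has_real_derivative
        (0 + P s (L f) x) * ln (q + P s f x) + 1 / (q + P s f x) * (0 + P s (L f) x) * (q + P s f x)) (at s)"
      by (rule DERIV_mult[OF dU DERIV_chain2[where f=ln and g="\<lambda>s. q + P s f x", OF DERIV_ln_divide[OF U_pos[OF s0]] dU]])
    moreover have "(0 + P s (L f) x) * ln (q + P s f x) + 1 / (q + P s f x) * (0 + P s (L f) x) * (q + P s f x)
       = P s (L f) x * (ln (q + P s f x) + 1)"
    proof -
      have "(0 + a) * b + 1 / c * (0 + a) * c = a * (b + 1)" if "c > 0" for a b c :: real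
        using that by (simp add: distrib_left)
      from this[OF U_pos[OF s0]] show ?thesis .
    qed
    ultimately show "((\<lambda>s. (q + P s f x) * ln (q + P s f x)) has_real_derivative P s (L f) x * (ln (q + P s f x) + 1)) (at s)"
      by simp
    have "\<bar>ln (q + P s f x) + 1\<bar> \<le> B2 + 1" using B2(2)[OF s0, of x] by linarith
    then show "\<bar>P s (L f) x * (ln (q + P s f x) + 1)\<bar> \<le> B3 * (B2 + 1)"
      by (rule abs_mult_le[OF B3(2)[OF s0]])
  qed (use t in auto)
  have CP: "P t f \<in> C" by (rule P_smooth[OF density_Ctest t0])
  define v where "v = (\<lambda>x. ln (q + P t f x))"
  have vC: "v \<in> C" unfolding v_def by (rule Csmooth_ln[OF U_smooth[OF t0] U_pos[OF t0]])
  have LP: "L (P t f) = P t (L f)" using L_P[OF density_Ctest t0] by auto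
  have \<Gamma>v: "\<Gamma> v (P t f) x = \<Gamma> (P t f) (P t f) x / (q + P t f x)" for x
  proof -
    have "\<Gamma> v (P t f) x = 1 / (q + P t f x) * \<Gamma> (\<lambda>x. q + P t f x) (P t f) x"
      unfolding v_def
      by (rule form_chain[OF cdc_form U_smooth[OF t0] CP vC[unfolded v_def] DERIV_ln_divide[OF U_pos[OF t0]]])
    then show ?thesis by (simp add: form_add_const[OF cdc_form CP CP])
  qed
  have \<Gamma>P: "0 \<le> \<Gamma> (P t f) (P t f) x" "\<Gamma> (P t f) (P t f) x \<le> B4" for x
    using form_nonneg[OF cdc_form CP] B4(2)[of t x] t0 by auto
  have \<Gamma>vb: "\<bar>\<Gamma> v (P t f) x\<bar> \<le> B4 / \<epsilon>" for x
  proof -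
    have "\<Gamma> (P t f) (P t f) x / (q + P t f x) \<le> B4 / \<epsilon>"
      using \<Gamma>P[of x] U_ge[OF t0, of x] density_pos by (intro frac_le) auto
    moreover have "0 \<le> \<Gamma> (P t f) (P t f) x / (q + P t f x)" using \<Gamma>P[of x] U_pos[OF t0, of x] by simp
    ultimately show ?thesis unfolding \<Gamma>v by linarith
  qed
  define B where "B = B2 + B3 + B4 + B4 / \<epsilon>"
  have Be: "B4 / \<epsilon> \<ge> 0" using B4(1) density_pos by simp
  have parts: "(\<integral>x. v x * L (P t f) x \<partial>\<mu>) = - (\<integral>x. \<Gamma> v (P t f) x \<partial>\<mu>)"
  proof (rule integration_by_parts_bounded[OF vC CP, of B])
    fix x
    show "\<bar>v x\<bar> \<le> B" using B2(2)[OF t0, of x] B2(1) B3(1) B4(1) Be unfolding v_def B_def by linarith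
    show "\<bar>L (P t f) x\<bar> \<le> B" using B3(2)[OF t0, of x] B2(1) B3(1) B4(1) Be unfolding LP B_def by linarith
    show "\<bar>\<Gamma> (P t f) (P t f) x\<bar> \<le> B" using \<Gamma>P[of x] B2(1) B3(1) B4(1) Be unfolding B_def by linarith
    show "\<bar>\<Gamma> v (P t f) x\<bar> \<le> B" using \<Gamma>vb[of x] B2(1) B3(1) B4(1) Be unfolding B_def by linarith
  qed
  have CL: "P t (L f) \<in> C" by (rule P_smooth[OF Lf t0])
  have i1: "integrable \<mu> (\<lambda>x. v x * P t (L f) x)"
    by (rule integrable_bounded_Csmooth[OF Csmooth_mult[OF vC CL] abs_mult_le[OF _ B3(2)[OF t0]], of B2])
       (use B2(2)[OF t0] in \<open>simp add: v_def\<close>)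
  have i2: "integrable \<mu> (P t (L f))" by (rule integrable_bounded_Csmooth[OF CL B3(2)[OF t0]])
  have "(\<integral>x. P t (L f) x * (ln (q + P t f x) + 1) \<partial>\<mu>) = (\<integral>x. v x * P t (L f) x + P t (L f) x \<partial>\<mu>)"
    by (simp add: v_def algebra_simps)
  also have "\<dots> = (\<integral>x. v x * P t (L f) x \<partial>\<mu>) + (\<integral>x. P t (L f) x \<partial>\<mu>)"
    by (rule Bochner_Integration.integral_add[OF i1 i2])
  also have "(\<integral>x. P t (L f) x \<partial>\<mu>) = 0"
    using integral_P[OF Lf t0] integral_L_eq_0[OF density_Ctest] by simp
  also have "(\<integral>x. v x * P t (L f) x \<partial>\<mu>) = - fisher q f t"
    using parts unfolding LP fisher_def \<Gamma>v .
  finally show ?thesis using D by simp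
qed

section \<open>Transport along the flow\<close>

lemma transport_DERIV:
  assumes t: "t > 0" and v: "v \<in> T"
  shows "((\<lambda>t. \<integral>x. (q + P t f x) * v x \<partial>\<mu>) has_real_derivative - (\<integral>x. \<Gamma> v (P t f) x \<partial>\<mu>)) (at t)"
proof -
  have t0: "t \<ge> 0" using t by simp
  have eq: "(\<integral>x. (q + P s f x) * v x \<partial>\<mu>) = q * (\<integral>x. v x \<partial>\<mu>) + (\<integral>x. v x * P s f x \<partial>\<mu>)" if "s > 0" for s
  proof -
    have "(\<lambda>x. (q + P s f x) * v x) = (\<lambda>x. q * v x + v x * P s f x)" by (auto simp: algebra_simps)
    moreover have "integrable \<mu> (\<lambda>x. v x * P s f x)"
      by (rule Ctest_integrable_mult[OF v P_smooth[OF density_Ctest]]) (use that in simp)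
    ultimately show ?thesis using Ctest_integrable[OF v] by simp
  qed
  have "((\<lambda>t. q * (\<integral>x. v x \<partial>\<mu>) + (\<integral>x. v x * P t f x \<partial>\<mu>)) has_real_derivative 0 + (\<integral>x. v x * P t (L f) x \<partial>\<mu>)) (at t)"
    by (rule DERIV_add[OF DERIV_const DERIV_integral_mult_P[OF density_Ctest Ctest_integrable[OF v] t]])
  then have "((\<lambda>t. \<integral>x. (q + P t f x) * v x \<partial>\<mu>) has_real_derivative 0 + (\<integral>x. v x * P t (L f) x \<partial>\<mu>)) (at t)"
    by (rule has_field_derivative_transform_within_open[of _ _ _ "{0<..}"]) (use t eq in auto)
  moreover have "(\<integral>x. v x * P t (L f) x \<partial>\<mu>) = - (\<integral>x. \<Gamma> v (P t f) x \<partial>\<mu>)"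
    using integration_by_parts(2)[OF v P_smooth[OF density_Ctest t0]] L_P[OF density_Ctest t0] by simp
  ultimately show ?thesis by simp
qed

text \<open>Young's inequality under the integral: \<Gamma>(v, P t f) is at most
  \<open>k / 2 * \<Gamma>(P t f) / U + U / (2 k)\<close> when \<Gamma>(v) \<le> 1. The free
  parameter \<open>k\<close> will be chosen as a function of time.\<close>

lemma transport_le:
  assumes t: "t > 0" and v: "v \<in> T" and \<Gamma>v: "\<And>x. \<Gamma> v v x \<le> 1" and k: "k > 0"
  shows "(\<integral>x. \<Gamma> v (P t f) x \<partial>\<mu>) \<le> (k * fisher q f t + mass / k) / 2"
proof -
  have t0: "t \<ge> 0" using t by simp
  have CP: "P t f \<in> C" by (rule P_smooth[OF density_Ctest t0])
  have vC: "v \<in> C" by (rule Ctest_Csmooth[OF v])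
  obtain B4 where B4: "B4 \<ge> 0" "\<And>s x. s \<in> {0..t} \<Longrightarrow> \<Gamma> (P s f) (P s f) x \<le> B4"
    using gradient_bounded[OF density_Ctest t0] by blast
  have iF: "integrable \<mu> (\<lambda>x. \<Gamma> (P t f) (P t f) x / (q + P t f x))"
  proof (rule integrable_const_bound)
    show "(\<lambda>x. \<Gamma> (P t f) (P t f) x / (q + P t f x)) \<in> borel_measurable \<mu>"
      by (intro borel_measurable_divide Csmooth_measurable Csmooth_cdc CP U_smooth t0)
    show "AE x in \<mu>. norm (\<Gamma> (P t f) (P t f) x / (q + P t f x)) \<le> B4 / \<epsilon>"
    proof (rule AE_I2)
      fix x
      have "0 \<le> \<Gamma> (P t f) (P t f) x" by (rule form_nonneg[OF cdc_form CP])
      then have "\<Gamma> (P t f) (P t f) x / (q + P t f x) \<le> B4 / \<epsilon>" "0 \<le> \<Gamma> (P t f) (P t f) x / (q + P t f x)"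
        using B4(2)[of t x] U_ge[OF t0, of x] U_pos[OF t0, of x] density_pos t0 by (auto intro!: frac_le)
      then show "norm (\<Gamma> (P t f) (P t f) x / (q + P t f x)) \<le> B4 / \<epsilon>" by (simp only: real_norm_def abs_of_nonneg)
    qed
  qed
  have "(\<integral>x. \<Gamma> v (P t f) x \<partial>\<mu>)
      \<le> (\<integral>x. k / 2 * (\<Gamma> (P t f) (P t f) x / (q + P t f x)) + 1 / (2 * k) * (q + P t f x) \<partial>\<mu>)"
  proof (rule integral_mono[OF integration_by_parts(1)[OF v CP]])
    show "integrable \<mu> (\<lambda>x. k / 2 * (\<Gamma> (P t f) (P t f) x / (q + P t f x)) + 1 / (2 * k) * (q + P t f x))"
      by (intro Bochner_Integration.integrable_add integrable_mult_right iF integral_U(1) t0)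
    fix x
    let ?u = "q + P t f x"
    have u: "?u > 0" by (rule U_pos[OF t0])
    have "0 \<le> (- (?u / k))\<^sup>2 * \<Gamma> v v x + 2 * (- (?u / k)) * 1 * \<Gamma> v (P t f) x + 1\<^sup>2 * \<Gamma> (P t f) (P t f) x"
      by (rule form_quadratic[OF cdc_form vC CP])
    moreover have "(- (?u / k))\<^sup>2 * \<Gamma> v v x \<le> (- (?u / k))\<^sup>2 * 1" using \<Gamma>v by (intro mult_left_mono) auto
    ultimately have "2 * (?u / k) * \<Gamma> v (P t f) x \<le> (?u / k)\<^sup>2 + \<Gamma> (P t f) (P t f) x" by simp
    then have "(k / (2 * ?u)) * (2 * (?u / k) * \<Gamma> v (P t f) x) \<le> (k / (2 * ?u)) * ((?u / k)\<^sup>2 + \<Gamma> (P t f) (P t f) x)"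
      using u k by (intro mult_left_mono) auto
    moreover have "(k / (2 * ?u)) * (2 * (?u / k) * \<Gamma> v (P t f) x) = \<Gamma> v (P t f) x" using u k by simp
    moreover have "(k / (2 * ?u)) * ((?u / k)\<^sup>2 + \<Gamma> (P t f) (P t f) x)
        = k / 2 * (\<Gamma> (P t f) (P t f) x / ?u) + 1 / (2 * k) * ?u"
    proof -
      have "(k / (2 * y)) * ((y / k)\<^sup>2 + z) = k / 2 * (z / y) + 1 / (2 * k) * y" if "y > 0" for y z
        using that k by (simp add: field_simps power2_eq_square)
      from this[OF u] show ?thesis .
    qed
    ultimately show "\<Gamma> v (P t f) x \<le> k / 2 * (\<Gamma> (P t f) (P t f) x / ?u) + 1 / (2 * k) * ?u" by simp
  qed
  also have "\<dots> = k / 2 * fisher q f t + 1 / (2 * k) * mass"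
    using Bochner_Integration.integral_add[OF integrable_mult_right[OF iF] integrable_mult_right[OF integral_U(1)[OF t0]], of "k / 2" "1 / (2 * k)"]
    unfolding integral_mult_right_zero fisher_def integral_U(2)[OF t0] .
  also have "\<dots> = (k * fisher q f t + mass / k) / 2" using k by (simp add: field_simps)
  finally show ?thesis .
qed

text \<open>The weight \<open>w0\<close> equalizes the two error terms, both of which become multiples of the
  derivative of \<open>arctan (w0 t)\<close>.\<close>
lemma functional_mono:
  assumes v: "v \<in> T" and \<Gamma>v: "\<And>x. \<Gamma> v v x \<le> 1" and s: "0 < s" "s \<le> t"
  defines "Q \<equiv> \<lambda>t. (\<integral>x. (q + P t f x) * v x \<partial>\<mu>) + w0 t / (2 * S0) * (mass * lnK t - entropy q f t)
      + 2 * S0 / \<alpha> * mass * arctan (w0 t)"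
  shows "Q s \<le> Q t"
proof (rule DERIV_nonneg_imp_nondecreasing[OF s(2)])
  fix r assume r: "s \<le> r" "r \<le> t"
  then have r0: "r > 0" using s by simp
  let ?w = "w0 r" and ?X = "exp (\<alpha> * r)" and ?I = "fisher q f r"
  let ?w' = "\<alpha> * ?X / (2 * ?w)"
  have w: "?w > 0" by (rule w0_pos[OF r0])
  have ww: "?w * ?w = ?X - 1" by (rule w0_sq[OF r0])
  have w': "?w' \<ge> 0" using \<alpha>_pos w by simp
  have dQ: "(Q has_real_derivative (- (\<integral>x. \<Gamma> v (P r f) x \<partial>\<mu>)
       + (?w' / (2 * S0) * (mass * lnK r - entropy q f r)
          + (mass * (- (\<alpha> * D / 2 / (?X - 1))) - - ?I) * (?w / (2 * S0)))
       + 2 * S0 / \<alpha> * mass * (inverse (1 + ?w\<^sup>2) * ?w'))) (at r)"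
    unfolding Q_def
    by (intro DERIV_add DERIV_mult DERIV_diff DERIV_cdivide DERIV_cmult transport_DERIV[OF r0 v] w0_DERIV[OF r0]
        lnK_DERIV[OF r0] entropy_DERIV[OF r0] DERIV_chain2[OF DERIV_arctan])
  \<comment> \<open>With \<open>k = w0 / S0\<close> the Fisher information enters with the same
    factor \<open>w0 / (2 S0)\<close> with which the weighted entropy releases it.\<close>
  have le: "(\<integral>x. \<Gamma> v (P r f) x \<partial>\<mu>) \<le> (?w / S0 * ?I + mass / (?w / S0)) / 2"
    by (rule transport_le[OF r0 v \<Gamma>v]) (use w S0_pos in simp)
  \<comment> \<open>This term comes from the derivative of the weight. Its sign is the reason for
    weighting the gap between the bound \<open>mass * lnK\<close> and the entropy instead of the
    entropy alone.\<close>
  have 1: "0 \<le> ?w' / (2 * S0) * (mass * lnK r - entropy q f r)"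
    using entropy_le[OF r0] by (intro mult_nonneg_nonneg divide_nonneg_nonneg w') (use S0_pos in auto)
  have 2: "(mass * (- (\<alpha> * D / 2 / (?X - 1))) - - ?I) * (?w / (2 * S0)) = ?w / S0 * ?I / 2 - mass * S0 / (2 * ?w)"
  proof -
    have "(mass * (- (\<alpha> * D / 2 / (?X - 1))) - - ?I) * (?w / (2 * S0))
      = ?w / S0 * ?I / 2 - mass * ((S0 * S0) / (?w * ?w)) * (?w / (2 * S0))"
      unfolding ww S0_sq by (simp add: algebra_simps)
    also have "mass * ((S0 * S0) / (?w * ?w)) * (?w / (2 * S0)) = mass * S0 / (2 * ?w)"
      using w S0_pos by simp
    finally show ?thesis .
  qed
  \<comment> \<open>Since \<open>1 + w0^2 = exp (\<alpha> r)\<close>, the derivative of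
    \<open>arctan (w0 r)\<close> is \<open>\<alpha> / (2 w0)\<close>. The factor in front turns it
    into the sum of the two errors: the one from Young's inequality and the one from the derivative
    of \<open>lnK\<close>.\<close>
  have 3: "2 * S0 / \<alpha> * mass * (inverse (1 + ?w\<^sup>2) * ?w') = mass * S0 / ?w"
  proof -
    have "1 + ?w\<^sup>2 = ?X" using ww by (simp add: power2_eq_square)
    then show ?thesis using w \<alpha>_pos by (simp add: field_simps)
  qed
  have 4: "mass / (?w / S0) / 2 = mass * S0 / (2 * ?w)" by simp
  have "(?w / S0 * ?I + mass / (?w / S0)) / 2 = ?w / S0 * ?I / 2 + mass * S0 / (2 * ?w)"
    unfolding add_divide_distrib 4 ..
  moreover have "mass * S0 / ?w = mass * S0 / (2 * ?w) + mass * S0 / (2 * ?w)" using w by simp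
  ultimately have "0 \<le> - (\<integral>x. \<Gamma> v (P r f) x \<partial>\<mu>)
       + (?w' / (2 * S0) * (mass * lnK r - entropy q f r)
          + (mass * (- (\<alpha> * D / 2 / (?X - 1))) - - ?I) * (?w / (2 * S0)))
       + 2 * S0 / \<alpha> * mass * (inverse (1 + ?w\<^sup>2) * ?w')"
    using le 1 unfolding 2 3 by linarith
  then show "\<exists>y. (Q has_real_derivative y) (at r) \<and> 0 \<le> y" using dQ by blast
qed

text \<open>The functional of \<open>functional_mono\<close> is compared at times \<open>s\<close>
  and \<open>t\<close>. Its correction terms at \<open>s\<close> are nonnegative and are dropped, at
  \<open>t\<close> the entropy is bounded below by 0, and then \<open>s\<close> tends to 0.\<close>

lemma transport_initial:
  assumes v: "v \<in> T" and \<Gamma>v: "\<And>x. \<Gamma> v v x \<le> 1" and t: "t > 0"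
  shows "(\<integral>x. (q + f x) * v x \<partial>\<mu>) \<le> (\<integral>x. (q + P t f x) * v x \<partial>\<mu>)
     + mass * (w0 t / (2 * S0) * lnK t + 2 * S0 / \<alpha> * arctan (w0 t))"
proof -
  let ?E = "mass * (w0 t / (2 * S0) * lnK t + 2 * S0 / \<alpha> * arctan (w0 t))"
  have J: "(\<integral>x. (q + P s f x) * v x \<partial>\<mu>) \<le> (\<integral>x. (q + P t f x) * v x \<partial>\<mu>) + ?E" if s: "0 < s" "s \<le> t" for s
  proof -
    have "0 \<le> w0 s / (2 * S0) * (mass * lnK s - entropy q f s)"
      using w0_pos[OF s(1)] S0_pos entropy_le[OF s(1)] by (intro mult_nonneg_nonneg) auto
    moreover have "0 \<le> 2 * S0 / \<alpha> * mass * arctan (w0 s)"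
      using w0_pos[OF s(1)] S0_pos \<alpha>_pos mass_pos by (intro mult_nonneg_nonneg) (auto simp: zero_le_arctan_iff)
    moreover have "w0 t / (2 * S0) * (mass * lnK t - entropy q f t) \<le> w0 t / (2 * S0) * (mass * lnK t)"
      using w0_pos[OF t] S0_pos entropy_nonneg[of t] t by (intro mult_left_mono) auto
    moreover have "?E = w0 t / (2 * S0) * (mass * lnK t) + 2 * S0 / \<alpha> * mass * arctan (w0 t)"
      by (simp add: algebra_simps)
    ultimately show ?thesis using functional_mono[OF v \<Gamma>v s] by linarith
  qed
  obtain B where B: "\<And>x. \<bar>L f x\<bar> \<le> B" using Ctest_bounded[OF Ctest_L[OF density_Ctest]] by blast
  define s where "s n = t / real (Suc n)" for n
  have s: "0 < s n" "s n \<le> t" for n using t by (auto simp: s_def divide_simps)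
  have s0: "s \<longlonglongrightarrow> 0"
    unfolding s_def using tendsto_mult_left[OF LIMSEQ_inverse_real_of_nat, of t]
    by (simp add: divide_inverse)
  have lim: "(\<lambda>n. \<integral>x. (q + P (s n) f x) * v x \<partial>\<mu>) \<longlonglongrightarrow> (\<integral>x. (q + f x) * v x \<partial>\<mu>)"
  proof -
    obtain M where M: "M > 0" "\<And>t x. t \<ge> 0 \<Longrightarrow> \<bar>q + P t f x\<bar> \<le> M" using U_bounded by auto
    have s00: "s n \<ge> 0" for n using s(1)[of n] by simp
    show ?thesis
    proof (rule integral_dominated_convergence[where w="\<lambda>x. M * \<bar>v x\<bar>"])
      show "(\<lambda>x. (q + f x) * v x) \<in> borel_measurable \<mu>"
        using Ctest_measurable[OF density_Ctest] Ctest_measurable[OF v] by measurable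
      show "(\<lambda>x. (q + P (s n) f x) * v x) \<in> borel_measurable \<mu>" for n
        by (intro borel_measurable_times Csmooth_measurable U_smooth s00 Ctest_Csmooth v)
      show "integrable \<mu> (\<lambda>x. M * \<bar>v x\<bar>)" using Ctest_integrable[OF v] by simp
      show "AE x in \<mu>. (\<lambda>n. (q + P (s n) f x) * v x) \<longlonglongrightarrow> (q + f x) * v x"
      proof (rule AE_I2)
        fix x
        have "(\<lambda>n. P (s n) f x) \<longlonglongrightarrow> f x"
          by (rule filterlim_compose[OF P_tendsto_initial[OF density_Ctest]])
             (use s s0 in \<open>auto simp: filterlim_at less_imp_neq[THEN not_sym] intro!: always_eventually\<close>)
        then show "(\<lambda>n. (q + P (s n) f x) * v x) \<longlonglongrightarrow> (q + f x) * v x" by (intro tendsto_intros)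
      qed
      show "AE x in \<mu>. norm ((q + P (s n) f x) * v x) \<le> M * \<bar>v x\<bar>" for n
      proof (rule AE_I2)
        fix x show "norm ((q + P (s n) f x) * v x) \<le> M * \<bar>v x\<bar>"
          using abs_mult_le[OF M(2)[OF s00] order_refl] by simp
      qed
    qed
  qed
  then show ?thesis by (rule LIMSEQ_le_const2) (use J s in auto)
qed

text \<open>In \<open>transport_initial\<close> let \<open>t\<close> tend to infinity: the entropy
  correction is at most a multiple of \<open>1 / w0\<close> and disappears, while the arctangent
  tends to pi / 2.\<close>

lemma transport_mean:
  assumes v: "v \<in> T" and \<Gamma>v: "\<And>x. \<Gamma> v v x \<le> 1"
  shows "(\<integral>x. (q + f x) * v x \<partial>\<mu>) \<le> mass * (mean v + S0 / \<alpha> * pi)"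
proof -
  obtain M where M: "M > 0" "\<And>t x. t \<ge> 0 \<Longrightarrow> \<bar>q + P t f x\<bar> \<le> M" using U_bounded by auto
  have lim: "(\<lambda>n. \<integral>x. (q + P (real n) f x) * v x \<partial>\<mu>) \<longlonglongrightarrow> (\<integral>x. 1 * v x \<partial>\<mu>)"
  proof (rule integral_dominated_convergence[where w="\<lambda>x. M * \<bar>v x\<bar>"])
    show "(\<lambda>x. 1 * v x) \<in> borel_measurable \<mu>" using Ctest_measurable[OF v] by simp
    show "(\<lambda>x. (q + P (real n) f x) * v x) \<in> borel_measurable \<mu>" for n
      by (intro borel_measurable_times Csmooth_measurable U_smooth Ctest_Csmooth v) simp
    show "integrable \<mu> (\<lambda>x. M * \<bar>v x\<bar>)" using Ctest_integrable[OF v] by simp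
    show "AE x in \<mu>. (\<lambda>n. (q + P (real n) f x) * v x) \<longlonglongrightarrow> 1 * v x"
    proof (rule AE_I2)
      fix x
      have "(\<lambda>n. (q + P (real n) f x) * v x) \<longlonglongrightarrow> (q + mean f) * v x"
        by (intro tendsto_intros P_tendsto_mean density_Ctest)
      then show "(\<lambda>n. (q + P (real n) f x) * v x) \<longlonglongrightarrow> 1 * v x" using density_mean by simp
    qed
    show "AE x in \<mu>. norm ((q + P (real n) f x) * v x) \<le> M * \<bar>v x\<bar>" for n
    proof (rule AE_I2)
      fix x show "norm ((q + P (real n) f x) * v x) \<le> M * \<bar>v x\<bar>"
        using abs_mult_le[OF M(2) order_refl, of "real n" x] by simp
    qed
  qed
  have w_lim: "(\<lambda>n. 1 / w0 (real n)) \<longlonglongrightarrow> 0"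
  proof -
    have "filterlim (\<lambda>n. \<alpha> * real n) at_top sequentially"
      using \<alpha>_pos by (intro filterlim_tendsto_pos_mult_at_top[OF tendsto_const] filterlim_real_sequentially)
    then have "filterlim (\<lambda>n. exp (\<alpha> * real n)) at_top sequentially"
      by (rule filterlim_compose[OF exp_at_top])
    then have "filterlim (\<lambda>n. -1 + exp (\<alpha> * real n)) at_top sequentially"
      by (rule filterlim_tendsto_add_at_top[OF tendsto_const])
    then have "filterlim (\<lambda>n. w0 (real n)) at_top sequentially"
      unfolding w0_def by (intro filterlim_compose[OF sqrt_at_top]) (simp add: add.commute)
    then show ?thesis
      by (intro tendsto_divide_0[OF tendsto_const] filterlim_at_top_imp_at_infinity)
  qed
  have le: "(\<integral>x. (q + f x) * v x \<partial>\<mu>) \<le> (\<integral>x. (q + P (real n) f x) * v x \<partial>\<mu>)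
      + mass * (D / (4 * S0) * (1 / w0 (real n)) + S0 / \<alpha> * pi)" if n: "n \<ge> 1" for n
  proof -
    let ?t = "real n"
    have t: "?t > 0" using n by simp
    let ?w = "w0 ?t"
    have w: "?w > 0" by (rule w0_pos[OF t])
    have "lnK ?t \<le> D / 2 * (1 / (?w * ?w))"
      unfolding lnK_eq[OF t] using D_pos w by (intro mult_left_mono ln_add_one_self_le_self) auto
    then have "?w / (2 * S0) * lnK ?t \<le> ?w / (2 * S0) * (D / 2 * (1 / (?w * ?w)))"
      using w S0_pos by (intro mult_left_mono) auto
    also have "\<dots> = D / (4 * S0) * (1 / ?w)" using w S0_pos by simp
    finally have 1: "?w / (2 * S0) * lnK ?t \<le> D / (4 * S0) * (1 / ?w)" .
    have "2 * S0 / \<alpha> * arctan ?w \<le> 2 * S0 / \<alpha> * (pi / 2)"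
      using S0_pos \<alpha>_pos arctan_bounded[of ?w] by (intro mult_left_mono) auto
    then have "mass * (?w / (2 * S0) * lnK ?t + 2 * S0 / \<alpha> * arctan ?w) \<le> mass * (D / (4 * S0) * (1 / ?w) + S0 / \<alpha> * pi)"
      using 1 mass_pos by (intro mult_left_mono) auto
    then show ?thesis using transport_initial[OF v \<Gamma>v t] by linarith
  qed
  have "(\<lambda>n. (\<integral>x. (q + P (real n) f x) * v x \<partial>\<mu>) + mass * (D / (4 * S0) * (1 / w0 (real n)) + S0 / \<alpha> * pi))
     \<longlonglongrightarrow> (\<integral>x. 1 * v x \<partial>\<mu>) + mass * (D / (4 * S0) * 0 + S0 / \<alpha> * pi)"
    by (intro tendsto_intros lim w_lim)
  then have "(\<integral>x. (q + f x) * v x \<partial>\<mu>) \<le> (\<integral>x. 1 * v x \<partial>\<mu>) + mass * (D / (4 * S0) * 0 + S0 / \<alpha> * pi)"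
    by (rule LIMSEQ_le_const) (use le in auto)
  then show ?thesis using mean_eq[OF v] by (simp add: distrib_left)
qed

end

section \<open>Oscillation of functions with gradient at most one\<close>

lemma mean_cmult: assumes f: "f \<in> T" shows "mean (\<lambda>x. c * f x) = c * mean f"
proof -
  have "mass * mean (\<lambda>x. c * f x) = mass * (c * mean f)"
    unfolding mean_eq[OF Ctest_cmult[OF f], symmetric] mult.left_commute[of mass c] mean_eq[OF f, symmetric]
    by (rule integral_mult_right_zero)
  then show ?thesis using mass_pos by (simp only: mult_left_cancel[OF less_imp_neq[THEN not_sym]])
qed

text \<open>If \<open>F\<close> were positive somewhere, a density concentrated on the set
  \<open>F > 0\<close> would give a positive integral. Such a density is \<open>h k\<close> squared
  times \<open>bump (F x)\<close>, which vanishes where \<open>F \<le> 0\<close>.\<close>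

lemma positivity_test:
  assumes F: "F \<in> C" "integrable \<mu> F"
    and test: "\<And>\<epsilon> q f. density \<epsilon> q f \<Longrightarrow> (\<integral>x. (q + f x) * F x \<partial>\<mu>) \<le> 0"
  shows "F x \<le> 0"
proof -
  have "(h k x)\<^sup>2 * bump (F x) * F x = 0" for k
  proof -
    define \<theta> where "\<theta> = (\<lambda>x. h k x * (h k x * bump (F x)))"
    have \<theta>: "\<theta> \<in> T" unfolding \<theta>_def by (intro Ctest_mult[OF h_test] Csmooth_mult h_Csmooth Csmooth_bump F)
    have \<theta>0: "0 \<le> \<theta> x" for x
      using mult_nonneg_nonneg[OF zero_le_square[of "h k x"] bump_nonneg(1)[of "F x"]] by (simp add: \<theta>_def mult.assoc)
    have m0: "0 \<le> mean \<theta>"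
      using mean_eq[OF \<theta>] Bochner_Integration.integral_nonneg[of \<mu> \<theta>] \<theta>0 mass_pos by (simp add: zero_le_mult_iff)
    have i\<theta>: "integrable \<mu> (\<lambda>x. \<theta> x * F x)" by (rule Ctest_integrable_mult[OF \<theta> F(1)])
    have le: "(\<integral>x. \<theta> x * F x \<partial>\<mu>) \<le> - \<eta> * (\<integral>x. F x \<partial>\<mu>)" if \<eta>: "\<eta> > 0" for \<eta>
    proof -
      \<comment> \<open>Adding \<eta> makes the density strictly positive and dividing by
        \<open>m\<close> gives it mean 1; \<eta> then tends to 0.\<close>
      define m where "m = \<eta> + mean \<theta>"
      have m: "m > 0" using \<eta> m0 by (simp add: m_def)
      have T\<theta>: "(\<lambda>x. inverse m * \<theta> x) \<in> T" by (rule Ctest_cmult[OF \<theta>])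
      have "density (inverse m * \<eta>) (inverse m * \<eta>) (\<lambda>x. inverse m * \<theta> x)"
        unfolding density_def mean_cmult[OF \<theta>] using T\<theta> \<theta>0 \<eta> m by (auto simp: m_def distrib_left[symmetric])
      from test[OF this] have "0 \<ge> (\<integral>x. inverse m * (\<eta> * F x + \<theta> x * F x) \<partial>\<mu>)" by (simp add: algebra_simps)
      also have "(\<integral>x. inverse m * (\<eta> * F x + \<theta> x * F x) \<partial>\<mu>) = inverse m * (\<eta> * (\<integral>x. F x \<partial>\<mu>) + (\<integral>x. \<theta> x * F x \<partial>\<mu>))"
        using F(2) i\<theta> by simp
      finally show ?thesis using m by (simp add: mult_le_0_iff)
    qed
    have "((\<lambda>\<eta>. - \<eta> * (\<integral>x. F x \<partial>\<mu>)) \<longlongrightarrow> - 0 * (\<integral>x. F x \<partial>\<mu>)) (at_right 0)"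
      by (intro tendsto_intros)
    then have "(\<integral>x. \<theta> x * F x \<partial>\<mu>) \<le> - 0 * (\<integral>x. F x \<partial>\<mu>)"
      by (rule tendsto_lowerbound) (use le in \<open>auto simp: eventually_at_filter\<close>)
    moreover have "0 \<le> \<theta> x * F x" for x
      using \<theta>0[of x] bump_le_0(1)[of "F x"] by (cases "F x \<le> 0") (auto simp: \<theta>_def)
    ultimately have "\<theta> x * F x = 0"
      by (intro Ctest_nonneg_integral_zero[OF Ctest_mult[OF \<theta> F(1)]]) auto
    then show ?thesis by (simp add: \<theta>_def power2_eq_square mult.assoc)
  qed
  moreover have "(\<lambda>k. (h k x)\<^sup>2 * bump (F x) * F x) \<longlonglongrightarrow> 1\<^sup>2 * bump (F x) * F x"
    by (intro tendsto_intros h_lim)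
  ultimately have "(\<lambda>k::nat. 0) \<longlonglongrightarrow> 1\<^sup>2 * bump (F x) * F x" by (simp only:)
  then have "bump (F x) * F x = 0" by (simp add: LIMSEQ_const_iff)
  then show ?thesis using bump_pos[of "F x"] by (cases "F x > 0") auto
qed

lemma density_integral:
  assumes "density \<epsilon> q f" shows "integrable \<mu> (\<lambda>x. q + f x)" "(\<integral>x. q + f x \<partial>\<mu>) = mass"
  using integral_U[OF assms, of 0] by (auto simp: P_0)

text \<open>A bound for oscillations, hence for the diameter: \<open>v\<close> and \<open>-v\<close>
  each exceed their mean by at most half of it. It equals
  \<open>2 pi sqrt (D / (2 \<alpha>))\<close>.\<close>

definition radius :: real where "radius = 2 * (S0 / \<alpha> * pi)"

definition defect :: "real \<Rightarrow> real" where
  "defect t = w0 t / (2 * S0) * lnK t + 2 * S0 / \<alpha> * arctan (w0 t)"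

lemma Ctest_le_mean:
  assumes v: "v \<in> T" and \<Gamma>v: "\<And>x. \<Gamma> v v x \<le> 1"
  shows "v x \<le> mean v + S0 / \<alpha> * pi"
proof -
  define c where "c = mean v + S0 / \<alpha> * pi"
  have "v x - c \<le> 0"
  proof (rule positivity_test[where F="\<lambda>x. v x - c"])
    show "(\<lambda>x. v x - c) \<in> C" by (intro Csmooth_diff Csmooth_const Ctest_Csmooth v)
    show "integrable \<mu> (\<lambda>x. v x - c)" using Ctest_integrable[OF v] by simp
    fix \<epsilon> q f assume d: "density \<epsilon> q f"
    then have f: "f \<in> T" by (simp add: density_def)
    have "integrable \<mu> (\<lambda>x. v x * (q + f x))"
      by (rule Ctest_integrable_mult[OF v Csmooth_add[OF Csmooth_const Ctest_Csmooth[OF f]]])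
    then have "(\<integral>x. (q + f x) * v x - (q + f x) * c \<partial>\<mu>) = (\<integral>x. (q + f x) * v x \<partial>\<mu>) - mass * c"
      using density_integral[OF d] by (simp add: mult.commute)
    also have "\<dots> \<le> 0" using transport_mean[OF d v \<Gamma>v] by (simp add: c_def)
    finally show "(\<integral>x. (q + f x) * (v x - c) \<partial>\<mu>) \<le> 0" by (simp add: right_diff_distrib)
  qed
  then show ?thesis by (simp add: c_def)
qed

lemma Ctest_oscillation:
  assumes v: "v \<in> T" and \<Gamma>v: "\<And>x. \<Gamma> v v x \<le> 1"
  shows "v x - v y \<le> radius"
proof -
  have vC: "v \<in> C" by (rule Ctest_Csmooth[OF v])
  have v': "(\<lambda>x. (-1) * v x) \<in> T" by (rule Ctest_cmult[OF v])
  have \<Gamma>v': "\<Gamma> (\<lambda>x. (-1) * v x) (\<lambda>x. (-1) * v x) x \<le> 1" for x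
    unfolding form_cmult[OF cdc_form vC Ctest_Csmooth[OF v']] form_cmult_right[OF cdc_form vC vC] using \<Gamma>v[of x] by simp
  have "a - b \<le> c + c" if "a \<le> m + c" "(-1) * b \<le> (-1) * m + c" for a b c m :: real using that by simp
  from this[OF Ctest_le_mean[OF v \<Gamma>v] Ctest_le_mean[OF v' \<Gamma>v', unfolded mean_cmult[OF v]]]
  show ?thesis unfolding radius_def mult_2 .
qed

text \<open>Symmetry of \<open>P t\<close> moves the flow from the density to \<open>v\<close>, so
  that \<open>transport_initial\<close> becomes an inequality between \<open>v\<close> and
  \<open>P t v\<close> tested against every density.\<close>

lemma Ctest_defect_upper:
  assumes v: "v \<in> T" and \<Gamma>v: "\<And>x. \<Gamma> v v x \<le> 1" and t: "t > 0"
  shows "v x \<le> P t v x + defect t"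
proof -
  have t0: "t \<ge> 0" using t by simp
  obtain B where B: "B \<ge> 0" "\<And>t x. t \<ge> 0 \<Longrightarrow> \<bar>P t v x\<bar> \<le> B" using P_bounded[OF v] by auto
  have iP: "integrable \<mu> (P t v)" by (rule integrable_bounded_Csmooth[OF P_smooth[OF v t0] B(2)[OF t0]])
  have "v x - P t v x - defect t \<le> 0"
  proof (rule positivity_test[where F="\<lambda>x. v x - P t v x - defect t"])
    show "(\<lambda>x. v x - P t v x - defect t) \<in> C" by (intro Csmooth_diff Csmooth_const Ctest_Csmooth v P_smooth t0)
    show "integrable \<mu> (\<lambda>x. v x - P t v x - defect t)" using Ctest_integrable[OF v] iP by simp
    fix \<epsilon> q f assume d: "density \<epsilon> q f"
    then have f: "f \<in> T" by (simp add: density_def)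
    have fC: "(\<lambda>x. q + f x) \<in> C" by (intro Csmooth_add Csmooth_const Ctest_Csmooth f)
    have 1: "integrable \<mu> (\<lambda>x. (q + f x) * v x)"
      using Ctest_integrable_mult[OF v fC] by (simp add: mult.commute)
    have 2: "integrable \<mu> (\<lambda>x. f x * P t v x)" "integrable \<mu> (\<lambda>x. v x * P t f x)"
      by (rule Ctest_integrable_mult[OF f P_smooth[OF v t0]] Ctest_integrable_mult[OF v P_smooth[OF f t0]])+
    obtain Bv where Bv: "\<And>x. \<bar>v x\<bar> \<le> Bv" using Ctest_bounded[OF v] by blast
    have "(\<integral>x. (q + f x) * P t v x \<partial>\<mu>) = q * (\<integral>x. P t v x \<partial>\<mu>) + (\<integral>x. f x * P t v x \<partial>\<mu>)"
      using iP 2 by (simp add: distrib_right)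
    also have "\<dots> = q * (\<integral>x. v x \<partial>\<mu>) + (\<integral>x. v x * P t f x \<partial>\<mu>)"
      using P_symmetric[OF t0 Ctest_integrable[OF f] Ctest_measurable[OF v] Bv] integral_P[OF v t0] by simp
    also have "\<dots> = (\<integral>x. (q + P t f x) * v x \<partial>\<mu>)"
      using Ctest_integrable[OF v] 2 by (simp add: distrib_right mult.commute[of "v _"])
    finally have eq: "(\<integral>x. (q + f x) * P t v x \<partial>\<mu>) = (\<integral>x. (q + P t f x) * v x \<partial>\<mu>)" .
    have 3: "integrable \<mu> (\<lambda>x. (q + f x) * P t v x)" using iP 2 by (simp add: distrib_right)
    have "(\<integral>x. (q + f x) * v x - (q + f x) * P t v x - (q + f x) * defect t \<partial>\<mu>)
        = (\<integral>x. (q + f x) * v x \<partial>\<mu>) - (\<integral>x. (q + f x) * P t v x \<partial>\<mu>) - mass * defect t"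
      using 1 3 density_integral[OF d] by simp
    also have "\<dots> \<le> 0"
      using transport_initial[OF d v \<Gamma>v t] unfolding eq defect_def by simp
    finally show "(\<integral>x. (q + f x) * (v x - P t v x - defect t) \<partial>\<mu>) \<le> 0" by (simp add: right_diff_distrib)
  qed
  then show ?thesis by simp
qed

lemma Ctest_defect:
  assumes v: "v \<in> T" and \<Gamma>v: "\<And>x. \<Gamma> v v x \<le> 1" and t: "t > 0"
  shows "\<bar>v x - P t v x\<bar> \<le> defect t"
proof -
  have vC: "v \<in> C" by (rule Ctest_Csmooth[OF v])
  have v': "(\<lambda>x. (-1) * v x) \<in> T" by (rule Ctest_cmult[OF v])
  have \<Gamma>v': "\<Gamma> (\<lambda>x. (-1) * v x) (\<lambda>x. (-1) * v x) x \<le> 1" for x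
    unfolding form_cmult[OF cdc_form vC Ctest_Csmooth[OF v']] form_cmult_right[OF cdc_form vC vC] using \<Gamma>v[of x] by simp
  have "P t (\<lambda>x. (-1) * v x) x = - P t v x" using t by (simp add: P_pos)
  then show ?thesis using Ctest_defect_upper[OF v \<Gamma>v t, of x] Ctest_defect_upper[OF v' \<Gamma>v' t, of x] by linarith
qed

text \<open>\<open>lnK\<close> grows only logarithmically in \<open>1 / w0\<close>, so the factor
  \<open>w0\<close> prevails; the arctangent vanishes with \<open>w0\<close>.\<close>

lemma defect_tendsto_0: "(defect \<longlongrightarrow> 0) (at_right 0)"
proof -
  have w: "(w0 \<longlongrightarrow> 0) (at_right 0)"
    unfolding w0_def by (rule tendsto_eq_intros refl | simp)+
  moreover have "w0 t \<noteq> 0" if "t > 0" for t using w0_pos[OF that] by simp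
  ultimately have w: "filterlim w0 (at_right 0) (at_right 0)"
    using w0_pos by (auto simp: filterlim_at eventually_at_filter intro!: always_eventually)
  have "((\<lambda>w. w * ln (1 + 1 / (w * w))) \<longlongrightarrow> 0) (at_right (0::real))" by real_asymp
  from filterlim_compose[OF this w]
  have l: "((\<lambda>t. D / (4 * S0) * (w0 t * ln (1 + 1 / (w0 t * w0 t))) + 2 * S0 / \<alpha> * arctan (w0 t))
      \<longlongrightarrow> D / (4 * S0) * 0 + 2 * S0 / \<alpha> * arctan 0) (at_right 0)"
    using w by (intro tendsto_intros) (auto simp: filterlim_at)
  have "((\<lambda>t. D / (4 * S0) * (w0 t * ln (1 + 1 / (w0 t * w0 t))) + 2 * S0 / \<alpha> * arctan (w0 t)) \<longlongrightarrow> 0) (at_right 0)"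
    using l by simp
  then show ?thesis
    by (rule Lim_transform_eventually) (auto simp: eventually_at_filter defect_def lnK_eq)
qed

text \<open>The cutoffs \<open>h k\<close> may drop below -1, and a factor larger than 1 in absolute
  value would spoil gradient bounds for products. The sine brings them into \<open>[-1, 1]\<close>,
  and pi / 2 makes the limit 1.\<close>

definition cutoff :: "nat \<Rightarrow> 'a \<Rightarrow> real" where "cutoff k = (\<lambda>x. sin (pi / 2 * h k x))"

lemma cutoff_test: "cutoff k \<in> T"
proof (rule Ctest_subset[OF h_test[of k]])
  show "cutoff k \<in> C" unfolding cutoff_def by (intro Csmooth_sin Csmooth_cmult h_Csmooth)
qed (simp add: cutoff_def)

lemma cutoff_le: "\<bar>cutoff k x\<bar> \<le> 1"
  by (simp add: cutoff_def)

lemma cutoff_lim: "(\<lambda>k. cutoff k x) \<longlonglongrightarrow> 1"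
proof -
  have "(\<lambda>k. cutoff k x) \<longlonglongrightarrow> sin (pi / 2 * 1)" unfolding cutoff_def by (intro tendsto_intros h_lim)
  then show ?thesis by simp
qed

lemma cutoff_grad:
  assumes "e > 0" shows "eventually (\<lambda>k. \<forall>x. \<Gamma> (cutoff k) (cutoff k) x \<le> e) sequentially"
proof -
  have "eventually (\<lambda>k. \<forall>x. \<Gamma> (h k) (h k) x \<le> e / 4) sequentially" using assms by (intro h_grad_le) simp
  then show ?thesis
  proof (rule eventually_mono)
    fix k assume k: "\<forall>x. \<Gamma> (h k) (h k) x \<le> e / 4"
    have cC: "cutoff k \<in> C" by (rule Ctest_Csmooth[OF cutoff_test])
    show "\<forall>x. \<Gamma> (cutoff k) (cutoff k) x \<le> e"
    proof
      fix x
      let ?d = "cos (pi / 2 * h k x) * (pi / 2)"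
      have dF: "((\<lambda>y. sin (pi / 2 * y)) has_real_derivative ?d) (at (h k x))"
        by (auto intro!: derivative_eq_intros)
      have 1: "\<Gamma> (cutoff k) g x = ?d * \<Gamma> (h k) g x" if "g \<in> C" for g
        unfolding cutoff_def by (rule form_chain[OF cdc_form h_Csmooth that cC[unfolded cutoff_def] dF])
      have "\<Gamma> (cutoff k) (cutoff k) x = ?d * \<Gamma> (cutoff k) (h k) x"
        using 1[OF cC] form_sym[OF cdc_form h_Csmooth cC] by simp
      also have "\<dots> = ?d\<^sup>2 * \<Gamma> (h k) (h k) x" unfolding 1[OF h_Csmooth] by (simp add: power2_eq_square)
      also have "\<dots> \<le> 2\<^sup>2 * (e / 4)"
      proof (rule mult_mono)
        have "\<bar>?d\<bar> \<le> 1 * 2" using pi_less_4 by (intro abs_mult_le) auto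
        then show "?d\<^sup>2 \<le> 2\<^sup>2" by (intro abs_le_square_iff[THEN iffD1]) simp
      qed (use k form_nonneg[OF cdc_form h_Csmooth] in auto)
      finally show "\<Gamma> (cutoff k) (cutoff k) x \<le> e" by simp
    qed
  qed
qed

lemma cutoff_mult_test: "v \<in> C \<Longrightarrow> (\<lambda>x. inverse (1 + e) * (cutoff k x * v x)) \<in> T"
  by (intro Ctest_cmult Ctest_mult[OF cutoff_test])

text \<open>In \<Gamma>(cutoff k * v) the terms with the gradient of the cutoff carry factors
  \<open>v\<close> and \<open>v^2\<close> and are small because \<open>v\<close> is bounded. The
  factor \<open>inverse (1 + e)\<close> compensates for what remains above 1.\<close>

lemma cutoff_mult_grad:
  assumes v: "v \<in> C" and \<Gamma>v: "\<And>x. \<Gamma> v v x \<le> 1" and R: "\<And>x. \<bar>v x\<bar> \<le> R" and e: "e > 0"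
  defines "u \<equiv> \<lambda>k x. inverse (1 + e) * (cutoff k x * v x)"
  shows "eventually (\<lambda>k. \<forall>x. \<Gamma> (u k) (u k) x \<le> 1) sequentially"
proof -
  have R0: "R \<ge> 0" using order_trans[OF abs_ge_zero R] .
  \<comment> \<open>If the gradient of the cutoff has length at most \<open>s\<close>, that of the
    product has length at most \<open>1 + R * s\<close>, and this \<open>s\<close> makes it at most
    \<open>1 + e\<close>.\<close>
  define s where "s = e / (1 + R)"
  have s: "s > 0" using e R0 by (simp add: s_def)
  have Rs: "R * s \<le> e" using e R0 by (simp add: s_def divide_simps algebra_simps)
  have "eventually (\<lambda>k. \<forall>x. \<Gamma> (cutoff k) (cutoff k) x \<le> s\<^sup>2) sequentially" using s by (intro cutoff_grad) simp
  then show ?thesis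
  proof (rule eventually_mono)
    fix k assume k: "\<forall>x. \<Gamma> (cutoff k) (cutoff k) x \<le> s\<^sup>2"
    have cC: "cutoff k \<in> C" by (rule Ctest_Csmooth[OF cutoff_test])
    define w where "w = (\<lambda>x. cutoff k x * v x)"
    have wC: "w \<in> C" unfolding w_def by (rule Csmooth_mult[OF cC v])
    show "\<forall>x. \<Gamma> (u k) (u k) x \<le> 1"
    proof
      fix x
      let ?g = "cutoff k x"
      have 1: "\<Gamma> w f x = ?g * \<Gamma> v f x + v x * \<Gamma> (cutoff k) f x" if "f \<in> C" for f
        unfolding w_def by (rule form_mult[OF cdc_form cC v that])
      have "\<Gamma> w w x = ?g\<^sup>2 * \<Gamma> v v x + 2 * (?g * v x * \<Gamma> v (cutoff k) x) + (v x)\<^sup>2 * \<Gamma> (cutoff k) (cutoff k) x"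
        unfolding 1[OF wC] form_sym[OF cdc_form v wC] form_sym[OF cdc_form cC wC] 1[OF v] 1[OF cC]
          form_sym[OF cdc_form cC v] by (simp add: algebra_simps power2_eq_square)
      moreover have "?g\<^sup>2 * \<Gamma> v v x \<le> 1 * 1"
        using cutoff_le[of k x] form_nonneg[OF cdc_form v] by (intro mult_mono \<Gamma>v) (auto simp: abs_square_le_1)
      moreover have "\<bar>?g * v x * \<Gamma> v (cutoff k) x\<bar> \<le> 1 * R * (sqrt 1 * sqrt (s\<^sup>2))"
        using k by (intro abs_mult_le cutoff_le R form_cauchy_schwarz_le[OF cdc_form v cC \<Gamma>v]) auto
      moreover have "(v x)\<^sup>2 * \<Gamma> (cutoff k) (cutoff k) x \<le> R\<^sup>2 * s\<^sup>2"
        using R[of x] k form_nonneg[OF cdc_form cC]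
        by (intro mult_mono) (auto simp: abs_le_square_iff[symmetric])
      ultimately have "\<Gamma> w w x \<le> 1 + 2 * (R * s) + (R * s)\<^sup>2" using s by (simp add: power_mult_distrib abs_le_iff)
      also have "\<dots> = (1 + R * s)\<^sup>2" by (simp add: power2_eq_square algebra_simps)
      also have "\<dots> \<le> (1 + e)\<^sup>2" using Rs R0 s by (intro power_mono) auto
      finally have "\<Gamma> w w x \<le> (1 + e)\<^sup>2" .
      moreover have "\<Gamma> (u k) (u k) x = (inverse (1 + e))\<^sup>2 * \<Gamma> w w x"
      proof -
        have u: "u k = (\<lambda>x. inverse (1 + e) * w x)" by (simp add: u_def w_def)
        show ?thesis
          unfolding u form_cmult[OF cdc_form wC Csmooth_cmult[OF wC]] form_cmult_right[OF cdc_form wC wC]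
          by (simp add: power2_eq_square)
      qed
      moreover have "(inverse (1 + e))\<^sup>2 * (1 + e)\<^sup>2 = 1" using e by (simp add: power_mult_distrib[symmetric])
      ultimately show "\<Gamma> (u k) (u k) x \<le> 1"
        using mult_left_mono[of "\<Gamma> w w x" "(1 + e)\<^sup>2" "(inverse (1 + e))\<^sup>2"] by simp
    qed
  qed
qed

section \<open>From test functions to bounded and to arbitrary functions\<close>

lemma le_by_scaling:
  fixes a b :: real
  assumes "\<And>e. e > 0 \<Longrightarrow> inverse (1 + e) * a \<le> b" shows "a \<le> b"
proof -
  have "((\<lambda>e. inverse (1 + e) * a) \<longlongrightarrow> inverse (1 + 0) * a) (at_right 0)"
    by (intro tendsto_intros) auto
  then have "inverse (1 + 0) * a \<le> b"
    by (rule tendsto_upperbound) (use assms in \<open>auto simp: eventually_at_filter\<close>)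
  then show ?thesis by simp
qed

lemma bounded_oscillation:
  assumes v: "v \<in> C" and \<Gamma>v: "\<And>x. \<Gamma> v v x \<le> 1" and R: "\<And>x. \<bar>v x\<bar> \<le> R"
  shows "v x - v y \<le> radius"
proof (rule le_by_scaling)
  fix e :: real assume e: "e > 0"
  have lim: "(\<lambda>k. inverse (1 + e) * (cutoff k x * v x) - inverse (1 + e) * (cutoff k y * v y))
      \<longlonglongrightarrow> inverse (1 + e) * (1 * v x) - inverse (1 + e) * (1 * v y)"
    by (intro tendsto_intros cutoff_lim)
  have "inverse (1 + e) * (1 * v x) - inverse (1 + e) * (1 * v y) \<le> radius"
    by (rule tendsto_upperbound[OF lim eventually_mono[OF cutoff_mult_grad[OF v \<Gamma>v R e]]])
       (use Ctest_oscillation[OF cutoff_mult_test[OF v]] in auto)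
  then show "inverse (1 + e) * (v x - v y) \<le> radius" by (simp add: right_diff_distrib)
qed

lemma bounded_defect:
  assumes v: "v \<in> C" and \<Gamma>v: "\<And>x. \<Gamma> v v x \<le> 1" and R: "\<And>x. \<bar>v x\<bar> \<le> R" and t: "t > 0"
  shows "\<bar>v x - P t v x\<bar> \<le> defect t"
proof (rule le_by_scaling)
  fix e :: real assume e: "e > 0"
  let ?c = "inverse (1 + e)"
  have limP: "(\<lambda>k. P t (\<lambda>x. ?c * (cutoff k x * v x)) x) \<longlonglongrightarrow> P t (\<lambda>x. ?c * (1 * v x)) x"
    unfolding P_pos[OF t]
  proof (rule integral_dominated_convergence[where w="\<lambda>y. ?c * (R * p x y t)"])
    show "(\<lambda>y. p x y t * (?c * (1 * v y))) \<in> borel_measurable \<mu>"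
      by (intro borel_measurable_times measurable_kernel t Csmooth_measurable v borel_measurable_const)
    show "(\<lambda>y. p x y t * (?c * (cutoff k y * v y))) \<in> borel_measurable \<mu>" for k
      by (intro borel_measurable_times measurable_kernel t Csmooth_measurable v borel_measurable_const Ctest_Csmooth cutoff_test)
    show "integrable \<mu> (\<lambda>y. ?c * (R * p x y t))" using integrable_kernel[OF t] by simp
    show "AE y in \<mu>. (\<lambda>k. p x y t * (?c * (cutoff k y * v y))) \<longlonglongrightarrow> p x y t * (?c * (1 * v y))"
      by (intro AE_I2 tendsto_intros cutoff_lim)
    show "AE y in \<mu>. norm (p x y t * (?c * (cutoff k y * v y))) \<le> ?c * (R * p x y t)" for k
    proof (rule AE_I2)
      fix y
      have "\<bar>p x y t * (?c * (cutoff k y * v y))\<bar> \<le> p x y t * (?c * (1 * R))"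
        using p_pos[OF t, of x y] e by (intro abs_mult_le cutoff_le R) auto
      then show "norm (p x y t * (?c * (cutoff k y * v y))) \<le> ?c * (R * p x y t)" by (simp add: mult_ac)
    qed
  qed
  have lim: "(\<lambda>k. \<bar>?c * (cutoff k x * v x) - P t (\<lambda>x. ?c * (cutoff k x * v x)) x\<bar>)
      \<longlonglongrightarrow> \<bar>?c * (1 * v x) - P t (\<lambda>x. ?c * (1 * v x)) x\<bar>"
    by (intro tendsto_intros cutoff_lim limP)
  have "\<bar>?c * (1 * v x) - P t (\<lambda>x. ?c * (1 * v x)) x\<bar> \<le> defect t"
    by (rule tendsto_upperbound[OF lim eventually_mono[OF cutoff_mult_grad[OF v \<Gamma>v R e]]])
       (use Ctest_defect[OF cutoff_mult_test[OF v] _ t] in auto)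
  moreover have "P t (\<lambda>x. ?c * (1 * v x)) x = ?c * P t v x" by (simp add: P_pos[OF t] mult.left_commute)
  moreover have "\<bar>?c * (1 * v x) - ?c * P t v x\<bar> = ?c * \<bar>v x - P t v x\<bar>"
    using e by (simp add: right_diff_distrib[symmetric] abs_mult)
  ultimately show "?c * \<bar>v x - P t v x\<bar> \<le> defect t" by simp
qed

text \<open>Truncation by \<open>R * sin (v / R)\<close> does not increase the gradient.\<close>
lemma oscillation_le:
  assumes v: "v \<in> C" and \<Gamma>v: "\<And>x. \<Gamma> v v x \<le> 1"
  shows "\<bar>v x - v y\<bar> \<le> radius"
proof -
  have "v x - v y \<le> radius" for x y
  proof -
    have lim: "((\<lambda>R. R * sin (c / R)) \<longlongrightarrow> c) at_top" for c :: real by real_asymp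
    have le: "R * sin (v x / R) - R * sin (v y / R) \<le> radius" if R: "R > 0" for R
    proof -
      define u where "u = (\<lambda>x. R * sin (inverse R * v x))"
      have uC: "u \<in> C" unfolding u_def by (intro Csmooth_cmult Csmooth_sin v)
      have "\<Gamma> u u x \<le> 1" for x
      proof -
        let ?d = "cos (inverse R * v x)"
        have dF: "((\<lambda>y. R * sin (inverse R * y)) has_real_derivative ?d) (at (v x))"
          using R by (auto intro!: derivative_eq_intros)
        have 1: "\<Gamma> u g x = ?d * \<Gamma> v g x" if "g \<in> C" for g
          unfolding u_def by (rule form_chain[OF cdc_form v that uC[unfolded u_def] dF])
        have "\<Gamma> u u x = ?d * \<Gamma> u v x" using 1[OF uC] form_sym[OF cdc_form v uC] by simp
        also have "\<dots> = ?d\<^sup>2 * \<Gamma> v v x" using 1[OF v] by (simp add: power2_eq_square)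
        also have "\<dots> \<le> 1 * 1" using form_nonneg[OF cdc_form v] by (intro mult_mono \<Gamma>v) (auto simp: abs_square_le_1)
        finally show ?thesis by simp
      qed
      moreover have "\<bar>u x\<bar> \<le> R" for x
        using abs_mult_le[OF order_refl abs_sin_le_one, of R "inverse R * v x"] R by (simp add: u_def)
      ultimately have "u x - u y \<le> radius" by (rule bounded_oscillation[OF uC])
      then show ?thesis by (simp add: u_def divide_inverse mult.commute)
    qed
    show ?thesis
      by (rule tendsto_upperbound[OF tendsto_diff[OF lim[of "v x"] lim[of "v y"]]])
         (auto intro: eventually_mono[OF eventually_gt_at_top[of 0]] le)
  qed
  from this[of x y] this[of y x] show ?thesis by linarith
qed

section \<open>Total boundedness\<close>

text \<open>Scheffe's lemma: the kernels converge pointwise and all have mass 1, so they converge in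
  mean. Countable neighbourhood bases allow the argument to be run along sequences.\<close>

lemma kernel_L1_continuous:
  assumes t: "t > 0" and e: "e > 0"
  shows "\<exists>U. open U \<and> z \<in> U \<and> (\<forall>x\<in>U. (\<integral>y. \<bar>p x y t - p z y t\<bar> \<partial>\<mu>) \<le> e)"
proof -
  have "eventually (\<lambda>x. (\<integral>y. \<bar>p x y t - p z y t\<bar> \<partial>\<mu>) \<le> e) (inf (nhds z) (principal UNIV))"
  proof (rule sequentially_imp_eventually_nhds_within, intro allI impI, elim conjE)
    fix x assume x: "x \<longlonglongrightarrow> z"
    have n: "(\<integral>\<^sup>+y. norm (p x y t) \<partial>\<mu>) = 1" for x
    proof -
      have "(\<integral>\<^sup>+y. norm (p x y t) \<partial>\<mu>) = (\<integral>\<^sup>+y. ennreal (p x y t) \<partial>\<mu>)"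
        using p_pos[OF t, of x] by (simp add: less_imp_le)
      also have "\<dots> = ennreal (\<integral>y. p x y t \<partial>\<mu>)"
        by (rule nn_integral_eq_integral[OF integrable_kernel[OF t]]) (simp add: p_pos[OF t] less_imp_le)
      finally show ?thesis by (simp add: integral_kernel[OF t])
    qed
    have "(\<lambda>n. \<integral>\<^sup>+y. norm (p (x n) y t - p z y t) \<partial>\<mu>) \<longlonglongrightarrow> 0"
    proof (rule Scheffe_lemma1[OF integrable_kernel[OF t] integrable_kernel[OF t]])
      show "AE y in \<mu>. (\<lambda>n. p (x n) y t) \<longlonglongrightarrow> p z y t"
      proof (rule AE_I2)
        fix y
        show "(\<lambda>n. p (x n) y t) \<longlonglongrightarrow> p z y t"
          by (rule continuous_on_tendsto_compose[OF continuous_kernel_left[OF t] x]) auto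
      qed
      show "limsup (\<lambda>n. \<integral>\<^sup>+y. norm (p (x n) y t) \<partial>\<mu>) \<le> (\<integral>\<^sup>+y. norm (p z y t) \<partial>\<mu>)"
        unfolding n by (simp add: Limsup_const)
    qed
    moreover have "(\<integral>\<^sup>+y. norm (p (x n) y t - p z y t) \<partial>\<mu>) = ennreal (\<integral>y. \<bar>p (x n) y t - p z y t\<bar> \<partial>\<mu>)" for n
      using nn_integral_eq_integral[OF integrable_abs[OF Bochner_Integration.integrable_diff[OF integrable_kernel[OF t, of "x n"] integrable_kernel[OF t, of z]]]]
      by simp
    ultimately have "eventually (\<lambda>n. ennreal (\<integral>y. \<bar>p (x n) y t - p z y t\<bar> \<partial>\<mu>) < ennreal e) sequentially"
      using e by (auto intro: order_tendstoD)
    then show "eventually (\<lambda>n. (\<integral>y. \<bar>p (x n) y t - p z y t\<bar> \<partial>\<mu>) \<le> e) sequentially"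
      by (rule eventually_mono) (use e in \<open>auto simp: ennreal_less_iff\<close>)
  qed
  then show ?thesis by (auto simp: eventually_nhds)
qed

section \<open>Closeness measured by functions of gradient at most 1\<close>

definition lip :: "('a \<Rightarrow> real) set" where "lip = {v \<in> C. \<forall>x. \<Gamma> v v x \<le> 1}"

lemma lipD: "v \<in> lip \<Longrightarrow> v \<in> C" "v \<in> lip \<Longrightarrow> \<Gamma> v v x \<le> 1"
  by (auto simp: lip_def)

lemma lip_shift: "v \<in> lip \<Longrightarrow> (\<lambda>x. q + v x) \<in> lip"
  by (auto simp: lip_def form_add_const2[OF cdc_form] intro: Csmooth_add)

lemma lip_minus:
  assumes "v \<in> lip" shows "(\<lambda>x. (-1) * v x) \<in> lip"
proof -
  have vC: "v \<in> C" by (rule lipD(1)[OF assms])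
  have v': "(\<lambda>x. (-1) * v x) \<in> C" by (rule Csmooth_cmult[OF vC])
  show ?thesis
    unfolding lip_def using v' lipD(2)[OF assms]
    by (simp only: mem_Collect_eq form_cmult[OF cdc_form vC v'] form_cmult_right[OF cdc_form vC vC]) simp
qed

text \<open>Says that the supremum defining the distance of \<open>x\<close> and \<open>y\<close> is
  at most \<open>r\<close>, but without forming a supremum of reals, which is meaningful only for
  bounded sets.\<close>

definition near :: "real \<Rightarrow> 'a \<Rightarrow> 'a \<Rightarrow> bool" where
  "near r x y \<longleftrightarrow> (\<forall>v\<in>lip. \<bar>v x - v y\<bar> \<le> r)"

lemma near_triangle: "near r x y \<Longrightarrow> near s y z \<Longrightarrow> near (r + s) x z"
  unfolding near_def
proof
  fix v assume "\<forall>v\<in>lip. \<bar>v x - v y\<bar> \<le> r" "\<forall>v\<in>lip. \<bar>v y - v z\<bar> \<le> s" "v \<in> lip"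
  then have "\<bar>v x - v y\<bar> \<le> r" "\<bar>v y - v z\<bar> \<le> s" by auto
  then show "\<bar>v x - v z\<bar> \<le> r + s" by linarith
qed

lemma near_radius: "near radius x y"
  unfolding near_def using oscillation_le lipD by blast

lemma radius_nonneg: "radius \<ge> 0"
  using S0_pos \<alpha>_pos by (simp add: radius_def)

lemma small_defect: assumes "e > 0" obtains t where "t > 0" "defect t \<le> e"
proof -
  have "eventually (\<lambda>t. t > 0 \<and> defect t < e) (at_right 0)"
    using order_tendstoD(2)[OF defect_tendsto_0 assms] eventually_at_right_less[of "0::real"] by eventually_elim auto
  from eventually_happens[OF this] show ?thesis using that by (auto dest: less_imp_le)
qed

text \<open>Normalised to vanish at \<open>z\<close>, such a function is bounded by
  \<open>radius\<close>. It changes by at most \<open>e / 3\<close> under \<open>P t\<close> at both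
  points, and \<open>P t\<close> of it varies by at most \<open>radius\<close> times the change of
  the kernel in mean. Thus balls of the intrinsic distance are neighbourhoods in the manifold
  topology.\<close>

lemma near_open:
  assumes e: "e > 0" shows "\<exists>U. open U \<and> z \<in> U \<and> (\<forall>x\<in>U. near e x z)"
proof -
  obtain t where t: "t > 0" "defect t \<le> e / 3" using small_defect[of "e / 3"] e by auto
  have "e / (3 * (radius + 1)) > 0" using e radius_nonneg by simp
  from kernel_L1_continuous[OF t(1) this, of z] obtain U where U: "open U" "z \<in> U"
    and le: "\<And>x. x \<in> U \<Longrightarrow> (\<integral>y. \<bar>p x y t - p z y t\<bar> \<partial>\<mu>) \<le> e / (3 * (radius + 1))" by blast
  have "near e x z" if x: "x \<in> U" for x
    unfolding near_def
  proof
    fix v assume v: "v \<in> lip"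
    define w where "w = (\<lambda>x. - v z + v x)"
    have w: "w \<in> lip" unfolding w_def by (rule lip_shift[OF v])
    have wC: "w \<in> C" by (rule lipD(1)[OF w])
    have wb: "\<bar>w y\<bar> \<le> radius" for y
      using near_radius[of y z] v by (auto simp: near_def w_def)
    have d: "\<bar>w y - P t w y\<bar> \<le> e / 3" for y
      using bounded_defect[OF wC lipD(2)[OF w] wb t(1), of y] t(2) by linarith
    have i: "integrable \<mu> (\<lambda>y. p x y t * w y)" for x
      by (rule integrable_kernel_mult[OF t(1) Csmooth_measurable[OF wC] wb])
    have "\<bar>P t w x - P t w z\<bar> = \<bar>\<integral>y. (p x y t - p z y t) * w y \<partial>\<mu>\<bar>"
      using i by (simp add: P_pos[OF t(1)] left_diff_distrib)
    also have "\<dots> \<le> (\<integral>y. \<bar>(p x y t - p z y t) * w y\<bar> \<partial>\<mu>)" by (rule integral_abs_bound)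
    also have "\<dots> \<le> (\<integral>y. \<bar>p x y t - p z y t\<bar> * radius \<partial>\<mu>)"
    proof (rule integral_mono)
      show "integrable \<mu> (\<lambda>y. \<bar>(p x y t - p z y t) * w y\<bar>)" using i by (simp add: left_diff_distrib)
      show "integrable \<mu> (\<lambda>y. \<bar>p x y t - p z y t\<bar> * radius)" using integrable_kernel[OF t(1)] by simp
      show "\<bar>(p x y t - p z y t) * w y\<bar> \<le> \<bar>p x y t - p z y t\<bar> * radius" for y
        unfolding abs_mult by (rule mult_left_mono[OF wb]) simp
    qed
    also have "\<dots> = (\<integral>y. \<bar>p x y t - p z y t\<bar> \<partial>\<mu>) * radius" by (rule integral_mult_left_zero)
    also have "\<dots> \<le> e / (3 * (radius + 1)) * radius" by (rule mult_right_mono[OF le[OF x] radius_nonneg])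
    also have "\<dots> \<le> e / 3" using e radius_nonneg by (simp add: field_simps)
    finally have "\<bar>P t w x - P t w z\<bar> \<le> e / 3" .
    with d[of x] d[of z] have "\<bar>w x - w z\<bar> \<le> e" by linarith
    then show "\<bar>v x - v z\<bar> \<le> e" by (simp add: w_def)
  qed
  with U show ?thesis by blast
qed

section \<open>Smooth maxima\<close>

lemma Csmooth_exp: assumes "f \<in> C" shows "(\<lambda>x. exp (m * f x)) \<in> C"
proof -
  have "(\<lambda>x. m ^ 0 * exp (m * f x)) \<in> C"
    by (rule Csmooth_compose[OF assms, of "\<lambda>n y. m ^ n * exp (m * y)"]) (auto intro!: derivative_eq_intros)
  then show ?thesis by simp
qed

text \<open>The true maximum is not smooth. Here \<open>F = ln (exp (m u) + exp (m v)) / m\<close>,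
  whose differential is a convex combination of those of \<open>u\<close> and \<open>v\<close>.
  Combining \<open>2 \<Gamma>(u, F) \<le> 1 + \<Gamma>(F)\<close> and its analogue for
  \<open>v\<close> with the same weights gives
  \<open>2 \<Gamma>(F) \<le> 1 + \<Gamma>(F)\<close>.\<close>

lemma soft_max:
  assumes u: "u \<in> lip" and v: "v \<in> lip" and e: "e > 0"
  obtains F where "F \<in> lip" "\<And>x. u x \<le> F x" "\<And>x. v x \<le> F x" "\<And>x. F x \<le> max (u x) (v x) + e"
proof -
  \<comment> \<open>The excess over the true maximum is at most \<open>ln 2 / m\<close>, attained
    where \<open>u\<close> and \<open>v\<close> agree.\<close>
  define m where "m = ln 2 / e"
  have m: "m > 0" using e by (simp add: m_def)
  define a b E where "a = (\<lambda>x. exp (m * u x))" and "b = (\<lambda>x. exp (m * v x))" and "E = (\<lambda>x. a x + b x)"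
  have uC: "u \<in> C" and vC: "v \<in> C" using lipD(1) u v by auto
  have aC: "a \<in> C" and bC: "b \<in> C" unfolding a_def b_def by (intro Csmooth_exp uC vC)+
  have EC: "E \<in> C" unfolding E_def by (rule Csmooth_add[OF aC bC])
  have ab: "a x > 0" "b x > 0" and E: "E x > 0" for x by (auto simp: a_def b_def E_def add_pos_pos)
  define F where "F = (\<lambda>x. inverse m * ln (E x))"
  have lC: "(\<lambda>x. ln (E x)) \<in> C" by (rule Csmooth_ln[OF EC E])
  have FC: "F \<in> C" unfolding F_def by (rule Csmooth_cmult[OF lC])
  have "\<Gamma> F F x \<le> 1" for x
  proof -
    have 1: "\<Gamma> F g x = a x / E x * \<Gamma> u g x + b x / E x * \<Gamma> v g x" if g: "g \<in> C" for g
    proof -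
      have d: "((\<lambda>y. exp (m * y)) has_real_derivative m * exp (m * y)) (at y)" for y
        by (auto intro!: derivative_eq_intros)
      have "\<Gamma> a g x = m * a x * \<Gamma> u g x" "\<Gamma> b g x = m * b x * \<Gamma> v g x"
        using form_chain[OF cdc_form uC g aC[unfolded a_def] d] form_chain[OF cdc_form vC g bC[unfolded b_def] d]
        by (simp_all add: a_def b_def)
      moreover have "\<Gamma> F g x = inverse m * (1 / E x * \<Gamma> E g x)"
        unfolding F_def form_cmult[OF cdc_form lC g] form_chain[OF cdc_form EC g lC DERIV_ln_divide[OF E]] ..
      moreover have "\<Gamma> E g x = \<Gamma> a g x + \<Gamma> b g x" unfolding E_def by (rule form_add[OF cdc_form aC bC g])
      ultimately have "\<Gamma> F g x = inverse m * (m * (a x / E x * \<Gamma> u g x + b x / E x * \<Gamma> v g x))"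
        by (simp add: algebra_simps)
      then show ?thesis using m by simp
    qed
    have "2 * \<Gamma> u F x \<le> 1 + \<Gamma> F F x" "2 * \<Gamma> v F x \<le> 1 + \<Gamma> F F x"
      using form_abs_le[OF cdc_form uC FC, of x] form_abs_le[OF cdc_form vC FC, of x] lipD(2)[OF u, of x] lipD(2)[OF v, of x]
      by linarith+
    then have "a x / E x * (2 * \<Gamma> u F x) + b x / E x * (2 * \<Gamma> v F x)
        \<le> a x / E x * (1 + \<Gamma> F F x) + b x / E x * (1 + \<Gamma> F F x)"
      using ab[of x] E[of x] by (intro add_mono mult_left_mono) auto
    also have "\<dots> = (a x + b x) / E x * (1 + \<Gamma> F F x)" by (simp add: add_divide_distrib distrib_right)
    also have "\<dots> = 1 + \<Gamma> F F x" using E[of x] unfolding E_def by simp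
    finally show ?thesis using 1[OF FC] by (simp add: mult.left_commute[of _ 2])
  qed
  then have "F \<in> lip" using FC by (simp add: lip_def)
  moreover have "u x \<le> F x" for x
  proof -
    have "m * u x \<le> ln (E x)" using ln_mono[of "a x" "E x"] ab[of x] by (simp add: E_def a_def)
    then show ?thesis using m by (simp add: F_def field_simps)
  qed
  moreover have "v x \<le> F x" for x
  proof -
    have "m * v x \<le> ln (E x)" using ln_mono[of "b x" "E x"] ab[of x] by (simp add: E_def b_def)
    then show ?thesis using m by (simp add: F_def field_simps)
  qed
  moreover have "F x \<le> max (u x) (v x) + e" for x
  proof -
    have "a x \<le> exp (m * max (u x) (v x))" "b x \<le> exp (m * max (u x) (v x))" using m by (auto simp: a_def b_def)
    then have "E x \<le> 2 * exp (m * max (u x) (v x))" by (simp add: E_def)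
    then have "ln (E x) \<le> ln (2 * exp (m * max (u x) (v x)))" using E[of x] by (intro ln_mono) auto
    also have "\<dots> = ln 2 + m * max (u x) (v x)" by (simp add: ln_mult)
    finally have "F x \<le> inverse m * (ln 2 + m * max (u x) (v x))"
      unfolding F_def using m by (intro mult_left_mono) auto
    also have "\<dots> = e + max (u x) (v x)" using m e by (simp add: distrib_left mult.assoc[symmetric]) (simp add: m_def)
    finally show ?thesis by simp
  qed
  ultimately show ?thesis by (rule that)
qed

text \<open>One function is added at a time, with half of the allowed error spent on it and the
  other half left to the induction hypothesis. The empty case 0 makes \<open>F\<close>
  nonnegative.\<close>

lemma finite_soft_max:
  assumes "finite J" "\<And>j. j \<in> J \<Longrightarrow> v j \<in> lip" "e > 0"
  shows "\<exists>F\<in>lip. (\<forall>x. 0 \<le> F x) \<and> (\<forall>j\<in>J. \<forall>x. v j x \<le> F x) \<and> (\<forall>x. (\<forall>j\<in>J. v j x \<le> 0) \<longrightarrow> F x \<le> e)"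
  using assms
proof (induction J arbitrary: e rule: finite_induct)
  case empty
  have "(\<lambda>_. 0) \<in> lip" by (simp add: lip_def form_const[OF cdc_form])
  then show ?case using empty by (intro bexI[of _ "\<lambda>_. 0"]) auto
next
  case (insert i J)
  obtain F where F: "F \<in> lip" "\<And>x. 0 \<le> F x" "\<And>j x. j \<in> J \<Longrightarrow> v j x \<le> F x"
    "\<And>x. (\<forall>j\<in>J. v j x \<le> 0) \<Longrightarrow> F x \<le> e / 2"
    using insert.IH[of "e / 2"] insert.prems by auto
  obtain G where G: "G \<in> lip" "\<And>x. v i x \<le> G x" "\<And>x. F x \<le> G x" "\<And>x. G x \<le> max (v i x) (F x) + e / 2"
    using soft_max[OF insert.prems(1)[of i] F(1), of "e / 2"] insert.prems(2) by auto
  have "0 \<le> G x" for x using F(2)[of x] G(3)[of x] by linarith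
  moreover have "v j x \<le> G x" if "j \<in> insert i J" for j x
    using that G(2)[of x] F(3)[of j x] G(3)[of x] by auto
  moreover have "G x \<le> e" if "\<forall>j\<in>insert i J. v j x \<le> 0" for x
    using that F(4)[of x] G(4)[of x] insert.prems(2) by auto
  ultimately show ?case using G(1) by blast
qed

text \<open>Compactness refers to the manifold topology, in which \<open>near_open\<close> provides
  the open cover.\<close>

lemma compact_near_net:
  assumes K: "compact K" and e: "e > 0"
  obtains N where "finite N" "N \<subseteq> K" "\<And>x. x \<in> K \<Longrightarrow> \<exists>z\<in>N. near e x z"
proof -
  obtain U where U: "\<And>z. open (U z)" "\<And>z. z \<in> U z" "\<And>z x. x \<in> U z \<Longrightarrow> near e x z"
    using near_open[OF e] by metis
  have cover: "\<And>z. z \<in> K \<Longrightarrow> open (U z)" "K \<subseteq> (\<Union>z\<in>K. U z)" using U by auto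
  obtain N where "N \<subseteq> K" "finite N" "K \<subseteq> (\<Union>z\<in>N. U z)" using compactE_image[OF K cover] .
  then show ?thesis using U(3) by (intro that[of N]) blast+
qed

text \<open>Ultracontractivity is applied to \<open>1 + e - h k\<close>, which is at least
  \<open>e\<close> and has mean below \<open>2 e\<close> for large \<open>k\<close>. Its flow at
  time \<open>t\<close> is then at most \<open>2 e K = 1 / 2\<close> at every point, uniformly
  although \<open>h k\<close> has compact support.\<close>

lemma P_h_ge_half:
  assumes t: "t > 0" shows "\<exists>k. \<forall>x. 1 / 2 \<le> P t (h k) x"
proof -
  define K where "K = exp (lnK t)"
  have K: "K \<ge> 1" using lnK_nonneg[OF t] by (simp add: K_def)
  define e where "e = 1 / (4 * K)"
  have e: "e > 0" using K by (simp add: e_def)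
  have "(\<lambda>k. \<integral>x. h k x * 1 \<partial>\<mu>) \<longlonglongrightarrow> (\<integral>x. 1 \<partial>\<mu>)" by (rule h_mult_limit) simp
  then have "(\<lambda>k. mass * mean (h k) / mass) \<longlonglongrightarrow> mass / mass"
    using mass_pos by (intro tendsto_divide tendsto_const) (simp_all add: mean_eq[OF h_test])
  then have "(\<lambda>k. mean (h k)) \<longlonglongrightarrow> 1" using mass_pos by simp
  then have "eventually (\<lambda>k. 1 - e < mean (h k)) sequentially" using e by (intro order_tendstoD) auto
  then obtain k where k: "1 - e < mean (h k)" by (auto simp: eventually_sequentially)
  have T: "(\<lambda>x. (-1) * h k x) \<in> T" by (rule Ctest_cmult[OF h_test])
  have ge: "e \<le> (1 + e) + (-1) * h k x" for x using h_le_1[of k x] by simp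
  have "1 / 2 \<le> P t (h k) x" for x
  proof -
    let ?f = "\<lambda>x. (-1) * h k x"
    have Pf: "P t ?f x = - P t (h k) x" using t by (simp add: P_pos)
    have mf: "mean ?f = - mean (h k)" using mean_cmult[OF h_test, of "-1" k] by simp
    have pos: "0 < 1 + e + P t ?f x" "0 < 1 + e + mean ?f"
      using ultracontractive(2)[OF T e ge t, of x] ultracontractive(3)[OF T e ge t] e by linarith+
    have "1 + e + P t ?f x = exp (ln (1 + e + P t ?f x))" using pos by simp
    also have "\<dots> \<le> exp (ln (1 + e + mean ?f) + lnK t)" using ultracontractive(1)[OF T e ge t, of x] by simp
    also have "\<dots> = (1 + e + mean ?f) * K" using pos by (simp add: exp_add K_def)
    also have "\<dots> \<le> (2 * e) * K" using k K unfolding mf by (intro mult_right_mono) auto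
    also have "\<dots> = 1 / 2" using K by (simp add: e_def)
    finally show ?thesis using e unfolding Pf by linarith
  qed
  then show ?thesis by blast
qed

text \<open>If \<open>x\<close> were far from the support of \<open>h k\<close>, a soft maximum \<open>F\<close> of finitely many functions of
  gradient at most 1 would be small at \<open>x\<close> and large on this support, which carries half of
  the heat started at \<open>x\<close>; but \<open>P t F x\<close> is close to \<open>F x\<close> for small \<open>t\<close>.\<close>
lemma near_net:
  assumes r: "r > 0"
  shows "\<exists>N. finite N \<and> (\<forall>x. \<exists>z\<in>N. near r x z)"
proof -
  \<comment> \<open>One half of \<open>r\<close> is spent on reaching the support of
    \<open>h k\<close>, the other on a finite net of that support.\<close>
  define s where "s = r / 2"
  have s: "s > 0" using r by (simp add: s_def)
  obtain t where t: "t > 0" "defect t \<le> s / 8" using small_defect[of "s / 8"] s by auto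
  obtain k where k: "\<And>x. 1 / 2 \<le> P t (h k) x" using P_h_ge_half[OF t(1)] by blast
  define K where "K = closure {x. h k x \<noteq> 0}"
  have K: "compact K" unfolding K_def by (rule Ctest_compact[OF h_test])
  have hit: "\<exists>z\<in>K. near s x z" for x
  proof (rule ccontr)
    assume "\<not> ?thesis"
    then have "\<exists>v\<in>lip. v x = 0 \<and> s < v z" if zK: "z \<in> K" for z
    proof -
      obtain v where v: "v \<in> lip" "s < \<bar>v x - v z\<bar>"
        using zK \<open>\<not> (\<exists>z\<in>K. near s x z)\<close> unfolding near_def by (meson not_le)
      show ?thesis
      \<comment> \<open>A shift makes the function vanish at \<open>x\<close>; if its value at
        \<open>z\<close> is the smaller one, its sign is changed first.\<close>
      proof (cases "v x \<le> v z")
        case True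
        then show ?thesis using v by (intro bexI[OF _ lip_shift[OF v(1), of "- v x"]]) auto
      next
        case False
        then show ?thesis using v by (intro bexI[OF _ lip_shift[OF lip_minus[OF v(1)], of "v x"]]) auto
      qed
    qed
    then obtain v where v: "\<And>z. z \<in> K \<Longrightarrow> v z \<in> lip" "\<And>z. z \<in> K \<Longrightarrow> v z x = 0" "\<And>z. z \<in> K \<Longrightarrow> s < v z z"
      by metis
    \<comment> \<open>A finite net of \<open>K\<close> reduces the family \<open>v z\<close> to
      finitely many functions: at points within \<open>s / 8\<close> of \<open>z\<close>, the
      function \<open>v z\<close> has lost at most \<open>s / 8\<close> of its value at
      \<open>z\<close>.\<close>
    obtain J where J: "finite J" "J \<subseteq> K" "\<And>y. y \<in> K \<Longrightarrow> \<exists>z\<in>J. near (s / 8) y z"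
      using compact_near_net[OF K, of "s / 8"] s by auto
    have vJ: "\<And>j. j \<in> J \<Longrightarrow> v j \<in> lip" using J(2) v(1) by auto
    have "s / 8 > 0" using s by simp
    from finite_soft_max[of J v "s / 8", OF J(1) vJ this]
    obtain F where F: "F \<in> lip" "\<And>y. 0 \<le> F y" "\<And>j y. j \<in> J \<Longrightarrow> v j y \<le> F y"
      "\<And>y. (\<forall>j\<in>J. v j y \<le> 0) \<Longrightarrow> F y \<le> s / 8" by blast
    have Fx: "F x \<le> s / 8" using J(2) v(2) by (intro F(4)) auto
    have FK: "7 / 8 * s \<le> F y" if y: "y \<in> K" for y
    proof -
      obtain z where z: "z \<in> J" "near (s / 8) y z" using J(3)[OF y] by blast
      then have "\<bar>v z y - v z z\<bar> \<le> s / 8" using vJ by (auto simp: near_def)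
      moreover have "s < v z z" using v(3) J(2) z(1) by auto
      ultimately show ?thesis using F(3)[OF z(1), of y] by linarith
    qed
    have FC: "F \<in> C" by (rule lipD(1)[OF F(1)])
    have Fb: "\<bar>F y\<bar> \<le> radius + s / 8" for y
      using near_radius[of y x] F(1,2) Fx by (auto simp: near_def abs_le_iff)
    obtain B where B: "\<And>x. \<bar>h k x\<bar> \<le> B" using h_bounded by metis
    \<comment> \<open>The chain \<open>7 s / 16 \<le> P t F x \<le> F x + s / 8 \<le> s / 4\<close>
      is the contradiction.\<close>
    have "7 / 8 * s * (1 / 2) \<le> 7 / 8 * s * P t (h k) x" using k s by (intro mult_left_mono) auto
    also have "\<dots> = P t (\<lambda>y. 7 / 8 * s * h k y) x" 
      unfolding P_pos[OF t(1)] mult.left_commute[of "p x _ t"] by (rule integral_mult_right_zero[symmetric])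
    also have "\<dots> \<le> P t F x"
    proof (rule P_mono[OF less_imp_le[OF t(1)] Csmooth_measurable[OF Csmooth_cmult[OF h_Csmooth]] _ Csmooth_measurable[OF FC] Fb])
      show "\<bar>7 / 8 * s * h k y\<bar> \<le> 7 / 8 * s * B" for y using s by (intro abs_mult_le B) auto
      show "7 / 8 * s * h k y \<le> F y" for y
      proof (cases "y \<in> K")
        case True
        have "7 / 8 * s * h k y \<le> 7 / 8 * s * 1" using s by (intro mult_left_mono h_le_1) auto
        then show ?thesis using FK[OF True] by simp
      next
        case False
        then have "h k y = 0" unfolding K_def by (rule Ctest_zero)
        then show ?thesis using F(2) by simp
      qed
    qed
    also have "\<dots> \<le> F x + s / 8" using bounded_defect[OF FC lipD(2)[OF F(1)] Fb t(1), of x] t(2) by linarith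
    finally show False using Fx s by simp
  qed
  obtain N where N: "finite N" "\<And>x. x \<in> K \<Longrightarrow> \<exists>z\<in>N. near s x z" using compact_near_net[OF K s] by metis
  have "\<exists>z\<in>N. near r x z" for x
  proof -
    obtain y where y: "y \<in> K" "near s x y" using hit by blast
    obtain z where "z \<in> N" "near s y z" using N(2)[OF y(1)] by blast
    then show ?thesis using near_triangle[OF y(2), of s z] by (auto simp: s_def)
  qed
  then show ?thesis using N(1) by blast
qed

end

section \<open>The intrinsic distance\<close>

text \<open>Reparametrisation by a translation. The almost-everywhere condition on the velocity
  survives because Lebesgue measure is translation invariant.\<close>

lemma subunit_path_restrict:
  assumes \<gamma>: "subunit_path A \<mu> L T \<gamma>" and s: "0 \<le> s" "s \<le> s'" "s' \<le> T"
  shows "subunit_path A \<mu> L (s' - s) (\<lambda>r. \<gamma> (s + r))"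
  unfolding subunit_path_def lipschitz_path_def
proof (intro conjI ballI allI impI)
  have cont: "continuous_on {0..T} \<gamma>"
    and lip: "\<And>c r q. c \<in> A \<Longrightarrow> {r..q} \<subseteq> {0..T} \<Longrightarrow> \<gamma> ` {r..q} \<subseteq> fst c \<Longrightarrow> \<exists>C. C-lipschitz_on {r..q} (snd c \<circ> \<gamma>)"
    using \<gamma> by (auto simp: subunit_path_def lipschitz_path_def)
  show "0 \<le> s' - s" using s by simp
  show "continuous_on {0..s' - s} (\<lambda>r. \<gamma> (s + r))"
    by (rule continuous_on_compose2[OF cont]) (use s in \<open>auto intro!: continuous_intros\<close>)
  show "\<exists>C. C-lipschitz_on {r..q} (snd c \<circ> (\<lambda>r. \<gamma> (s + r)))"
    if c: "c \<in> A" and rq: "{r..q} \<subseteq> {0..s' - s} \<and> (\<lambda>r. \<gamma> (s + r)) ` {r..q} \<subseteq> fst c" for c r q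
  proof -
    have im: "(+) s ` {r..q} = {s + r..s + q}" by simp
    have "{s + r..s + q} \<subseteq> {0..T}" using rq s unfolding im[symmetric] by fastforce
    moreover have "\<gamma> ` {s + r..s + q} \<subseteq> fst c" using rq unfolding im[symmetric] image_image by blast
    ultimately obtain C where C: "C-lipschitz_on {s + r..s + q} (snd c \<circ> \<gamma>)" using lip[OF c] by blast
    have "C-lipschitz_on {r..q} (snd c \<circ> (\<lambda>r. \<gamma> (s + r)))"
    proof (rule lipschitz_onI)
      show "0 \<le> C" by (rule lipschitz_on_nonneg[OF C])
      show "dist ((snd c \<circ> (\<lambda>r. \<gamma> (s + r))) x) ((snd c \<circ> (\<lambda>r. \<gamma> (s + r))) y) \<le> C * dist x y"
        if "x \<in> {r..q}" "y \<in> {r..q}" for x y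
        using lipschitz_onD[OF C, of "s + x" "s + y"] that by (simp add: dist_real_def)
    qed
    then show ?thesis by blast
  qed
  have "AE t in distr lborel borel ((+) s). t \<in> {0<..<T} \<longrightarrow> (\<exists>c\<in>A. \<gamma> t \<in> fst c \<and>
        (\<exists>v. ((snd c \<circ> \<gamma>) has_vector_derivative v) (at t) \<and> subunit_vector A \<mu> L c (\<gamma> t) v))"
    using \<gamma> unfolding lborel_distr_plus subunit_path_def by blast
  then have "AE t in lborel. s + t \<in> {0<..<T} \<longrightarrow> (\<exists>c\<in>A. \<gamma> (s + t) \<in> fst c \<and>
        (\<exists>v. ((snd c \<circ> \<gamma>) has_vector_derivative v) (at (s + t)) \<and> subunit_vector A \<mu> L c (\<gamma> (s + t)) v))"
    by (rule AE_distrD[rotated]) simp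
  then show "AE t in lborel. t \<in> {0<..<s' - s} \<longrightarrow> (\<exists>c\<in>A. \<gamma> (s + t) \<in> fst c \<and>
        (\<exists>v. ((snd c \<circ> (\<lambda>r. \<gamma> (s + r))) has_vector_derivative v) (at t) \<and> subunit_vector A \<mu> L c (\<gamma> (s + t)) v))"
  proof (rule AE_mp, intro AE_I2 impI)
    fix t assume ex: "s + t \<in> {0<..<T} \<longrightarrow> (\<exists>c\<in>A. \<gamma> (s + t) \<in> fst c \<and>
        (\<exists>v. ((snd c \<circ> \<gamma>) has_vector_derivative v) (at (s + t)) \<and> subunit_vector A \<mu> L c (\<gamma> (s + t)) v))"
      and t: "t \<in> {0<..<s' - s}"
    have "s + t \<in> {0<..<T}" using t s by auto
    with ex obtain c v where cv: "c \<in> A" "\<gamma> (s + t) \<in> fst c"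
      "((snd c \<circ> \<gamma>) has_vector_derivative v) (at (s + t))" "subunit_vector A \<mu> L c (\<gamma> (s + t)) v" by blast
    have "((\<lambda>r. s + r) has_vector_derivative 1) (at t)" by (auto intro!: derivative_eq_intros)
    from vector_diff_chain_at[OF this cv(3)]
    have "((snd c \<circ> (\<lambda>r. \<gamma> (s + r))) has_vector_derivative v) (at t)" by (simp add: comp_def)
    with cv show "\<exists>c\<in>A. \<gamma> (s + t) \<in> fst c \<and>
        (\<exists>v. ((snd c \<circ> (\<lambda>r. \<gamma> (s + r))) has_vector_derivative v) (at t) \<and> subunit_vector A \<mu> L c (\<gamma> (s + t)) v)"
      by blast
  qed
qed

text \<open>If the supremum defining \<open>cc_dist A L x y\<close> is infinite, its value is the same junk real for all such
  \<open>x\<close> and \<open>y\<close>. This value is positive, whereas points of a subunit path between \<open>x\<close> and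
  \<open>y\<close> with close parameters have small distance.\<close>
lemma finite_oscillation:
  assumes accessible: "\<exists>T \<gamma>. subunit_path A \<mu> L T \<gamma> \<and> \<gamma> 0 = x \<and> \<gamma> T = y"
    and distance: "\<And>x y. cc_dist A L x y = Inf {T. \<exists>\<gamma>. subunit_path A \<mu> L T \<gamma> \<and> \<gamma> 0 = x \<and> \<gamma> T = y}"
    and metric: "Metric_space UNIV (cc_dist A L)"
  shows "\<exists>K. \<forall>f\<in>{f \<in> Csmooth A. sup_norm (cdc L f f) \<le> 1}. \<bar>f x - f y\<bar> \<le> K"
proof (rule ccontr)
  interpret Metric_space UNIV "cc_dist A L" by (rule metric)
  define S where "S = {f \<in> Csmooth A. sup_norm (cdc L f f) \<le> 1}"
  define finite_osc where "finite_osc x y \<longleftrightarrow> (\<exists>K. \<forall>f\<in>S. \<bar>f x - f y\<bar> \<le> K)" for x y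
  have trans: "finite_osc x z" if xy: "finite_osc x y" and yz: "finite_osc y z" for x y z
  proof -
    obtain K K' where "\<And>f. f \<in> S \<Longrightarrow> \<bar>f x - f y\<bar> \<le> K" "\<And>f. f \<in> S \<Longrightarrow> \<bar>f y - f z\<bar> \<le> K'"
      using xy yz unfolding finite_osc_def by blast
    then have "\<bar>f x - f z\<bar> \<le> K + K'" if "f \<in> S" for f using that by fastforce
    then show ?thesis unfolding finite_osc_def by blast
  qed
  \<comment> \<open>The supremum of a set of reals is defined as its least upper bound; for an
    unbounded set the predicate of being an upper bound is constantly false, so the value is this
    unspecified number, the same for all unbounded sets.\<close>
  define c0 where "c0 = (LEAST z::real. False)"
  have junk: "cc_dist A L x y = c0" if "\<not> finite_osc x y" for x y
  proof -
    have "\<not> (\<forall>u\<in>(\<lambda>f. \<bar>f x - f y\<bar>) ` S. u \<le> z)" for z using that by (auto simp: finite_osc_def)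
    then have "(\<lambda>z. \<forall>u\<in>(\<lambda>f. \<bar>f x - f y\<bar>) ` S. u \<le> z) = (\<lambda>z. False)" by (intro ext) metis
    then show ?thesis unfolding cc_dist_def S_def[symmetric] Sup_real_def c0_def by (rule arg_cong)
  qed
  assume "\<not> ?thesis"
  then have no: "\<not> finite_osc x y" by (simp add: finite_osc_def S_def)
  moreover have "finite_osc x x" by (auto simp: finite_osc_def)
  ultimately have "x \<noteq> y" by auto
  then have c0: "c0 > 0" using junk[OF no] mdist_pos_less[of x y] by simp
  obtain T \<gamma> where \<gamma>: "subunit_path A \<mu> L T \<gamma>" "\<gamma> 0 = x" "\<gamma> T = y" using accessible by blast
  have T: "T \<ge> 0" using \<gamma>(1) by (simp add: subunit_path_def)
  have close: "finite_osc (\<gamma> s) (\<gamma> s')" if s: "0 \<le> s" "s \<le> s'" "s' \<le> T" "s' - s < c0" for s s'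
  proof (rule ccontr)
    assume "\<not> finite_osc (\<gamma> s) (\<gamma> s')"
    then have "c0 = Inf {T. \<exists>\<delta>. subunit_path A \<mu> L T \<delta> \<and> \<delta> 0 = \<gamma> s \<and> \<delta> T = \<gamma> s'}"
      using junk distance by simp
    also have "\<dots> \<le> s' - s"
    proof (rule cInf_lower)
      show "s' - s \<in> {T. \<exists>\<delta>. subunit_path A \<mu> L T \<delta> \<and> \<delta> 0 = \<gamma> s \<and> \<delta> T = \<gamma> s'}"
        using subunit_path_restrict[OF \<gamma>(1) s(1-3)] by (intro CollectI exI[of _ "\<lambda>r. \<gamma> (s + r)"]) simp
      show "bdd_below {T. \<exists>\<delta>. subunit_path A \<mu> L T \<delta> \<and> \<delta> 0 = \<gamma> s \<and> \<delta> T = \<gamma> s'}"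
        by (rule bdd_belowI[of _ 0]) (auto simp: subunit_path_def)
    qed
    finally show False using s(4) by simp
  qed
  \<comment> \<open>The path is cut into \<open>N\<close> equal pieces of parameter length below
    \<open>c0\<close>; finiteness of the oscillation holds on each piece and is transitive.\<close>
  obtain N where N: "T / c0 < real N" using reals_Archimedean2 by blast
  then have N0: "N > 0" using divide_nonneg_pos[OF T c0] by (cases N) auto
  define \<tau> where "\<tau> = T / real N"
  have \<tau>: "0 \<le> \<tau>" "\<tau> < c0" "real N * \<tau> = T"
    using N N0 T c0 by (auto simp: \<tau>_def field_simps)
  have "finite_osc x (\<gamma> (real k * \<tau>))" if "k \<le> N" for k
    using that
  proof (induction k)
    case 0
    then show ?case using \<gamma>(2) by (auto simp: finite_osc_def)
  next
    case (Suc k)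
    have "real (Suc k) * \<tau> \<le> real N * \<tau>" using Suc.prems \<tau>(1) by (intro mult_right_mono) auto
    then have "finite_osc (\<gamma> (real k * \<tau>)) (\<gamma> (real (Suc k) * \<tau>))"
      using \<tau> by (intro close) (auto simp: distrib_right)
    then show ?case using trans Suc by auto
  qed
  from this[of N] have "finite_osc x y" using \<gamma>(3) \<tau>(3) by simp
  with no show False by simp
qed

section \<open>Compactness and the diameter bound\<close>

lemma sup_norm_le_1_iff: "sup_norm f \<le> 1 \<longleftrightarrow> (\<forall>x. \<bar>f x\<bar> \<le> 1)"
  by (simp add: sup_norm_def SUP_le_iff)

context bonnet_myers
begin

lemma lip_eq: "lip = {f \<in> C. sup_norm (\<Gamma> f f) \<le> 1}"
  using form_nonneg[OF cdc_form] by (auto simp: lip_def sup_norm_le_1_iff)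

lemma cc_dist_le:
  assumes "near r x y" shows "cc_dist A L x y \<le> r"
proof -
  have "(\<lambda>_. 0) \<in> lip" by (simp add: lip_def form_const[OF cdc_form])
  then have "lip \<noteq> {}" by blast
  then show ?thesis unfolding cc_dist_def lip_eq[symmetric]
    using assms by (intro cSUP_least) (auto simp: near_def)
qed

lemma compact_space_cc_dist:
  assumes "Metric_space UNIV (cc_dist A L)" "Metric_space.mcomplete UNIV (cc_dist A L)"
  shows "compact_space (Metric_space.mtopology UNIV (cc_dist A L))"
proof -
  interpret Metric_space UNIV "cc_dist A L" by (rule assms(1))
  have "mtotally_bounded UNIV"
    unfolding mtotally_bounded_def
  proof (intro allI impI)
    fix \<epsilon> :: real assume \<epsilon>: "\<epsilon> > 0"
    \<comment> \<open>Half of \<epsilon>, since \<open>near\<close> gives a weak inequality and the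
      balls are open.\<close>
    then obtain N where N: "finite N" "\<And>x. \<exists>z\<in>N. near (\<epsilon> / 2) x z" using near_net[of "\<epsilon> / 2"] by auto
    have "\<exists>z\<in>N. x \<in> mball z \<epsilon>" for x
    proof -
      obtain z where z: "z \<in> N" "near (\<epsilon> / 2) x z" using N(2) by blast
      then have "cc_dist A L z x < \<epsilon>" using cc_dist_le[OF z(2)] \<epsilon> commute[of x z] by simp
      then show ?thesis using z(1) by (auto simp: in_mball)
    qed
    then show "\<exists>K. finite K \<and> K \<subseteq> UNIV \<and> UNIV \<subseteq> (\<Union>x\<in>K. mball x \<epsilon>)" using N(1) by (intro exI[of _ N]) auto
  qed
  then show ?thesis using assms(2) compact_space_eq_mcomplete_mtotally_bounded by blast
qed

text \<open>Inserting \<open>S0\<close> and \<alpha>, the square of \<open>radius\<close> is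
  \<open>2 pi^2 D / \<alpha> = 3 pi^2 D (\<kappa> / \<rho>2 + 1) / \<rho>1\<close>; on the right the
  factor 3 is replaced by 12.\<close>

lemma radius_le: "radius \<le> pi / sqrt \<rho>1 * (2 * sqrt 3) * sqrt ((\<kappa> / \<rho>2 + 1) * D)"
proof (rule power2_le_imp_le)
  have "radius\<^sup>2 = 4 * pi\<^sup>2 * (S0 * S0) / \<alpha>\<^sup>2" by (simp add: radius_def power2_eq_square)
  also have "\<dots> = 2 * pi\<^sup>2 * D / \<alpha>" unfolding S0_sq using \<alpha>_pos by (simp add: power2_eq_square)
  also have "\<dots> = 3 * (pi\<^sup>2 * D * ((\<kappa> / \<rho>2 + 1) / \<rho>1))"
    using pos by (simp add: \<alpha>_def field_simps)
  also have "\<dots> \<le> 12 * (pi\<^sup>2 * D * ((\<kappa> / \<rho>2 + 1) / \<rho>1))"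
    using pos D_pos by (intro mult_right_mono mult_nonneg_nonneg divide_nonneg_nonneg add_nonneg_nonneg) auto
  also have "\<dots> = (pi / sqrt \<rho>1 * (2 * sqrt 3) * sqrt ((\<kappa> / \<rho>2 + 1) * D))\<^sup>2"
    using pos D_pos by (simp add: power_mult_distrib power_divide)
  finally show "radius\<^sup>2 \<le> (pi / sqrt \<rho>1 * (2 * sqrt 3) * sqrt ((\<kappa> / \<rho>2 + 1) * D))\<^sup>2" .
  show "0 \<le> pi / sqrt \<rho>1 * (2 * sqrt 3) * sqrt ((\<kappa> / \<rho>2 + 1) * D)" using pos D_pos by simp
qed

lemma cc_dist_bound: "cc_dist A L x y \<le> pi / sqrt \<rho>1 * (2 * sqrt 3) * sqrt ((\<kappa> / \<rho>2 + 1) * (d * (1 + 3 * \<kappa> / (2 * \<rho>2))))"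
  using cc_dist_le[OF near_radius, of x y] radius_le by (simp add: D_def A'_def)

end

lemma sqrt_constant_eq:
  fixes \<rho>1 \<rho>2 \<kappa> r a :: real
  assumes "\<rho>1 > 0" "\<rho>2 > 0"
  shows "pi / sqrt \<rho>1 * (2 * sqrt 3) * sqrt ((\<kappa> / \<rho>2 + 1) * (r * a))
    = 2 * sqrt 3 * pi * sqrt ((\<rho>2 + \<kappa>) / (\<rho>1 * \<rho>2) * a * r)"
proof -
  have "(\<rho>2 + \<kappa>) / (\<rho>1 * \<rho>2) * a * r = (\<kappa> / \<rho>2 + 1) * (r * a) / \<rho>1"
    using assms by (simp add: field_simps)
  then have "sqrt ((\<rho>2 + \<kappa>) / (\<rho>1 * \<rho>2) * a * r) = sqrt ((\<kappa> / \<rho>2 + 1) * (r * a)) / sqrt \<rho>1"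
    by (simp only: real_sqrt_divide)
  then show ?thesis by simp
qed

theorem theorem10p1:
  fixes A :: "('a::{t2_space, second_countable_topology}, 'b::euclidean_space) chart set"
    and \<mu> :: "'a measure"
    and L :: "('a \<Rightarrow> real) \<Rightarrow> 'a \<Rightarrow> real"
    and \<Gamma>Z :: "('a \<Rightarrow> real) \<Rightarrow> ('a \<Rightarrow> real) \<Rightarrow> 'a \<Rightarrow> real"
    and p :: "'a \<Rightarrow> 'a \<Rightarrow> real \<Rightarrow> real"
    and h :: "nat \<Rightarrow> 'a \<Rightarrow> real"
    and \<rho>1 \<rho>2 \<kappa> :: real
    and d :: ereal
  defines "\<Gamma> \<equiv> cdc L"
    and "P \<equiv> heat_op \<mu> p"
    and "D \<equiv> d * ereal (1 + 3 * \<kappa> / (2 * \<rho>2))"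
  assumes manifold: "smooth_atlas A" "connected (UNIV :: 'a set)"
    and measure: "smooth_measure A \<mu>"
    and operator: "diffusion_operator A L" "L (\<lambda>_. 1) = (\<lambda>_. 0)"
      "symmetric_nonpositive A \<mu> L" "locally_subelliptic A \<mu> L"
      "locally_sum_of_squares A \<mu> L" "essentially_self_adjoint A \<mu> L"
    and accessible: "\<And>x y. \<exists>T \<gamma>. subunit_path A \<mu> L T \<gamma> \<and> \<gamma> 0 = x \<and> \<gamma> T = y"
    and distance: "\<And>x y. cc_dist A L x y = Inf {T. \<exists>\<gamma>. subunit_path A \<mu> L T \<gamma> \<and> \<gamma> 0 = x \<and> \<gamma> T = y}"
    and complete: "Metric_space UNIV (cc_dist A L)" "Metric_space.mcomplete UNIV (cc_dist A L)"
    and form: "first_order_form A \<Gamma>Z"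
    and kernel: "heat_kernel A \<mu> L p"
    and a: "\<And>k. h k \<in> Ctest A" "\<And>k x. h k x \<le> h (Suc k) x" "\<And>x. (\<lambda>k. h k x) \<longlonglongrightarrow> 1"
      "(\<lambda>k. sup_norm (\<Gamma> (h k) (h k)) + sup_norm (\<Gamma>Z (h k) (h k))) \<longlonglongrightarrow> 0"
    and b: "\<And>f. f \<in> Csmooth A \<Longrightarrow> \<Gamma> f (\<Gamma>Z f f) = \<Gamma>Z f (\<Gamma> f f)"
    and c: "\<And>t. t \<ge> 0 \<Longrightarrow> P t (\<lambda>_. 1) = (\<lambda>_. 1)"
      "\<And>f T. f \<in> Ctest A \<Longrightarrow> T \<ge> 0 \<Longrightarrow>
         (SUP t\<in>{0..T}. sup_norm (\<Gamma> (P t f) (P t f)) + sup_norm (\<Gamma>Z (P t f) (P t f))) < \<infinity>"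
    and d: "\<rho>1 > 0" "\<rho>2 > 0" "\<kappa> \<ge> 0" "d > 0"
      "\<And>f \<nu> x. f \<in> Csmooth A \<Longrightarrow> \<nu> > 0 \<Longrightarrow>
         iterated_form L \<Gamma> f x + \<nu> * iterated_form L \<Gamma>Z f x
           \<ge> real_of_ereal (1 / d) * (L f x)\<^sup>2 + (\<rho>1 - \<kappa> / \<nu>) * \<Gamma> f f x + \<rho>2 * \<Gamma>Z f f x"
  shows "(d < \<infinity> \<longrightarrow> compact_space (Metric_space.mtopology UNIV (cc_dist A L))) \<and>
    (SUP x. SUP y. ereal (cc_dist A L x y))
      \<le> ereal (pi / sqrt \<rho>1 * (2 * sqrt 3)) * ereal_sqrt (ereal (\<kappa> / \<rho>2 + 1) * D) \<and>
    ereal (pi / sqrt \<rho>1 * (2 * sqrt 3)) * ereal_sqrt (ereal (\<kappa> / \<rho>2 + 1) * D)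
      = ereal (2 * sqrt 3 * pi) *
        ereal_sqrt (ereal ((\<rho>2 + \<kappa>) / (\<rho>1 * \<rho>2) * (1 + 3 * \<kappa> / (2 * \<rho>2))) * d)"
\<comment> \<open>For infinite \<open>d\<close> both right-hand sides are infinite and the claim of
  compactness is conditional on finite \<open>d\<close>, so the analysis concerns real
  dimensions.\<close>
proof (cases "d = \<infinity>")
  case True
  have pos: "1 + 3 * \<kappa> / (2 * \<rho>2) > 0" using d(2,3) by (intro add_pos_nonneg) auto
  have inf: "ereal q * \<infinity> = \<infinity>" if "q > 0" for q using that by simp
  have "ereal (\<kappa> / \<rho>2 + 1) * D = \<infinity>" "ereal ((\<rho>2 + \<kappa>) / (\<rho>1 * \<rho>2) * (1 + 3 * \<kappa> / (2 * \<rho>2))) * d = \<infinity>"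
    unfolding D_def True mult.commute[of \<infinity>] inf[OF pos] using d(1-3)
    by (intro inf mult_pos_pos pos divide_pos_pos add_nonneg_pos add_pos_nonneg divide_nonneg_pos; simp)+
  moreover have "ereal (pi / sqrt \<rho>1 * (2 * sqrt 3)) * \<infinity> = \<infinity>" "ereal (2 * sqrt 3 * pi) * \<infinity> = \<infinity>"
    using d(1) by simp_all
  ultimately show ?thesis using True by (simp add: ereal_sqrt_def)
next
  case False
  with d(4) obtain r where r: "d = ereal r" "r > 0" by (cases d) auto
  have D: "D = ereal (r * (1 + 3 * \<kappa> / (2 * \<rho>2)))" by (simp add: D_def r)
  interpret bonnet_myers A \<mu> L p h \<Gamma>Z \<rho>1 \<rho>2 \<kappa> r
  proof
    show "smooth_atlas A" "smooth_measure A \<mu>" "diffusion_operator A L" "L (\<lambda>_. 1) = (\<lambda>_. 0)"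
      "symmetric_nonpositive A \<mu> L" "heat_kernel A \<mu> L p" "first_order_form A \<Gamma>Z"
      "\<rho>1 > 0" "\<rho>2 > 0" "\<kappa> \<ge> 0" "r > 0"
      by (fact manifold measure operator kernel form d r)+
    show "h k \<in> Ctest A" "h k x \<le> h (Suc k) x" "(\<lambda>k. h k x) \<longlonglongrightarrow> 1" for k x by (fact a)+
    \<comment> \<open>Both summands in the cutoff condition are nonnegative, so the first one is
      squeezed to 0.\<close>
    show "(\<lambda>k. sup_norm (cdc L (h k) (h k))) \<longlonglongrightarrow> 0"
      by (rule tendsto_sandwich[OF _ _ tendsto_const a(4)]) (auto simp: \<Gamma>_def)
    show "heat_op \<mu> p t (\<lambda>_. 1) = (\<lambda>_. 1)" if "t \<ge> 0" for t using c(1)[OF that] by (simp add: P_def)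
    show "cdc L f (\<Gamma>Z f f) = \<Gamma>Z f (cdc L f f)" if "f \<in> Csmooth A" for f using b[OF that] by (simp add: \<Gamma>_def)
    show "(SUP t\<in>{0..T}. sup_norm (cdc L (heat_op \<mu> p t f) (heat_op \<mu> p t f))
            + sup_norm (\<Gamma>Z (heat_op \<mu> p t f) (heat_op \<mu> p t f))) < \<infinity>" if "f \<in> Ctest A" "T \<ge> 0" for f T
      using c(2)[OF that] by (simp only: \<Gamma>_def P_def)
    have "real_of_ereal (1 / d) = 1 / r" using r by (simp add: one_ereal_def)
    then show "iterated_form L (cdc L) f x + \<nu> * iterated_form L \<Gamma>Z f x
           \<ge> 1 / r * (L f x)\<^sup>2 + (\<rho>1 - \<kappa> / \<nu>) * cdc L f f x + \<rho>2 * \<Gamma>Z f f x"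
      if "f \<in> Csmooth A" "\<nu> > 0" for f \<nu> x
      using d(5)[OF that, of x] by (simp only: \<Gamma>_def)
    show "\<exists>K. \<forall>f\<in>Csmooth A. (\<forall>z. cdc L f f z \<le> 1) \<longrightarrow> \<bar>f x - f y\<bar> \<le> K" for x y
    proof -
      interpret diffusion A \<mu> L by standard (fact manifold measure operator)+
      obtain K where "\<And>f. f \<in> Csmooth A \<Longrightarrow> sup_norm (cdc L f f) \<le> 1 \<Longrightarrow> \<bar>f x - f y\<bar> \<le> K"
        using finite_oscillation[OF accessible distance complete(1), of x y] by blast
      then show ?thesis using form_nonneg[OF cdc_form] by (intro exI[of _ K]) (simp add: sup_norm_le_1_iff)
    qed
  qed
  have rhs: "ereal (pi / sqrt \<rho>1 * (2 * sqrt 3)) * ereal_sqrt (ereal (\<kappa> / \<rho>2 + 1) * D)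
      = ereal (pi / sqrt \<rho>1 * (2 * sqrt 3) * sqrt ((\<kappa> / \<rho>2 + 1) * (r * (1 + 3 * \<kappa> / (2 * \<rho>2)))))"
    unfolding D by (simp add: ereal_sqrt_def)
  show ?thesis
  proof (intro conjI impI)
    show "compact_space (Metric_space.mtopology UNIV (cc_dist A L))"
      by (rule compact_space_cc_dist[OF complete])
    show "(SUP x. SUP y. ereal (cc_dist A L x y))
      \<le> ereal (pi / sqrt \<rho>1 * (2 * sqrt 3)) * ereal_sqrt (ereal (\<kappa> / \<rho>2 + 1) * D)"
      unfolding rhs by (intro SUP_least) (simp only: ereal_less_eq cc_dist_bound)
    show "ereal (pi / sqrt \<rho>1 * (2 * sqrt 3)) * ereal_sqrt (ereal (\<kappa> / \<rho>2 + 1) * D)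
      = ereal (2 * sqrt 3 * pi) *
        ereal_sqrt (ereal ((\<rho>2 + \<kappa>) / (\<rho>1 * \<rho>2) * (1 + 3 * \<kappa> / (2 * \<rho>2))) * d)"
      unfolding rhs sqrt_constant_eq[OF d(1,2)] r(1) by (simp add: ereal_sqrt_def)
  qed
qed

end
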